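(* Let $(M,\omega)$ be a symplectic manifold with a symplectic connection $\nabla$ and let $\Phi:G\times M\to M$ be a Hamiltonian action of a Lie group $G$ on $M$ which is affine with respect to $\nabla$ and has an equivariant moment map $J:M\to\mathcal{G}^*$, where $\mathcal{G}^*$ is the dual of the Lie algebra $\mathcal{G}$ of $G$. Let $\xi\in\mathcal{G}^*$ be a non-critical value of $J$ such that the submanifold $C:=J^{-1}(\xi)$ is $\nabla$-self-parallel, and such that the reduced symplectic manifold $(N=C/G_\xi,\omega')$ exists. Then $\nabla$ induces a well defined symplectic connection $\nabla'$ on $(N,\omega')$.
   Context: Everything is $C^\infty$. A symplectic connection on a symplectic manifold $(M,\omega)$ is a torsionless linear connection $\nabla$ on $M$ with $\nabla\omega=0$. The action $\Phi$ is affine with respect to $\nabla$ if it preserves $\nabla$: for every $g\in G$, with $\Phi_g(x):=\Phi(g,x)$, one has $\Phi_{g*}(\nabla_XY)=\nabla_{\Phi_{g*}X}(\Phi_{g*}Y)$ for all vector fields $X,Y$ on $M$. The action is Hamiltonian with equivariant moment map $J$ if it preserves $\omega$, if for every $A\in\mathcal{G}$ with infinitesimal generator $A_M$ on $M$ one has $i(A_M)\omega=d\langle J,A\rangle$ (up to the usual sign convention), and if $J\circ\Phi_g=\mathrm{Ad}^*_g\circ J$ for the coadjoint action of $G$ on $\mathcal{G}^*$. $G_\xi\subseteq G$ is the isotropy subgroup of $\xi$ for the coadjoint action; it acts on $C=J^{-1}(\xi)$. "The reduced symplectic manifold exists" means that $N=C/G_\xi$ is a manifold with the natural projection $\pi:C\to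 N$ a submersion; then $\omega'$ is the symplectic form on $N$ determined by $\pi^*\omega'=\omega|_C$ (Marsden-Weinstein reduction). A submanifold $C\subseteq M$ is $\nabla$-self-parallel if $TC$ is preserved by $\nabla$-parallel translations along paths in $C$. In this case $\nabla_XY$ is tangent to $C$ for all vector fields $X,Y$ on $C$, so that $\nabla$ may be seen as a linear connection on $C$. "$\nabla$ induces a well defined connection $\nabla'$ on $N$" means that the formula $\nabla'_{\mathcal{X}}\mathcal{Y}=\pi_*(\nabla_XY)$, where $\mathcal{X},\mathcal{Y}$ are vector fields on $N$ and $X,Y$ are vector fields on $C$ that project by $\pi$ to $\mathcal{X},\mathcal{Y}$ respectively ($G_\xi$-invariant lifts, defined up to terms tangent to the orbits of $G_\xi$), makes sense (i.e. $\nabla_XY$ is $\pi$-projectable), is independent of the choice of $X,Y$, and defines a linear connection on $N$. *)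

theory Defs
  imports "HOL-Analysis.Analysis" "HOL-Algebra.Group_Action"
begin

section \<open>Smooth maps between Euclidean spaces\<close>

text \<open>\<open>Ck_on k U f\<close>: \<open>f\<close> is of class $C^k$ on the open set \<open>U\<close>.\<close>

primrec Ck_on :: "nat \<Rightarrow> 'e::euclidean_space set \<Rightarrow> ('e \<Rightarrow> 'f::euclidean_space) \<Rightarrow> bool" where
  "Ck_on 0 U f \<longleftrightarrow> continuous_on U f"
| "Ck_on (Suc k) U f \<longleftrightarrow>
     (\<forall>x\<in>U. f differentiable (at x)) \<and>
     (\<forall>v. Ck_on k U (\<lambda>x. frechet_derivative f (at x) v))"

text \<open>On an arbitrary set, smooth means: locally the restriction of a smooth function
  defined on an open set of the ambient Euclidean space.\<close>

definition smooth_on :: "'e::euclidean_space set \<Rightarrow> ('e \<Rightarrow> 'f::euclidean_space) \<Rightarrow> bool" where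
  "smooth_on A f \<longleftrightarrow>
     (\<forall>x\<in>A. \<exists>U g. open U \<and> x \<in> U \<and> (\<forall>k. Ck_on k U g) \<and> (\<forall>y\<in>U \<inter> A. g y = f y))"

section \<open>Smooth manifolds\<close>

text \<open>The charts of a manifold take values in a linear subspace \<open>model\<close> of a Euclidean
  space. Its dimension is the dimension of the manifold and may be any natural number,
  including 0, which \<open>DIM('e)\<close> excludes.\<close>

record ('a, 'e) mfd =
  mtop :: "'a topology"
  model :: "'e set"
  atlas :: "('a set \<times> ('a \<Rightarrow> 'e)) set"

definition smooth_manifold :: "('a, 'e::euclidean_space) mfd \<Rightarrow> bool" where
  "smooth_manifold M \<longleftrightarrow>
     Hausdorff_space (mtop M) \<and> second_countable (mtop M) \<and> subspace (model M) \<and>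
     (\<Union>(U, \<phi>)\<in>atlas M. U) = topspace (mtop M) \<and>
     (\<forall>(U, \<phi>)\<in>atlas M.
        openin (mtop M) U \<and> openin (top_of_set (model M)) (\<phi> ` U) \<and>
        homeomorphic_map (subtopology (mtop M) U) (top_of_set (\<phi> ` U)) \<phi>) \<and>
     (\<forall>(U, \<phi>)\<in>atlas M. \<forall>(V, \<psi>)\<in>atlas M.
        smooth_on (\<phi> ` (U \<inter> V)) (\<psi> \<circ> inv_into U \<phi>))"

definition prod_mfd ::
  "('a, 'e::euclidean_space) mfd \<Rightarrow> ('b, 'f::euclidean_space) mfd \<Rightarrow> ('a \<times> 'b, 'e \<times> 'f) mfd" where
  "prod_mfd M N =
     \<lparr>mtop = prod_topology (mtop M) (mtop N),
      model = model M \<times> model N,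
      atlas = {(U \<times> V, map_prod \<phi> \<psi>) | U \<phi> V \<psi>. (U, \<phi>) \<in> atlas M \<and> (V, \<psi>) \<in> atlas N}\<rparr>"

text \<open>Tangent vectors, vector fields, smooth maps etc. are all derived from the algebra of
  smooth real functions. This serves manifolds and embedded submanifolds uniformly. The values
  of a smooth function outside \<open>points\<close> are arbitrary.\<close>

record 'a smooth_space =
  points :: "'a set"
  funs :: "('a \<Rightarrow> real) set"

definition mfd_space :: "('a, 'e::euclidean_space) mfd \<Rightarrow> 'a smooth_space" where
  "mfd_space M =
     \<lparr>points = topspace (mtop M),
      funs = {f. \<forall>(U, \<phi>)\<in>atlas M. smooth_on (\<phi> ` U) (f \<circ> inv_into U \<phi>)}\<rparr>"

text \<open>An embedded submanifold \<open>C\<close>: a function on \<open>C\<close> is smooth iff it is locally the restriction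
  of a smooth function on \<open>M\<close> (which can be taken to be defined on all of \<open>M\<close>, by cutting off).\<close>

definition subm_space :: "('a, 'e::euclidean_space) mfd \<Rightarrow> 'a set \<Rightarrow> 'a smooth_space" where
  "subm_space M C =
     \<lparr>points = C,
      funs = {f. \<forall>x\<in>C. \<exists>U F. openin (mtop M) U \<and> x \<in> U \<and> F \<in> funs (mfd_space M) \<and>
                             (\<forall>y\<in>U \<inter> C. F y = f y)}\<rparr>"

definition smooth_map :: "'a smooth_space \<Rightarrow> 'b smooth_space \<Rightarrow> ('a \<Rightarrow> 'b) \<Rightarrow> bool" where
  "smooth_map S T \<phi> \<longleftrightarrow> \<phi> ` points S \<subseteq> points T \<and> (\<forall>f\<in>funs T. f \<circ> \<phi> \<in> funs S)"

section \<open>Tangent vectors and vector fields\<close>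

text \<open>Tangent vectors at \<open>p\<close> are derivations at \<open>p\<close>, extended by 0 to nonsmooth functions.
  A derivation automatically ignores the values of a function outside \<open>points S\<close>, because
  the indicator function of the complement of \<open>points S\<close> belongs to \<open>funs S\<close>.\<close>

type_synonym 'a tvec = "('a \<Rightarrow> real) \<Rightarrow> real"

definition tangent :: "'a smooth_space \<Rightarrow> 'a \<Rightarrow> 'a tvec set" where
  "tangent S p =
     {v. (\<forall>f\<in>funs S. \<forall>g\<in>funs S. v (\<lambda>x. f x + g x) = v f + v g) \<and>
         (\<forall>f\<in>funs S. \<forall>c. v (\<lambda>x. c * f x) = c * v f) \<and>
         (\<forall>f\<in>funs S. \<forall>g\<in>funs S. v (\<lambda>x. f x * g x) = v f * g p + f p * v g) \<and>
         (\<forall>f. f \<notin> funs S \<longrightarrow> v f = 0)}"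

text \<open>The differential of a smooth map \<open>\<phi>\<close> into \<open>T\<close>.\<close>

definition pushforward :: "'b smooth_space \<Rightarrow> ('a \<Rightarrow> 'b) \<Rightarrow> 'a tvec \<Rightarrow> 'b tvec" where
  "pushforward T \<phi> v = (\<lambda>f. if f \<in> funs T then v (f \<circ> \<phi>) else 0)"

definition submersion :: "'a smooth_space \<Rightarrow> 'b smooth_space \<Rightarrow> ('a \<Rightarrow> 'b) \<Rightarrow> bool" where
  "submersion S T \<phi> \<longleftrightarrow> smooth_map S T \<phi> \<and>
     (\<forall>p\<in>points S. pushforward T \<phi> ` tangent S p = tangent T (\<phi> p))"

text \<open>The values of a vector field outside \<open>points S\<close> are irrelevant.\<close>

type_synonym 'a vfield = "'a \<Rightarrow> 'a tvec"

definition vector_field :: "'a smooth_space \<Rightarrow> 'a vfield \<Rightarrow> bool" where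
  "vector_field S X \<longleftrightarrow>
     (\<forall>p\<in>points S. X p \<in> tangent S p) \<and> (\<forall>f\<in>funs S. (\<lambda>p. X p f) \<in> funs S)"

definition lie_bracket :: "'a vfield \<Rightarrow> 'a vfield \<Rightarrow> 'a vfield" where
  "lie_bracket X Y = (\<lambda>p f. X p (\<lambda>q. Y q f) - Y p (\<lambda>q. X q f))"

text \<open>\<open>X\<close> projects by \<open>\<pi>\<close> to \<open>X'\<close>.\<close>

definition projects_to ::
  "'a smooth_space \<Rightarrow> 'b smooth_space \<Rightarrow> ('a \<Rightarrow> 'b) \<Rightarrow> 'a vfield \<Rightarrow> 'b vfield \<Rightarrow> bool" where
  "projects_to S T \<pi> X X' \<longleftrightarrow> (\<forall>p\<in>points S. pushforward T \<pi> (X p) = X' (\<pi> p))"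

section \<open>Symplectic forms and connections\<close>

type_synonym 'a form2 = "'a \<Rightarrow> 'a tvec \<Rightarrow> 'a tvec \<Rightarrow> real"

definition two_form :: "'a smooth_space \<Rightarrow> 'a form2 \<Rightarrow> bool" where
  "two_form S \<omega> \<longleftrightarrow>
     (\<forall>p\<in>points S. \<forall>u\<in>tangent S p. \<forall>v\<in>tangent S p. \<forall>w\<in>tangent S p. \<forall>c.
        \<omega> p (\<lambda>f. u f + v f) w = \<omega> p u w + \<omega> p v w \<and>
        \<omega> p (\<lambda>f. c * u f) w = c * \<omega> p u w \<and>
        \<omega> p u w = - \<omega> p w u) \<and>
     (\<forall>X Y. vector_field S X \<and> vector_field S Y \<longrightarrow> (\<lambda>p. \<omega> p (X p) (Y p)) \<in> funs S)"

text \<open>The exterior derivative, by Cartan's invariant formula.\<close>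

definition ext_deriv ::
  "'a form2 \<Rightarrow> 'a vfield \<Rightarrow> 'a vfield \<Rightarrow> 'a vfield \<Rightarrow> 'a \<Rightarrow> real" where
  "ext_deriv \<omega> X Y Z p =
     X p (\<lambda>q. \<omega> q (Y q) (Z q)) + Y p (\<lambda>q. \<omega> q (Z q) (X q)) + Z p (\<lambda>q. \<omega> q (X q) (Y q))
     - \<omega> p (lie_bracket X Y p) (Z p) - \<omega> p (lie_bracket Y Z p) (X p)
     - \<omega> p (lie_bracket Z X p) (Y p)"

definition symplectic_form :: "'a smooth_space \<Rightarrow> 'a form2 \<Rightarrow> bool" where
  "symplectic_form S \<omega> \<longleftrightarrow> two_form S \<omega> \<and>
     (\<forall>X Y Z. vector_field S X \<and> vector_field S Y \<and> vector_field S Z \<longrightarrow>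
        (\<forall>p\<in>points S. ext_deriv \<omega> X Y Z p = 0)) \<and>
     (\<forall>p\<in>points S. \<forall>v\<in>tangent S p. (\<forall>w\<in>tangent S p. \<omega> p v w = 0) \<longrightarrow> v = (\<lambda>_. 0))"

type_synonym 'a conn = "'a vfield \<Rightarrow> 'a vfield \<Rightarrow> 'a vfield"

definition linear_connection :: "'a smooth_space \<Rightarrow> 'a conn \<Rightarrow> bool" where
  "linear_connection S D \<longleftrightarrow>
     (\<forall>X Y. vector_field S X \<and> vector_field S Y \<longrightarrow> vector_field S (D X Y)) \<and>
     (\<forall>X Y Z. vector_field S X \<and> vector_field S Y \<and> vector_field S Z \<longrightarrow>
        (\<forall>f\<in>funs S. \<forall>p\<in>points S. \<forall>h.
           D (\<lambda>q h. X q h + Y q h) Z p h = D X Z p h + D Y Z p h \<and>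
           D (\<lambda>q h. f q * X q h) Z p h = f p * D X Z p h \<and>
           D X (\<lambda>q h. Y q h + Z q h) p h = D X Y p h + D X Z p h \<and>
           D X (\<lambda>q h. f q * Y q h) p h = X p f * Y p h + f p * D X Y p h))"

definition torsionless :: "'a smooth_space \<Rightarrow> 'a conn \<Rightarrow> bool" where
  "torsionless S D \<longleftrightarrow>
     (\<forall>X Y. vector_field S X \<and> vector_field S Y \<longrightarrow>
        (\<forall>p\<in>points S. \<forall>h. D X Y p h - D Y X p h = lie_bracket X Y p h))"

text \<open>$\nabla\omega = 0$.\<close>

definition parallel_form :: "'a smooth_space \<Rightarrow> 'a conn \<Rightarrow> 'a form2 \<Rightarrow> bool" where
  "parallel_form S D \<omega> \<longleftrightarrow>
     (\<forall>X Y Z. vector_field S X \<and> vector_field S Y \<and> vector_field S Z \<longrightarrow>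
        (\<forall>p\<in>points S.
           X p (\<lambda>q. \<omega> q (Y q) (Z q)) = \<omega> p (D X Y p) (Z p) + \<omega> p (Y p) (D X Z p)))"

definition symplectic_connection :: "'a smooth_space \<Rightarrow> 'a form2 \<Rightarrow> 'a conn \<Rightarrow> bool" where
  "symplectic_connection S \<omega> D \<longleftrightarrow>
     linear_connection S D \<and> torsionless S D \<and> parallel_form S D \<omega>"

section \<open>Parallel translation\<close>

definition smooth_curve :: "'a smooth_space \<Rightarrow> real set \<Rightarrow> (real \<Rightarrow> 'a) \<Rightarrow> bool" where
  "smooth_curve S I \<gamma> \<longleftrightarrow> open I \<and> is_interval I \<and> \<gamma> ` I \<subseteq> points S \<and>
     (\<forall>f\<in>funs S. smooth_on I (f \<circ> \<gamma>))"

definition velocity :: "'a smooth_space \<Rightarrow> (real \<Rightarrow> 'a) \<Rightarrow> real \<Rightarrow> 'a tvec" where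
  "velocity S \<gamma> t = (\<lambda>f. if f \<in> funs S then deriv (f \<circ> \<gamma>) t else 0)"

text \<open>$\nabla_v Y$ for a single tangent vector \<open>v\<close> at \<open>p\<close>; it does not depend on the vector field
  chosen to extend \<open>v\<close>, since \<open>D\<close> is tensorial in its first argument.\<close>

definition conn_at :: "'a smooth_space \<Rightarrow> 'a conn \<Rightarrow> 'a \<Rightarrow> 'a tvec \<Rightarrow> 'a vfield \<Rightarrow> 'a tvec" where
  "conn_at S D p v Y = D (SOME X. vector_field S X \<and> X p = v) Y p"

text \<open>\<open>W\<close> is the covariant derivative at time \<open>t\<close> of the vector field \<open>V\<close> along the curve \<open>\<gamma>\<close>:
  writing $V = \sum_i a_i\, (Y_i \circ \gamma)$ near \<open>t\<close>, it is
  $\sum_i (a_i'\, Y_i + a_i \nabla_{\gamma'} Y_i)$.\<close>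

definition has_covariant_derivative ::
  "'a smooth_space \<Rightarrow> 'a conn \<Rightarrow> (real \<Rightarrow> 'a) \<Rightarrow> (real \<Rightarrow> 'a tvec) \<Rightarrow> real \<Rightarrow> 'a tvec \<Rightarrow> bool" where
  "has_covariant_derivative S D \<gamma> V t W \<longleftrightarrow>
     (\<exists>J (n::nat) a Y. open J \<and> t \<in> J \<and>
        (\<forall>i<n. vector_field S (Y i) \<and> smooth_on J (a i)) \<and>
        (\<forall>s\<in>J. V s = (\<lambda>f. \<Sum>i<n. a i s * Y i (\<gamma> s) f)) \<and>
        W = (\<lambda>f. \<Sum>i<n. deriv (a i) t * Y i (\<gamma> t) f
                         + a i t * conn_at S D (\<gamma> t) (velocity S \<gamma> t) (Y i) f))"

definition parallel_along ::
  "'a smooth_space \<Rightarrow> 'a conn \<Rightarrow> real set \<Rightarrow> (real \<Rightarrow> 'a) \<Rightarrow> (real \<Rightarrow> 'a tvec) \<Rightarrow> bool" where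
  "parallel_along S D I \<gamma> V \<longleftrightarrow> (\<forall>t\<in>I. has_covariant_derivative S D \<gamma> V t (\<lambda>_. 0))"

text \<open>The image in $T_xM$ of a vector tangent to the submanifold, under the differential of
  the inclusion.\<close>

abbreviation incl :: "('a, 'e::euclidean_space) mfd \<Rightarrow> 'a tvec \<Rightarrow> 'a tvec" where
  "incl M \<equiv> pushforward (mfd_space M) (\<lambda>x. x)"

text \<open>Smooth curves suffice: parallel translation along a piecewise smooth path is the composite
  of those along its pieces. A smooth path on a compact interval extends to an open one.\<close>

definition self_parallel :: "('a, 'e::euclidean_space) mfd \<Rightarrow> 'a conn \<Rightarrow> 'a set \<Rightarrow> bool" where
  "self_parallel M D C \<longleftrightarrow>
     (\<forall>I \<gamma> V. smooth_curve (mfd_space M) I \<gamma> \<and> \<gamma> ` I \<subseteq> C \<and> parallel_along (mfd_space M) D I \<gamma> V \<longrightarrow>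
        (\<forall>s\<in>I. \<forall>t\<in>I. V s \<in> incl M ` tangent (subm_space M C) (\<gamma> s) \<longrightarrow>
                      V t \<in> incl M ` tangent (subm_space M C) (\<gamma> t)))"

text \<open>The connection \<open>D\<close> seen on the submanifold \<open>C\<close>: the vector tangent to \<open>C\<close> obtained by
  differentiating any vector fields on \<open>M\<close> that extend \<open>X\<close> and \<open>Y\<close> near \<open>x\<close>.\<close>

definition extends_near ::
  "('a, 'e::euclidean_space) mfd \<Rightarrow> 'a set \<Rightarrow> 'a \<Rightarrow> 'a vfield \<Rightarrow> 'a vfield \<Rightarrow> bool" where
  "extends_near M C x X X' \<longleftrightarrow> vector_field (mfd_space M) X' \<and>
     (\<exists>U. openin (mtop M) U \<and> x \<in> U \<and> (\<forall>y\<in>U \<inter> C. X' y = incl M (X y)))"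

definition conn_on :: "('a, 'e::euclidean_space) mfd \<Rightarrow> 'a set \<Rightarrow> 'a conn \<Rightarrow> 'a conn" where
  "conn_on M C D X Y x =
     (THE z. z \<in> tangent (subm_space M C) x \<and>
        (\<exists>X' Y'. extends_near M C x X X' \<and> extends_near M C x Y Y' \<and> incl M z = D X' Y' x))"

section \<open>Lie groups and Hamiltonian actions\<close>

definition lie_group :: "'g monoid \<Rightarrow> ('g, 'e::euclidean_space) mfd \<Rightarrow> bool" where
  "lie_group G L \<longleftrightarrow> group G \<and> smooth_manifold L \<and> topspace (mtop L) = carrier G \<and>
     smooth_map (mfd_space (prod_mfd L L)) (mfd_space L) (\<lambda>(g, h). g \<otimes>\<^bsub>G\<^esub> h) \<and>
     smooth_map (mfd_space L) (mfd_space L) (m_inv G)"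

definition lie_algebra :: "'g monoid \<Rightarrow> ('g, 'e::euclidean_space) mfd \<Rightarrow> 'g tvec set" where
  "lie_algebra G L = tangent (mfd_space L) \<one>\<^bsub>G\<^esub>"

type_synonym 'g covec = "'g tvec \<Rightarrow> real"

text \<open>Linear forms on the Lie algebra, extended by 0.\<close>

definition lie_dual :: "'g monoid \<Rightarrow> ('g, 'e::euclidean_space) mfd \<Rightarrow> 'g covec set" where
  "lie_dual G L =
     {\<eta>. (\<forall>A\<in>lie_algebra G L. \<forall>B\<in>lie_algebra G L. \<eta> (\<lambda>f. A f + B f) = \<eta> A + \<eta> B) \<and>
         (\<forall>A\<in>lie_algebra G L. \<forall>c. \<eta> (\<lambda>f. c * A f) = c * \<eta> A) \<and>
         (\<forall>A. A \<notin> lie_algebra G L \<longrightarrow> \<eta> A = 0)}"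

definition Ad :: "'g monoid \<Rightarrow> ('g, 'e::euclidean_space) mfd \<Rightarrow> 'g \<Rightarrow> 'g tvec \<Rightarrow> 'g tvec" where
  "Ad G L g = pushforward (mfd_space L) (\<lambda>h. g \<otimes>\<^bsub>G\<^esub> h \<otimes>\<^bsub>G\<^esub> inv\<^bsub>G\<^esub> g)"

text \<open>The left coadjoint action
  $\langle \mathrm{Ad}^*_g \eta, A\rangle = \langle \eta, \mathrm{Ad}_{g^{-1}} A\rangle$.\<close>

definition coAd :: "'g monoid \<Rightarrow> ('g, 'e::euclidean_space) mfd \<Rightarrow> 'g \<Rightarrow> 'g covec \<Rightarrow> 'g covec" where
  "coAd G L g \<eta> = (\<lambda>A. if A \<in> lie_algebra G L then \<eta> (Ad G L (inv\<^bsub>G\<^esub> g) A) else 0)"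

definition smooth_action ::
  "'g monoid \<Rightarrow> ('g, 'k::euclidean_space) mfd \<Rightarrow> ('a, 'e::euclidean_space) mfd \<Rightarrow>
   ('g \<Rightarrow> 'a \<Rightarrow> 'a) \<Rightarrow> bool" where
  "smooth_action G L M \<Phi> \<longleftrightarrow> group_action G (topspace (mtop M)) \<Phi> \<and>
     smooth_map (mfd_space (prod_mfd L M)) (mfd_space M) (\<lambda>(g, x). \<Phi> g x)"

definition affine_action ::
  "'g monoid \<Rightarrow> ('a, 'e::euclidean_space) mfd \<Rightarrow> 'a conn \<Rightarrow> ('g \<Rightarrow> 'a \<Rightarrow> 'a) \<Rightarrow> bool" where
  "affine_action G M D \<Phi> \<longleftrightarrow>
     (\<forall>g\<in>carrier G.
        let push = (\<lambda>X q. pushforward (mfd_space M) (\<Phi> g) (X (\<Phi> (inv\<^bsub>G\<^esub> g) q)))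
        in \<forall>X Y. vector_field (mfd_space M) X \<and> vector_field (mfd_space M) Y \<longrightarrow>
             (\<forall>q\<in>points (mfd_space M). push (D X Y) q = D (push X) (push Y) q))"

text \<open>The infinitesimal generator
  $A_M(x) = \frac{d}{dt}\big|_{t=0} \Phi(\exp tA, x)$, that is, the image of \<open>A\<close> under the
  differential at the identity of the orbit map $g \mapsto \Phi(g,x)$.\<close>

definition inf_gen ::
  "('a, 'e::euclidean_space) mfd \<Rightarrow> ('g \<Rightarrow> 'a \<Rightarrow> 'a) \<Rightarrow> 'g tvec \<Rightarrow> 'a vfield" where
  "inf_gen M \<Phi> A x = pushforward (mfd_space M) (\<lambda>g. \<Phi> g x) A"

text \<open>\<open>J\<close> is smooth as a map into the finite-dimensional vector space \<open>lie_dual G L\<close> iff all its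
  components $\langle J, A\rangle$ are smooth. With the opposite sign convention for the moment map,
  replace \<open>\<omega>\<close> by \<open>-\<omega>\<close>.\<close>

definition hamiltonian_action ::
  "'g monoid \<Rightarrow> ('g, 'k::euclidean_space) mfd \<Rightarrow> ('a, 'e::euclidean_space) mfd \<Rightarrow> 'a form2 \<Rightarrow>
   ('g \<Rightarrow> 'a \<Rightarrow> 'a) \<Rightarrow> ('a \<Rightarrow> 'g covec) \<Rightarrow> bool" where
  "hamiltonian_action G L M \<omega> \<Phi> J \<longleftrightarrow>
     smooth_action G L M \<Phi> \<and>
     (\<forall>g\<in>carrier G. \<forall>x\<in>points (mfd_space M).
        \<forall>v\<in>tangent (mfd_space M) x. \<forall>w\<in>tangent (mfd_space M) x.
          \<omega> (\<Phi> g x) (pushforward (mfd_space M) (\<Phi> g) v) (pushforward (mfd_space M) (\<Phi> g) w) = \<omega> x v w) \<and>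
     (\<forall>x\<in>points (mfd_space M). J x \<in> lie_dual G L) \<and>
     (\<forall>A\<in>lie_algebra G L. (\<lambda>x. J x A) \<in> funs (mfd_space M)) \<and>
     (\<forall>A\<in>lie_algebra G L. \<forall>x\<in>points (mfd_space M). \<forall>v\<in>tangent (mfd_space M) x.
        \<omega> x (inf_gen M \<Phi> A x) v = v (\<lambda>y. J y A)) \<and>
     (\<forall>g\<in>carrier G. \<forall>x\<in>points (mfd_space M). J (\<Phi> g x) = coAd G L g (J x))"

definition level_set ::
  "('a, 'e::euclidean_space) mfd \<Rightarrow> ('a \<Rightarrow> 'g covec) \<Rightarrow> 'g covec \<Rightarrow> 'a set" where
  "level_set M J \<xi> = {x \<in> topspace (mtop M). J x = \<xi>}"

text \<open>At every point \<open>x\<close> of the level set, the differential of \<open>J\<close> maps $T_xM$ onto the dual of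
  the Lie algebra.\<close>

definition noncritical_value ::
  "'g monoid \<Rightarrow> ('g, 'k::euclidean_space) mfd \<Rightarrow> ('a, 'e::euclidean_space) mfd \<Rightarrow>
   ('a \<Rightarrow> 'g covec) \<Rightarrow> 'g covec \<Rightarrow> bool" where
  "noncritical_value G L M J \<xi> \<longleftrightarrow>
     (\<forall>x\<in>level_set M J \<xi>. \<forall>\<eta>\<in>lie_dual G L. \<exists>v\<in>tangent (mfd_space M) x.
        \<forall>A\<in>lie_algebra G L. v (\<lambda>y. J y A) = \<eta> A)"

section \<open>Reduction\<close>

definition isotropy :: "'g monoid \<Rightarrow> ('g, 'k::euclidean_space) mfd \<Rightarrow> 'g covec \<Rightarrow> 'g monoid" where
  "isotropy G L \<xi> = G\<lparr>carrier := stabilizer G (coAd G L) \<xi>\<rparr>"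

text \<open>The manifold \<open>N\<close> with the 2-form \<open>\<omega>'\<close> is the reduced symplectic manifold of \<open>C\<close> by the
  group \<open>H\<close>.\<close>

definition reduced_symplectic_manifold ::
  "('a, 'e::euclidean_space) mfd \<Rightarrow> 'a form2 \<Rightarrow> 'g monoid \<Rightarrow> ('g \<Rightarrow> 'a \<Rightarrow> 'a) \<Rightarrow> 'a set \<Rightarrow>
   ('a set, 'n::euclidean_space) mfd \<Rightarrow> 'a set form2 \<Rightarrow> bool" where
  "reduced_symplectic_manifold M \<omega> H \<Phi> C N \<omega>' \<longleftrightarrow>
     smooth_manifold N \<and> topspace (mtop N) = orbits H C \<Phi> \<and>
     submersion (subm_space M C) (mfd_space N) (orbit H \<Phi>) \<and>
     symplectic_form (mfd_space N) \<omega>' \<and>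
     (\<forall>x\<in>C. \<forall>v\<in>tangent (subm_space M C) x. \<forall>w\<in>tangent (subm_space M C) x.
        \<omega>' (orbit H \<Phi> x) (pushforward (mfd_space N) (orbit H \<Phi>) v)
                         (pushforward (mfd_space N) (orbit H \<Phi>) w)
        = \<omega> x (incl M v) (incl M w))"

text \<open>The connection \<open>D'\<close> on \<open>T\<close> is given by the formula
  $\nabla'_{\mathcal X}\mathcal Y = \pi_*(\nabla_X Y)$: vector fields on \<open>T\<close> have lifts, and
  $\nabla_X Y$ projects to the same vector field for all lifts \<open>X\<close>, \<open>Y\<close> of
  $\mathcal X$, $\mathcal Y$.\<close>

definition induces_connection ::
  "'a smooth_space \<Rightarrow> 'a conn \<Rightarrow> 'b smooth_space \<Rightarrow> ('a \<Rightarrow> 'b) \<Rightarrow> 'b conn \<Rightarrow> bool" where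
  "induces_connection S D T \<pi> D' \<longleftrightarrow>
     linear_connection T D' \<and>
     (\<forall>X'. vector_field T X' \<longrightarrow> (\<exists>X. vector_field S X \<and> projects_to S T \<pi> X X')) \<and>
     (\<forall>X' Y' X Y. vector_field T X' \<and> vector_field T Y' \<and> vector_field S X \<and> vector_field S Y \<and>
        projects_to S T \<pi> X X' \<and> projects_to S T \<pi> Y Y' \<longrightarrow>
          vector_field S (D X Y) \<and> projects_to S T \<pi> (D X Y) (D' X' Y'))"

end

theory Submission
  imports Defs
begin

text \<open>The kernel of \<open>\<omega>|\<^sub>C\<close> consists of the vertical vectors, those tangent to the fibres of
  \<open>\<pi> : C \<rightarrow> N\<close>. As \<open>\<omega>\<close> and \<open>TC\<close> are parallel, \<open>\<nabla>\<^sub>X V\<close> is vertical for vertical \<open>V\<close>; if \<open>X\<close> is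
  projectable then \<open>[X, V]\<close> is vertical, hence so is \<open>\<nabla>\<^sub>V X\<close> because the torsion vanishes. So
  \<open>\<pi>\<^sub>* (\<nabla>\<^sub>X Y)\<close> at a point does not depend on the lifts \<open>X\<close>, \<open>Y\<close>, and it is constant along the fibres
  because moving the lifts by an affine \<open>\<Phi> g\<close> gives lifts of the same fields. Global lifts come
  from local ones by a partition of unity, and a function on \<open>N\<close> with smooth pullback is smooth
  since the integral curves of lifted coordinate fields project to straight lines in a chart.\<close>

section \<open>Calculus of smooth maps on open sets\<close>

text \<open>\<open>C\<close> never receives charts. It is seen only through its algebra of smooth
  functions, so implicit functions and local sections of \<pi> give way to integral curves: fields
  on \<open>M\<close> annihilating the defining functions of \<open>C\<close> have integral curves
  inside \<open>C\<close>, and these realise tangent vectors, carry parallel transport and detect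
  smoothness on \<open>N\<close>. The hypothesis on parallel transport concerns whole curves, while
  the argument needs it at a point, as tangency of \<open>D X Y\<close>; an adjoint linear equation
  for covectors leads from one to the other. The kernel of the form on \<open>C\<close> is read off
  from the reduced form: the pullback relation, surjectivity of the differential of \<pi> and
  nondegeneracy of \<omega>' make it the kernel of that differential. A basis of the Lie algebra
  turns \<open>J x = \<xi>\<close> into finitely many independent equations, and two points of one
  fibre of \<pi> differ by an element of the isotropy group. The passage to \<open>N\<close> is then
  carried out for an abstract submersion, in the locale \<open>projection\<close>.\<close>

definition Cinf_on :: "'e::euclidean_space set \<Rightarrow> ('e \<Rightarrow> 'f::euclidean_space) \<Rightarrow> bool" where
  "Cinf_on U f \<longleftrightarrow> (\<forall>k. Ck_on k U f)"

lemma differentiable_onI_at: "(\<And>x. x \<in> U \<Longrightarrow> f differentiable (at x)) \<Longrightarrow> f differentiable_on U"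
  by (meson differentiable_at_imp_differentiable_on)

lemma Ck_on_continuous: "Ck_on k U f \<Longrightarrow> continuous_on U f"
  by (cases k) (auto intro!: differentiable_imp_continuous_on differentiable_onI_at)

lemma Ck_on_SucD: "Ck_on (Suc k) U f \<Longrightarrow> Ck_on k U f"
proof (induction k arbitrary: f)
  case 0
  then show ?case using Ck_on_continuous by fastforce
qed auto

lemma Ck_on_has_derivative:
  "Ck_on (Suc k) U f \<Longrightarrow> x \<in> U \<Longrightarrow> (f has_derivative frechet_derivative f (at x)) (at x)"
  by (simp add: frechet_derivative_works)

lemma Ck_on_subset: "Ck_on k U f \<Longrightarrow> V \<subseteq> U \<Longrightarrow> Ck_on k V f"
  by (induction k arbitrary: f) (auto intro: continuous_on_subset)

text \<open>\<open>frechet_derivative\<close> is a choice among all derivatives. Functions with the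
  same germ admit the same derivatives, so the choice agrees even where no derivative
  exists.\<close>

lemma frechet_derivative_transform:
  assumes "open U" "x \<in> U" "\<And>y. y \<in> U \<Longrightarrow> f y = g y"
  shows "frechet_derivative f (at x) = frechet_derivative g (at x)"
proof -
  have "(f has_derivative D) (at x) \<longleftrightarrow> (g has_derivative D) (at x)" for D
    using has_derivative_transform_within_open[of f D x UNIV U g]
      has_derivative_transform_within_open[of g D x UNIV U f] assms by auto
  then show ?thesis by (simp add: frechet_derivative_def)
qed

lemma differentiable_transform_open:
  assumes "open U" "x \<in> U" "\<And>y. y \<in> U \<Longrightarrow> f y = g y" "f differentiable (at x)"
  shows "g differentiable (at x)"
  using assms has_derivative_transform_within_open[of f _ x UNIV U g]
  by (auto simp: differentiable_def)

lemma Ck_on_cong: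
  assumes "open U" "\<And>x. x \<in> U \<Longrightarrow> f x = g x" "Ck_on k U f"
  shows "Ck_on k U g"
  using assms(2,3)
proof (induction k arbitrary: f g)
  case 0
  then show ?case using continuous_on_cong by fastforce
next
  case (Suc k)
  have "Ck_on k U (\<lambda>x. frechet_derivative g (at x) v)" for v
    by (rule Suc.IH[of "\<lambda>x. frechet_derivative f (at x) v"])
      (use Suc.prems frechet_derivative_transform[OF assms(1), of _ f g] in auto)
  then show ?case
    using Suc.prems differentiable_transform_open[OF assms(1), of _ f g] by auto
qed

text \<open>Derivatives at interior points are unique, so an explicit \<open>F\<close> may stand in
  for \<open>frechet_derivative\<close>. Most closure properties below are inductions through this
  rule.\<close>

lemma Ck_on_SucI:
  assumes "open U" "\<And>x. x \<in> U \<Longrightarrow> (f has_derivative F x) (at x)"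
    "\<And>v. Ck_on k U (\<lambda>x. F x v)"
  shows "Ck_on (Suc k) U f"
proof -
  have "Ck_on k U (\<lambda>x. frechet_derivative f (at x) v)" for v
    by (rule Ck_on_cong[OF assms(1) _ assms(3)[of v]])
      (use assms(2) frechet_derivative_at in metis)
  then show ?thesis using assms(2) by (auto simp: differentiable_def)
qed

lemma Ck_on_local:
  assumes "\<And>x. x \<in> U \<Longrightarrow> \<exists>W. open W \<and> x \<in> W \<and> Ck_on k W f"
  shows "Ck_on k U f"
  using assms
proof (induction k arbitrary: f)
  case 0
  have "continuous (at x within U) f" if x: "x \<in> U" for x
    using 0[OF x] by (meson Ck_on_continuous continuous_at_imp_continuous_at_within
        continuous_on_eq_continuous_at)
  then show ?case by (simp add: continuous_on_eq_continuous_within)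
next
  case (Suc k)
  have "Ck_on k U (\<lambda>x. frechet_derivative f (at x) v)" for v
    by (rule Suc.IH) (use Suc.prems in fastforce)
  moreover have "f differentiable (at x)" if "x \<in> U" for x
    using Suc.prems[OF that] by auto
  ultimately show ?case by simp
qed

lemma Ck_on_const: "Ck_on k U (\<lambda>_. c)"
proof (induction k arbitrary: c)
  case (Suc k)
  have "frechet_derivative (\<lambda>_. c) (at x) = (\<lambda>_. 0)" for x :: 'a
    using frechet_derivative_at[OF has_derivative_const] by metis
  then show ?case using Suc[of 0] by simp
qed simp

lemma Ck_on_bounded_linear:
  assumes "bounded_linear L" "open U"
  shows "Ck_on k U L"
proof (cases k)
  case 0
  then show ?thesis using assms by (simp add: linear_continuous_on)
next
  case (Suc m)
  show ?thesis unfolding Suc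
    by (rule Ck_on_SucI[where F="\<lambda>_. L"]) (use assms in \<open>auto intro: Ck_on_const
        bounded_linear_imp_has_derivative\<close>)
qed

lemma Ck_on_add:
  assumes "open U" "Ck_on k U f" "Ck_on k U g"
  shows "Ck_on k U (\<lambda>x. f x + g x)"
  using assms(2,3)
proof (induction k arbitrary: f g)
  case (Suc k)
  show ?case
    by (rule Ck_on_SucI[OF assms(1), where
          F="\<lambda>x v. frechet_derivative f (at x) v + frechet_derivative g (at x) v"])
      (use Suc.prems[THEN Ck_on_has_derivative] Suc
        in \<open>simp_all add: has_derivative_add\<close>)
qed (simp add: continuous_on_add)

lemma Ck_on_sum:
  assumes "open U" "\<And>i. i \<in> I \<Longrightarrow> Ck_on k U (f i)"
  shows "Ck_on k U (\<lambda>x. \<Sum>i\<in>I. f i x)"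
  using assms(2)
proof (induction I rule: infinite_finite_induct)
  case (insert i I)
  then show ?case by (simp add: Ck_on_add[OF assms(1)])
qed (auto intro: Ck_on_const)

lemma Ck_on_scaleR:
  assumes "open U" "Ck_on k U f" "Ck_on k U g"
  shows "Ck_on k U (\<lambda>x. (f x :: real) *\<^sub>R g x)"
  using assms(2,3)
proof (induction k arbitrary: f g)
  case (Suc k)
  show ?case
    by (rule Ck_on_SucI[OF assms(1), where
          F="\<lambda>x v. f x *\<^sub>R frechet_derivative g (at x) v + frechet_derivative f (at x) v *\<^sub>R g x"])
      (use Suc.prems[THEN Ck_on_has_derivative] Suc.prems[THEN Ck_on_SucD] Suc in
        \<open>simp_all add: has_derivative_scaleR Ck_on_add[OF assms(1)]\<close>)
qed (simp add: continuous_on_scaleR)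

lemma Ck_on_mult:
  "open U \<Longrightarrow> Ck_on k U f \<Longrightarrow> Ck_on k U g \<Longrightarrow> Ck_on k U (\<lambda>x. (f x :: real) * g x)"
  using Ck_on_scaleR[of U k f g] by simp

lemma linear_frechet: "f differentiable (at x) \<Longrightarrow> linear (frechet_derivative f (at x))"
  by (simp add: linear_frechet_derivative)

lemma linear_Basis_expand:
  assumes "linear L"
  shows "L v = (\<Sum>b\<in>Basis. (v \<bullet> b) *\<^sub>R L b)"
proof -
  have "L v = L (\<Sum>b\<in>Basis. (v \<bullet> b) *\<^sub>R b)" by (simp add: euclidean_representation)
  then show ?thesis using assms by (simp add: linear_sum linear_cmul)
qed

lemma Ck_on_linear_comp:
  assumes "bounded_linear L" "open U" "Ck_on k U f"
  shows "Ck_on k U (\<lambda>x. L (f x))"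
  using assms(3)
proof (induction k arbitrary: f)
  case 0
  then show ?case using assms(1) by (simp add: bounded_linear.continuous_on)
next
  case (Suc k)
  show ?case
  proof (rule Ck_on_SucI[OF assms(2)])
    show "((\<lambda>x. L (f x)) has_derivative (\<lambda>v. L (frechet_derivative f (at x) v))) (at x)"
      if "x \<in> U" for x
      by (rule bounded_linear.has_derivative[OF assms(1) Ck_on_has_derivative[OF Suc.prems that]])
    show "Ck_on k U (\<lambda>x. L (frechet_derivative f (at x) v))" for v
      by (rule Suc.IH) (use Suc.prems in simp)
  qed
qed

text \<open>The chain rule yields the derivative of \<open>g\<close> at a moving point in a moving
  direction, a form not covered by the induction. Expanding the direction in \<open>Basis\<close>
  leaves derivatives of \<open>g\<close> in fixed directions, to which the induction hypothesis
  applies, times coordinates of the derivative of \<open>f\<close>.\<close>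

lemma Ck_on_compose:
  assumes "open U" "open V" "f ` U \<subseteq> V" "Ck_on k U f" "Ck_on k V g"
  shows "Ck_on k U (\<lambda>x. g (f x))"
  using assms(4,5)
proof (induction k arbitrary: g)
  case 0
  then show ?case using continuous_on_compose2[OF _ _ assms(3), of g] by simp
next
  case (Suc k)
  have g: "linear (frechet_derivative g (at (f x)))" if "x \<in> U" for x
    using Suc.prems(2) that assms(3) by (intro linear_frechet) auto
  show ?case
  proof (rule Ck_on_SucI[OF assms(1), where F="\<lambda>x v. \<Sum>b\<in>Basis.
          (frechet_derivative f (at x) v \<bullet> b) *\<^sub>R frechet_derivative g (at (f x)) b"])
    fix x assume x: "x \<in> U"
    have "((\<lambda>x. g (f x)) has_derivative
        (\<lambda>v. frechet_derivative g (at (f x)) (frechet_derivative f (at x) v))) (at x)"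
      using has_derivative_compose[OF Ck_on_has_derivative[OF Suc.prems(1) x]
          Ck_on_has_derivative[OF Suc.prems(2)]] x assms(3) by blast
    then show "((\<lambda>x. g (f x)) has_derivative (\<lambda>v. \<Sum>b\<in>Basis.
          (frechet_derivative f (at x) v \<bullet> b) *\<^sub>R frechet_derivative g (at (f x)) b)) (at x)"
      by (rule has_derivative_eq_rhs) (rule ext, rule linear_Basis_expand[OF g[OF x]])
  next
    fix v
    show "Ck_on k U (\<lambda>x. \<Sum>b\<in>Basis.
          (frechet_derivative f (at x) v \<bullet> b) *\<^sub>R frechet_derivative g (at (f x)) b)"
    proof (intro Ck_on_sum Ck_on_scaleR assms(1))
      fix b
      show "Ck_on k U (\<lambda>x. frechet_derivative f (at x) v \<bullet> b)"
        by (rule Ck_on_linear_comp[OF bounded_linear_inner_left assms(1)]) (use Suc.prems in simp)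
      show "Ck_on k U (\<lambda>x. frechet_derivative g (at (f x)) b)"
        by (rule Suc.IH[OF Ck_on_SucD[OF Suc.prems(1)]]) (use Suc.prems in simp)
    qed
  qed
qed

lemma open_nonzero: "open {x::real. x \<noteq> 0}"
proof -
  have "{x::real. x \<noteq> 0} = - {0}" by auto
  then show ?thesis by (metis open_Compl closed_singleton)
qed

text \<open>The derivative is a polynomial in \<open>inverse\<close> itself, so the induction closes
  without tracking higher powers.\<close>

lemma Ck_on_inverse: "Ck_on k {x::real. x \<noteq> 0} inverse"
proof (induction k)
  case 0
  then show ?case using continuous_on_inverse[OF continuous_on_id, of "{x::real. x \<noteq> 0}"] by simp
next
  case (Suc k)
  note o = open_nonzero
  show ?case
  proof (rule Ck_on_SucI[OF o, where F="\<lambda>x v. - (inverse x * v * inverse x)"])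
    fix v
    have "Ck_on k {x::real. x \<noteq> 0} (\<lambda>x. (-v) * (inverse x * inverse x))"
      by (rule Ck_on_mult[OF o Ck_on_const Ck_on_mult[OF o Suc Suc]])
    moreover have "(\<lambda>x::real. (-v) * (inverse x * inverse x)) = (\<lambda>x. - (inverse x * v * inverse x))"
      by (simp add: fun_eq_iff)
    ultimately show "Ck_on k {x::real. x \<noteq> 0} (\<lambda>x. - (inverse x * v * inverse x))"
      by (rule back_subst)
  next
    fix x :: real assume "x \<in> {x. x \<noteq> 0}"
    then show "(inverse has_derivative (\<lambda>v. - (inverse x * v * inverse x))) (at x)"
      using has_derivative_inverse'[of x UNIV] by blast
  qed
qed

lemma Cinf_onD: "Cinf_on U f \<Longrightarrow> Ck_on k U f"
  by (simp add: Cinf_on_def)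

lemma Cinf_on_continuous: "Cinf_on U f \<Longrightarrow> continuous_on U f"
  by (rule Ck_on_continuous[OF Cinf_onD])

lemma Cinf_on_has_derivative:
  "Cinf_on U f \<Longrightarrow> x \<in> U \<Longrightarrow> (f has_derivative frechet_derivative f (at x)) (at x)"
  by (rule Ck_on_has_derivative[OF Cinf_onD])

lemma Cinf_on_frechet: "Cinf_on U f \<Longrightarrow> Cinf_on U (\<lambda>x. frechet_derivative f (at x) v)"
  unfolding Cinf_on_def
proof
  fix k assume "\<forall>k. Ck_on k U f"
  then have "Ck_on (Suc k) U f" ..
  then show "Ck_on k U (\<lambda>x. frechet_derivative f (at x) v)" by simp
qed

lemma Cinf_onI: "(\<And>k. Ck_on k U f) \<Longrightarrow> Cinf_on U f"
  by (simp add: Cinf_on_def)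

lemma Cinf_on_subset: "Cinf_on U f \<Longrightarrow> V \<subseteq> U \<Longrightarrow> Cinf_on V f"
  by (rule Cinf_onI) (rule Ck_on_subset[OF Cinf_onD])

lemma Cinf_on_cong:
  "open U \<Longrightarrow> (\<And>x. x \<in> U \<Longrightarrow> f x = g x) \<Longrightarrow> Cinf_on U f \<Longrightarrow> Cinf_on U g"
  by (rule Cinf_onI) (rule Ck_on_cong[OF _ _ Cinf_onD])

lemma Cinf_on_local:
  assumes "\<And>x. x \<in> U \<Longrightarrow> \<exists>W. open W \<and> x \<in> W \<and> Cinf_on W f"
  shows "Cinf_on U f"
proof (rule Cinf_onI, rule Ck_on_local)
  fix k x assume "x \<in> U"
  then show "\<exists>W. open W \<and> x \<in> W \<and> Ck_on k W f" using assms Cinf_onD by metis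
qed

lemma Cinf_on_const: "Cinf_on U (\<lambda>_. c)"
  by (rule Cinf_onI) (rule Ck_on_const)

lemma Cinf_on_linear: "bounded_linear L \<Longrightarrow> open U \<Longrightarrow> Cinf_on U L"
  by (rule Cinf_onI) (rule Ck_on_bounded_linear)

lemma Cinf_on_add:
  "open U \<Longrightarrow> Cinf_on U f \<Longrightarrow> Cinf_on U g \<Longrightarrow> Cinf_on U (\<lambda>x. f x + g x)"
  by (rule Cinf_onI) (rule Ck_on_add[OF _ Cinf_onD Cinf_onD])

lemma Cinf_on_sum:
  "open U \<Longrightarrow> (\<And>i. i \<in> I \<Longrightarrow> Cinf_on U (f i)) \<Longrightarrow> Cinf_on U (\<lambda>x. \<Sum>i\<in>I. f i x)"
  by (rule Cinf_onI) (rule Ck_on_sum[OF _ Cinf_onD])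

lemma Cinf_on_scaleR:
  "open U \<Longrightarrow> Cinf_on U f \<Longrightarrow> Cinf_on U g \<Longrightarrow> Cinf_on U (\<lambda>x. (f x :: real) *\<^sub>R g x)"
  by (rule Cinf_onI) (rule Ck_on_scaleR[OF _ Cinf_onD Cinf_onD])

lemma Cinf_on_mult:
  "open U \<Longrightarrow> Cinf_on U f \<Longrightarrow> Cinf_on U g \<Longrightarrow> Cinf_on U (\<lambda>x. (f x :: real) * g x)"
  by (rule Cinf_onI) (rule Ck_on_mult[OF _ Cinf_onD Cinf_onD])

lemma Cinf_on_compose:
  "open U \<Longrightarrow> open V \<Longrightarrow> f ` U \<subseteq> V \<Longrightarrow> Cinf_on U f \<Longrightarrow> Cinf_on V g \<Longrightarrow>
    Cinf_on U (\<lambda>x. g (f x))"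
  by (rule Cinf_onI) (rule Ck_on_compose[OF _ _ _ Cinf_onD Cinf_onD])

lemma Cinf_on_inverse:
  fixes f :: "'a::euclidean_space \<Rightarrow> real"
  assumes "open U" "Cinf_on U f" "\<And>x. x \<in> U \<Longrightarrow> f x \<noteq> 0"
  shows "Cinf_on U (\<lambda>x. inverse (f x))"
proof (rule Cinf_on_compose[OF assms(1) _ _ assms(2)])
  show "open {x::real. x \<noteq> 0}"
    by (rule open_nonzero)
  show "f ` U \<subseteq> {x. x \<noteq> 0}" by (rule image_subsetI) (simp add: assms(3))
  show "Cinf_on {x::real. x \<noteq> 0} inverse" by (rule Cinf_onI) (rule Ck_on_inverse)
qed

lemma smooth_onE:
  assumes "smooth_on A f" "x \<in> A"
  obtains U g where "open U" "x \<in> U" "Cinf_on U g" "\<forall>y\<in>U \<inter> A. g y = f y"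
proof -
  have "\<exists>U g. open U \<and> x \<in> U \<and> Cinf_on U g \<and> (\<forall>y\<in>U \<inter> A. g y = f y)"
    using bspec[OF assms(1)[unfolded smooth_on_def] assms(2)] unfolding Cinf_on_def .
  then show ?thesis by (elim exE conjE) (rule that)
qed

lemma smooth_onI:
  "(\<And>x. x \<in> A \<Longrightarrow> \<exists>U g. open U \<and> x \<in> U \<and> Cinf_on U g \<and> (\<forall>y\<in>U \<inter> A. g y = f y)) \<Longrightarrow> smooth_on A f"
  unfolding smooth_on_def Cinf_on_def by (rule ballI)

lemma Cinf_on_imp_smooth_on: "open U \<Longrightarrow> A \<subseteq> U \<Longrightarrow> Cinf_on U f \<Longrightarrow> smooth_on A f"
  by (rule smooth_onI, rule exI[of _ U], rule exI[of _ f]) (simp add: subset_iff)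

section \<open>Bump functions\<close>

text \<open>The derivatives of \<open>exp (- 1 / x)\<close> are combinations of the functions \<open>flat m\<close>.\<close>

definition flat :: "nat \<Rightarrow> real \<Rightarrow> real" where
  "flat m x = (if x > 0 then exp (- inverse x) * inverse x ^ m else 0)"

text \<open>Only the point 0 is delicate. From the right the difference quotient is
  \<open>exp (- inverse h) * inverse h ^ Suc m\<close>, and after substituting
  \<open>y = inverse h\<close> the exponential beats the power; from the left the quotient is
  0.\<close>

lemma flat_has_derivative:
  "(flat m has_field_derivative flat (m + 2) x - real m * flat (m + 1) x) (at x)"
proof -
  consider "x > 0" | "x < 0" | "x = 0" by linarith
  then show ?thesis
  proof cases
    case 1
    have "((\<lambda>x. exp (- inverse x) * inverse x ^ m) has_field_derivative
        flat (m + 2) x - real m * flat (m + 1) x) (at x)"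
      using 1 by (auto intro!: derivative_eq_intros simp: flat_def algebra_simps power2_eq_square
          power_Suc[symmetric] simp del: power_Suc)
        (cases m; simp add: algebra_simps)
    then show ?thesis
      by (rule has_field_derivative_transform_within_open[of _ _ _ "{0<..}"])
        (use 1 in \<open>auto simp: flat_def\<close>)
  next
    case 2
    have "((\<lambda>x. 0) has_field_derivative flat (m + 2) x - real m * flat (m + 1) x) (at x)"
      using 2 by (auto simp: flat_def)
    then show ?thesis
      by (rule has_field_derivative_transform_within_open[of _ _ _ "{..<0}"])
        (use 2 in \<open>auto simp: flat_def\<close>)
  next
    case 3
    have lim: "((\<lambda>y::real. exp (- y) * y ^ Suc m) \<longlongrightarrow> 0) at_top"
    proof -
      have eq: "exp (- y) * y ^ Suc m = y ^ Suc m / exp y" for y :: real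
        by (simp only: exp_minus divide_inverse mult.commute)
      show ?thesis unfolding eq by (rule tendsto_power_div_exp_0)
    qed
    have "((\<lambda>h. exp (- inverse h) * inverse h ^ Suc m) \<longlongrightarrow> 0) (at_right (0::real))"
      using filterlim_compose[OF lim filterlim_inverse_at_top_right] .
    then have "((\<lambda>h. (flat m (0 + h) - flat m 0) / h) \<longlongrightarrow> 0) (at_right 0)"
      by (rule Lim_transform_eventually)
        (auto simp: flat_def eventually_at_right_less field_simps intro!: eventually_at_rightI[of 0 1])
    moreover have "((\<lambda>h. (flat m (0 + h) - flat m 0) / h) \<longlongrightarrow> 0) (at_left 0)"
      by (rule Lim_transform_eventually[of "\<lambda>_. 0"])
        (auto simp: flat_def intro!: eventually_at_leftI[of "-1"])
    ultimately have "((\<lambda>h. (flat m (0 + h) - flat m 0) / h) \<longlongrightarrow> 0) (at 0)"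
      using filterlim_split_at by blast
    then show ?thesis using 3 by (simp add: DERIV_def flat_def)
  qed
qed

lemma Cinf_on_flat: "Cinf_on UNIV (flat m)"
proof -
  have "Ck_on k UNIV (flat m)" for k
  proof (induction k arbitrary: m)
    case 0
    then show ?case
      using DERIV_continuous[OF flat_has_derivative] by (simp add: continuous_at_imp_continuous_on)
  next
    case (Suc k)
    show ?case
    proof (rule Ck_on_SucI)
      show "(flat m has_derivative (\<lambda>v. (flat (m + 2) x - real m * flat (m + 1) x) * v)) (at x)" for x
        using flat_has_derivative[of m x] by (simp add: has_field_derivative_def)
      fix v
      have "Ck_on k UNIV (\<lambda>x. v * (flat (m + 2) x + (- real m) * flat (m + 1) x))"
        by (intro Ck_on_mult Ck_on_add Suc.IH Ck_on_const open_UNIV)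
      then show "Ck_on k UNIV (\<lambda>x. (flat (m + 2) x - real m * flat (m + 1) x) * v)"
        by (simp add: algebra_simps)
    qed simp
  qed
  then show ?thesis by (simp add: Cinf_on_def)
qed

lemma Cinf_on_inner_self: "Cinf_on UNIV (\<lambda>x::'a::euclidean_space. (x - a) \<bullet> (x - a))"
proof -
  have "Cinf_on UNIV (\<lambda>x. (x - a) \<bullet> b)" for b :: 'a
    using Cinf_on_add[OF open_UNIV Cinf_on_linear[OF bounded_linear_inner_left[of b] open_UNIV]
        Cinf_on_const[of UNIV "- (a \<bullet> b)"]] by (simp add: inner_diff_left)
  then have "Cinf_on UNIV (\<lambda>x. \<Sum>b\<in>Basis. ((x - a) \<bullet> b) * ((x - a) \<bullet> b))"
    by (intro Cinf_on_sum Cinf_on_mult open_UNIV)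
  then show ?thesis by (simp add: euclidean_inner[symmetric])
qed

text \<open>The function \<beta> is a / (a + b), where a is positive exactly inside the ball of
  radius \<open>R\<close> and b exactly outside the closed ball of radius \<open>r\<close>. Since
  \<open>r < R\<close> they never vanish together. Squared distances keep the arguments of
  \<open>flat\<close> smooth at the centre.\<close>

lemma bump_function:
  fixes a :: "'a::euclidean_space"
  assumes "0 < r" "r < R"
  obtains \<beta> :: "'a \<Rightarrow> real" where "Cinf_on UNIV \<beta>" "\<And>x. dist a x \<le> r \<Longrightarrow> \<beta> x = 1"
    "\<And>x. R \<le> dist a x \<Longrightarrow> \<beta> x = 0"
proof
  define s where "s = (\<lambda>x. (x - a) \<bullet> (x - a))"
  define \<beta> where "\<beta> = (\<lambda>x. flat 0 (R\<^sup>2 - s x) * inverse (flat 0 (R\<^sup>2 - s x) + flat 0 (s x - r\<^sup>2)))"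
  have rR: "r\<^sup>2 < R\<^sup>2" using assms by (simp add: power_strict_mono)
  have s: "s x = (dist a x)\<^sup>2" for x
    by (simp only: s_def dist_norm norm_minus_commute[of a] power2_norm_eq_inner)
  have pos: "flat 0 y \<ge> 0" "y > 0 \<Longrightarrow> flat 0 y > 0" for y by (auto simp: flat_def)
  have "flat 0 (R\<^sup>2 - s x) + flat 0 (s x - r\<^sup>2) > 0" for x
  proof (cases "s x < R\<^sup>2")
    case True
    then show ?thesis using pos(1)[of "s x - r\<^sup>2"] pos(2)[of "R\<^sup>2 - s x"] by linarith
  next
    case False
    then show ?thesis using pos(1)[of "R\<^sup>2 - s x"] pos(2)[of "s x - r\<^sup>2"] rR by linarith
  qed
  then have nz: "flat 0 (R\<^sup>2 - s x) + flat 0 (s x - r\<^sup>2) \<noteq> 0" for x by (metis less_irrefl)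
  have s1: "Cinf_on UNIV s" unfolding s_def by (rule Cinf_on_inner_self)
  have c1: "Cinf_on UNIV (\<lambda>x. s x - r\<^sup>2)"
    using Cinf_on_add[OF open_UNIV s1 Cinf_on_const[of _ "-r\<^sup>2"]] by simp
  have "Cinf_on UNIV (\<lambda>x. R\<^sup>2 + (-1) *\<^sub>R s x)"
    by (intro Cinf_on_add Cinf_on_scaleR s1 Cinf_on_const open_UNIV)
  then have c2: "Cinf_on UNIV (\<lambda>x. R\<^sup>2 - s x)" by simp
  have f1: "Cinf_on UNIV (\<lambda>x. flat 0 (R\<^sup>2 - s x))" "Cinf_on UNIV (\<lambda>x. flat 0 (s x - r\<^sup>2))"
    using Cinf_on_compose[OF open_UNIV open_UNIV subset_UNIV c2 Cinf_on_flat]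
      Cinf_on_compose[OF open_UNIV open_UNIV subset_UNIV c1 Cinf_on_flat] .
  show "Cinf_on UNIV \<beta>" unfolding \<beta>_def
    by (intro Cinf_on_mult Cinf_on_inverse Cinf_on_add f1 open_UNIV nz)
  show "\<beta> x = 1" if "dist a x \<le> r" for x
  proof -
    have "s x \<le> r\<^sup>2" unfolding s using that by (simp add: power_mono)
    then have "flat 0 (s x - r\<^sup>2) = 0" by (simp add: flat_def)
    then show ?thesis using nz[of x] by (simp add: \<beta>_def)
  qed
  show "\<beta> x = 0" if "R \<le> dist a x" for x
  proof -
    have "R\<^sup>2 \<le> s x" unfolding s using that assms by (simp add: power_mono)
    then show ?thesis by (simp add: \<beta>_def flat_def)
  qed
qed

section \<open>Hadamard's lemma\<close>

lemma star_mem: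
  assumes "convex U" "q \<in> U" "x \<in> U" "t \<in> {0..1}"
  shows "q + t *\<^sub>R (x - q) \<in> U"
  using convexD_alt[OF assms(1-3), of t] assms(4) by (simp add: algebra_simps)

text \<open>Differentiation under the integral sign. The map from \<open>x\<close> to
  \<open>q + t *\<^sub>R (x - q)\<close> contributes a factor \<open>t\<close> to each derivative,
  which is why the integrand carries \<open>t ^ m\<close> and the induction generalises over
  \<open>m\<close>.\<close>

lemma Ck_on_integral_star:
  fixes f :: "'a::euclidean_space \<Rightarrow> real"
  assumes U: "open U" "convex U" "q \<in> U" and f: "Cinf_on U f"
  shows "Ck_on k U (\<lambda>x. integral {0..1} (\<lambda>t. t ^ m * f (q + t *\<^sub>R (x - q))))"
  using f
proof (induction k arbitrary: f m)
  case 0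
  have c: "continuous_on (U \<times> cbox 0 1) (\<lambda>(x, t). t ^ m * f (q + t *\<^sub>R (x - q)))"
    unfolding split_beta
    by (intro continuous_on_mult continuous_on_power continuous_on_compose2[OF Cinf_on_continuous[OF 0]]
        continuous_intros) (auto intro: star_mem[OF U(2,3)])
  have "continuous_on U (\<lambda>x. integral (cbox 0 1) (\<lambda>t. t ^ m * f (q + t *\<^sub>R (x - q))))"
    by (rule integral_continuous_on_param[OF c])
  then show ?case by simp
next
  case (Suc k)
  let ?df = "\<lambda>y v. frechet_derivative f (at y) v"
  \<comment> \<open>The Leibniz rule asks for derivatives that are continuous as bounded linear
    maps; in finite dimension this is checked on basis vectors. \<open>Blinfun\<close> is meaningful
    only where \<open>f\<close> is known to be differentiable, hence the side conditions of the fact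
    \<open>fx\<close>.\<close>
  define fx where "fx = (\<lambda>x t. Blinfun (\<lambda>v. t ^ Suc m * ?df (q + t *\<^sub>R (x - q)) v))"
  have fd: "(f has_derivative ?df y) (at y)" if "y \<in> U" for y
    using Cinf_on_has_derivative[OF Suc.prems that] .
  have fx: "blinfun_apply (fx x t) v = t ^ Suc m * ?df (q + t *\<^sub>R (x - q)) v"
    if "x \<in> U" "t \<in> {0..1}" for x t v
  proof -
    have "bounded_linear (?df (q + t *\<^sub>R (x - q)))"
      using fd[OF star_mem[OF U(2,3) that]] by (rule has_derivative_bounded_linear)
    then have "bounded_linear (\<lambda>v. t ^ Suc m * ?df (q + t *\<^sub>R (x - q)) v)"
      using bounded_linear_const_mult by blast
    then show ?thesis by (simp add: fx_def bounded_linear_Blinfun_apply)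
  qed
  have cont: "continuous_on (U \<times> cbox 0 1) (\<lambda>(x, t). fx x t)"
  proof (rule continuous_on_blinfun_componentwise)
    fix b :: 'a assume "b \<in> Basis"
    have "continuous_on (U \<times> cbox 0 1) (\<lambda>p. snd p ^ Suc m * ?df (q + snd p *\<^sub>R (fst p - q)) b)"
      by (intro continuous_on_mult continuous_on_power
          continuous_on_compose2[OF Cinf_on_continuous[OF Cinf_on_frechet[OF Suc.prems, of b]]]
        continuous_intros) (auto intro: star_mem[OF U(2,3)])
    then show "continuous_on (U \<times> cbox 0 1) (\<lambda>x. blinfun_apply (case x of (x, t) \<Rightarrow> fx x t) b)"
      by (rule continuous_on_eq) (auto simp: fx)
  qed
  show ?case
  proof (rule Ck_on_SucI[OF U(1)])
    fix x assume x: "x \<in> U"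
    have "((\<lambda>x. integral (cbox 0 1) (\<lambda>t. t ^ m * f (q + t *\<^sub>R (x - q)))) has_derivative
        blinfun_apply (integral (cbox 0 1) (fx x))) (at x within U)"
    proof (rule leibniz_rule[OF _ _ cont x U(2)])
      fix x t assume xt: "x \<in> U" "t \<in> cbox (0::real) 1"
      have "((\<lambda>x. f (q + t *\<^sub>R (x - q))) has_derivative
          (\<lambda>v. ?df (q + t *\<^sub>R (x - q)) (t *\<^sub>R v))) (at x)"
        by (rule has_derivative_compose[of "\<lambda>x. q + t *\<^sub>R (x - q)" "\<lambda>v. t *\<^sub>R v" x UNIV f, OF _ fd])
          (use xt star_mem[OF U(2,3)] in \<open>auto intro!: derivative_eq_intros simp: algebra_simps\<close>)
      then have "((\<lambda>x. t ^ m * f (q + t *\<^sub>R (x - q))) has_derivative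
          (\<lambda>v. t ^ m * ?df (q + t *\<^sub>R (x - q)) (t *\<^sub>R v))) (at x)"
        by (rule has_derivative_mult_right)
      moreover have "(\<lambda>v. t ^ m * ?df (q + t *\<^sub>R (x - q)) (t *\<^sub>R v)) = blinfun_apply (fx x t)"
      proof
        fix v
        have "t \<in> {0..1}" using xt(2) by simp
        then have "linear (?df (q + t *\<^sub>R (x - q)))"
          by (rule has_derivative_linear[OF fd[OF star_mem[OF U(2,3) xt(1)]]])
        then show "t ^ m * ?df (q + t *\<^sub>R (x - q)) (t *\<^sub>R v) = blinfun_apply (fx x t) v"
          using xt by (simp add: fx linear_cmul)
      qed
      ultimately show "((\<lambda>x. t ^ m * f (q + t *\<^sub>R (x - q))) has_derivative blinfun_apply (fx x t))
          (at x within U)"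
        using has_derivative_at_withinI by metis
    next
      fix x assume "x \<in> U"
      then show "(\<lambda>t. t ^ m * f (q + t *\<^sub>R (x - q))) integrable_on cbox 0 1"
        by (intro integrable_continuous continuous_on_mult continuous_on_power
            continuous_on_compose2[OF Cinf_on_continuous[OF Suc.prems]] continuous_intros)
          (auto intro: star_mem[OF U(2,3)])
    qed
    then have 1: "((\<lambda>x. integral {0..1} (\<lambda>t. t ^ m * f (q + t *\<^sub>R (x - q)))) has_derivative
        blinfun_apply (integral (cbox 0 1) (fx x))) (at x)"
      using at_within_open[OF x U(1)] by simp
    have "continuous_on (cbox 0 1) (fx x)"
      using continuous_on_compose2[OF cont, of "cbox 0 1" "\<lambda>t. (x, t)"] x
      by (simp add: continuous_on_Pair image_subset_iff)
    then have "fx x integrable_on cbox 0 1" by (rule integrable_continuous)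
    note i = blinfun_apply_integral[OF this]
    have "blinfun_apply (integral (cbox 0 1) (fx x)) v
        = integral {0..1} (\<lambda>t. t ^ Suc m * ?df (q + t *\<^sub>R (x - q)) v)" for v
      unfolding i unfolding cbox_interval by (rule integral_cong) (rule fx[OF x])
    then have 2: "blinfun_apply (integral (cbox 0 1) (fx x))
        = (\<lambda>v. integral {0..1} (\<lambda>t. t ^ Suc m * ?df (q + t *\<^sub>R (x - q)) v))" by (rule ext)
    show "((\<lambda>x. integral {0..1} (\<lambda>t. t ^ m * f (q + t *\<^sub>R (x - q)))) has_derivative
        (\<lambda>v. integral {0..1} (\<lambda>t. t ^ Suc m * ?df (q + t *\<^sub>R (x - q)) v))) (at x)"
      using 1 unfolding 2 .
  next
    fix v
    show "Ck_on k U (\<lambda>x. integral {0..1} (\<lambda>t. t ^ Suc m * ?df (q + t *\<^sub>R (x - q)) v))"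
      by (rule Suc.IH[OF Cinf_on_frechet[OF Suc.prems]])
  qed
qed

text \<open>\<open>g b\<close> is the mean of the partial derivative in direction \<open>b\<close>
  over the segment from \<open>q\<close> to \<open>x\<close>, and the expansion is the fundamental
  theorem of calculus along that segment. Smooth coefficients, rather than a remainder estimate, are
  what a derivation can act on.\<close>

lemma Hadamard:
  fixes f :: "'a::euclidean_space \<Rightarrow> real"
  assumes U: "open U" "convex U" "q \<in> U" and f: "Cinf_on U f"
  obtains g where "\<forall>b. Cinf_on U (g b)" "\<forall>b. g b q = frechet_derivative f (at q) b"
    "\<forall>x\<in>U. f x = f q + (\<Sum>b\<in>Basis. ((x - q) \<bullet> b) * g b x)"
proof -
  let ?df = "\<lambda>y v. frechet_derivative f (at y) v"
  define g where "g = (\<lambda>b x. integral {0..1} (\<lambda>t. ?df (q + t *\<^sub>R (x - q)) b))"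
  have 1: "Cinf_on U (g b)" for b
    using Ck_on_integral_star[OF U Cinf_on_frechet[OF f], of _ 0 b] by (auto simp: g_def Cinf_on_def)
  have 2: "g b q = ?df q b" for b by (simp add: g_def)
  have 3: "f x = f q + (\<Sum>b\<in>Basis. ((x - q) \<bullet> b) * g b x)" if x: "x \<in> U" for x
  proof -
    have mem: "q + t *\<^sub>R (x - q) \<in> U" if "t \<in> {0..1}" for t using star_mem[OF U(2,3) x that] .
    have "((\<lambda>t. f (q + t *\<^sub>R (x - q))) has_vector_derivative ?df (q + t *\<^sub>R (x - q)) (x - q))
        (at t within {0..1})" if t: "t \<in> {0..1}" for t
    proof -
      have "((\<lambda>t. f (q + t *\<^sub>R (x - q))) has_derivative
          (\<lambda>s. ?df (q + t *\<^sub>R (x - q)) (s *\<^sub>R (x - q)))) (at t within {0..1})"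
        by (rule has_derivative_compose[of "\<lambda>t. q + t *\<^sub>R (x - q)" "\<lambda>s. s *\<^sub>R (x - q)" t _ f,
            OF _ Cinf_on_has_derivative[OF f mem[OF t]]]) (auto intro!: derivative_eq_intros)
      moreover have "linear (?df (q + t *\<^sub>R (x - q)))"
        using Cinf_on_has_derivative[OF f mem[OF t]] by (rule has_derivative_linear)
      ultimately show ?thesis by (simp add: has_vector_derivative_def linear_cmul)
    qed
    then have "((\<lambda>t. ?df (q + t *\<^sub>R (x - q)) (x - q)) has_integral
        f (q + 1 *\<^sub>R (x - q)) - f (q + 0 *\<^sub>R (x - q))) {0..1}"
      by (intro fundamental_theorem_of_calculus) auto
    then have "f x - f q = integral {0..1} (\<lambda>t. ?df (q + t *\<^sub>R (x - q)) (x - q))"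
      by (simp add: integral_unique)
    also have "\<dots> = integral {0..1} (\<lambda>t. \<Sum>b\<in>Basis. ((x - q) \<bullet> b) * ?df (q + t *\<^sub>R (x - q)) b)"
    proof (rule integral_cong)
      fix t :: real assume t: "t \<in> {0..1}"
      have l: "linear (?df (q + t *\<^sub>R (x - q)))"
        using Cinf_on_has_derivative[OF f mem[OF t]] by (rule has_derivative_linear)
      show "?df (q + t *\<^sub>R (x - q)) (x - q) = (\<Sum>b\<in>Basis. ((x - q) \<bullet> b) * ?df (q + t *\<^sub>R (x - q)) b)"
        by (subst linear_Basis_expand[OF l]) simp
    qed
    also have "\<dots> = (\<Sum>b\<in>Basis. integral {0..1} (\<lambda>t. ((x - q) \<bullet> b) * ?df (q + t *\<^sub>R (x - q)) b))"
    proof (rule integral_sum[OF finite_Basis])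
      fix b :: 'a
      have "continuous_on {0..1} (\<lambda>t. ?df (q + t *\<^sub>R (x - q)) b)"
        by (intro continuous_on_compose2[OF Cinf_on_continuous[OF Cinf_on_frechet[OF f, of b]]]
            continuous_intros) (auto intro: mem)
      then show "(\<lambda>t. ((x - q) \<bullet> b) * ?df (q + t *\<^sub>R (x - q)) b) integrable_on {0..1}"
        by (intro integrable_continuous_real continuous_intros)
    qed
    also have "\<dots> = (\<Sum>b\<in>Basis. ((x - q) \<bullet> b) * g b x)" by (simp add: g_def)
    finally show ?thesis by simp
  qed
  show ?thesis by (rule that[of g]) (simp_all add: 1 2 3)
qed

section \<open>Ordinary differential equations\<close>

text \<open>Banach's fixed point theorem in the space of bounded continuous functions on the whole
  line. Clamping the time by \<open>cl\<close> makes the integral operator map this space to itself.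
  The initial time \<open>s\<close> is arbitrary because linear equations will be solved from a
  value prescribed at any time.\<close>

lemma picard:
  fixes g :: "real \<Rightarrow> 'a::euclidean_space \<Rightarrow> 'a"
  assumes T: "0 < T" "2 * L * T < 1" "0 \<le> L" and s: "s \<in> {-T..T}"
    and cont: "continuous_on ({-T..T} \<times> UNIV) (\<lambda>p. g (fst p) (snd p))"
    and lip: "\<And>t x y. t \<in> {-T..T} \<Longrightarrow> norm (g t x - g t y) \<le> L * norm (x - y)"
  obtains u where "u s = w" "\<forall>t\<in>{-T..T}. (u has_vector_derivative g t (u t)) (at t within {-T..T})"
proof -
  define cl where "cl = (\<lambda>t. max (-T) (min T t))"
  have cl: "cl t \<in> {-T..T}" for t using T by (auto simp: cl_def)
  have clid: "t \<in> {-T..T} \<Longrightarrow> cl t = t" for t by (auto simp: cl_def)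
  have clc: "continuous_on A cl" for A unfolding cl_def by (intro continuous_intros)
  define I where "I = (\<lambda>(u :: real \<Rightarrow>\<^sub>C 'a) t. integral {-T..t} (\<lambda>\<tau>. g \<tau> (u \<tau>)))"
  have gc: "continuous_on {-T..T} (\<lambda>t. g t (apply_bcontfun u t))" for u
    using continuous_on_compose2[OF cont, of "{-T..T}" "\<lambda>t. (t, apply_bcontfun u t)"]
    by (simp add: continuous_on_Pair image_subset_iff)
  have I: "(I u has_vector_derivative g t (u t)) (at t within {-T..T})" if "t \<in> {-T..T}" for u t
    unfolding I_def by (rule integral_has_vector_derivative[OF gc that])
  have Ic: "continuous_on {-T..T} (I u)" for u
    by (rule continuous_on_vector_derivative) (rule I)
  define F where "F = (\<lambda>u t. w + (I u (cl t) - I u s))"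
  have "F u \<in> bcontfun" for u
  proof -
    have c: "continuous_on UNIV (\<lambda>t. I u (cl t))"
      by (rule continuous_on_compose2[OF Ic clc]) (use cl in auto)
    have "bounded ((\<lambda>t. w + (I u t - I u s)) ` {-T..T})"
      by (intro compact_imp_bounded compact_continuous_image continuous_intros Ic compact_Icc)
    moreover have "range (F u) \<subseteq> (\<lambda>t. w + (I u t - I u s)) ` {-T..T}"
      using cl by (auto simp: F_def)
    ultimately have "bounded (range (F u))" using bounded_subset by blast
    moreover have "continuous_on UNIV (F u)" unfolding F_def by (intro continuous_intros c)
    ultimately show ?thesis by (simp add: bcontfun_def)
  qed
  then have FB: "apply_bcontfun (Bcontfun (F u)) = F u" for u by (simp add: Bcontfun_inverse)
  have "dist (Bcontfun (F u)) (Bcontfun (F v)) \<le> (2 * L * T) * dist u v" for u v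
  proof (rule dist_bound)
    fix t
    \<comment> \<open>The mean value inequality between \<open>s\<close> and \<open>cl t\<close>,
      which are at most \<open>2 * T\<close> apart, gives the contraction constant
      \<open>2 * L * T\<close>.\<close>
    have "norm ((I u (cl t) - I v (cl t)) - (I u s - I v s)) \<le> (L * dist u v) * norm (cl t - s)"
    proof (rule differentiable_bound[of "{-T..T}" "\<lambda>t. I u t - I v t"
          "\<lambda>t h. h *\<^sub>R (g t (u t) - g t (v t))"])
      fix x assume x: "x \<in> {-T..T}"
      show "((\<lambda>t. I u t - I v t) has_derivative (\<lambda>h. h *\<^sub>R (g x (u x) - g x (v x)))) (at x within {-T..T})"
        using has_vector_derivative_diff[OF I[OF x, of u] I[OF x, of v]]
        by (simp add: has_vector_derivative_def)
      have "norm (g x (u x) - g x (v x)) \<le> L * norm (u x - v x)" by (rule lip[OF x])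
      also have "\<dots> \<le> L * dist u v"
        using dist_bounded[of u x v] T(3) by (simp add: mult_left_mono dist_norm)
      finally show "onorm (\<lambda>h. h *\<^sub>R (g x (u x) - g x (v x))) \<le> L * dist u v"
        by (intro onorm_le) (simp add: mult.commute mult_left_mono)
    qed (use cl s in auto)
    also have "\<dots> \<le> (L * dist u v) * (2 * T)"
      using cl[of t] s T(3) by (intro mult_left_mono) (auto simp: abs_le_iff)
    finally show "dist (apply_bcontfun (Bcontfun (F u)) t) (apply_bcontfun (Bcontfun (F v)) t)
        \<le> (2 * L * T) * dist u v"
      unfolding FB unfolding F_def dist_norm[of "w + _"] by (simp add: algebra_simps)
  qed
  then obtain u where u: "Bcontfun (F u) = u"
    using banach_fix_type[of "2 * L * T" "\<lambda>u. Bcontfun (F u)"] T by auto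
  then have uF: "apply_bcontfun u = F u" using FB by metis
  show ?thesis
  proof (rule that[of "apply_bcontfun u"])
    show "apply_bcontfun u s = w" using s by (simp add: uF F_def clid)
    show "\<forall>t\<in>{-T..T}. (apply_bcontfun u has_vector_derivative g t (u t)) (at t within {-T..T})"
    proof
      fix t assume t: "t \<in> {-T..T}"
      have "((\<lambda>t. w + (I u t - I u s)) has_vector_derivative g t (u t)) (at t within {-T..T})"
        using I[OF t, of u] by (auto intro!: derivative_eq_intros)
      then show "(apply_bcontfun u has_vector_derivative g t (u t)) (at t within {-T..T})"
        by (rule has_vector_derivative_transform[OF t, rotated]) (simp add: uF F_def clid)
    qed
  qed
qed

text \<open>A field that is Lipschitz only on a ball is composed with the nearest point projection,
  which does not increase distances, and thereby becomes globally Lipschitz. The solution of the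
  modified equation has speed at most \<open>B\<close>, so within time \<open>T\<close> it stays in
  the ball, where the two fields agree.\<close>

lemma picard_ball:
  fixes g :: "'a::euclidean_space \<Rightarrow> 'a"
  assumes T: "0 < T" "2 * L * T < 1" "0 \<le> L" "B * T \<le> r" "0 \<le> B" "0 < r"
    and lip: "\<And>x y. x \<in> cball z r \<Longrightarrow> y \<in> cball z r \<Longrightarrow> norm (g x - g y) \<le> L * norm (x - y)"
    and B: "\<And>x. x \<in> cball z r \<Longrightarrow> norm (g x) \<le> B"
  obtains u where "u 0 = z" "\<forall>t\<in>{-T..T}. u t \<in> cball z r"
    "\<forall>t\<in>{-T..T}. (u has_vector_derivative g (u t)) (at t within {-T..T})"
proof -
  define h where "h = (\<lambda>x. g (closest_point (cball z r) x))"
  have K: "convex (cball z r)" "closed (cball z r)" "cball z r \<noteq> {}" using T by auto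
  have cp: "closest_point (cball z r) x \<in> cball z r" for x
    using closest_point_in_set[OF K(2,3)] by blast
  have hl: "norm (h x - h y) \<le> L * norm (x - y)" for x y
  proof -
    have "norm (h x - h y) \<le> L * norm (closest_point (cball z r) x - closest_point (cball z r) y)"
      unfolding h_def by (rule lip[OF cp cp])
    also have "\<dots> \<le> L * norm (x - y)"
      using closest_point_lipschitz[OF K, of x y] T(3) by (simp add: dist_norm mult_left_mono)
    finally show ?thesis .
  qed
  have "L-lipschitz_on UNIV h"
    by (rule lipschitz_onI) (use hl T in \<open>auto simp: dist_norm\<close>)
  then have "continuous_on UNIV h" by (rule lipschitz_on_continuous_on)
  then have "continuous_on ({-T..T} \<times> UNIV) (\<lambda>p. h (snd p))"
    by (rule continuous_on_compose2) (auto intro: continuous_intros)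
  then obtain u where u: "u 0 = z"
    "\<forall>t\<in>{-T..T}. (u has_vector_derivative h (u t)) (at t within {-T..T})"
    using picard[of T L 0 "\<lambda>_. h" z] T hl by auto
  have in_ball: "u t \<in> cball z r" if t: "t \<in> {-T..T}" for t
  proof -
    have "norm (u t - u 0) \<le> B * norm (t - 0)"
    proof (rule differentiable_bound[of "{-T..T}" u "\<lambda>t x. x *\<^sub>R h (u t)"])
      fix x assume "x \<in> {-T..T}"
      then show "(u has_derivative (\<lambda>s. s *\<^sub>R h (u x))) (at x within {-T..T})"
        using u(2) by (simp add: has_vector_derivative_def)
      have "norm (h (u x)) \<le> B" unfolding h_def by (rule B[OF cp])
      then show "onorm (\<lambda>s. s *\<^sub>R h (u x)) \<le> B"
        by (intro onorm_le) (simp add: mult.commute[of B] mult_left_mono)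
    qed (use t T in auto)
    also have "\<dots> \<le> B * T" using t T by (intro mult_left_mono) auto
    finally show ?thesis using T(4) u(1) by (simp add: dist_norm norm_minus_commute)
  qed
  have "h (u t) = g (u t)" if "t \<in> {-T..T}" for t
    unfolding h_def closest_point_self[OF in_ball[OF that]] ..
  then show ?thesis using that[of u] u in_ball by simp
qed

text \<open>Compactness of the ball bounds \<open>g\<close> and its derivatives in the basis
  directions; convexity of the ball turns the latter bound into a Lipschitz constant by the mean
  value inequality.\<close>

lemma Cinf_on_lipschitz_bound:
  fixes g :: "'a::euclidean_space \<Rightarrow> 'b::euclidean_space"
  assumes "open U" "cball z r \<subseteq> U" "Cinf_on U g"
  obtains L B where "0 \<le> L" "0 \<le> B" "\<forall>x\<in>cball z r. norm (g x) \<le> B"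
    "\<forall>x\<in>cball z r. \<forall>y\<in>cball z r. norm (g x - g y) \<le> L * norm (x - y)"
proof -
  have bd: "\<exists>B\<ge>0. \<forall>x\<in>cball z r. norm (f x) \<le> B" if "Cinf_on U f" for f :: "'a \<Rightarrow> 'b"
  proof -
    have "compact (f ` cball z r)"
      by (intro compact_continuous_image continuous_on_subset[OF Cinf_on_continuous[OF that] assms(2)]) simp
    from bounded_pos[THEN iffD1, OF compact_imp_bounded[OF this]]
    obtain B where "0 < B" "\<forall>y\<in>f ` cball z r. norm y \<le> B" by auto
    then show ?thesis by (intro exI[of _ B]) auto
  qed
  let ?dg = "\<lambda>b x. frechet_derivative g (at x) b"
  obtain B where B: "0 \<le> B" "\<forall>x\<in>cball z r. norm (g x) \<le> B" using bd[OF assms(3)] by auto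
  have "\<exists>B. \<forall>b. 0 \<le> B b \<and> (\<forall>x\<in>cball z r. norm (?dg b x) \<le> B b)"
    using bd[OF Cinf_on_frechet[OF assms(3)]] by (intro choice) blast
  then obtain C where C: "\<And>b. 0 \<le> C b" "\<And>b x. x \<in> cball z r \<Longrightarrow> norm (?dg b x) \<le> C b" by blast
  define L where "L = (\<Sum>b\<in>Basis. C b)"
  have "norm (g x - g y) \<le> L * norm (x - y)" if "x \<in> cball z r" "y \<in> cball z r" for x y
  proof (rule differentiable_bound[of "cball z r" g "\<lambda>x v. ?dg v x"])
    fix x assume x: "x \<in> cball z r"
    then have d: "(g has_derivative (\<lambda>v. ?dg v x)) (at x)"
      using Cinf_on_has_derivative[OF assms(3)] assms(2) by auto
    then show "(g has_derivative (\<lambda>v. ?dg v x)) (at x within cball z r)"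
      by (rule has_derivative_at_withinI)
    show "onorm (\<lambda>v. ?dg v x) \<le> L"
    proof (rule onorm_le)
      fix v
      have "?dg v x = (\<Sum>b\<in>Basis. (v \<bullet> b) *\<^sub>R ?dg b x)"
        by (rule linear_Basis_expand[OF has_derivative_linear[OF d]])
      also have "norm \<dots> \<le> (\<Sum>b\<in>Basis. norm v * C b)"
        by (rule order_trans[OF norm_sum sum_mono])
          (use C x Basis_le_norm[of _ v] in \<open>auto intro: mult_mono\<close>)
      finally show "norm (?dg v x) \<le> L * norm v"
        by (simp add: L_def sum_distrib_left mult.commute)
    qed
  qed (use that in auto)
  moreover have "0 \<le> L" unfolding L_def by (rule sum_nonneg) (rule C)
  ultimately show ?thesis using that[of L B] B by auto
qed

section \<open>Smooth spaces\<close>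

text \<open>The properties of \<open>mfd_space M\<close> shared by its embedded submanifolds; open sets are those of
  the ambient manifold.\<close>

locale sspace =
  fixes S :: "'a smooth_space" and \<tau> :: "'a topology"
  assumes points_subset: "points S \<subseteq> topspace \<tau>"
    and funs_const: "(\<lambda>_. c) \<in> funs S"
    and funs_add: "f \<in> funs S \<Longrightarrow> g \<in> funs S \<Longrightarrow> (\<lambda>q. f q + g q) \<in> funs S"
    and funs_mult: "f \<in> funs S \<Longrightarrow> g \<in> funs S \<Longrightarrow> (\<lambda>q. f q * g q) \<in> funs S"
    and funs_localI: "(\<And>p. p \<in> points S \<Longrightarrow> \<exists>U F. openin \<tau> U \<and> p \<in> U \<and> F \<in> funs S \<and>
      (\<forall>q\<in>U \<inter> points S. F q = f q)) \<Longrightarrow> f \<in> funs S"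
    and bump: "p \<in> points S \<Longrightarrow> openin \<tau> U \<Longrightarrow> p \<in> U \<Longrightarrow>
      \<exists>\<rho> W K. \<rho> \<in> funs S \<and> openin \<tau> W \<and> p \<in> W \<and> W \<subseteq> K \<and> closedin \<tau> K \<and> K \<subseteq> U \<and>
        (\<forall>q\<in>W. \<rho> q = 1) \<and> (\<forall>q. q \<notin> K \<longrightarrow> \<rho> q = 0)"
    and recip: "f \<in> funs S \<Longrightarrow> p \<in> points S \<Longrightarrow> f p \<noteq> 0 \<Longrightarrow>
      \<exists>g W. g \<in> funs S \<and> openin \<tau> W \<and> p \<in> W \<and> (\<forall>q\<in>W \<inter> points S. g q * f q = 1)"
begin

lemma funs_sum: "(\<And>i. i \<in> I \<Longrightarrow> f i \<in> funs S) \<Longrightarrow> (\<lambda>q. \<Sum>i\<in>I. f i q) \<in> funs S"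
  by (induction I rule: infinite_finite_induct) (auto intro: funs_const funs_add)

lemma funs_minus: "f \<in> funs S \<Longrightarrow> (\<lambda>q. - f q) \<in> funs S"
  using funs_mult[OF funs_const[of "-1"], of f] by simp

lemma funs_diff: "f \<in> funs S \<Longrightarrow> g \<in> funs S \<Longrightarrow> (\<lambda>q. f q - g q) \<in> funs S"
  using funs_add[OF _ funs_minus, of f g] by simp

lemma funs_prod: "(\<And>i. i \<in> I \<Longrightarrow> f i \<in> funs S) \<Longrightarrow> (\<lambda>q. \<Prod>i\<in>I. f i q) \<in> funs S"
  by (induction I rule: infinite_finite_induct) (auto intro: funs_const funs_mult)

lemma funs_cong: "f \<in> funs S \<Longrightarrow> (\<And>q. q \<in> points S \<Longrightarrow> f q = g q) \<Longrightarrow> g \<in> funs S"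
  by (rule funs_localI, rule exI[of _ "topspace \<tau>"], rule exI[of _ f]) (use points_subset in auto)

lemma tangentD:
  assumes "v \<in> tangent S p"
  shows tangent_add: "f \<in> funs S \<Longrightarrow> g \<in> funs S \<Longrightarrow> v (\<lambda>x. f x + g x) = v f + v g"
    and tangent_scale: "f \<in> funs S \<Longrightarrow> v (\<lambda>x. c * f x) = c * v f"
    and tangent_mult: "f \<in> funs S \<Longrightarrow> g \<in> funs S \<Longrightarrow> v (\<lambda>x. f x * g x) = v f * g p + f p * v g"
    and tangent_notin: "h \<notin> funs S \<Longrightarrow> v h = 0"
  using assms by (auto simp: tangent_def)

lemma tangent_const: assumes "v \<in> tangent S p" shows "v (\<lambda>_. c) = 0"
proof -
  have "v (\<lambda>_. 1 * 1) = v (\<lambda>_. 1) * 1 + 1 * v (\<lambda>_. 1)"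
    by (rule tangent_mult[OF assms]) (rule funs_const)+
  then have "v (\<lambda>_. 1) = 0" by simp
  then show ?thesis using tangent_scale[OF assms funs_const[of 1], of c] by simp
qed

lemma tangent_diff:
  assumes "v \<in> tangent S p" "f \<in> funs S" "g \<in> funs S"
  shows "v (\<lambda>x. f x - g x) = v f - v g"
  using tangent_add[OF assms(1,2) funs_minus[OF assms(3)]] tangent_scale[OF assms(1,3), of "-1"] by simp

lemma tangent_sum:
  assumes "v \<in> tangent S p" "\<And>i. i \<in> I \<Longrightarrow> f i \<in> funs S"
  shows "v (\<lambda>x. \<Sum>i\<in>I. f i x) = (\<Sum>i\<in>I. v (f i))"
  using assms(2)
proof (induction I rule: infinite_finite_induct)
  case (insert i I)
  then show ?case by (simp add: tangent_add[OF assms(1)] funs_sum)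
qed (auto simp: tangent_const[OF assms(1)])

text \<open>The functions \<open>f\<close> and \<open>g\<close> may differ outside \<open>points S\<close>.\<close>

lemma tangent_local:
  assumes v: "v \<in> tangent S p" and p: "p \<in> points S" and f: "f \<in> funs S" and g: "g \<in> funs S"
    and U: "openin \<tau> U" "p \<in> U" and eq: "\<And>q. q \<in> U \<Longrightarrow> q \<in> points S \<Longrightarrow> f q = g q"
  shows "v f = v g"
proof -
  obtain \<rho> W K where \<rho>: "\<rho> \<in> funs S" "p \<in> W" "W \<subseteq> K" "K \<subseteq> U" "\<forall>q\<in>W. \<rho> q = 1"
    "\<forall>q. q \<notin> K \<longrightarrow> \<rho> q = 0"
    using bump[OF p U] by (elim exE conjE)
  \<comment> \<open>\<open>k\<close> vanishes at \<open>p\<close> and equals 1 wherever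
    \<open>f\<close> and \<open>g\<close> can differ, so multiplying their difference by
    \<open>k\<close> changes nothing on the whole type. Off \<open>points S\<close> it has to be 1,
    since nothing is known there about \<open>f\<close> and \<open>g\<close>, even inside
    \<open>U\<close>.\<close>
  define k where "k = (\<lambda>q. if q \<in> points S then 1 - \<rho> q else 1)"
  have k: "k \<in> funs S"
    by (rule funs_cong[OF funs_diff[OF funs_const \<rho>(1)]]) (simp add: k_def)
  have h: "(\<lambda>q. f q - g q) \<in> funs S" by (rule funs_diff[OF f g])
  have kk: "k q * (f q - g q) = f q - g q" for q
    using \<rho>(4,6) eq[of q] by (auto simp: k_def)
  have "v (\<lambda>q. f q - g q) = v (\<lambda>q. k q * (f q - g q))" unfolding kk ..
  also have "\<dots> = v k * (f p - g p) + k p * v (\<lambda>q. f q - g q)"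
    by (rule tangent_mult[OF v k h])
  also have "\<dots> = 0" using p U(2) eq[of p] \<rho>(2,5) by (simp add: k_def)
  finally show ?thesis using tangent_diff[OF v f g] by simp
qed

lemma tangent_cong:
  assumes "v \<in> tangent S p" "p \<in> points S" "f \<in> funs S" "\<And>q. q \<in> points S \<Longrightarrow> f q = g q"
  shows "v f = v g"
  by (rule tangent_local[OF assms(1-3) funs_cong[OF assms(3,4)] openin_topspace])
    (use assms points_subset in auto)

lemma tangent_zero: "(\<lambda>_. 0) \<in> tangent S p"
  by (simp add: tangent_def)

lemma tangent_plus:
  assumes "u \<in> tangent S p" "v \<in> tangent S p"
  shows "(\<lambda>f. u f + v f) \<in> tangent S p"
  using assms unfolding tangent_def by (simp add: algebra_simps)

lemma tangent_scaled: "u \<in> tangent S p \<Longrightarrow> (\<lambda>f. c * u f) \<in> tangent S p"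
  unfolding tangent_def by (simp add: algebra_simps)

lemma tangent_lincomb:
  "(\<And>i. i \<in> I \<Longrightarrow> u i \<in> tangent S p) \<Longrightarrow> (\<lambda>f. \<Sum>i\<in>I. c i * u i f) \<in> tangent S p"
proof (induction I rule: infinite_finite_induct)
  case (insert i I)
  then show ?case using tangent_plus[OF tangent_scaled[of "u i" p "c i"]] by simp
qed (simp_all add: tangent_zero)

lemma vector_field_tangent: "vector_field S X \<Longrightarrow> p \<in> points S \<Longrightarrow> X p \<in> tangent S p"
  by (simp add: vector_field_def)

lemma vector_field_funs: "vector_field S X \<Longrightarrow> f \<in> funs S \<Longrightarrow> (\<lambda>p. X p f) \<in> funs S"
  by (simp add: vector_field_def)

lemma vector_fieldI:
  assumes "\<And>p. p \<in> points S \<Longrightarrow> X p \<in> tangent S p"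
    "\<And>f p. f \<in> funs S \<Longrightarrow> p \<in> points S \<Longrightarrow>
      \<exists>U F. openin \<tau> U \<and> p \<in> U \<and> F \<in> funs S \<and> (\<forall>q\<in>U \<inter> points S. F q = X q f)"
  shows "vector_field S X"
  unfolding vector_field_def using assms(1) funs_localI[OF assms(2)] by simp

lemma vector_field_zero: "vector_field S (\<lambda>_ _. 0)"
  by (simp add: vector_field_def tangent_zero funs_const)

lemma vector_field_add:
  "vector_field S X \<Longrightarrow> vector_field S Y \<Longrightarrow> vector_field S (\<lambda>p h. X p h + Y p h)"
  by (simp add: vector_field_def tangent_plus funs_add)

lemma vector_field_scale:
  "f \<in> funs S \<Longrightarrow> vector_field S X \<Longrightarrow> vector_field S (\<lambda>p h. f p * X p h)"
  by (simp add: vector_field_def tangent_scaled funs_mult)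

lemma vector_field_diff:
  assumes "vector_field S X" "vector_field S Y"
  shows "vector_field S (\<lambda>p h. X p h - Y p h)"
  using vector_field_add[OF assms(1) vector_field_scale[OF funs_const[of "-1"] assms(2)]] by simp

lemma vector_field_sum:
  "(\<And>i. i \<in> I \<Longrightarrow> f i \<in> funs S) \<Longrightarrow> (\<And>i. i \<in> I \<Longrightarrow> vector_field S (X i)) \<Longrightarrow>
    vector_field S (\<lambda>p h. \<Sum>i\<in>I. f i p * X i p h)"
  by (simp add: vector_field_def tangent_lincomb funs_sum funs_mult)

lemma vector_field_lie_bracket:
  assumes X: "vector_field S X" and Y: "vector_field S Y"
  shows "vector_field S (lie_bracket X Y)"
proof (unfold vector_field_def, intro conjI ballI)
  show "(\<lambda>p. lie_bracket X Y p f) \<in> funs S" if "f \<in> funs S" for f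
    unfolding lie_bracket_def
    by (rule funs_diff[OF vector_field_funs[OF X vector_field_funs[OF Y that]]
        vector_field_funs[OF Y vector_field_funs[OF X that]]])
next
  fix p assume p: "p \<in> points S"
  note Xp = vector_field_tangent[OF X p] and Yp = vector_field_tangent[OF Y p]
  have fX: "(\<lambda>q. X q f) \<in> funs S" and fY: "(\<lambda>q. Y q f) \<in> funs S" if "f \<in> funs S" for f
    using that X Y vector_field_funs by auto
  have cong: "v (\<lambda>q. Z q f) = v F"
    if "v \<in> tangent S p" "\<And>q. q \<in> points S \<Longrightarrow> F q = Z q f" "F \<in> funs S" for v F Z f
    using tangent_cong[OF that(1) p that(3,2)] by simp
  show "lie_bracket X Y p \<in> tangent S p"
    unfolding tangent_def mem_Collect_eq
  proof (intro conjI ballI allI impI)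
    fix f g assume f: "f \<in> funs S" and g: "g \<in> funs S"
    have "X p (\<lambda>q. Y q (\<lambda>x. f x + g x)) = X p (\<lambda>q. Y q f + Y q g)"
      by (rule cong[OF Xp]) (use f g in \<open>auto simp: tangent_add[OF vector_field_tangent[OF Y]] intro: funs_add fY\<close>)
    moreover have "Y p (\<lambda>q. X q (\<lambda>x. f x + g x)) = Y p (\<lambda>q. X q f + X q g)"
      by (rule cong[OF Yp]) (use f g in \<open>auto simp: tangent_add[OF vector_field_tangent[OF X]] intro: funs_add fX\<close>)
    ultimately show "lie_bracket X Y p (\<lambda>x. f x + g x) = lie_bracket X Y p f + lie_bracket X Y p g"
      by (simp add: lie_bracket_def tangent_add[OF Xp] tangent_add[OF Yp] fX fY f g)
    have "X p (\<lambda>q. Y q (\<lambda>x. f x * g x)) = X p (\<lambda>q. Y q f * g q + f q * Y q g)"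
      by (rule cong[OF Xp])
        (use f g in \<open>auto simp: tangent_mult[OF vector_field_tangent[OF Y]] intro!: funs_add funs_mult fY\<close>)
    moreover have "Y p (\<lambda>q. X q (\<lambda>x. f x * g x)) = Y p (\<lambda>q. X q f * g q + f q * X q g)"
      by (rule cong[OF Yp])
        (use f g in \<open>auto simp: tangent_mult[OF vector_field_tangent[OF X]] intro!: funs_add funs_mult fX\<close>)
    ultimately show "lie_bracket X Y p (\<lambda>x. f x * g x) = lie_bracket X Y p f * g p + f p * lie_bracket X Y p g"
      by (simp add: lie_bracket_def tangent_add[OF Xp] tangent_add[OF Yp] tangent_mult[OF Xp]
          tangent_mult[OF Yp] fX fY f g funs_mult algebra_simps)
  next
    fix f c assume f: "f \<in> funs S"
    have "X p (\<lambda>q. Y q (\<lambda>x. c * f x)) = X p (\<lambda>q. c * Y q f)"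
      by (rule cong[OF Xp]) (use f in \<open>auto simp: tangent_scale[OF vector_field_tangent[OF Y]]
          intro: funs_mult funs_const fY\<close>)
    moreover have "Y p (\<lambda>q. X q (\<lambda>x. c * f x)) = Y p (\<lambda>q. c * X q f)"
      by (rule cong[OF Yp]) (use f in \<open>auto simp: tangent_scale[OF vector_field_tangent[OF X]]
          intro: funs_mult funs_const fX\<close>)
    ultimately show "lie_bracket X Y p (\<lambda>x. c * f x) = c * lie_bracket X Y p f"
      by (simp add: lie_bracket_def tangent_scale[OF Xp] tangent_scale[OF Yp] fX fY f algebra_simps)
  next
    fix f assume f: "f \<notin> funs S"
    have "X p (\<lambda>q. Y q f) = X p (\<lambda>_. 0)"
      by (rule cong[OF Xp]) (use f tangent_notin[OF vector_field_tangent[OF Y]] funs_const in auto)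
    moreover have "Y p (\<lambda>q. X q f) = Y p (\<lambda>_. 0)"
      by (rule cong[OF Yp]) (use f tangent_notin[OF vector_field_tangent[OF X]] funs_const in auto)
    ultimately show "lie_bracket X Y p f = 0"
      by (simp add: lie_bracket_def tangent_const[OF Xp] tangent_const[OF Yp])
  qed
qed

text \<open>The field is multiplied by a bump function that vanishes off a closed set contained in
  \<open>U\<close>, so the product is 0 near every point outside \<open>U\<close>. Smoothness of
  \<open>X\<close> is asked for only near points of \<open>U\<close>, as chart expressions are
  defined only there.\<close>

lemma vector_field_extend:
  assumes p: "p \<in> points S" and U: "openin \<tau> U" "p \<in> U"
    and tan: "\<And>q. q \<in> U \<Longrightarrow> q \<in> points S \<Longrightarrow> X q \<in> tangent S q"
    and sm: "\<And>f q. f \<in> funs S \<Longrightarrow> q \<in> U \<Longrightarrow> q \<in> points S \<Longrightarrow>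
      \<exists>W F. openin \<tau> W \<and> q \<in> W \<and> F \<in> funs S \<and> (\<forall>y\<in>W \<inter> points S. F y = X y f)"
  obtains Y W where "vector_field S Y" "openin \<tau> W" "p \<in> W" "W \<subseteq> U" "\<forall>q\<in>W. Y q = X q"
    "\<forall>q\<in>points S. \<exists>c. Y q = (\<lambda>h. c * X q h) \<and> (q \<notin> U \<longrightarrow> c = 0)"
proof -
  obtain \<rho> W K where \<rho>: "\<rho> \<in> funs S" "openin \<tau> W" "p \<in> W" "W \<subseteq> K" "closedin \<tau> K" "K \<subseteq> U"
    "\<forall>q\<in>W. \<rho> q = 1" "\<forall>q. q \<notin> K \<longrightarrow> \<rho> q = 0"
    using bump[OF p U] by (elim exE conjE)
  define Y where "Y = (\<lambda>q h. \<rho> q * X q h)"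
  have "vector_field S Y"
  proof (rule vector_fieldI)
    show "Y q \<in> tangent S q" if "q \<in> points S" for q
    proof (cases "q \<in> U")
      case True
      then show ?thesis unfolding Y_def by (rule tangent_scaled[OF tan[OF _ that]])
    next
      case False
      then show ?thesis using \<rho>(6,8) tangent_zero by (auto simp: Y_def)
    qed
    show "\<exists>W F. openin \<tau> W \<and> q \<in> W \<and> F \<in> funs S \<and> (\<forall>y\<in>W \<inter> points S. F y = Y y f)"
      if f: "f \<in> funs S" and q: "q \<in> points S" for f q
    proof (cases "q \<in> U")
      case True
      obtain W F where "openin \<tau> W" "q \<in> W" "F \<in> funs S" "\<forall>y\<in>W \<inter> points S. F y = X y f"
        using sm[OF f True q] by (elim exE conjE)
      then show ?thesis
        by (intro exI[of _ W] exI[of _ "\<lambda>y. \<rho> y * F y"]) (simp add: Y_def funs_mult \<rho>(1))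
    next
      case False
      then show ?thesis
        by (intro exI[of _ "topspace \<tau> - K"] exI[of _ "\<lambda>_. 0"])
          (use q False points_subset \<rho> in \<open>auto simp: Y_def funs_const\<close>)
    qed
  qed
  then show ?thesis
  proof (rule that[OF _ \<rho>(2,3)])
    show "W \<subseteq> U" using \<rho>(4,6) by (rule order_trans)
    show "\<forall>q\<in>W. Y q = X q" using \<rho>(7) by (simp add: Y_def)
    show "\<forall>q\<in>points S. \<exists>c. Y q = (\<lambda>h. c * X q h) \<and> (q \<notin> U \<longrightarrow> c = 0)"
    proof
      fix q
      show "\<exists>c. Y q = (\<lambda>h. c * X q h) \<and> (q \<notin> U \<longrightarrow> c = 0)"
        by (rule exI[of _ "\<rho> q"]) (use \<rho>(6,8) in \<open>auto simp: Y_def\<close>)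
    qed
  qed
qed

lemma vector_field_glue:
  assumes "\<And>p. p \<in> points S \<Longrightarrow> \<exists>W Y. openin \<tau> W \<and> p \<in> W \<and> vector_field S Y \<and>
    (\<forall>q\<in>W \<inter> points S. Y q = X q)"
  shows "vector_field S X"
proof (rule vector_fieldI)
  fix p assume p: "p \<in> points S"
  obtain W Y where WY: "openin \<tau> W" "p \<in> W" "vector_field S Y" "\<forall>q\<in>W \<inter> points S. Y q = X q"
    using assms[OF p] by (elim exE conjE)
  show "X p \<in> tangent S p" using WY p vector_field_tangent[OF WY(3) p] by simp
  show "\<exists>U F. openin \<tau> U \<and> p \<in> U \<and> F \<in> funs S \<and> (\<forall>q\<in>U \<inter> points S. F q = X q f)"
    if "f \<in> funs S" for f
    by (rule exI[of _ W], rule exI[of _ "\<lambda>q. Y q f"]) (use WY vector_field_funs[OF WY(3) that] in simp)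
qed

text \<open>Elimination instead of inverting a matrix of functions. The fields already found remove
  from \<open>E n\<close> its action on the first \<open>n\<close> functions; what is left sends
  \<open>f n\<close> to 1 at \<open>p\<close>, hence to an invertible function nearby. After
  division it clears \<open>f n\<close> from the earlier fields.\<close>

lemma dual_frame:
  fixes n :: nat
  assumes p: "p \<in> points S"
    and f: "\<And>i. i < n \<Longrightarrow> f i \<in> funs S" and E: "\<And>i. i < n \<Longrightarrow> vector_field S (E i)"
    and dual: "\<And>i j. i < n \<Longrightarrow> j < n \<Longrightarrow> E i p (f j) = (if i = j then 1 else 0)"
  shows "\<exists>F W. (\<forall>i<n. vector_field S (F i)) \<and> openin \<tau> W \<and> p \<in> W \<and>
    (\<forall>q\<in>W \<inter> points S. \<forall>i<n. \<forall>j<n. F i q (f j) = (if i = j then 1 else 0))"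
  using f E dual
proof (induction n)
  case 0
  then show ?case using p points_subset by (auto intro!: exI[of _ "topspace \<tau>"])
next
  case (Suc n)
  have "\<exists>F W. (\<forall>i<n. vector_field S (F i)) \<and> openin \<tau> W \<and> p \<in> W \<and>
    (\<forall>q\<in>W \<inter> points S. \<forall>i<n. \<forall>j<n. F i q (f j) = (if i = j then 1 else 0))"
    by (rule Suc.IH) (use Suc.prems in auto)
  then obtain F W where F': "\<forall>i<n. vector_field S (F i)" and W: "openin \<tau> W" "p \<in> W"
    and FW': "\<forall>q\<in>W \<inter> points S. \<forall>i<n. \<forall>j<n. F i q (f j) = (if i = j then 1 else 0)"
    by (elim exE conjE)
  have F: "vector_field S (F i)" if "i < n" for i using F' that by simp
  have FW: "F i q (f j) = (if i = j then 1 else 0)" if "q \<in> W" "q \<in> points S" "i < n" "j < n" for q i j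
    using FW' that by simp
  define H where "H = (\<lambda>q h. E n q h - (\<Sum>i<n. E n q (f i) * F i q h))"
  have H: "vector_field S H" unfolding H_def
    by (intro vector_field_diff vector_field_sum) (use Suc.prems F vector_field_funs in auto)
  have H0: "H q (f j) = 0" if "q \<in> W" "q \<in> points S" "j < n" for q j
  proof -
    have "(\<Sum>i<n. E n q (f i) * F i q (f j)) = (\<Sum>i<n. if i = j then E n q (f i) else 0)"
      by (rule sum.cong) (use FW that in auto)
    then show ?thesis using that(3) by (simp add: H_def)
  qed
  have H1: "H p (f n) = 1" unfolding H_def using Suc.prems(3)[of n] by (simp add: sum.neutral)
  have "(\<lambda>q. H q (f n)) \<in> funs S" using vector_field_funs[OF H Suc.prems(1)[of n]] by simp
  moreover have "H p (f n) \<noteq> 0" using H1 by simp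
  ultimately obtain g W' where g: "g \<in> funs S" "openin \<tau> W'" "p \<in> W'"
    "\<forall>q\<in>W' \<inter> points S. g q * H q (f n) = 1" using recip[OF _ p] by (metis (no_types, lifting))
  define Fn where "Fn = (\<lambda>q h. g q * H q h)"
  define F' where "F' = (\<lambda>i q h. if i = n then Fn q h else F i q h - F i q (f n) * Fn q h)"
  have Fn: "vector_field S Fn" unfolding Fn_def by (rule vector_field_scale[OF g(1) H])
  have 1: "vector_field S (F' i)" if "i < Suc n" for i
  proof (cases "i = n")
    case True
    then show ?thesis using Fn by (simp add: F'_def)
  next
    case False
    then show ?thesis using that F[of i] Fn Suc.prems(1)[of n]
      by (simp add: F'_def vector_field_diff vector_field_scale vector_field_funs)
  qed
  have 2: "F' i q (f j) = (if i = j then 1 else 0)"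
    if "q \<in> W \<inter> W'" "q \<in> points S" "i < Suc n" "j < Suc n" for q i j
  proof -
    have "Fn q (f n) = 1" using g(4) that by (simp add: Fn_def)
    moreover have "Fn q (f j) = 0" if "j < n" for j using H0[of q j] that \<open>q \<in> W \<inter> W'\<close> \<open>q \<in> points S\<close>
      by (simp add: Fn_def)
    ultimately show ?thesis using that FW[of q i j] by (auto simp: F'_def less_Suc_eq)
  qed
  show ?case
  proof (intro exI conjI)
    show "\<forall>i<Suc n. vector_field S (F' i)" by (simp add: 1)
    show "openin \<tau> (W \<inter> W')" by (rule openin_Int[OF W(1) g(2)])
    show "p \<in> W \<inter> W'" using W g by simp
    show "\<forall>q\<in>W \<inter> W' \<inter> points S. \<forall>i<Suc n. \<forall>j<Suc n. F' i q (f j) = (if i = j then 1 else 0)"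
    proof (intro ballI allI impI)
      fix q i j assume "q \<in> W \<inter> W' \<inter> points S" "i < Suc n" "j < Suc n"
      then show "F' i q (f j) = (if i = j then 1 else 0)" using 2[of q i j] by simp
    qed
  qed
qed

end

subsection \<open>Connections\<close>

locale connected_sspace = sspace +
  fixes D :: "'a conn"
  assumes conn: "linear_connection S D"
begin

lemma conn_vector_field: "vector_field S X \<Longrightarrow> vector_field S Y \<Longrightarrow> vector_field S (D X Y)"
  using conn by (simp add: linear_connection_def)

lemma conn_rules:
  assumes "vector_field S X" "vector_field S Y" "vector_field S Z" "f \<in> funs S" "p \<in> points S"
  shows conn_add_left: "D (\<lambda>q h. X q h + Y q h) Z p = (\<lambda>h. D X Z p h + D Y Z p h)"
    and conn_scale_left: "D (\<lambda>q h. f q * X q h) Z p = (\<lambda>h. f p * D X Z p h)"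
    and conn_add_right: "D X (\<lambda>q h. Y q h + Z q h) p = (\<lambda>h. D X Y p h + D X Z p h)"
    and conn_leibniz: "D X (\<lambda>q h. f q * Y q h) p = (\<lambda>h. X p f * Y p h + f p * D X Y p h)"
proof -
  note * = conn[unfolded linear_connection_def, THEN conjunct2, THEN spec, THEN spec, THEN spec,
      THEN mp, OF conjI[OF assms(1) conjI[OF assms(2,3)]], THEN bspec, OF assms(4), THEN bspec,
      OF assms(5), THEN spec]
  show "D (\<lambda>q h. X q h + Y q h) Z p = (\<lambda>h. D X Z p h + D Y Z p h)"
    "D (\<lambda>q h. f q * X q h) Z p = (\<lambda>h. f p * D X Z p h)"
    "D X (\<lambda>q h. Y q h + Z q h) p = (\<lambda>h. D X Y p h + D X Z p h)"
    "D X (\<lambda>q h. f q * Y q h) p = (\<lambda>h. X p f * Y p h + f p * D X Y p h)"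
    by (rule ext, use * in blast)+
qed

lemma conn_zero:
  assumes "vector_field S X" "p \<in> points S"
  shows "D (\<lambda>_ _. 0) X p = (\<lambda>_. 0)" "D X (\<lambda>_ _. 0) p = (\<lambda>_. 0)"
  using conn_scale_left[OF assms(1,1,1) funs_const[of 0] assms(2)]
    conn_leibniz[OF assms(1,1,1) funs_const[of 0] assms(2)]
    tangent_const[OF vector_field_tangent[OF assms]] by simp_all

text \<open>The difference of the fields equals \<open>k\<close> times itself, for a function
  \<open>k\<close> that vanishes near \<open>p\<close> on \<open>points S\<close>. In the first slot
  linearity over functions leaves the factor \<open>k p = 0\<close>; in the second the Leibniz rule
  adds a derivative of \<open>k\<close> at \<open>p\<close>, which is 0 as well.\<close>

lemma conn_local:
  assumes X: "vector_field S X" "vector_field S X'" and Y: "vector_field S Y"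
    and p: "p \<in> points S" and U: "openin \<tau> U" "p \<in> U"
    and eq: "\<And>q. q \<in> U \<Longrightarrow> q \<in> points S \<Longrightarrow> X q = X' q"
  shows conn_local_left: "D X Y p = D X' Y p" and conn_local_right: "D Y X p = D Y X' p"
proof -
  obtain \<rho> W K where \<rho>: "\<rho> \<in> funs S" "openin \<tau> W" "p \<in> W" "W \<subseteq> K" "K \<subseteq> U"
    "\<forall>q\<in>W. \<rho> q = 1" "\<forall>q. q \<notin> K \<longrightarrow> \<rho> q = 0"
    using bump[OF p U] by (elim exE conjE)
  define k where "k = (\<lambda>q. if q \<in> points S then 1 - \<rho> q else 1)"
  have k: "k \<in> funs S"
    by (rule funs_cong[OF funs_diff[OF funs_const \<rho>(1)]]) (simp add: k_def)
  have kp: "k p = 0" using p \<rho> by (simp add: k_def)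
  have k0: "v k = 0" if "v \<in> tangent S p" for v
    using tangent_local[OF that p k funs_const[of 0] \<rho>(2,3)] \<rho>(6) tangent_const[OF that]
    by (simp add: k_def)
  let ?d = "\<lambda>q h. X q h - X' q h"
  have d: "vector_field S ?d" by (rule vector_field_diff[OF X])
  have kd: "k q * (X q h - X' q h) = X q h - X' q h" for q h
    using eq[of q] \<rho>(5,7) by (auto simp: k_def)
  have XX': "X = (\<lambda>q h. X' q h + k q * (X q h - X' q h))"
    unfolding kd by simp
  have v: "vector_field S (\<lambda>q h. k q * (X q h - X' q h))" by (rule vector_field_scale[OF k d])
  have "D X Y p = D (\<lambda>q h. X' q h + k q * (X q h - X' q h)) Y p"
    using XX' by simp
  also have "\<dots> = (\<lambda>h. D X' Y p h + D (\<lambda>q h. k q * (X q h - X' q h)) Y p h)"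
    by (rule conn_add_left[OF X(2) v Y k p])
  also have "\<dots> = D X' Y p" unfolding conn_scale_left[OF d d Y k p] kp by simp
  finally show "D X Y p = D X' Y p" .
  have "D Y X p = D Y (\<lambda>q h. X' q h + k q * (X q h - X' q h)) p"
    using XX' by simp
  also have "\<dots> = (\<lambda>h. D Y X' p h + D Y (\<lambda>q h. k q * (X q h - X' q h)) p h)"
    by (rule conn_add_right[OF Y X(2) v k p])
  also have "\<dots> = D Y X' p" unfolding conn_leibniz[OF Y d d k p] kp
    using k0[OF vector_field_tangent[OF Y p]] by simp
  finally show "D Y X p = D Y X' p" .
qed

lemma conn_sum_left:
  assumes "vector_field S Y" "p \<in> points S"
    "\<And>i. i < (n::nat) \<Longrightarrow> f i \<in> funs S" "\<And>i. i < n \<Longrightarrow> vector_field S (X i)"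
  shows "D (\<lambda>q h. \<Sum>i<n. f i q * X i q h) Y p = (\<lambda>h. \<Sum>i<n. f i p * D (X i) Y p h)"
  using assms(3,4)
proof (induction n)
  case 0
  then show ?case using conn_zero[OF assms(1,2)] by simp
next
  case (Suc n)
  have v: "vector_field S (\<lambda>q h. \<Sum>i<n. f i q * X i q h)"
    by (rule vector_field_sum) (use Suc.prems in auto)
  have fn: "f n \<in> funs S" "vector_field S (X n)" using Suc.prems by auto
  note w = vector_field_scale[OF fn]
  have IH: "D (\<lambda>q h. \<Sum>i<n. f i q * X i q h) Y p = (\<lambda>h. \<Sum>i<n. f i p * D (X i) Y p h)"
    by (rule Suc.IH; rule Suc.prems) simp_all
  show ?case
    unfolding sum.lessThan_Suc conn_add_left[OF v w assms(1) fn(1) assms(2)]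
      conn_scale_left[OF fn(2) fn(2) assms(1) fn(1) assms(2)] IH ..
qed

lemma conn_sum_right:
  assumes "vector_field S X" "p \<in> points S"
    "\<And>i. i < (n::nat) \<Longrightarrow> f i \<in> funs S" "\<And>i. i < n \<Longrightarrow> vector_field S (Y i)"
  shows "D X (\<lambda>q h. \<Sum>i<n. f i q * Y i q h) p
    = (\<lambda>h. \<Sum>i<n. X p (f i) * Y i p h + f i p * D X (Y i) p h)"
  using assms(3,4)
proof (induction n)
  case 0
  then show ?case using conn_zero[OF assms(1,2)] by simp
next
  case (Suc n)
  have v: "vector_field S (\<lambda>q h. \<Sum>i<n. f i q * Y i q h)"
    by (rule vector_field_sum) (use Suc.prems in auto)
  have fn: "f n \<in> funs S" "vector_field S (Y n)" using Suc.prems by auto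
  note w = vector_field_scale[OF fn]
  have IH: "D X (\<lambda>q h. \<Sum>i<n. f i q * Y i q h) p
      = (\<lambda>h. \<Sum>i<n. X p (f i) * Y i p h + f i p * D X (Y i) p h)"
    by (rule Suc.IH; rule Suc.prems) simp_all
  show ?case
    unfolding sum.lessThan_Suc conn_add_right[OF assms(1) v w fn(1) assms(2)]
      conn_leibniz[OF assms(1) fn(2) fn(2) fn(1) assms(2)] IH ..
qed

end

section \<open>Manifolds\<close>

text \<open>The number of vectors and the vectors form one pair, so that a single choice in the
  locale \<open>manifold\<close> fixes both consistently. The number may be 0.\<close>

definition orthonormal_frame :: "'e::euclidean_space set \<Rightarrow> nat \<times> (nat \<Rightarrow> 'e) \<Rightarrow> bool" where
  "orthonormal_frame V p \<longleftrightarrow> (\<forall>i<fst p. snd p i \<in> V) \<and>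
    (\<forall>i<fst p. \<forall>j<fst p. snd p i \<bullet> snd p j = (if i = j then 1 else 0)) \<and>
    (\<forall>v\<in>V. v = (\<Sum>i<fst p. (v \<bullet> snd p i) *\<^sub>R snd p i))"

text \<open>The expansion holds because its remainder \<open>w\<close> lies in the span of the basis
  and is orthogonal to the basis, hence to itself.\<close>

lemma orthonormal_frame_exists:
  fixes V :: "'e::euclidean_space set"
  assumes V: "subspace V"
  shows "\<exists>p. orthonormal_frame V p"
proof -
  obtain B where B: "B \<subseteq> V" "pairwise orthogonal B" "\<And>x. x \<in> B \<Longrightarrow> norm x = 1" "independent B"
    "span B = V"
    using orthonormal_basis_subspace[OF V] by metis
  have fin: "finite B" using B(4) independent_imp_finite by blast
  obtain e where e: "bij_betw e {..<card B} B"
    using fin by (metis bij_betw_from_nat_into_finite)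
  have eB: "e i \<in> B" if "i < card B" for i using e that by (auto simp: bij_betw_def)
  have ee: "e i \<bullet> e j = (if i = j then 1 else 0)" if ij: "i < card B" "j < card B" for i j
  proof (cases "i = j")
    case True
    then show ?thesis using B(3)[OF eB[OF ij(1)]] by (simp add: norm_eq_1)
  next
    case False
    then have "e i \<noteq> e j" using e ij by (auto simp: bij_betw_def inj_on_def)
    then show ?thesis using False B(2) eB[OF ij(1)] eB[OF ij(2)]
      by (auto simp: pairwise_def orthogonal_def)
  qed
  have "v = (\<Sum>i<card B. (v \<bullet> e i) *\<^sub>R e i)" if v: "v \<in> V" for v
  proof -
    define w where "w = v - (\<Sum>i<card B. (v \<bullet> e i) *\<^sub>R e i)"
    have wV: "w \<in> V" unfolding w_def using v eB B(1)
      by (intro subspace_diff[OF V] subspace_sum[OF V] subspace_scale[OF V]) auto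
    have wb: "w \<bullet> b = 0" if "b \<in> B" for b
    proof -
      have "b \<in> e ` {..<card B}" using e that by (simp add: bij_betw_def)
      then obtain j where j: "j < card B" "b = e j" by auto
      have "(\<Sum>i<card B. (v \<bullet> e i) * (e i \<bullet> e j)) = (\<Sum>i<card B. if i = j then v \<bullet> e i else 0)"
        by (rule sum.cong) (use ee j in auto)
      then show ?thesis using j by (simp add: w_def inner_diff_left inner_sum_left)
    qed
    have "w \<in> span B" using wV B(5) by simp
    from orthogonal_to_span[OF this, of w] wb have "w \<bullet> w = 0" by (simp add: orthogonal_def)
    then show ?thesis by (simp add: w_def)
  qed
  then show ?thesis
    by (intro exI[of _ "(card B, e)"]) (use eB B(1) ee in \<open>auto simp: orthonormal_frame_def\<close>)
qed

locale manifold =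
  fixes M :: "('a, 'e::euclidean_space) mfd"
  assumes sm: "smooth_manifold M"
begin

abbreviation "S \<equiv> mfd_space M"
abbreviation "\<tau> \<equiv> mtop M"
abbreviation "V \<equiv> model M"

definition dm :: nat where "dm = fst (SOME p. orthonormal_frame V p)"
definition ev :: "nat \<Rightarrow> 'e" where "ev = snd (SOME p. orthonormal_frame V p)"
definition prj :: "'e \<Rightarrow> 'e" where "prj z = (\<Sum>i<dm. (z \<bullet> ev i) *\<^sub>R ev i)"

lemma points_S [simp]: "points S = topspace \<tau>"
  by (simp add: mfd_space_def)

lemma subspace_V: "subspace V"
  using sm by (simp add: smooth_manifold_def)

lemma frame: "orthonormal_frame V (dm, ev)"
  using someI_ex[OF orthonormal_frame_exists[OF subspace_V]] by (simp add: dm_def ev_def)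

lemma ev_V: "i < dm \<Longrightarrow> ev i \<in> V"
  and ev_inner: "i < dm \<Longrightarrow> j < dm \<Longrightarrow> ev i \<bullet> ev j = (if i = j then 1 else 0)"
  and V_expand: "v \<in> V \<Longrightarrow> v = (\<Sum>i<dm. (v \<bullet> ev i) *\<^sub>R ev i)"
  using frame by (simp_all add: orthonormal_frame_def)

lemma prj_V: "prj z \<in> V"
  unfolding prj_def by (intro subspace_sum[OF subspace_V] subspace_scale[OF subspace_V]) (simp add: ev_V)

lemma prj_id: "v \<in> V \<Longrightarrow> prj v = v"
  using V_expand by (simp add: prj_def)

lemma bounded_linear_prj: "bounded_linear prj"
  unfolding prj_def
  by (intro bounded_linear_sum bounded_linear_scaleR_const bounded_linear_inner_left)

lemma prj_inner: assumes "i < dm" shows "prj z \<bullet> ev i = z \<bullet> ev i"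
proof -
  have "prj z \<bullet> ev i = (\<Sum>j<dm. if j = i then z \<bullet> ev j else 0)"
    unfolding prj_def inner_sum_left by (rule sum.cong) (use assms ev_inner in auto)
  then show ?thesis using assms by simp
qed

lemma chartD:
  assumes "(U, \<phi>) \<in> atlas M"
  shows chart_open: "openin \<tau> U" and chart_image: "openin (top_of_set V) (\<phi> ` U)"
    and chart_homeo: "homeomorphic_map (subtopology \<tau> U) (top_of_set (\<phi> ` U)) \<phi>"
  using sm assms unfolding smooth_manifold_def by fast+

lemma transition:
  "(U, \<phi>) \<in> atlas M \<Longrightarrow> (U', \<psi>) \<in> atlas M \<Longrightarrow> smooth_on (\<phi> ` (U \<inter> U')) (\<psi> \<circ> inv_into U \<phi>)"
  using sm unfolding smooth_manifold_def by fast

lemma chart_exists: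
  assumes "p \<in> topspace \<tau>" obtains U \<phi> where "(U, \<phi>) \<in> atlas M" "p \<in> U"
proof -
  have "p \<in> (\<Union>(U, \<phi>)\<in>atlas M. U)" using sm assms by (simp add: smooth_manifold_def)
  then show ?thesis using that by blast
qed

lemma chart_sub: "(U, \<phi>) \<in> atlas M \<Longrightarrow> U \<subseteq> topspace \<tau>"
  using chart_open openin_subset by blast

lemma chart_topspace: "(U, \<phi>) \<in> atlas M \<Longrightarrow> topspace (subtopology \<tau> U) = U"
  using chart_sub[of U \<phi>] by (simp add: inf_absorb2)

lemma chart_inj: assumes "(U, \<phi>) \<in> atlas M" shows "inj_on \<phi> U"
  using homeomorphic_imp_injective_map[OF chart_homeo[OF assms]] chart_topspace[OF assms] by simp

lemma chart_V: assumes "(U, \<phi>) \<in> atlas M" "q \<in> U" shows "\<phi> q \<in> V"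
  using openin_imp_subset[OF chart_image[OF assms(1)]] assms(2) by auto

lemma chart_open_image:
  assumes c: "(U, \<phi>) \<in> atlas M" and W: "openin \<tau> W" "W \<subseteq> U"
  obtains T where "open T" "\<phi> ` W = T \<inter> V"
proof -
  have oW: "openin (subtopology \<tau> U) W"
    using W by (metis openin_subtopology_Int2 inf.absorb_iff2)
  have Wt: "W \<subseteq> topspace (subtopology \<tau> U)" unfolding chart_topspace[OF c] by (rule W(2))
  have "openin (top_of_set (\<phi> ` U)) (\<phi> ` W)"
    using homeomorphic_map_openness[OF chart_homeo[OF c] Wt] oW by blast
  then have "openin (top_of_set V) (\<phi> ` W)" by (rule openin_trans[OF _ chart_image[OF c]])
  then show ?thesis using that by (auto simp: openin_open Int_commute)
qed

lemma chart_preimage: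
  assumes c: "(U, \<phi>) \<in> atlas M" and T: "open T"
  shows "openin \<tau> {q \<in> U. \<phi> q \<in> T}"
proof -
  have "continuous_map (subtopology \<tau> U) euclidean \<phi>"
    using homeomorphic_imp_continuous_map[OF chart_homeo[OF c]] continuous_map_into_fulltopology by blast
  from openin_continuous_map_preimage[OF this, of T] T
  have "openin (subtopology \<tau> U) {q \<in> U. \<phi> q \<in> T}" by (simp only: chart_topspace[OF c] open_openin)
  then show ?thesis by (rule openin_trans_full) (rule chart_open[OF c])
qed

definition cdom :: "'a set \<Rightarrow> ('a \<Rightarrow> 'e) \<Rightarrow> 'e set" where
  "cdom U \<phi> = {z. prj z \<in> \<phi> ` U}"

text \<open>The coordinate representation of \<open>f\<close>, extended to an open set of the ambient Euclidean
  space through the orthogonal projection.\<close>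

definition rep :: "'a set \<Rightarrow> ('a \<Rightarrow> 'e) \<Rightarrow> ('a \<Rightarrow> real) \<Rightarrow> 'e \<Rightarrow> real" where
  "rep U \<phi> f z = f (inv_into U \<phi> (prj z))"

lemma open_prj_vimage: "open T \<Longrightarrow> open {z. prj z \<in> T}"
  using open_vimage[of T prj] linear_continuous_on[OF bounded_linear_prj, of UNIV] by (simp add: vimage_def)

lemma open_cdom: assumes c: "(U, \<phi>) \<in> atlas M" shows "open (cdom U \<phi>)"
proof -
  obtain T where T: "open T" "\<phi> ` U = T \<inter> V"
    by (rule chart_open_image[OF c chart_open[OF c] subset_refl])
  have "cdom U \<phi> = {z. prj z \<in> T}" using T prj_V by (auto simp: cdom_def)
  then show ?thesis using open_prj_vimage[OF T(1)] by simp
qed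

lemma chart_cdom:
  assumes "(U, \<phi>) \<in> atlas M" "q \<in> U"
  shows "\<phi> q \<in> cdom U \<phi>" "prj (\<phi> q) = \<phi> q" "rep U \<phi> f (\<phi> q) = f q"
  using assms chart_V[OF assms] prj_id inv_into_f_f[OF chart_inj[OF assms(1)] assms(2)]
  by (auto simp: cdom_def rep_def)

lemma Cinf_on_prj: "open A \<Longrightarrow> Cinf_on A prj"
  by (rule Cinf_on_linear[OF bounded_linear_prj])

lemma rep_smooth:
  assumes c: "(U, \<phi>) \<in> atlas M" and f: "f \<in> funs S"
  shows "Cinf_on (cdom U \<phi>) (rep U \<phi> f)"
proof (rule Cinf_on_local)
  fix z assume z: "z \<in> cdom U \<phi>"
  have "smooth_on (\<phi> ` U) (f \<circ> inv_into U \<phi>)"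
    using f c by (auto simp: mfd_space_def)
  moreover have "prj z \<in> \<phi> ` U" using z by (simp add: cdom_def)
  ultimately obtain T g where T: "open T" "prj z \<in> T" "Cinf_on T g"
    "\<forall>y\<in>T \<inter> \<phi> ` U. g y = (f \<circ> inv_into U \<phi>) y"
    by (rule smooth_onE)
  let ?W = "{z. prj z \<in> T} \<inter> cdom U \<phi>"
  have W: "open ?W" by (rule open_Int[OF open_prj_vimage[OF T(1)] open_cdom[OF c]])
  have 1: "Cinf_on ?W (\<lambda>z. g (prj z))"
    by (rule Cinf_on_compose[OF W T(1) _ Cinf_on_prj[OF W] T(3)]) auto
  have "Cinf_on ?W (rep U \<phi> f)"
    by (rule Cinf_on_cong[OF W _ 1]) (use T(4) in \<open>auto simp: cdom_def rep_def\<close>)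
  then show "\<exists>W. open W \<and> z \<in> W \<and> Cinf_on W (rep U \<phi> f)"
    using W z T(2) by (intro exI[of _ ?W]) simp
qed

text \<open>Membership in \<open>funs\<close> quantifies over all charts. Smoothness of the
  transition maps reduces it to one chart of choice around each point, with a smooth function
  \<open>h\<close> on an open set of the ambient Euclidean space.\<close>

lemma funs_chartI:
  assumes "\<And>q. q \<in> topspace \<tau> \<Longrightarrow> \<exists>U \<phi> W T h. (U, \<phi>) \<in> atlas M \<and> openin \<tau> W \<and> q \<in> W \<and> W \<subseteq> U \<and>
    open T \<and> Cinf_on T h \<and> (\<forall>y\<in>W. \<phi> y \<in> T \<and> f y = h (\<phi> y))"
  shows "f \<in> funs S"
proof -
  have "smooth_on (\<psi> ` U') (f \<circ> inv_into U' \<psi>)" if c': "(U', \<psi>) \<in> atlas M" for U' \<psi>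
  proof (rule smooth_onI)
    fix z assume "z \<in> \<psi> ` U'"
    then obtain q where q: "q \<in> U'" "z = \<psi> q" by auto
    then have "q \<in> topspace \<tau>" using chart_sub[OF c'] by auto
    from assms[OF this] obtain U \<phi> W T h where c: "(U, \<phi>) \<in> atlas M" and W: "openin \<tau> W" "q \<in> W" "W \<subseteq> U"
      and T: "open T" "Cinf_on T h" "\<forall>y\<in>W. \<phi> y \<in> T \<and> f y = h (\<phi> y)" by (elim exE conjE)
    have "z \<in> \<psi> ` (U' \<inter> U)" using q W by auto
    from smooth_onE[OF transition[OF c' c] this] obtain R g where R: "open R" "z \<in> R" "Cinf_on R g"
      "\<forall>y\<in>R \<inter> \<psi> ` (U' \<inter> U). g y = (\<phi> \<circ> inv_into U' \<psi>) y" .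
    \<comment> \<open>The extension \<open>g\<close> of the transition map is controlled only on the
      chart image. Among the points of that image, \<open>R'\<close> selects those whose preimage
      lies in \<open>W\<close>; the further cut with the preimage of \<open>T\<close> under
      \<open>g\<close> makes \<open>h\<close> applicable.\<close>
    obtain R' where R': "open R'" "\<psi> ` (W \<inter> U') = R' \<inter> V"
      by (rule chart_open_image[OF c' openin_Int[OF W(1) chart_open[OF c']] Int_lower2])
    let ?R = "(R \<inter> R') \<inter> g -` T"
    have "continuous_on (R \<inter> R') g"
      using continuous_on_subset[OF Cinf_on_continuous[OF R(3)]] by simp
    then have oR: "open ?R" 
      using continuous_open_preimage[OF _ open_Int[OF R(1) R'(1)] T(1)] by (simp add: Int_commute)
    have gz: "g y = \<phi> (inv_into U' \<psi> y)" "inv_into U' \<psi> y \<in> W \<inter> U'" if "y \<in> R \<inter> R'" "y \<in> \<psi> ` U'" for y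
    proof -
      have "y \<in> V" using that(2) chart_V[OF c'] by auto
      then have "y \<in> \<psi> ` (W \<inter> U')" using that(1) R'(2) by auto
      then obtain x where x: "x \<in> W" "x \<in> U'" "y = \<psi> x" by auto
      then have "inv_into U' \<psi> y = x" using inv_into_f_f[OF chart_inj[OF c']] by simp
      then show "inv_into U' \<psi> y \<in> W \<inter> U'" "g y = \<phi> (inv_into U' \<psi> y)"
        using x R(4) that(1) W(3) by auto
    qed
    have z2: "z \<in> R \<inter> R'" using R(2) R'(2) q W(2) by blast
    have zR: "z \<in> ?R" using gz[OF z2] q T(3) z2 by auto
    have "Cinf_on ?R (\<lambda>y. h (g y))"
      by (rule Cinf_on_compose[OF oR T(1) _ Cinf_on_subset[OF R(3)] T(2)]) auto
    moreover have "\<forall>y\<in>?R \<inter> \<psi> ` U'. h (g y) = (f \<circ> inv_into U' \<psi>) y"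
      using gz T(3) by auto
    ultimately show "\<exists>R g. open R \<and> z \<in> R \<and> Cinf_on R g \<and>
        (\<forall>y\<in>R \<inter> \<psi> ` U'. g y = (f \<circ> inv_into U' \<psi>) y)"
      using oR zR by (intro exI[of _ ?R] exI[of _ "\<lambda>y. h (g y)"] conjI)
  qed
  then show ?thesis by (auto simp: mfd_space_def)
qed

lemma funs_repI:
  assumes "\<And>U \<phi>. (U, \<phi>) \<in> atlas M \<Longrightarrow> Cinf_on (cdom U \<phi>) (rep U \<phi> f)"
  shows "f \<in> funs S"
proof (rule funs_chartI)
  fix q assume "q \<in> topspace \<tau>"
  then obtain U \<phi> where c: "(U, \<phi>) \<in> atlas M" "q \<in> U" by (rule chart_exists)
  have "\<forall>y\<in>U. \<phi> y \<in> cdom U \<phi> \<and> f y = rep U \<phi> f (\<phi> y)"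
    using chart_cdom[OF c(1)] by metis
  then show "\<exists>U \<phi> W T h. (U, \<phi>) \<in> atlas M \<and> openin \<tau> W \<and> q \<in> W \<and> W \<subseteq> U \<and>
    open T \<and> Cinf_on T h \<and> (\<forall>y\<in>W. \<phi> y \<in> T \<and> f y = h (\<phi> y))"
    by (intro exI[of _ U] exI[of _ \<phi>] exI[of _ "cdom U \<phi>"] exI[of _ "rep U \<phi> f"] conjI c
        chart_open[OF c(1)] open_cdom[OF c(1)] assms[OF c(1)] subset_refl)
qed

text \<open>Off the closed set \<open>K\<close> the product vanishes, and near points of
  \<open>K\<close> its chart expression is smooth. In this way a function known only in coordinates
  becomes a global one.\<close>

lemma cutoff_funs:
  assumes \<rho>: "\<rho> \<in> funs S" "closedin \<tau> K" "\<forall>q. q \<notin> K \<longrightarrow> \<rho> q = 0"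
    and c: "(U, \<phi>) \<in> atlas M" and T: "open T" "K \<subseteq> {q \<in> U. \<phi> q \<in> T}" and h: "Cinf_on T h"
  shows "(\<lambda>q. \<rho> q * h (\<phi> q)) \<in> funs S"
proof (rule funs_chartI)
  fix q assume q: "q \<in> topspace \<tau>"
  show "\<exists>U' \<psi> W T' h'. (U', \<psi>) \<in> atlas M \<and> openin \<tau> W \<and> q \<in> W \<and> W \<subseteq> U' \<and>
    open T' \<and> Cinf_on T' h' \<and> (\<forall>y\<in>W. \<psi> y \<in> T' \<and> \<rho> y * h (\<phi> y) = h' (\<psi> y))"
  proof (cases "q \<in> K")
    case True
    let ?T = "cdom U \<phi> \<inter> T" and ?W = "{q \<in> U. \<phi> q \<in> T}"
    have o: "open ?T" by (rule open_Int[OF open_cdom[OF c] T(1)])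
    have "Cinf_on ?T (\<lambda>z. rep U \<phi> \<rho> z * h z)"
      by (rule Cinf_on_mult[OF o Cinf_on_subset[OF rep_smooth[OF c \<rho>(1)]] Cinf_on_subset[OF h]]) auto
    moreover have "\<forall>y\<in>?W. \<phi> y \<in> ?T \<and> \<rho> y * h (\<phi> y) = rep U \<phi> \<rho> (\<phi> y) * h (\<phi> y)"
      using chart_cdom[OF c] by simp
    moreover have "q \<in> ?W" using True T(2) by blast
    ultimately show ?thesis using o
      by (intro exI[of _ U] exI[of _ \<phi>] exI[of _ ?W] exI[of _ ?T]
          exI[of _ "\<lambda>z. rep U \<phi> \<rho> z * h z"] conjI c chart_preimage[OF c T(1)]) auto
  next
    case False
    obtain U' \<psi> where c': "(U', \<psi>) \<in> atlas M" "q \<in> U'" by (rule chart_exists[OF q])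
    have W: "openin \<tau> (U' - K)" by (rule openin_diff[OF chart_open[OF c'(1)] \<rho>(2)])
    have "Cinf_on (UNIV :: 'e set) (\<lambda>_. 0 :: real)" by (rule Cinf_on_const)
    then show ?thesis using False c' W \<rho>(3)
      by (intro exI[of _ U'] exI[of _ \<psi>] exI[of _ "U' - K"] exI[of _ UNIV] exI[of _ "\<lambda>_. 0"] conjI) auto
  qed
qed

text \<open>The Hausdorff property enters here: the preimage \<open>K\<close> of a closed coordinate
  ball is compact, hence closed in the whole manifold, and so extension by 0 preserves
  smoothness.\<close>

lemma manifold_bump:
  assumes p: "p \<in> topspace \<tau>" and U0: "openin \<tau> U0" "p \<in> U0"
  shows "\<exists>\<rho> W K. \<rho> \<in> funs S \<and> openin \<tau> W \<and> p \<in> W \<and> W \<subseteq> K \<and> closedin \<tau> K \<and> K \<subseteq> U0 \<and>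
        (\<forall>q\<in>W. \<rho> q = 1) \<and> (\<forall>q. q \<notin> K \<longrightarrow> \<rho> q = 0)"
proof -
  obtain U \<phi> where c: "(U, \<phi>) \<in> atlas M" "p \<in> U" by (rule chart_exists[OF p])
  obtain T where T: "open T" "\<phi> ` (U \<inter> U0) = T \<inter> V"
    by (rule chart_open_image[OF c(1) openin_Int[OF chart_open[OF c(1)] U0(1)] Int_lower1])
  have "\<phi> p \<in> T" using T(2) c(2) U0(2) by blast
  then obtain R where R: "R > 0" "cball (\<phi> p) R \<subseteq> T"
    using T(1) open_contains_cball by metis
  obtain \<beta> :: "'e \<Rightarrow> real" where \<beta>: "Cinf_on UNIV \<beta>" "\<And>x. dist (\<phi> p) x \<le> R / 2 \<Longrightarrow> \<beta> x = 1"
    "\<And>x. R \<le> dist (\<phi> p) x \<Longrightarrow> \<beta> x = 0"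
    using bump_function[of "R / 2" R "\<phi> p"] R by auto
  define K where "K = {q \<in> U. \<phi> q \<in> cball (\<phi> p) R}"
  have "\<phi> ` K = cball (\<phi> p) R \<inter> V"
  proof
    show "\<phi> ` K \<subseteq> cball (\<phi> p) R \<inter> V" using chart_V[OF c(1)] by (auto simp: K_def)
    show "cball (\<phi> p) R \<inter> V \<subseteq> \<phi> ` K"
    proof
      fix z assume z: "z \<in> cball (\<phi> p) R \<inter> V"
      then have "z \<in> \<phi> ` (U \<inter> U0)" using T(2) R(2) by auto
      then show "z \<in> \<phi> ` K" using z by (auto simp: K_def)
    qed
  qed
  then have cK: "compact (\<phi> ` K)"
    using compact_Int_closed[OF compact_cball closed_subspace[OF subspace_V]] by simp
  have KU: "K \<subseteq> U" by (auto simp: K_def)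
  have "compactin (top_of_set (\<phi> ` U)) (\<phi> ` K)"
    using cK KU by (simp add: compactin_subtopology image_mono)
  moreover have "K \<subseteq> topspace (subtopology \<tau> U)" unfolding chart_topspace[OF c(1)] by (rule KU)
  ultimately have "compactin (subtopology \<tau> U) K"
    using homeomorphic_map_compactness[OF chart_homeo[OF c(1)]] by blast
  then have "compactin \<tau> K" by (simp add: compactin_subtopology)
  moreover have "Hausdorff_space \<tau>" using sm by (simp add: smooth_manifold_def)
  ultimately have clK: "closedin \<tau> K" using compactin_imp_closedin by blast
  have KU0: "K \<subseteq> U0"
  proof
    fix q assume q: "q \<in> K"
    then have "\<phi> q \<in> T \<inter> V" using R(2) chart_V[OF c(1)] by (auto simp: K_def)
    then obtain x where "x \<in> U \<inter> U0" "\<phi> q = \<phi> x" using T(2) by blast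
    then show "q \<in> U0" using chart_inj[OF c(1)] KU q by (auto simp: inj_on_def)
  qed
  define \<rho> where "\<rho> = (\<lambda>q. if q \<in> U then \<beta> (\<phi> q) else 0)"
  define W where "W = {q \<in> U. \<phi> q \<in> ball (\<phi> p) (R / 2)}"
  have 0: "\<rho> q = 0" if "q \<notin> K" for q
    using that \<beta>(3)[of "\<phi> q"] by (auto simp: \<rho>_def K_def)
  have "\<rho> \<in> funs S"
  proof (rule funs_chartI)
    fix q assume q: "q \<in> topspace \<tau>"
    show "\<exists>U' \<psi> W T' h'. (U', \<psi>) \<in> atlas M \<and> openin \<tau> W \<and> q \<in> W \<and> W \<subseteq> U' \<and>
      open T' \<and> Cinf_on T' h' \<and> (\<forall>y\<in>W. \<psi> y \<in> T' \<and> \<rho> y = h' (\<psi> y))"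
    proof (cases "q \<in> U")
      case True
      then show ?thesis
        by (intro exI[of _ U] exI[of _ \<phi>] exI[of _ U] exI[of _ UNIV] exI[of _ \<beta>] conjI
            c chart_open[OF c(1)] \<beta>(1)) (auto simp: \<rho>_def)
    next
      case False
      then have qK: "q \<notin> K" using KU by blast
      obtain U' \<psi> where c': "(U', \<psi>) \<in> atlas M" "q \<in> U'" by (rule chart_exists[OF q])
      have W: "openin \<tau> (U' - K)" by (rule openin_diff[OF chart_open[OF c'(1)] clK])
      have "Cinf_on (UNIV :: 'e set) (\<lambda>_. 0 :: real)" by (rule Cinf_on_const)
      then show ?thesis using qK c' W 0
        by (intro exI[of _ U'] exI[of _ \<psi>] exI[of _ "U' - K"] exI[of _ UNIV] exI[of _ "\<lambda>_. 0"] conjI) auto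
    qed
  qed
  moreover have "openin \<tau> W" unfolding W_def by (rule chart_preimage[OF c(1) open_ball])
  moreover have "p \<in> W" using c(2) R(1) by (simp add: W_def)
  moreover have "W \<subseteq> K" using R(1) by (auto simp: W_def K_def)
  moreover have "\<forall>q\<in>W. \<rho> q = 1" using \<beta>(2) by (auto simp: W_def \<rho>_def)
  ultimately show ?thesis using 0 clK KU0
    by (intro exI[of _ \<rho>] exI[of _ W] exI[of _ K] conjI) auto
qed

lemma chart_preimage_neq:
  assumes c: "(U, \<phi>) \<in> atlas M" and f: "f \<in> funs S"
  shows "openin \<tau> {q \<in> U. f q \<noteq> 0}"
proof -
  have "open (cdom U \<phi> \<inter> rep U \<phi> f -` {x. x \<noteq> 0})"
    by (rule continuous_open_preimage[OF Cinf_on_continuous[OF rep_smooth[OF c f]] open_cdom[OF c] open_nonzero])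
  from chart_preimage[OF c this] show ?thesis
    using chart_cdom[OF c] by (auto elim!: back_subst[of "openin \<tau>"])
qed

end

sublocale manifold \<subseteq> sspace S \<tau>
proof
  show "points S \<subseteq> topspace \<tau>" by simp
  show "(\<lambda>_. c) \<in> funs S" for c :: real
    by (rule funs_repI) (simp add: rep_def[abs_def] Cinf_on_const)
  show "(\<lambda>q. f q + g q) \<in> funs S" if f: "f \<in> funs S" and g: "g \<in> funs S" for f g
  proof (rule funs_repI)
    fix U \<phi> assume c: "(U, \<phi>) \<in> atlas M"
    show "Cinf_on (cdom U \<phi>) (rep U \<phi> (\<lambda>q. f q + g q))"
      using Cinf_on_add[OF open_cdom[OF c] rep_smooth[OF c f] rep_smooth[OF c g]]
      by (simp add: rep_def[abs_def])
  qed
  show mult: "(\<lambda>q. f q * g q) \<in> funs S" if f: "f \<in> funs S" and g: "g \<in> funs S" for f g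
  proof (rule funs_repI)
    fix U \<phi> assume c: "(U, \<phi>) \<in> atlas M"
    show "Cinf_on (cdom U \<phi>) (rep U \<phi> (\<lambda>q. f q * g q))"
      using Cinf_on_mult[OF open_cdom[OF c] rep_smooth[OF c f] rep_smooth[OF c g]]
      by (simp add: rep_def[abs_def])
  qed
  show "f \<in> funs S"
    if loc: "\<And>p. p \<in> points S \<Longrightarrow> \<exists>U F. openin \<tau> U \<and> p \<in> U \<and> F \<in> funs S \<and> (\<forall>q\<in>U \<inter> points S. F q = f q)"
    for f
  proof (rule funs_chartI)
    fix q assume q: "q \<in> topspace \<tau>"
    then obtain W F where W: "openin \<tau> W" "q \<in> W" "F \<in> funs S" "\<forall>y\<in>W \<inter> points S. F y = f y"
      using loc[of q] by (metis points_S)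
    obtain U \<phi> where c: "(U, \<phi>) \<in> atlas M" "q \<in> U" by (rule chart_exists[OF q])
    have "\<forall>y\<in>W \<inter> U. \<phi> y \<in> cdom U \<phi> \<and> f y = rep U \<phi> F (\<phi> y)"
      using chart_cdom[OF c(1)] W(4) chart_sub[OF c(1)] by auto
    then show "\<exists>U \<phi> W T h. (U, \<phi>) \<in> atlas M \<and> openin \<tau> W \<and> q \<in> W \<and> W \<subseteq> U \<and>
        open T \<and> Cinf_on T h \<and> (\<forall>y\<in>W. \<phi> y \<in> T \<and> f y = h (\<phi> y))"
      using W(2) c(2) by (intro exI[of _ U] exI[of _ \<phi>] exI[of _ "W \<inter> U"] exI[of _ "cdom U \<phi>"]
          exI[of _ "rep U \<phi> F"] conjI c(1) openin_Int W(1) chart_open[OF c(1)] open_cdom[OF c(1)]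
          rep_smooth[OF c(1) W(3)]) auto
  qed
  show "\<exists>\<rho> W K. \<rho> \<in> funs S \<and> openin \<tau> W \<and> p \<in> W \<and> W \<subseteq> K \<and> closedin \<tau> K \<and> K \<subseteq> U \<and>
        (\<forall>q\<in>W. \<rho> q = 1) \<and> (\<forall>q. q \<notin> K \<longrightarrow> \<rho> q = 0)"
    if "p \<in> points S" "openin \<tau> U" "p \<in> U" for p U
    using manifold_bump[of p U] that by simp
  show "\<exists>g W. g \<in> funs S \<and> openin \<tau> W \<and> p \<in> W \<and> (\<forall>q\<in>W \<inter> points S. g q * f q = 1)"
    if f: "f \<in> funs S" and p: "p \<in> points S" and fp: "f p \<noteq> 0" for f p
  proof -
    obtain U \<phi> where c: "(U, \<phi>) \<in> atlas M" "p \<in> U" using chart_exists[of p] p by auto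
    let ?N = "{q \<in> U. f q \<noteq> 0}"
    have N: "openin \<tau> ?N" by (rule chart_preimage_neq[OF c(1) f])
    obtain \<rho> W K where \<rho>: "\<rho> \<in> funs S" "openin \<tau> W" "p \<in> W" "W \<subseteq> K" "closedin \<tau> K" "K \<subseteq> ?N"
      "\<forall>q\<in>W. \<rho> q = 1" "\<forall>q. q \<notin> K \<longrightarrow> \<rho> q = 0"
      using manifold_bump[of p, OF _ N] p fp c(2) by auto
    let ?T = "cdom U \<phi> \<inter> rep U \<phi> f -` {x. x \<noteq> 0}"
    have T: "open ?T"
      by (rule continuous_open_preimage[OF Cinf_on_continuous[OF rep_smooth[OF c(1) f]]
            open_cdom[OF c(1)] open_nonzero])
    have KT: "K \<subseteq> {q \<in> U. \<phi> q \<in> ?T}" using \<rho>(6) chart_cdom[OF c(1)] by auto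
    have "Cinf_on ?T (\<lambda>z. inverse (rep U \<phi> f z))"
      by (rule Cinf_on_inverse[OF T Cinf_on_subset[OF rep_smooth[OF c(1) f]]]) auto
    from cutoff_funs[OF \<rho>(1,5,8) c(1) T KT this]
    have "(\<lambda>q. \<rho> q * inverse (rep U \<phi> f (\<phi> q))) \<in> funs S" .
    moreover have "\<forall>q\<in>W \<inter> points S. \<rho> q * inverse (rep U \<phi> f (\<phi> q)) * f q = 1"
      using \<rho>(4,6,7) chart_cdom[OF c(1)] by auto
    ultimately show ?thesis using \<rho>(2,3) by (intro exI conjI)
  qed
qed

text \<open>Bootstrapping: if \<open>u\<close> has class \<open>k\<close>, so does
  \<open>g (u t)\<close>, which is the derivative of \<open>u\<close>, and therefore
  \<open>u\<close> has class \<open>Suc k\<close>.\<close>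

lemma Cinf_on_ode:
  fixes u :: "real \<Rightarrow> 'e::euclidean_space"
  assumes I: "open I" and T: "open T" "u ` I \<subseteq> T" and g: "Cinf_on T g"
    and u: "\<And>t. t \<in> I \<Longrightarrow> (u has_vector_derivative g (u t)) (at t)"
  shows "Cinf_on I u"
proof (rule Cinf_onI)
  fix k show "Ck_on k I u"
  proof (induction k)
    case 0
    have "continuous (at t) u" if "t \<in> I" for t
      by (rule has_vector_derivative_continuous[OF u[OF that]])
    then show ?case by (simp add: continuous_at_imp_continuous_on)
  next
    case (Suc k)
    show ?case
    proof (rule Ck_on_SucI[OF I])
      show "(u has_derivative (\<lambda>s. s *\<^sub>R g (u t))) (at t)" if "t \<in> I" for t
        using u[OF that] by (simp add: has_vector_derivative_def)
      show "Ck_on k I (\<lambda>t. s *\<^sub>R g (u t))" for s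
        by (rule Ck_on_scaleR[OF I Ck_on_const Ck_on_compose[OF I T Suc Cinf_onD[OF g]]])
    qed
  qed
qed

context manifold
begin

lemma frechet_rep:
  assumes c: "(U, \<phi>) \<in> atlas M" and f: "f \<in> funs S" and z: "z \<in> cdom U \<phi>"
  shows "(rep U \<phi> f has_derivative frechet_derivative (rep U \<phi> f) (at z)) (at z)"
  by (rule Cinf_on_has_derivative[OF rep_smooth[OF c f] z])

text \<open>\<open>rep\<close> factors through \<open>prj\<close>, so its derivative depends only on
  the projections of the point and of the direction.\<close>

lemma frechet_rep_prj:
  assumes c: "(U, \<phi>) \<in> atlas M" and f: "f \<in> funs S" and z: "z \<in> cdom U \<phi>"
  shows "frechet_derivative (rep U \<phi> f) (at z) v = frechet_derivative (rep U \<phi> f) (at (prj z)) (prj v)"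
proof -
  have pz: "prj (prj z) = prj z" by (rule prj_id[OF prj_V])
  then have "prj z \<in> cdom U \<phi>" using z by (simp add: cdom_def)
  note 1 = frechet_rep[OF c f this]
  have 2: "(prj has_derivative prj) (at z)"
    by (rule bounded_linear_imp_has_derivative[OF bounded_linear_prj])
  have "((\<lambda>z. rep U \<phi> f (prj z)) has_derivative
      (\<lambda>v. frechet_derivative (rep U \<phi> f) (at (prj z)) (prj v))) (at z)"
    by (rule has_derivative_compose[OF 2 1])
  moreover have "(\<lambda>z. rep U \<phi> f (prj z)) = rep U \<phi> f"
    by (rule ext) (simp add: rep_def prj_id[OF prj_V])
  ultimately have "(rep U \<phi> f has_derivative
      (\<lambda>v. frechet_derivative (rep U \<phi> f) (at (prj z)) (prj v))) (at z)" by simp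
  from frechet_derivative_at[OF this] show ?thesis by metis
qed

lemma chart_tangent:
  assumes c: "(U, \<phi>) \<in> atlas M" and q: "q \<in> U"
  shows "(\<lambda>f. if f \<in> funs S then frechet_derivative (rep U \<phi> f) (at (\<phi> q)) v else 0) \<in> tangent S q"
proof -
  let ?z = "\<phi> q"
  have z: "?z \<in> cdom U \<phi>" by (rule chart_cdom[OF c q])
  note d = frechet_rep[OF c _ z]
  have rep: "rep U \<phi> f ?z = f q" for f by (rule chart_cdom[OF c q])
  have add: "frechet_derivative (rep U \<phi> (\<lambda>x. f x + g x)) (at ?z) v
      = frechet_derivative (rep U \<phi> f) (at ?z) v + frechet_derivative (rep U \<phi> g) (at ?z) v"
    if "f \<in> funs S" "g \<in> funs S" for f g
  proof -
    have "rep U \<phi> (\<lambda>x. f x + g x) = (\<lambda>z. rep U \<phi> f z + rep U \<phi> g z)" by (simp add: rep_def[abs_def])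
    from frechet_derivative_at[OF has_derivative_add[OF d[OF that(1)] d[OF that(2)]], folded this]
    show ?thesis by metis
  qed
  have mult: "frechet_derivative (rep U \<phi> (\<lambda>x. f x * g x)) (at ?z) v
      = frechet_derivative (rep U \<phi> f) (at ?z) v * g q + f q * frechet_derivative (rep U \<phi> g) (at ?z) v"
    if "f \<in> funs S" "g \<in> funs S" for f g
  proof -
    have "rep U \<phi> (\<lambda>x. f x * g x) = (\<lambda>z. rep U \<phi> f z * rep U \<phi> g z)" by (simp add: rep_def[abs_def])
    from frechet_derivative_at[OF has_derivative_mult[OF d[OF that(1)] d[OF that(2)]], folded this]
    have "frechet_derivative (rep U \<phi> (\<lambda>x. f x * g x)) (at ?z) v =
        rep U \<phi> f ?z * frechet_derivative (rep U \<phi> g) (at ?z) v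
        + frechet_derivative (rep U \<phi> f) (at ?z) v * rep U \<phi> g ?z" by metis
    then show ?thesis by (simp add: rep)
  qed
  have const: "frechet_derivative (rep U \<phi> (\<lambda>x. k)) (at ?z) v = 0" for k
  proof -
    have "rep U \<phi> (\<lambda>x. k) = (\<lambda>z. k)" by (simp add: rep_def[abs_def])
    then show ?thesis using frechet_derivative_at[OF has_derivative_const[of k "at ?z"]] by metis
  qed
  show ?thesis unfolding tangent_def
    using add mult mult[OF funs_const] const by (simp add: funs_add funs_mult funs_const)
qed

lemma coordinate_fields:
  assumes c: "(U, \<phi>) \<in> atlas M" and p: "p \<in> U" and i: "i < dm"
  obtains E W where "vector_field S E" "openin \<tau> W" "p \<in> W" "W \<subseteq> U"
    "\<forall>q\<in>W. \<forall>f\<in>funs S. E q f = frechet_derivative (rep U \<phi> f) (at (\<phi> q)) (ev i)"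
proof -
  let ?X = "\<lambda>q f. if f \<in> funs S then frechet_derivative (rep U \<phi> f) (at (\<phi> q)) (ev i) else 0"
  have p': "p \<in> points S" using p chart_sub[OF c] by auto
  have sm: "\<exists>W F. openin \<tau> W \<and> q \<in> W \<and> F \<in> funs S \<and> (\<forall>y\<in>W \<inter> points S. F y = ?X y f)"
    if f: "f \<in> funs S" and q: "q \<in> U" for f q
  proof -
    have q': "q \<in> points S" using q chart_sub[OF c] by auto
    obtain \<rho> W K where \<rho>: "\<rho> \<in> funs S" "openin \<tau> W" "q \<in> W" "W \<subseteq> K" "closedin \<tau> K" "K \<subseteq> U"
      "\<forall>q\<in>W. \<rho> q = 1" "\<forall>q. q \<notin> K \<longrightarrow> \<rho> q = 0"
      using bump[OF q' chart_open[OF c] q] by (elim exE conjE)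
    have "(\<lambda>y. \<rho> y * frechet_derivative (rep U \<phi> f) (at (\<phi> y)) (ev i)) \<in> funs S"
      by (rule cutoff_funs[OF \<rho>(1,5,8) c open_cdom[OF c] _ Cinf_on_frechet[OF rep_smooth[OF c f]]])
        (use \<rho>(6) chart_cdom[OF c] in auto)
    then show ?thesis using \<rho>(2,3,7) f
      by (intro exI[of _ W] exI[of _ "\<lambda>y. \<rho> y * frechet_derivative (rep U \<phi> f) (at (\<phi> y)) (ev i)"]) simp
  qed
  obtain Y W where Y: "vector_field S Y" "openin \<tau> W" "p \<in> W" "W \<subseteq> U" "\<forall>q\<in>W. Y q = ?X q"
    by (rule vector_field_extend[OF p' chart_open[OF c] p, of ?X])
      (use chart_tangent[OF c] sm in simp_all)
  show ?thesis by (rule that[OF Y(1-4)]) (use Y(5) in simp)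
qed

text \<open>By Hadamard's lemma \<open>f\<close> is near \<open>q\<close> a constant plus a sum of
  products of \<open>x i - x i q\<close> with smooth \<open>G i\<close>. A derivation kills the
  constant, and in the product rule only \<open>v (x i) * G i q\<close> survives, where
  \<open>G i q\<close> is the partial derivative of \<open>f\<close> in direction
  \<open>ev i\<close>.\<close>

lemma tangent_formula:
  assumes c: "(U, \<phi>) \<in> atlas M" and q: "q \<in> U" and W: "openin \<tau> W" "q \<in> W" "W \<subseteq> U"
    and x: "\<And>i. i < dm \<Longrightarrow> x i \<in> funs S" "\<And>i y. i < dm \<Longrightarrow> y \<in> W \<Longrightarrow> x i y = \<phi> y \<bullet> ev i"
    and v: "v \<in> tangent S q" and f: "f \<in> funs S"
  shows "v f = frechet_derivative (rep U \<phi> f) (at (\<phi> q)) (\<Sum>i<dm. v (x i) *\<^sub>R ev i)"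
proof -
  let ?df = "frechet_derivative (rep U \<phi> f) (at (\<phi> q))"
  have q': "q \<in> points S" using q chart_sub[OF c] by auto
  have z: "\<phi> q \<in> cdom U \<phi>" by (rule chart_cdom[OF c q])
  have lin: "linear ?df" by (rule has_derivative_linear[OF frechet_rep[OF c f z]])
  obtain r where r: "r > 0" "ball (\<phi> q) r \<subseteq> cdom U \<phi>"
    using open_contains_ball open_cdom[OF c] z by metis
  obtain g where g: "\<forall>b. Cinf_on (ball (\<phi> q) r) (g b)" "\<forall>b. g b (\<phi> q) = ?df b"
    "\<forall>y\<in>ball (\<phi> q) r. rep U \<phi> f y = rep U \<phi> f (\<phi> q) + (\<Sum>b\<in>Basis. ((y - \<phi> q) \<bullet> b) * g b y)"
    by (rule Hadamard[OF open_ball convex_ball _ Cinf_on_subset[OF rep_smooth[OF c f] r(2)]])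
      (use r(1) in auto)
  let ?N = "W \<inter> {y \<in> U. \<phi> y \<in> ball (\<phi> q) r}"
  have N: "openin \<tau> ?N" "q \<in> ?N"
    using openin_Int[OF W(1) chart_preimage[OF c open_ball]] W(2) q r(1) by auto
  obtain \<sigma> W' K where \<sigma>: "\<sigma> \<in> funs S" "openin \<tau> W'" "q \<in> W'" "W' \<subseteq> K" "closedin \<tau> K" "K \<subseteq> ?N"
    "\<forall>q\<in>W'. \<sigma> q = 1" "\<forall>q. q \<notin> K \<longrightarrow> \<sigma> q = 0"
    using bump[OF q' N] by (elim exE conjE)
  \<comment> \<open>Hadamard's coefficients belong to the basis of the ambient space; these sums
    convert them to the frame \<open>ev\<close> of the model, and \<sigma> makes them global
    functions on which \<open>v\<close> can act.\<close>
  define G where "G = (\<lambda>i y. \<sigma> y * (\<Sum>b\<in>Basis. (ev i \<bullet> b) * g b (\<phi> y)))"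
  have G: "G i \<in> funs S" for i unfolding G_def
  proof (rule cutoff_funs[OF \<sigma>(1,5,8) c open_ball])
    show "K \<subseteq> {y \<in> U. \<phi> y \<in> ball (\<phi> q) r}" using \<sigma>(6) by blast
    show "Cinf_on (ball (\<phi> q) r) (\<lambda>z. \<Sum>b\<in>Basis. (ev i \<bullet> b) * g b z)"
      by (intro Cinf_on_sum Cinf_on_mult Cinf_on_const open_ball g(1)[rule_format])
  qed
  have Gq: "G i q = ?df (ev i)" for i
    using linear_Basis_expand[OF lin, of "ev i"] g(2) \<sigma>(3,7) by (simp add: G_def)
  have fy: "f y = f q + (\<Sum>i<dm. (x i y - x i q) * G i y)" if y: "y \<in> W'" for y
  proof -
    have yN: "y \<in> W" "y \<in> U" "\<phi> y \<in> ball (\<phi> q) r" using y \<sigma>(4,6) by auto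
    have "\<phi> y - \<phi> q \<in> V" by (intro subspace_diff[OF subspace_V] chart_V[OF c] yN(2) q)
    from V_expand[OF this] have e: "\<phi> y - \<phi> q = (\<Sum>i<dm. (x i y - x i q) *\<^sub>R ev i)"
      using x(2) yN(1) W(2) by (simp add: inner_diff_left)
    have "(\<Sum>b\<in>Basis. ((\<phi> y - \<phi> q) \<bullet> b) * g b (\<phi> y))
        = (\<Sum>b\<in>Basis. \<Sum>i<dm. (x i y - x i q) * ((ev i \<bullet> b) * g b (\<phi> y)))"
      unfolding e inner_sum_left sum_distrib_right by (simp add: mult.assoc)
    also have "\<dots> = (\<Sum>i<dm. \<Sum>b\<in>Basis. (x i y - x i q) * ((ev i \<bullet> b) * g b (\<phi> y)))"
      by (rule sum.swap)
    also have "\<dots> = (\<Sum>i<dm. (x i y - x i q) * G i y)"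
      using \<sigma>(7) y by (simp add: G_def sum_distrib_left)
    finally have "(\<Sum>b\<in>Basis. ((\<phi> y - \<phi> q) \<bullet> b) * g b (\<phi> y)) = (\<Sum>i<dm. (x i y - x i q) * G i y)" .
    then show ?thesis using bspec[OF g(3) yN(3)]
        chart_cdom(3)[OF c yN(2), of f] chart_cdom(3)[OF c q, of f] by simp
  qed
  have xc: "(\<lambda>y. x i y - x i q) \<in> funs S" if "i < dm" for i
    by (rule funs_diff[OF x(1)[OF that] funs_const])
  have F: "(\<lambda>y. f q + (\<Sum>i<dm. (x i y - x i q) * G i y)) \<in> funs S"
    by (intro funs_add funs_const funs_sum funs_mult xc G) simp
  have "v f = v (\<lambda>y. f q + (\<Sum>i<dm. (x i y - x i q) * G i y))"
    by (rule tangent_local[OF v q' f F \<sigma>(2,3)]) (rule fy)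
  also have "\<dots> = v (\<lambda>_. f q) + v (\<lambda>y. \<Sum>i<dm. (x i y - x i q) * G i y)"
    by (rule tangent_add[OF v funs_const]) (intro funs_sum funs_mult xc G, simp)
  also have "\<dots> = (\<Sum>i<dm. v (\<lambda>y. (x i y - x i q) * G i y))"
    unfolding tangent_const[OF v] by (simp, rule tangent_sum[OF v]) (intro funs_mult xc G, simp)
  also have "\<dots> = (\<Sum>i<dm. v (x i) * ?df (ev i))"
  proof (rule sum.cong[OF refl])
    fix i assume "i \<in> {..<dm}"
    then have i: "i < dm" by simp
    show "v (\<lambda>y. (x i y - x i q) * G i y) = v (x i) * ?df (ev i)"
      unfolding tangent_mult[OF v xc[OF i] G] tangent_diff[OF v x(1)[OF i] funs_const]
        tangent_const[OF v] Gq by simp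
  qed
  also have "\<dots> = ?df (\<Sum>i<dm. v (x i) *\<^sub>R ev i)"
    by (simp add: linear_sum[OF lin] linear_cmul[OF lin])
  finally show ?thesis .
qed

text \<open>Derivations act on global functions only, so the linear coordinates of the chart are
  multiplied by a bump function that is 1 on \<open>W\<close>.\<close>

lemma chart_coordinates:
  assumes c: "(U, \<phi>) \<in> atlas M" and p: "p \<in> U"
  obtains x W where "openin \<tau> W" "p \<in> W" "W \<subseteq> U" "\<forall>i<dm. x i \<in> funs S"
    "\<forall>i<dm. \<forall>q\<in>W. x i q = \<phi> q \<bullet> ev i"
    "\<forall>q\<in>W. \<forall>v\<in>tangent S q. \<forall>f\<in>funs S.
      v f = frechet_derivative (rep U \<phi> f) (at (\<phi> q)) (\<Sum>i<dm. v (x i) *\<^sub>R ev i)"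
proof -
  have p': "p \<in> points S" using p chart_sub[OF c] by auto
  obtain \<rho> W K where \<rho>: "\<rho> \<in> funs S" "openin \<tau> W" "p \<in> W" "W \<subseteq> K" "closedin \<tau> K" "K \<subseteq> U"
    "\<forall>q\<in>W. \<rho> q = 1" "\<forall>q. q \<notin> K \<longrightarrow> \<rho> q = 0"
    using bump[OF p' chart_open[OF c] p] by (elim exE conjE)
  define x where "x = (\<lambda>i q. \<rho> q * (\<phi> q \<bullet> ev i))"
  have x: "x i \<in> funs S" for i unfolding x_def
    by (rule cutoff_funs[OF \<rho>(1,5,8) c open_UNIV _ Cinf_on_linear[OF bounded_linear_inner_left open_UNIV]])
      (use \<rho>(6) in auto)
  have x2: "x i q = \<phi> q \<bullet> ev i" if "q \<in> W" for i q using \<rho>(7) that by (simp add: x_def)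
  have WU: "W \<subseteq> U" using \<rho>(4,6) by (rule order_trans)
  show ?thesis
    by (rule that[OF \<rho>(2,3) WU, of x])
      (use x x2 tangent_formula[OF c _ \<rho>(2) _ WU x x2] WU in \<open>auto simp del: points_S\<close>)
qed

text \<open>Once a tangent vector is known to be a directional derivative, linearity in the
  direction recovers it from its values on the \<open>x i\<close>. The later arguments pass to
  components in this frame, which leaves only functions to be handled.\<close>

lemma chart_frame:
  assumes c: "(U, \<phi>) \<in> atlas M" and p: "p \<in> U"
  obtains x E W where "openin \<tau> W" "p \<in> W" "W \<subseteq> U" "\<forall>i<dm. x i \<in> funs S" "\<forall>i<dm. vector_field S (E i)"
    "\<forall>i<dm. \<forall>q\<in>W. x i q = \<phi> q \<bullet> ev i"
    "\<forall>i<dm. \<forall>q\<in>W. \<forall>f\<in>funs S. E i q f = frechet_derivative (rep U \<phi> f) (at (\<phi> q)) (ev i)"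
    "\<forall>q\<in>W. \<forall>i<dm. \<forall>j<dm. E i q (x j) = (if i = j then 1 else 0)"
    "\<forall>q\<in>W. \<forall>v\<in>tangent S q. v = (\<lambda>f. \<Sum>i<dm. v (x i) * E i q f)"
proof -
  have pt: "p \<in> topspace \<tau>" using p chart_sub[OF c] by auto
  obtain x W where W: "openin \<tau> W" "p \<in> W" "W \<subseteq> U" and x: "\<forall>i<dm. x i \<in> funs S"
    and xq: "\<forall>i<dm. \<forall>q\<in>W. x i q = \<phi> q \<bullet> ev i"
    and fm: "\<forall>q\<in>W. \<forall>v\<in>tangent S q. \<forall>f\<in>funs S.
      v f = frechet_derivative (rep U \<phi> f) (at (\<phi> q)) (\<Sum>i<dm. v (x i) *\<^sub>R ev i)"
    by (rule chart_coordinates[OF c p])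
  have "\<exists>E W. vector_field S E \<and> openin \<tau> W \<and> p \<in> W \<and>
      (\<forall>q\<in>W. \<forall>f\<in>funs S. E q f = frechet_derivative (rep U \<phi> f) (at (\<phi> q)) (ev i))" if i: "i < dm" for i
    by (rule coordinate_fields[OF c p i]) (intro exI conjI)
  then obtain E W' where E: "\<And>i. i < dm \<Longrightarrow> vector_field S (E i)"
    and W': "\<And>i. i < dm \<Longrightarrow> openin \<tau> (W' i)" "\<And>i. i < dm \<Longrightarrow> p \<in> W' i"
    and Ef: "\<And>i q f. i < dm \<Longrightarrow> q \<in> W' i \<Longrightarrow> f \<in> funs S \<Longrightarrow>
      E i q f = frechet_derivative (rep U \<phi> f) (at (\<phi> q)) (ev i)" by metis
  \<comment> \<open>The intersection with \<open>topspace\<close> matters in dimension 0, where the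
    intersection of the empty family is \<open>UNIV\<close>.\<close>
  define W0 where "W0 = W \<inter> (topspace \<tau> \<inter> (\<Inter>i<dm. W' i))"
  have oW0: "openin \<tau> W0" unfolding W0_def using W(1) W'(1)
    by (intro openin_Int openin_Int_Inter[of "W' ` {..<dm}"]) auto
  have pW0: "p \<in> W0" using W(2) W'(2) pt by (simp add: W0_def)
  have W0: "q \<in> W" "i < dm \<Longrightarrow> q \<in> W' i" if "q \<in> W0" for q i using that by (auto simp: W0_def)
  have dual: "E i q (x j) = (if i = j then 1 else 0)" if q: "q \<in> W0" and ij: "i < dm" "j < dm" for q i j
  proof -
    have qU: "q \<in> U" using W0(1)[OF q] W(3) by auto
    obtain T where T: "open T" "\<phi> ` W = T \<inter> V" by (rule chart_open_image[OF c W(1,3)])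
    let ?R = "{z. prj z \<in> T}"
    have R: "open ?R" by (rule open_prj_vimage[OF T(1)])
    have "\<phi> q \<in> T \<inter> V" using T(2) W0(1)[OF q] by blast
    then have zR: "\<phi> q \<in> ?R" using prj_id by auto
    have "rep U \<phi> (x j) z = z \<bullet> ev j" if "z \<in> ?R" for z
    proof -
      have "prj z \<in> \<phi> ` W" using that T(2) prj_V by blast
      then obtain y where y: "y \<in> W" "prj z = \<phi> y" by auto
      then have "inv_into U \<phi> (prj z) = y" using W(3) inv_into_f_f[OF chart_inj[OF c]] by auto
      then show ?thesis using xq ij(2) y prj_inner[OF ij(2), of z] by (simp add: rep_def)
    qed
    then have "frechet_derivative (rep U \<phi> (x j)) (at (\<phi> q)) = frechet_derivative (\<lambda>z. z \<bullet> ev j) (at (\<phi> q))"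
      by (rule frechet_derivative_transform[OF R zR])
    also have "\<dots> = (\<lambda>z. z \<bullet> ev j)"
      by (rule frechet_derivative_at[symmetric, OF bounded_linear_imp_has_derivative[OF bounded_linear_inner_left]])
    finally show ?thesis using Ef[OF ij(1) W0(2)[OF q ij(1)], of "x j"] x ij ev_inner by simp
  qed
  have expand: "v = (\<lambda>f. \<Sum>i<dm. v (x i) * E i q f)" if q: "q \<in> W0" and v: "v \<in> tangent S q" for q v
  proof
    fix f
    have qU: "q \<in> U" using W0(1)[OF q] W(3) by auto
    then have q': "q \<in> points S" using chart_sub[OF c] by auto
    show "v f = (\<Sum>i<dm. v (x i) * E i q f)"
    proof (cases "f \<in> funs S")
      case True
      have lin: "linear (frechet_derivative (rep U \<phi> f) (at (\<phi> q)))"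
        by (rule has_derivative_linear[OF frechet_rep[OF c True chart_cdom(1)[OF c qU]]])
      have "v f = frechet_derivative (rep U \<phi> f) (at (\<phi> q)) (\<Sum>i<dm. v (x i) *\<^sub>R ev i)"
        using fm W0(1)[OF q] v True by blast
      also have "\<dots> = (\<Sum>i<dm. v (x i) * frechet_derivative (rep U \<phi> f) (at (\<phi> q)) (ev i))"
        by (simp add: linear_sum[OF lin] linear_cmul[OF lin])
      also have "\<dots> = (\<Sum>i<dm. v (x i) * E i q f)"
        using Ef W0(2)[OF q] True by simp
      finally show ?thesis .
    next
      case False
      then show ?thesis
        using tangent_notin[OF v] tangent_notin[OF vector_field_tangent[OF E q']] by simp
    qed
  qed
  show ?thesis
  proof (rule that[OF oW0 pW0])
    show "W0 \<subseteq> U" using W0(1) W(3) by auto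
    show "\<forall>i<dm. x i \<in> funs S" by (rule x)
    show "\<forall>i<dm. vector_field S (E i)" using E by simp
    show "\<forall>i<dm. \<forall>q\<in>W0. x i q = \<phi> q \<bullet> ev i" using xq W0(1) by simp
    show "\<forall>i<dm. \<forall>q\<in>W0. \<forall>f\<in>funs S. E i q f = frechet_derivative (rep U \<phi> f) (at (\<phi> q)) (ev i)"
      using Ef W0(2) by simp
    show "\<forall>q\<in>W0. \<forall>i<dm. \<forall>j<dm. E i q (x j) = (if i = j then 1 else 0)" using dual by simp
    show "\<forall>q\<in>W0. \<forall>v\<in>tangent S q. v = (\<lambda>f. \<Sum>i<dm. v (x i) * E i q f)" using expand by blast
  qed
qed

text \<open>Scaling the fields down makes their integral curves live on the fixed interval \<open>(-2, 2)\<close>,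
  uniformly in the coefficients \<open>w\<close>.\<close>

lemma integral_curves:
  fixes X :: "nat \<Rightarrow> 'a vfield"
  assumes X': "\<forall>j<n. vector_field S (X j)" and p: "p \<in> topspace \<tau>" and U0: "openin \<tau> U0" "p \<in> U0"
  shows "\<exists>\<delta>>0. \<forall>w. (\<forall>j<n. \<bar>w j\<bar> < \<delta>) \<longrightarrow> (\<exists>\<gamma>. \<gamma> 0 = p \<and> (\<forall>t\<in>{-2<..<2}. \<gamma> t \<in> U0) \<and>
    (\<forall>f\<in>funs S. Cinf_on {-2<..<2::real} (f \<circ> \<gamma>)) \<and>
    (\<forall>f\<in>funs S. \<forall>t\<in>{-2<..<2}. ((f \<circ> \<gamma>) has_real_derivative (\<Sum>j<n. w j * X j (\<gamma> t) f)) (at t)))"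
proof -
  note X = X'[rule_format]
  obtain U \<phi> where c: "(U, \<phi>) \<in> atlas M" "p \<in> U" by (rule chart_exists[OF p])
  note c1 = c(1)
  obtain x W where W: "openin \<tau> W" "p \<in> W" "W \<subseteq> U" and x: "\<forall>i<dm. x i \<in> funs S"
    and "\<forall>i<dm. \<forall>q\<in>W. x i q = \<phi> q \<bullet> ev i"
    and fm: "\<forall>q\<in>W. \<forall>v\<in>tangent S q. \<forall>f\<in>funs S.
      v f = frechet_derivative (rep U \<phi> f) (at (\<phi> q)) (\<Sum>i<dm. v (x i) *\<^sub>R ev i)"
    by (rule chart_coordinates[OF c])
  have WU0: "W \<inter> U0 \<subseteq> U" using W(3) by auto
  obtain T where T: "open T" "\<phi> ` (W \<inter> U0) = T \<inter> V"
    by (rule chart_open_image[OF c1 openin_Int[OF W(1) U0(1)] WU0])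
  let ?R = "cdom U \<phi> \<inter> {z. prj z \<in> T}"
  have R: "open ?R" by (rule open_Int[OF open_cdom[OF c1] open_prj_vimage[OF T(1)]])
  have "\<phi> p \<in> T \<inter> V" using T(2) W(2) U0(2) by blast
  then have "\<phi> p \<in> ?R" using prj_id chart_cdom[OF c] by auto
  then obtain r where r: "r > 0" "cball (\<phi> p) r \<subseteq> ?R" using R open_contains_cball by metis
  define pt where "pt = (\<lambda>z. inv_into U \<phi> (prj z))"
  have pt: "pt z \<in> W \<inter> U0" "\<phi> (pt z) = prj z" "pt z \<in> U" if "z \<in> ?R" for z
  proof -
    have "prj z \<in> \<phi> ` (W \<inter> U0)" using that T(2) prj_V by blast
    then obtain y where y: "y \<in> W \<inter> U0" "prj z = \<phi> y" by auto
    then have "pt z = y" unfolding pt_def using WU0 inv_into_f_f[OF chart_inj[OF c1]] by auto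
    then show "pt z \<in> W \<inter> U0" "\<phi> (pt z) = prj z" "pt z \<in> U" using y WU0 by auto
  qed
  \<comment> \<open>The coordinate expression of \<open>X j\<close>: its components are the values
    of the field on the coordinate functions.\<close>
  define g where "g = (\<lambda>j z. \<Sum>i<dm. rep U \<phi> (\<lambda>q. X j q (x i)) z *\<^sub>R ev i)"
  have g: "Cinf_on (cdom U \<phi>) (g j)" if "j < n" for j unfolding g_def
    by (intro Cinf_on_sum Cinf_on_scaleR Cinf_on_const open_cdom[OF c1] rep_smooth[OF c1])
      (use x vector_field_funs[OF X[OF that]] in auto)
  have "\<exists>L B. 0 \<le> L \<and> 0 \<le> B \<and> (\<forall>x\<in>cball (\<phi> p) r. norm (g j x) \<le> B) \<and>
    (\<forall>x\<in>cball (\<phi> p) r. \<forall>y\<in>cball (\<phi> p) r. norm (g j x - g j y) \<le> L * norm (x - y))" if j: "j < n" for j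
    by (rule Cinf_on_lipschitz_bound[OF open_cdom[OF c1] _ g[OF j], of "\<phi> p" r])
      (use r(2) in blast, intro exI conjI)
  then obtain L B where LB: "\<And>j. j < n \<Longrightarrow> 0 \<le> L j" "\<And>j. j < n \<Longrightarrow> 0 \<le> B j"
    "\<And>j x. j < n \<Longrightarrow> x \<in> cball (\<phi> p) r \<Longrightarrow> norm (g j x) \<le> B j"
    "\<And>j x y. j < n \<Longrightarrow> x \<in> cball (\<phi> p) r \<Longrightarrow> y \<in> cball (\<phi> p) r \<Longrightarrow>
      norm (g j x - g j y) \<le> L j * norm (x - y)" by metis
  define L0 where "L0 = (\<Sum>j<n. L j) + 1"
  define B0 where "B0 = (\<Sum>j<n. B j) + 1"
  have LB0: "L0 > 0" "B0 > 0" using LB(1,2)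
    by (auto simp: L0_def B0_def intro!: add_nonneg_pos sum_nonneg)
  \<comment> \<open>Solutions are wanted up to time 2. The first bound makes the contraction
    constant \<open>2 * (\<delta> * L0) * 2\<close> at most 1/2; the second makes speed times time,
    \<open>(\<delta> * B0) * 2\<close>, at most the radius \<open>r\<close>. The summand 1 in
    \<open>L0\<close> and \<open>B0\<close> only ensures that they are positive.\<close>
  define \<delta> where "\<delta> = min (1 / (8 * L0)) (r / (2 * B0))"
  have \<delta>: "\<delta> > 0" using LB0 r(1) by (simp add: \<delta>_def)
  have \<delta>L: "2 * (\<delta> * L0) * 2 < 1"
  proof -
    have "\<delta> * L0 \<le> 1 / (8 * L0) * L0" using LB0 by (intro mult_right_mono) (auto simp: \<delta>_def)
    then show ?thesis using LB0 by simp
  qed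
  have \<delta>B: "(\<delta> * B0) * 2 \<le> r"
  proof -
    have "\<delta> * B0 \<le> r / (2 * B0) * B0" using LB0 by (intro mult_right_mono) (auto simp: \<delta>_def)
    then show ?thesis using LB0 by simp
  qed
  have "\<exists>\<gamma>. \<gamma> 0 = p \<and> (\<forall>t\<in>{-2<..<2}. \<gamma> t \<in> U0) \<and>
    (\<forall>f\<in>funs S. Cinf_on {-2<..<2::real} (f \<circ> \<gamma>)) \<and>
    (\<forall>f\<in>funs S. \<forall>t\<in>{-2<..<2}. ((f \<circ> \<gamma>) has_real_derivative (\<Sum>j<n. w j * X j (\<gamma> t) f)) (at t))"
    if w: "\<forall>j<n. \<bar>w j\<bar> < \<delta>" for w
  proof -
    define h where "h = (\<lambda>z. \<Sum>j<n. w j *\<^sub>R g j z)"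
    have h: "Cinf_on (cdom U \<phi>) h" unfolding h_def
      by (intro Cinf_on_sum Cinf_on_scaleR Cinf_on_const open_cdom[OF c1]) (use g in auto)
    have hl: "norm (h x - h y) \<le> \<delta> * L0 * norm (x - y)"
      if xy: "x \<in> cball (\<phi> p) r" "y \<in> cball (\<phi> p) r" for x y
    proof -
      have "h x - h y = (\<Sum>j<n. w j *\<^sub>R (g j x - g j y))"
        by (simp add: h_def sum_subtractf scaleR_diff_right)
      also have "norm \<dots> \<le> (\<Sum>j<n. \<delta> * (L j * norm (x - y)))"
      proof (rule sum_norm_le)
        fix j assume "j \<in> {..<n}"
        then have j: "j < n" by simp
        have "\<bar>w j\<bar> \<le> \<delta>" using w j by (simp add: less_imp_le)
        then show "norm (w j *\<^sub>R (g j x - g j y)) \<le> \<delta> * (L j * norm (x - y))"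
          unfolding norm_scaleR using LB(4)[OF j xy] \<delta> by (intro mult_mono) auto
      qed
      also have "\<dots> = \<delta> * (\<Sum>j<n. L j) * norm (x - y)"
        by (simp add: sum_distrib_left sum_distrib_right mult.assoc)
      also have "\<dots> \<le> \<delta> * L0 * norm (x - y)" using \<delta> by (intro mult_right_mono mult_left_mono) (auto simp: L0_def)
      finally show ?thesis .
    qed
    have hB: "norm (h x) \<le> \<delta> * B0" if xy: "x \<in> cball (\<phi> p) r" for x
    proof -
      have "norm (h x) \<le> (\<Sum>j<n. \<delta> * B j)" unfolding h_def
      proof (rule sum_norm_le)
        fix j assume "j \<in> {..<n}"
        then have j: "j < n" by simp
        have "\<bar>w j\<bar> \<le> \<delta>" using w j by (simp add: less_imp_le)
        then show "norm (w j *\<^sub>R g j x) \<le> \<delta> * B j"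
          unfolding norm_scaleR using LB(3)[OF j xy] \<delta> by (intro mult_mono) auto
      qed
      also have "\<dots> \<le> \<delta> * B0" using \<delta> by (simp add: B0_def sum_distrib_left distrib_left)
      finally show ?thesis .
    qed
    obtain u where u: "u 0 = \<phi> p" "\<forall>t\<in>{-2..2}. u t \<in> cball (\<phi> p) r"
      "\<forall>t\<in>{-2..2}. (u has_vector_derivative h (u t)) (at t within {-2..2})"
      by (rule picard_ball[of 2 "\<delta> * L0" "\<delta> * B0" r "\<phi> p" h])
        (use \<delta>L \<delta>B \<delta> LB0 r(1) hl hB in auto)
    let ?I = "{-2<..<2::real}"
    have ud: "(u has_vector_derivative h (u t)) (at t)" if "t \<in> ?I" for t
    proof -
      have "at t within {-2..2} = at t" using that by (intro at_within_Icc_at) auto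
      moreover have "t \<in> {-2..2}" using that by simp
      ultimately show ?thesis using u(3) by metis
    qed
    have uR: "u t \<in> ?R" if "t \<in> ?I" for t using u(2) that r(2) by (meson greaterThanLessThan_subseteq_atLeastAtMost_iff order_refl subsetD)
    have uc: "u ` ?I \<subseteq> cdom U \<phi>" using uR by auto
    have us: "Cinf_on ?I u"
      by (rule Cinf_on_ode[OF _ open_cdom[OF c1] uc h ud]) simp_all
    let ?\<gamma> = "\<lambda>t. pt (u t)"
    have f\<gamma>: "f \<circ> ?\<gamma> = (\<lambda>t. rep U \<phi> f (u t))" for f
      by (rule ext) (simp add: rep_def pt_def)
    have sm\<gamma>: "Cinf_on ?I (f \<circ> ?\<gamma>)" if "f \<in> funs S" for f
      unfolding f\<gamma> by (rule Cinf_on_compose[OF _ open_cdom[OF c1] uc us rep_smooth[OF c1 that]]) simp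
    have d\<gamma>: "((f \<circ> ?\<gamma>) has_real_derivative (\<Sum>j<n. w j * X j (?\<gamma> t) f)) (at t)"
      if f: "f \<in> funs S" and t: "t \<in> ?I" for f t
    proof -
      have z: "u t \<in> cdom U \<phi>" using uR[OF t] by simp
      note q = pt[OF uR[OF t]]
      then have q': "?\<gamma> t \<in> points S" using chart_sub[OF c1] by auto
      let ?df = "frechet_derivative (rep U \<phi> f) (at (prj (u t)))"
      have lin: "linear ?df"
        using frechet_rep[OF c1 f chart_cdom(1)[OF c1 q(3)]] q(2) has_derivative_linear by metis
      have "((\<lambda>t. rep U \<phi> f (u t)) has_derivative
          (\<lambda>s. frechet_derivative (rep U \<phi> f) (at (u t)) (s *\<^sub>R h (u t)))) (at t)"
        by (rule has_derivative_compose[OF ud[OF t, unfolded has_vector_derivative_def] frechet_rep[OF c1 f z]])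
      moreover have "linear (frechet_derivative (rep U \<phi> f) (at (u t)))"
        by (rule has_derivative_linear[OF frechet_rep[OF c1 f z]])
      ultimately have 1: "((f \<circ> ?\<gamma>) has_real_derivative frechet_derivative (rep U \<phi> f) (at (u t)) (h (u t))) (at t)"
        unfolding f\<gamma> has_real_derivative_iff_has_vector_derivative has_vector_derivative_def
        by (simp add: linear_cmul)
      have gj: "g j (u t) = (\<Sum>i<dm. X j (?\<gamma> t) (x i) *\<^sub>R ev i)" for j
        by (simp add: g_def rep_def pt_def)
      \<comment> \<open>There is no need to show that \<open>u\<close> stays in the model: as the
        velocity lies in it, the derivative of \<open>rep\<close> may be moved from
        \<open>u t\<close> to its projection, which is the chart image of the point on the
        curve.\<close>
      have hV: "h (u t) \<in> V" unfolding h_def gj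
        by (intro subspace_sum[OF subspace_V] subspace_scale[OF subspace_V]) (simp add: ev_V)
      have "frechet_derivative (rep U \<phi> f) (at (u t)) (h (u t)) = ?df (h (u t))"
        unfolding frechet_rep_prj[OF c1 f z] prj_id[OF hV] ..
      also have "\<dots> = (\<Sum>j<n. w j * ?df (g j (u t)))"
        unfolding h_def by (simp add: linear_sum[OF lin] linear_cmul[OF lin])
      also have "\<dots> = (\<Sum>j<n. w j * X j (?\<gamma> t) f)"
      proof (rule sum.cong[OF refl])
        fix j assume "j \<in> {..<n}"
        then have "X j (?\<gamma> t) \<in> tangent S (?\<gamma> t)" using vector_field_tangent[OF X _, of j] q' by auto
        then have "X j (?\<gamma> t) f = ?df (g j (u t))" using fm q f unfolding gj by auto
        then show "w j * ?df (g j (u t)) = w j * X j (?\<gamma> t) f" by simp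
      qed
      finally show ?thesis using 1 by simp
    qed
    have "?\<gamma> 0 = p" using u(1) chart_cdom(2)[OF c] inv_into_f_f[OF chart_inj[OF c1] c(2)] by (simp add: pt_def)
    then show ?thesis using pt(1) uR sm\<gamma> d\<gamma> by (intro exI[of _ ?\<gamma>] conjI ballI) auto
  qed
  then show ?thesis using \<delta> by (intro exI[of _ \<delta>]) simp
qed

text \<open>The coefficients are bounded on a compact interval, so the field has one Lipschitz
  constant for all values, and a single \<epsilon> serves every initial time and every initial
  value. This uniformity lets a vector prescribed at any time of a curve be carried to time 0. The
  bound \<open>1 / (4 * L)\<close> on \<open>T\<close> makes the contraction constant at most
  1/2.\<close>

lemma linear_ode:
  fixes A :: "nat \<Rightarrow> nat \<Rightarrow> real \<Rightarrow> real"
  assumes \<epsilon>0: "\<epsilon>0 > 0" and A: "\<And>i j. i < dm \<Longrightarrow> j < dm \<Longrightarrow> Cinf_on {-\<epsilon>0<..<\<epsilon>0} (A i j)"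
  shows "\<exists>\<epsilon>>0. \<epsilon> < \<epsilon>0 \<and> (\<forall>s\<in>{-\<epsilon><..<\<epsilon>}. \<forall>w. \<exists>a. (\<forall>i<dm. a i s = w i) \<and>
    (\<forall>i<dm. Cinf_on {-\<epsilon><..<\<epsilon>} (a i)) \<and>
    (\<forall>i<dm. \<forall>t\<in>{-\<epsilon><..<\<epsilon>}. (a i has_real_derivative (\<Sum>j<dm. A i j t * a j t)) (at t)))"
proof -
  define \<epsilon>1 where "\<epsilon>1 = \<epsilon>0 / 2"
  have e1: "0 < \<epsilon>1" "{-\<epsilon>1..\<epsilon>1} \<subseteq> {-\<epsilon>0<..<\<epsilon>0}" using \<epsilon>0 by (auto simp: \<epsilon>1_def)
  have "\<exists>B\<ge>0. \<forall>t\<in>{-\<epsilon>1..\<epsilon>1}. \<bar>A i j t\<bar> \<le> B" if "i < dm" "j < dm" for i j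
  proof -
    have "compact (A i j ` {-\<epsilon>1..\<epsilon>1})"
      by (intro compact_continuous_image continuous_on_subset[OF Cinf_on_continuous[OF A[OF that]] e1(2)]) simp
    from bounded_pos[THEN iffD1, OF compact_imp_bounded[OF this]]
    obtain B where "0 < B" "\<forall>y\<in>A i j ` {-\<epsilon>1..\<epsilon>1}. norm y \<le> B" by auto
    then show ?thesis by (intro exI[of _ B]) auto
  qed
  then obtain B where B: "\<And>i j. i < dm \<Longrightarrow> j < dm \<Longrightarrow> 0 \<le> B i j"
    "\<And>i j t. i < dm \<Longrightarrow> j < dm \<Longrightarrow> t \<in> {-\<epsilon>1..\<epsilon>1} \<Longrightarrow> \<bar>A i j t\<bar> \<le> B i j" by metis
  define L where "L = (\<Sum>i<dm. \<Sum>j<dm. B i j) + 1"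
  have L: "0 < L" using B(1) by (auto simp: L_def intro!: add_nonneg_pos sum_nonneg)
  define T where "T = min \<epsilon>1 (1 / (4 * L))"
  have T: "0 < T" "T \<le> \<epsilon>1" using e1 L by (auto simp: T_def)
  have "T * L \<le> 1 / (4 * L) * L" using L by (intro mult_right_mono) (auto simp: T_def)
  then have TL: "2 * L * T < 1" using L by (simp add: algebra_simps)
  \<comment> \<open>The system of \<open>dm\<close> scalar equations becomes a field on the ambient
    Euclidean space by means of the frame \<open>ev\<close>, so that the solution theorem for
    vectors applies.\<close>
  define g where "g = (\<lambda>t x. \<Sum>i<dm. (\<Sum>j<dm. A i j t * (x \<bullet> ev j)) *\<^sub>R ev i)"
  have AT: "continuous_on {-T..T} (A i j)" if "i < dm" "j < dm" for i j
    by (rule continuous_on_subset[OF Cinf_on_continuous[OF A[OF that]]]) (use e1(2) T in auto)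
  have cont: "continuous_on ({-T..T} \<times> UNIV) (\<lambda>p. g (fst p) (snd p))"
    unfolding g_def
    by (intro continuous_on_sum continuous_on_scaleR continuous_on_mult continuous_on_inner
        continuous_on_snd continuous_on_const continuous_on_id continuous_on_compose2[OF AT continuous_on_fst[OF continuous_on_id]])
      auto
  have ev1: "norm (ev i) = 1" if "i < dm" for i using ev_inner[OF that that] by (simp add: norm_eq_1)
  have lip: "norm (g t x - g t y) \<le> L * norm (x - y)" if t: "t \<in> {-T..T}" for t x y
  proof -
    have t1: "t \<in> {-\<epsilon>1..\<epsilon>1}" using t T by auto
    have "g t x - g t y = (\<Sum>i<dm. (\<Sum>j<dm. A i j t * ((x - y) \<bullet> ev j)) *\<^sub>R ev i)"
      by (simp add: g_def sum_subtractf inner_diff_left right_diff_distrib scaleR_diff_left)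
    also have "norm \<dots> \<le> (\<Sum>i<dm. \<Sum>j<dm. B i j * norm (x - y))"
    proof (rule sum_norm_le)
      fix i assume "i \<in> {..<dm}"
      then have i: "i < dm" by simp
      have "\<bar>\<Sum>j<dm. A i j t * ((x - y) \<bullet> ev j)\<bar> \<le> (\<Sum>j<dm. B i j * norm (x - y))"
      proof (rule order_trans[OF sum_abs sum_mono])
        fix j assume "j \<in> {..<dm}"
        then have j: "j < dm" by simp
        have "\<bar>(x - y) \<bullet> ev j\<bar> \<le> norm (x - y)"
          using Cauchy_Schwarz_ineq2[of "x - y" "ev j"] ev1[OF j] by simp
        then show "\<bar>A i j t * ((x - y) \<bullet> ev j)\<bar> \<le> B i j * norm (x - y)"
          unfolding abs_mult using B[OF i j] t1 by (intro mult_mono) auto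
      qed
      then show "norm ((\<Sum>j<dm. A i j t * ((x - y) \<bullet> ev j)) *\<^sub>R ev i) \<le> (\<Sum>j<dm. B i j * norm (x - y))"
        using ev1[OF i] by simp
    qed
    also have "\<dots> \<le> L * norm (x - y)" by (simp add: L_def sum_distrib_right distrib_right)
    finally show ?thesis .
  qed
  have "\<exists>a. (\<forall>i<dm. a i s = w i) \<and> (\<forall>i<dm. Cinf_on {-T<..<T} (a i)) \<and>
    (\<forall>i<dm. \<forall>t\<in>{-T<..<T}. (a i has_real_derivative (\<Sum>j<dm. A i j t * a j t)) (at t))"
    if s: "s \<in> {-T<..<T}" for s w
  proof -
    obtain u where u: "u s = (\<Sum>i<dm. w i *\<^sub>R ev i)"
      "\<forall>t\<in>{-T..T}. (u has_vector_derivative g t (u t)) (at t within {-T..T})"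
      by (rule picard[OF T(1) TL less_imp_le[OF L] _ cont lip, of s]) (use s in auto)
    define a where "a = (\<lambda>i t. u t \<bullet> ev i)"
    have pick: "(\<Sum>i<dm. k i *\<^sub>R ev i) \<bullet> ev j = k j" if "j < dm" for k j
    proof -
      have "(\<Sum>i<dm. k i *\<^sub>R ev i) \<bullet> ev j = (\<Sum>i<dm. if i = j then k i else 0)"
        unfolding inner_sum_left by (rule sum.cong) (use that ev_inner in auto)
      then show ?thesis using that by simp
    qed
    have d: "(a i has_real_derivative (\<Sum>j<dm. A i j t * a j t)) (at t)" if i: "i < dm" and t: "t \<in> {-T<..<T}" for i t
    proof -
      have "(u has_vector_derivative g t (u t)) (at t)"
      proof -
        have "at t within {-T..T} = at t" using t by (intro at_within_Icc_at) auto
        moreover have "t \<in> {-T..T}" using t by simp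
        ultimately show ?thesis using u(2) by metis
      qed
      from bounded_linear.has_vector_derivative[OF bounded_linear_inner_left this, of "ev i"]
      have "((\<lambda>t. u t \<bullet> ev i) has_vector_derivative (g t (u t) \<bullet> ev i)) (at t)" .
      moreover have "g t (u t) \<bullet> ev i = (\<Sum>j<dm. A i j t * a j t)"
        unfolding g_def pick[OF i] a_def ..
      ultimately show ?thesis by (simp add: a_def has_real_derivative_iff_has_vector_derivative)
    qed
    have I: "open {-T<..<T}" by simp
    have "Ck_on k {-T<..<T} (a i)" if "i < dm" for k i
      using that
    proof (induction k arbitrary: i)
      case 0
      have "continuous (at t) (a i)" if "t \<in> {-T<..<T}" for t
        using d[OF 0 that] by (rule DERIV_continuous)
      then show ?case by (simp add: continuous_at_imp_continuous_on)
    next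
      case (Suc k)
      show ?case
      proof (rule Ck_on_SucI[OF I])
        show "(a i has_derivative (\<lambda>v. (\<Sum>j<dm. A i j t * a j t) * v)) (at t)" if "t \<in> {-T<..<T}" for t
          using d[OF Suc.prems that] by (simp add: has_field_derivative_def)
        have "Ck_on k {-T<..<T} (A i j)" if "j < dm" for j
          by (rule Ck_on_subset[OF Cinf_onD[OF A[OF Suc.prems that]]]) (use e1 T in auto)
        then show "Ck_on k {-T<..<T} (\<lambda>t. (\<Sum>j<dm. A i j t * a j t) * v)" for v
          using Suc.IH by (intro Ck_on_mult Ck_on_sum Ck_on_const I) auto
      qed
    qed
    then have "Cinf_on {-T<..<T} (a i)" if "i < dm" for i using that by (intro Cinf_onI)
    moreover have "a i s = w i" if "i < dm" for i using pick[OF that] by (simp add: a_def u(1))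
    ultimately show ?thesis using d by (intro exI[of _ a]) simp
  qed
  then show ?thesis using T e1 \<epsilon>0 by (intro exI[of _ T]) (auto simp: \<epsilon>1_def)
qed

end

section \<open>Curves and frames\<close>

context sspace
begin

lemma velocity_tangent:
  assumes I: "open I" "t \<in> I" and \<gamma>: "\<forall>f\<in>funs S. Cinf_on I (f \<circ> \<gamma>)"
  shows "velocity S \<gamma> t \<in> tangent S (\<gamma> t)"
proof -
  have d: "((f \<circ> \<gamma>) has_real_derivative deriv (f \<circ> \<gamma>) t) (at t)" if "f \<in> funs S" for f
  proof -
    have "(f \<circ> \<gamma>) differentiable (at t)"
      using Cinf_on_has_derivative[OF bspec[OF \<gamma> that] I(2)] by (auto simp: differentiable_def)
    then show ?thesis by (simp add: DERIV_deriv_iff_real_differentiable)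
  qed
  have "deriv ((\<lambda>x. f x + g x) \<circ> \<gamma>) t = deriv (f \<circ> \<gamma>) t + deriv (g \<circ> \<gamma>) t"
    if "f \<in> funs S" "g \<in> funs S" for f g
    using DERIV_imp_deriv[OF DERIV_add[OF d[OF that(1)] d[OF that(2)]]] by (simp add: o_def)
  moreover have "deriv ((\<lambda>x. f x * g x) \<circ> \<gamma>) t = deriv (f \<circ> \<gamma>) t * g (\<gamma> t) + f (\<gamma> t) * deriv (g \<circ> \<gamma>) t"
    if "f \<in> funs S" "g \<in> funs S" for f g
    using DERIV_imp_deriv[OF DERIV_mult[OF d[OF that(1)] d[OF that(2)]]] by (simp add: o_def mult.commute)
  moreover have "deriv ((\<lambda>x. c * f x) \<circ> \<gamma>) t = c * deriv (f \<circ> \<gamma>) t" if "f \<in> funs S" for f c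
    using DERIV_imp_deriv[OF DERIV_cmult[OF d[OF that], of c]] by (simp add: o_def)
  ultimately show ?thesis
    unfolding tangent_def velocity_def by (simp add: funs_add funs_mult funs_const)
qed

text \<open>Continuity of \<gamma> is known only after composition with functions. A bump function
  supported in \<open>U\<close> turns it into continuity for the topology.\<close>

lemma curve_nbhd:
  assumes I: "open I" "t \<in> I" and \<gamma>: "\<forall>f\<in>funs S. continuous_on I (f \<circ> \<gamma>)"
    and U: "openin \<tau> U" "\<gamma> t \<in> U" "\<gamma> t \<in> points S"
  obtains J where "open J" "t \<in> J" "J \<subseteq> I" "\<gamma> ` J \<subseteq> U"
proof -
  obtain \<rho> W K where \<rho>: "\<rho> \<in> funs S" "openin \<tau> W" "\<gamma> t \<in> W" "W \<subseteq> K" "closedin \<tau> K" "K \<subseteq> U"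
    "\<forall>q\<in>W. \<rho> q = 1" "\<forall>q. q \<notin> K \<longrightarrow> \<rho> q = 0"
    using bump[OF U(3,1,2)] by (elim exE conjE)
  let ?J = "I \<inter> (\<rho> \<circ> \<gamma>) -` {x. x \<noteq> 0}"
  have "open ?J" by (rule continuous_open_preimage[OF bspec[OF \<gamma> \<rho>(1)] I(1) open_nonzero])
  moreover have "t \<in> ?J" using I(2) \<rho>(3,7) by simp
  moreover have "\<gamma> ` ?J \<subseteq> U" using \<rho>(6,8) by auto
  ultimately show ?thesis using that[of ?J] by blast
qed

end

context manifold
begin

lemma frame_exists:
  assumes "p \<in> topspace \<tau>"
  obtains x E W where "openin \<tau> W" "p \<in> W" "\<forall>i<dm. x i \<in> funs S" "\<forall>i<dm. vector_field S (E i)"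
    "\<forall>q\<in>W. \<forall>i<dm. \<forall>j<dm. E i q (x j) = (if i = j then 1 else 0)"
    "\<forall>q\<in>W. \<forall>v\<in>tangent S q. v = (\<lambda>f. \<Sum>i<dm. v (x i) * E i q f)"
proof -
  obtain U \<phi> where c: "(U, \<phi>) \<in> atlas M" "p \<in> U" by (rule chart_exists[OF assms])
  show ?thesis
    by (rule chart_frame[OF c]) (rule that)
qed

lemma vector_extend:
  assumes p: "p \<in> topspace \<tau>" and v: "v \<in> tangent S p"
  obtains X where "vector_field S X" "X p = v"
proof -
  obtain x E W where F: "openin \<tau> W" "p \<in> W" "\<forall>i<dm. x i \<in> funs S" "\<forall>i<dm. vector_field S (E i)"
    "\<forall>q\<in>W. \<forall>i<dm. \<forall>j<dm. E i q (x j) = (if i = j then 1 else 0)"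
    "\<forall>q\<in>W. \<forall>v\<in>tangent S q. v = (\<lambda>f. \<Sum>i<dm. v (x i) * E i q f)"
    by (rule frame_exists[OF p])
  have "vector_field S (\<lambda>q h. \<Sum>i<dm. v (x i) * E i q h)"
    by (rule vector_field_sum) (use F(4) funs_const in auto)
  moreover have "(\<lambda>h. \<Sum>i<dm. v (x i) * E i p h) = v"
    using F(6) F(2) v by metis
  ultimately show ?thesis by (rule that)
qed

end

locale manifold_connection = manifold M + connected_sspace "mfd_space M" "mtop M" D
  for M :: "('a, 'e::euclidean_space) mfd" and D
begin

text \<open>Tensoriality in the first slot: locality allows the field to be replaced by its
  expansion in a frame, and linearity over functions then leaves only the values of the components
  at \<open>p\<close>.\<close>

lemma conn_pointwise:
  assumes X: "vector_field S X" "vector_field S X'" and Y: "vector_field S Y"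
    and p: "p \<in> topspace \<tau>" and eq: "X p = X' p"
  shows "D X Y p = D X' Y p"
proof -
  obtain x E W where F: "openin \<tau> W" "p \<in> W" "\<forall>i<dm. x i \<in> funs S" "\<forall>i<dm. vector_field S (E i)"
    "\<forall>q\<in>W. \<forall>i<dm. \<forall>j<dm. E i q (x j) = (if i = j then 1 else 0)"
    "\<forall>q\<in>W. \<forall>v\<in>tangent S q. v = (\<lambda>f. \<Sum>i<dm. v (x i) * E i q f)"
    by (rule frame_exists[OF p])
  have p': "p \<in> points S" using p by simp
  have "D Z Y p = (\<lambda>h. \<Sum>i<dm. Z p (x i) * D (E i) Y p h)" if Z: "vector_field S Z" for Z
  proof -
    have xi: "(\<lambda>q. Z q (x i)) \<in> funs S" if "i < dm" for i
      using vector_field_funs[OF Z] F(3) that by blast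
    have Ei: "vector_field S (E i)" if "i < dm" for i using F(4) that by blast
    have "vector_field S (\<lambda>q h. \<Sum>i<dm. Z q (x i) * E i q h)"
      by (rule vector_field_sum) (use xi Ei in auto)
    then have "D Z Y p = D (\<lambda>q h. \<Sum>i<dm. Z q (x i) * E i q h) Y p"
    proof (rule conn_local_left[OF Z _ Y p' F(1,2)])
      fix q assume "q \<in> W" "q \<in> points S"
      then show "Z q = (\<lambda>h. \<Sum>i<dm. Z q (x i) * E i q h)"
        using F(6) vector_field_tangent[OF Z] by blast
    qed
    also have "\<dots> = (\<lambda>h. \<Sum>i<dm. Z p (x i) * D (E i) Y p h)"
      by (rule conn_sum_left[OF Y p' xi Ei])
    finally show ?thesis .
  qed
  then show ?thesis using X eq by simp
qed

lemma conn_at_eq: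
  assumes "vector_field S X" "vector_field S Y" "p \<in> topspace \<tau>" "X p = v"
  shows "conn_at S D p v Y = D X Y p"
proof -
  have "vector_field S (SOME X. vector_field S X \<and> X p = v) \<and> (SOME X. vector_field S X \<and> X p = v) p = v"
    by (rule someI[of "\<lambda>X. vector_field S X \<and> X p = v" X]) (simp add: assms)
  then show ?thesis unfolding conn_at_def
    by (intro conn_pointwise) (use assms in auto)
qed

end

section \<open>Regular level sets\<close>

text \<open>Regularity is expressed by vectors dual to the differentials of the \<open>f i\<close>,
  which is what a non-critical moment map provides and what \<open>dual_frame\<close>
  consumes.\<close>

locale level_set_mfd = manifold M for M :: "('a, 'e::euclidean_space) mfd" +
  fixes C :: "'a set" and f :: "nat \<Rightarrow> 'a \<Rightarrow> real" and r :: nat and cv :: "nat \<Rightarrow> real"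
  assumes C_eq: "C = {y \<in> topspace (mtop M). \<forall>i<r. f i y = cv i}"
    and f_funs: "i < r \<Longrightarrow> f i \<in> funs (mfd_space M)"
    and independent: "x \<in> C \<Longrightarrow> \<exists>v. \<forall>i<r. v i \<in> tangent (mfd_space M) x \<and>
      (\<forall>j<r. v i (f j) = (if i = j then 1 else 0))"
begin

abbreviation "SC \<equiv> subm_space M C"

lemma points_SC [simp]: "points SC = C"
  by (simp add: subm_space_def)

lemma C_subset: "C \<subseteq> topspace \<tau>"
  by (auto simp: C_eq)

lemma funs_SC_D:
  assumes "h \<in> funs SC" "x \<in> C"
  obtains U F where "openin \<tau> U" "x \<in> U" "F \<in> funs S" "\<forall>y\<in>U \<inter> C. F y = h y"
proof -
  have "\<exists>U F. openin \<tau> U \<and> x \<in> U \<and> F \<in> funs S \<and> (\<forall>y\<in>U \<inter> C. F y = h y)"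
    using assms by (simp add: subm_space_def)
  then show ?thesis by (elim exE conjE) (rule that)
qed

lemma funs_SC_I:
  assumes "\<And>x. x \<in> C \<Longrightarrow> \<exists>U F. openin \<tau> U \<and> x \<in> U \<and> F \<in> funs S \<and> (\<forall>y\<in>U \<inter> C. F y = h y)"
  shows "h \<in> funs SC"
  using assms by (simp add: subm_space_def)

lemma funs_restrict: "h \<in> funs S \<Longrightarrow> h \<in> funs SC"
  by (rule funs_SC_I, rule exI[of _ "topspace \<tau>"], rule exI[of _ h]) (use C_subset in auto)

end

sublocale level_set_mfd \<subseteq> C: sspace SC \<tau>
proof
  show "points SC \<subseteq> topspace \<tau>" using C_subset by simp
  show "(\<lambda>_. c) \<in> funs SC" for c by (rule funs_restrict[OF funs_const])
  have op: "(\<lambda>q. k (g q) (h q)) \<in> funs SC" if g: "g \<in> funs SC" and h: "h \<in> funs SC"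
    and k: "\<And>g h. g \<in> funs S \<Longrightarrow> h \<in> funs S \<Longrightarrow> (\<lambda>q. k (g q) (h q)) \<in> funs S" for g h k
  proof (rule funs_SC_I)
    fix x assume x: "x \<in> C"
    obtain U F where U: "openin \<tau> U" "x \<in> U" "F \<in> funs S" "\<forall>y\<in>U \<inter> C. F y = g y"
      by (rule funs_SC_D[OF g x])
    obtain U' F' where U': "openin \<tau> U'" "x \<in> U'" "F' \<in> funs S" "\<forall>y\<in>U' \<inter> C. F' y = h y"
      by (rule funs_SC_D[OF h x])
    show "\<exists>U F. openin \<tau> U \<and> x \<in> U \<and> F \<in> funs S \<and> (\<forall>y\<in>U \<inter> C. F y = k (g y) (h y))"
      using U U' k[OF U(3) U'(3)]
      by (intro exI[of _ "U \<inter> U'"] exI[of _ "\<lambda>q. k (F q) (F' q)"]) (simp add: openin_Int)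
  qed
  show "(\<lambda>q. g q + h q) \<in> funs SC" if "g \<in> funs SC" "h \<in> funs SC" for g h
    by (rule op[OF that funs_add])
  show "(\<lambda>q. g q * h q) \<in> funs SC" if "g \<in> funs SC" "h \<in> funs SC" for g h
    by (rule op[OF that funs_mult])
  show "h \<in> funs SC" if loc: "\<And>p. p \<in> points SC \<Longrightarrow>
      \<exists>U F. openin \<tau> U \<and> p \<in> U \<and> F \<in> funs SC \<and> (\<forall>q\<in>U \<inter> points SC. F q = h q)" for h
  proof (rule funs_SC_I)
    fix x assume x: "x \<in> C"
    then obtain U F where U: "openin \<tau> U" "x \<in> U" "F \<in> funs SC" "\<forall>y\<in>U \<inter> C. F y = h y"
      using loc[of x] unfolding points_SC by metis
    obtain U' F' where U': "openin \<tau> U'" "x \<in> U'" "F' \<in> funs S" "\<forall>y\<in>U' \<inter> C. F' y = F y"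
      by (rule funs_SC_D[OF U(3) x])
    show "\<exists>U F. openin \<tau> U \<and> x \<in> U \<and> F \<in> funs S \<and> (\<forall>y\<in>U \<inter> C. F y = h y)"
      using U U' by (intro exI[of _ "U \<inter> U'"] exI[of _ F']) (simp add: openin_Int)
  qed
  show "\<exists>\<rho> W K. \<rho> \<in> funs SC \<and> openin \<tau> W \<and> p \<in> W \<and> W \<subseteq> K \<and> closedin \<tau> K \<and> K \<subseteq> U \<and>
        (\<forall>q\<in>W. \<rho> q = 1) \<and> (\<forall>q. q \<notin> K \<longrightarrow> \<rho> q = 0)"
    if p: "p \<in> points SC" and U: "openin \<tau> U" "p \<in> U" for p U
  proof -
    have "p \<in> points S" using p C_subset by auto
    from bump[OF this U] obtain \<rho> W K where \<rho>: "\<rho> \<in> funs S" "openin \<tau> W" "p \<in> W" "W \<subseteq> K" "closedin \<tau> K" "K \<subseteq> U"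
      "\<forall>q\<in>W. \<rho> q = 1" "\<forall>q. q \<notin> K \<longrightarrow> \<rho> q = 0"
      by (elim exE conjE)
    show ?thesis by (intro exI conjI) (rule funs_restrict[OF \<rho>(1)] \<rho>)+
  qed
  show "\<exists>g W. g \<in> funs SC \<and> openin \<tau> W \<and> p \<in> W \<and> (\<forall>q\<in>W \<inter> points SC. g q * h q = 1)"
    if h: "h \<in> funs SC" "p \<in> points SC" "h p \<noteq> 0" for h p
  proof -
    have p: "p \<in> C" "p \<in> points S" using h(2) C_subset by auto
    obtain U F where U: "openin \<tau> U" "p \<in> U" "F \<in> funs S" "\<forall>y\<in>U \<inter> C. F y = h y"
      by (rule funs_SC_D[OF h(1) p(1)])
    have "F p \<noteq> 0" using U(2,4) p(1) h(3) by simp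
    then obtain g W where g: "g \<in> funs S" "openin \<tau> W" "p \<in> W" "\<forall>q\<in>W \<inter> points S. g q * F q = 1"
      using recip[OF U(3) p(2)] by metis
    have 1: "\<forall>q\<in>W \<inter> U \<inter> points SC. g q * h q = 1"
    proof
      fix q assume q: "q \<in> W \<inter> U \<inter> points SC"
      then have "g q * F q = 1" using g(4) C_subset by auto
      then show "g q * h q = 1" using U(4) q by simp
    qed
    have 2: "openin \<tau> (W \<inter> U)" "p \<in> W \<inter> U" using g(2,3) U(1,2) by (simp_all add: openin_Int)
    show ?thesis by (intro exI conjI) (rule funs_restrict[OF g(1)] 1 2)+
  qed
qed

context level_set_mfd
begin

lemma incl_apply: "h \<in> funs S \<Longrightarrow> incl M z h = z h"
  by (simp add: pushforward_def o_def)

lemma incl_notin: "h \<notin> funs S \<Longrightarrow> incl M z h = 0"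
  by (simp add: pushforward_def)

lemma incl_tangent: "z \<in> tangent SC x \<Longrightarrow> incl M z \<in> tangent S x"
  unfolding tangent_def[of S] mem_Collect_eq
  by (simp add: incl_apply incl_notin funs_add funs_mult funs_const funs_restrict
      C.tangent_add C.tangent_mult C.tangent_scale)

lemma incl_add: "incl M (\<lambda>h. u h + v h) = (\<lambda>h. incl M u h + incl M v h)"
  and incl_scale: "incl M (\<lambda>h. k * u h) = (\<lambda>h. k * incl M u h)"
  and incl_diff: "incl M (\<lambda>h. u h - v h) = (\<lambda>h. incl M u h - incl M v h)"
  by (rule ext, simp add: pushforward_def)+

lemma incl_local:
  assumes "z \<in> tangent SC x" "x \<in> C" "h \<in> funs SC" "openin \<tau> U" "x \<in> U" "F \<in> funs S" "\<forall>y\<in>U \<inter> C. F y = h y"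
  shows "z h = incl M z F"
  unfolding incl_apply[OF assms(6)]
  by (rule C.tangent_local[OF assms(1) _ assms(3) funs_restrict[OF assms(6)] assms(4,5)]) (use assms in auto)

text \<open>A function on \<open>C\<close> is near \<open>x\<close> the restriction of an ambient
  function, and derivations are local, so the values on ambient functions determine the
  derivation.\<close>

lemma incl_inj:
  assumes "z \<in> tangent SC x" "z' \<in> tangent SC x" "x \<in> C" "incl M z = incl M z'"
  shows "z = z'"
proof
  fix h
  show "z h = z' h"
  proof (cases "h \<in> funs SC")
    case True
    obtain U F where U: "openin \<tau> U" "x \<in> U" "F \<in> funs S" "\<forall>y\<in>U \<inter> C. F y = h y"
      by (rule funs_SC_D[OF True assms(3)])
    show ?thesis using incl_local[OF assms(1,3) True U] incl_local[OF assms(2,3) True U] assms(4) by simp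
  next
    case False
    then show ?thesis using C.tangent_notin[OF assms(1)] C.tangent_notin[OF assms(2)] by simp
  qed
qed

lemma f_C: "q \<in> C \<Longrightarrow> j < r \<Longrightarrow> f j q = cv j"
  using C_eq by blast

lemma incl_f: assumes "z \<in> tangent SC x" "x \<in> C" "j < r" shows "incl M z (f j) = 0"
proof -
  have "z (f j) = z (\<lambda>_. cv j)"
    by (rule C.tangent_cong[OF assms(1) _ funs_restrict[OF f_funs[OF assms(3)]]])
      (use assms(2,3) f_C in simp_all)
  then show ?thesis using C.tangent_const[OF assms(1)] incl_apply[OF f_funs[OF assms(3)]] by simp
qed

text \<open>Subtracting \<open>\<Sum> X(f\<^sub>i) F\<^sub>i\<close>, with \<open>F\<^sub>i\<close> dual to the \<open>f\<^sub>i\<close>, makes \<open>X\<close> tangent to all the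
  level sets of \<open>f\<close> near \<open>x\<close>, so that its integral curves through \<open>C\<close> stay in \<open>C\<close>.\<close>

lemma adjust:
  assumes x: "x \<in> C" and X: "vector_field S X"
  obtains X' W where "vector_field S X'" "openin \<tau> W" "x \<in> W" "\<forall>q\<in>W. \<forall>j<r. X' q (f j) = 0"
    "\<forall>q. (\<forall>j<r. X q (f j) = 0) \<longrightarrow> X' q = X q"
proof -
  have x': "x \<in> points S" using x C_subset by auto
  obtain v where v: "\<forall>i<r. v i \<in> tangent S x \<and> (\<forall>j<r. v i (f j) = (if i = j then 1 else 0))"
    using independent[OF x] ..
  have "\<exists>E. vector_field S E \<and> E x = v i" if "i < r" for i
    by (rule vector_extend[of x "v i"]) (use x' v that in auto)
  then obtain E where E: "\<And>i. i < r \<Longrightarrow> vector_field S (E i)" "\<And>i. i < r \<Longrightarrow> E i x = v i" by metis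
  have "\<exists>F W. (\<forall>i<r. vector_field S (F i)) \<and> openin \<tau> W \<and> x \<in> W \<and>
    (\<forall>q\<in>W \<inter> points S. \<forall>i<r. \<forall>j<r. F i q (f j) = (if i = j then 1 else 0))"
    by (rule dual_frame[OF x' f_funs E(1)]) (use E(2) v in auto)
  then obtain F W where F: "\<forall>i<r. vector_field S (F i)" "openin \<tau> W" "x \<in> W"
    "\<forall>q\<in>W \<inter> points S. \<forall>i<r. \<forall>j<r. F i q (f j) = (if i = j then 1 else 0)"
    by (elim exE conjE)
  define X' where "X' = (\<lambda>q h. X q h - (\<Sum>i<r. X q (f i) * F i q h))"
  have 1: "vector_field S X'" unfolding X'_def
    by (rule vector_field_diff[OF X vector_field_sum])
      (use F(1) vector_field_funs[OF X] f_funs in auto)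
  have 2: "\<forall>q\<in>W. \<forall>j<r. X' q (f j) = 0"
  proof (intro ballI allI impI)
    fix q j assume q: "q \<in> W" and j: "j < r"
    have "q \<in> points S" using q openin_subset[OF F(2)] by auto
    then have "(\<Sum>i<r. X q (f i) * F i q (f j)) = (\<Sum>i<r. if i = j then X q (f i) else 0)"
      by (intro sum.cong) (use F(4) q j in auto)
    then show "X' q (f j) = 0" using j by (simp add: X'_def)
  qed
  have 3: "\<forall>q. (\<forall>j<r. X q (f j) = 0) \<longrightarrow> X' q = X q" by (simp add: X'_def)
  show ?thesis by (rule that[OF 1 F(2,3) 2 3])
qed

text \<open>Integral curves in \<open>M\<close> are confined to \<open>W\<close>, where the fields
  annihilate the \<open>f i\<close>; so each \<open>f i\<close> keeps along the curve the value
  \<open>cv i\<close> it has at \<open>x\<close>.\<close>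

lemma C_curves:
  fixes X :: "nat \<Rightarrow> 'a vfield"
  assumes X: "\<forall>j<n. vector_field S (X j)" and x: "x \<in> C" and U: "openin \<tau> U" "x \<in> U"
    and W: "openin \<tau> W" "x \<in> W" "\<forall>q\<in>W. \<forall>j<n. \<forall>i<r. X j q (f i) = 0"
  shows "\<exists>\<delta>>0. \<forall>w. (\<forall>j<n. \<bar>w j\<bar> < \<delta>) \<longrightarrow> (\<exists>\<gamma>. \<gamma> 0 = x \<and> (\<forall>t\<in>{-2<..<2}. \<gamma> t \<in> U \<inter> C) \<and>
    (\<forall>f\<in>funs S. Cinf_on {-2<..<2::real} (f \<circ> \<gamma>)) \<and>
    (\<forall>f\<in>funs S. \<forall>t\<in>{-2<..<2}. ((f \<circ> \<gamma>) has_real_derivative (\<Sum>j<n. w j * X j (\<gamma> t) f)) (at t)))"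
proof -
  have xt: "x \<in> topspace \<tau>" using x C_subset by auto
  obtain \<delta> where \<delta>: "0 < \<delta>" "\<forall>w. (\<forall>j<n. \<bar>w j\<bar> < \<delta>) \<longrightarrow> (\<exists>\<gamma>. \<gamma> 0 = x \<and> (\<forall>t\<in>{-2<..<2}. \<gamma> t \<in> U \<inter> W) \<and>
    (\<forall>f\<in>funs S. Cinf_on {-2<..<2::real} (f \<circ> \<gamma>)) \<and>
    (\<forall>f\<in>funs S. \<forall>t\<in>{-2<..<2}. ((f \<circ> \<gamma>) has_real_derivative (\<Sum>j<n. w j * X j (\<gamma> t) f)) (at t)))"
    using integral_curves[of n X x, OF X xt openin_Int[OF U(1) W(1)] IntI[OF U(2) W(2)]]
    by (elim exE conjE)
  have "\<exists>\<gamma>. \<gamma> 0 = x \<and> (\<forall>t\<in>{-2<..<2}. \<gamma> t \<in> U \<inter> C) \<and>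
    (\<forall>f\<in>funs S. Cinf_on {-2<..<2::real} (f \<circ> \<gamma>)) \<and>
    (\<forall>f\<in>funs S. \<forall>t\<in>{-2<..<2}. ((f \<circ> \<gamma>) has_real_derivative (\<Sum>j<n. w j * X j (\<gamma> t) f)) (at t))"
    if w: "\<forall>j<n. \<bar>w j\<bar> < \<delta>" for w
  proof -
    obtain \<gamma> where \<gamma>: "\<gamma> 0 = x" "\<forall>t\<in>{-2<..<2}. \<gamma> t \<in> U \<inter> W"
      "\<forall>f\<in>funs S. Cinf_on {-2<..<2::real} (f \<circ> \<gamma>)"
      "\<forall>f\<in>funs S. \<forall>t\<in>{-2<..<2}. ((f \<circ> \<gamma>) has_real_derivative (\<Sum>j<n. w j * X j (\<gamma> t) f)) (at t)"
      using mp[OF spec[OF \<delta>(2), of w] w] by (elim exE conjE)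
    have "\<gamma> t \<in> C" if t: "t \<in> {-2<..<2}" for t
    proof -
      have "f i (\<gamma> t) = cv i" if i: "i < r" for i
      proof -
        have d: "((f i \<circ> \<gamma>) has_real_derivative 0) (at s within {-2<..<2})" if s: "s \<in> {-2<..<2}" for s
        proof -
          have "(\<Sum>j<n. w j * X j (\<gamma> s) (f i)) = 0"
            by (rule sum.neutral) (use \<gamma>(2) s W(3) i in auto)
          then show ?thesis using \<gamma>(4) f_funs[OF i] s has_field_derivative_at_within by metis
        qed
        have "\<exists>c. \<forall>s\<in>{-2<..<2}. (f i \<circ> \<gamma>) s = c"
          by (rule has_field_derivative_zero_constant[OF _ d]) simp_all
        then obtain c where c: "\<forall>s\<in>{-2<..<2::real}. (f i \<circ> \<gamma>) s = c" ..
        have "(f i \<circ> \<gamma>) t = (f i \<circ> \<gamma>) 0" using c t by (metis greaterThanLessThan_iff neg_less_0_iff_less zero_less_numeral)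
        then show ?thesis using x i \<gamma>(1) by (simp add: C_eq)
      qed
      moreover have "\<gamma> t \<in> topspace \<tau>" using \<gamma>(2) t openin_subset[OF U(1)] by auto
      ultimately show ?thesis by (simp add: C_eq)
    qed
    then show ?thesis using \<gamma> by (intro exI[of _ \<gamma>]) simp
  qed
  then show ?thesis using \<delta>(1) by (intro exI[of _ \<delta>]) simp
qed

lemma C_curve_smooth:
  assumes I: "open I" and \<gamma>: "\<forall>f\<in>funs S. Cinf_on I (f \<circ> \<gamma>)" "\<gamma> ` I \<subseteq> C"
  shows "\<forall>h\<in>funs SC. Cinf_on I (h \<circ> \<gamma>)"
    and "t \<in> I \<Longrightarrow> velocity S \<gamma> t = incl M (velocity SC \<gamma> t)"
proof -
  show "\<forall>h\<in>funs SC. Cinf_on I (h \<circ> \<gamma>)"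
  proof
    fix h assume h: "h \<in> funs SC"
    show "Cinf_on I (h \<circ> \<gamma>)"
    proof (rule Cinf_on_local)
      fix t assume t: "t \<in> I"
      then have \<gamma>t: "\<gamma> t \<in> C" "\<gamma> t \<in> points S" using \<gamma>(2) C_subset by auto
      obtain U F where U: "openin \<tau> U" "\<gamma> t \<in> U" "F \<in> funs S" "\<forall>y\<in>U \<inter> C. F y = h y"
        by (rule funs_SC_D[OF h \<gamma>t(1)])
      obtain J where J: "open J" "t \<in> J" "J \<subseteq> I" "\<gamma> ` J \<subseteq> U"
        by (rule curve_nbhd[of I t \<gamma> U, OF I t _ U(1,2) \<gamma>t(2)]) (use \<gamma>(1) Cinf_on_continuous in blast)
      have "Cinf_on J (h \<circ> \<gamma>)"
        by (rule Cinf_on_cong[OF J(1) _ Cinf_on_subset[OF bspec[OF \<gamma>(1) U(3)] J(3)]])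
          (use U(4) J(3,4) \<gamma>(2) in \<open>auto simp: image_subset_iff subset_iff\<close>)
      then show "\<exists>W. open W \<and> t \<in> W \<and> Cinf_on W (h \<circ> \<gamma>)" using J(1,2) by (intro exI[of _ J]) simp
    qed
  qed
  show "velocity S \<gamma> t = incl M (velocity SC \<gamma> t)" if "t \<in> I"
    by (rule ext) (simp add: velocity_def pushforward_def o_def funs_restrict)
qed

text \<open>For the nontrivial inclusion, a vector killed by the \<open>f j\<close> is extended to a
  field that annihilates them near \<open>x\<close>. Its integral curve stays in \<open>C\<close>,
  and the velocity, which also acts on functions defined only on \<open>C\<close>, is a preimage
  under \<open>incl\<close> up to a scalar.\<close>

lemma tangent_C:
  assumes x: "x \<in> C"
  shows "v \<in> incl M ` tangent SC x \<longleftrightarrow> v \<in> tangent S x \<and> (\<forall>j<r. v (f j) = 0)"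
proof
  assume "v \<in> incl M ` tangent SC x"
  then show "v \<in> tangent S x \<and> (\<forall>j<r. v (f j) = 0)" using incl_tangent incl_f x by auto
next
  assume v: "v \<in> tangent S x \<and> (\<forall>j<r. v (f j) = 0)"
  have xt: "x \<in> topspace \<tau>" using x C_subset by auto
  obtain X where X: "vector_field S X" "X x = v" by (rule vector_extend[OF xt]) (use v in auto)
  obtain X' W where X': "vector_field S X'" "openin \<tau> W" "x \<in> W" "\<forall>q\<in>W. \<forall>j<r. X' q (f j) = 0"
    "\<forall>q. (\<forall>j<r. X q (f j) = 0) \<longrightarrow> X' q = X q" by (rule adjust[OF x X(1)])
  have X'x: "X' x = v" using X'(5) X(2) v by simp
  have X1: "\<forall>j<1::nat. vector_field S ((\<lambda>_. X') j)"
    and X0: "\<forall>q\<in>W. \<forall>j<1::nat. \<forall>i<r. (\<lambda>_. X') j q (f i) = 0" using X'(1,4) by simp_all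
  obtain \<delta> where \<delta>: "0 < \<delta>" "\<forall>w. (\<forall>j<1. \<bar>w j\<bar> < \<delta>) \<longrightarrow> (\<exists>\<gamma>. \<gamma> 0 = x \<and> (\<forall>t\<in>{-2<..<2}. \<gamma> t \<in> W \<inter> C) \<and>
    (\<forall>f\<in>funs S. Cinf_on {-2<..<2::real} (f \<circ> \<gamma>)) \<and>
    (\<forall>f\<in>funs S. \<forall>t\<in>{-2<..<2}. ((f \<circ> \<gamma>) has_real_derivative (\<Sum>j<1::nat. w j * X' (\<gamma> t) f)) (at t)))"
    using C_curves[OF X1 x X'(2,3,2,3) X0] by (elim exE conjE)
  \<comment> \<open>The curves exist only for coefficients below \<delta>; the factor
    \<open>\<delta> / 2\<close> is undone at the end by \<open>2 / \<delta>\<close>.\<close>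
  have "\<forall>j<1::nat. \<bar>(\<lambda>_. \<delta> / 2) j\<bar> < \<delta>" using \<delta>(1) by simp
  from mp[OF spec[OF \<delta>(2), of "\<lambda>_. \<delta> / 2"] this]
  obtain \<gamma> where \<gamma>: "\<gamma> 0 = x" "\<forall>t\<in>{-2<..<2}. \<gamma> t \<in> W \<inter> C" "\<forall>f\<in>funs S. Cinf_on {-2<..<2::real} (f \<circ> \<gamma>)"
    "\<forall>f\<in>funs S. \<forall>t\<in>{-2<..<2}. ((f \<circ> \<gamma>) has_real_derivative (\<Sum>j<1::nat. \<delta> / 2 * X' (\<gamma> t) f)) (at t)"
    by (elim exE conjE)
  let ?I = "{-2<..<2::real}"
  have I: "open ?I" "0 \<in> ?I" by simp_all
  have \<gamma>C: "\<gamma> ` ?I \<subseteq> C" using \<gamma>(2) by auto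
  note sm = C_curve_smooth[OF I(1) \<gamma>(3) \<gamma>C]
  have z: "velocity SC \<gamma> 0 \<in> tangent SC x"
    using C.velocity_tangent[OF I sm(1)] \<gamma>(1) by simp
  have "velocity S \<gamma> 0 h = \<delta> / 2 * v h" for h
  proof (cases "h \<in> funs S")
    case True
    have "deriv (h \<circ> \<gamma>) 0 = (\<Sum>j<1::nat. \<delta> / 2 * X' (\<gamma> 0) h)"
      by (rule DERIV_imp_deriv) (use \<gamma>(4) True I(2) in blast)
    then show ?thesis using True by (simp add: velocity_def \<gamma>(1) X'x)
  next
    case False
    then show ?thesis using v tangent_notin[of v x h] by (simp add: velocity_def)
  qed
  then have iv: "incl M (velocity SC \<gamma> 0) h = \<delta> / 2 * v h" for h
    unfolding sm(2)[OF I(2)] .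
  have "v = (\<lambda>h. 2 / \<delta> * incl M (velocity SC \<gamma> 0) h)"
    unfolding iv using \<delta>(1) by simp
  also have "\<dots> = incl M (\<lambda>h. 2 / \<delta> * velocity SC \<gamma> 0 h)" by (rule incl_scale[symmetric])
  finally show "v \<in> incl M ` tangent SC x" using C.tangent_scaled[OF z, of "2 / \<delta>"] by blast
qed

text \<open>The components of \<open>X\<close> in an ambient frame are functions on
  \<open>C\<close>, and each extends locally. The resulting field agrees with \<open>X\<close> on
  \<open>C\<close>, where it annihilates the \<open>f j\<close>; so \<open>adjust\<close>, which
  secures this off \<open>C\<close> as well, leaves it unchanged on \<open>C\<close>.\<close>

lemma extend_from_C:
  assumes x: "x \<in> C" and X: "vector_field SC X"
  obtains X' W where "vector_field S X'" "openin \<tau> W" "x \<in> W" "\<forall>q\<in>W \<inter> C. X' q = incl M (X q)"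
    "\<forall>q\<in>W. \<forall>j<r. X' q (f j) = 0"
proof -
  have xt: "x \<in> topspace \<tau>" using x C_subset by auto
  obtain y E W where F: "openin \<tau> W" "x \<in> W" "\<forall>i<dm. y i \<in> funs S" "\<forall>i<dm. vector_field S (E i)"
    "\<forall>q\<in>W. \<forall>i<dm. \<forall>j<dm. E i q (y j) = (if i = j then 1 else 0)"
    "\<forall>q\<in>W. \<forall>v\<in>tangent S q. v = (\<lambda>f. \<Sum>i<dm. v (y i) * E i q f)"
    by (rule frame_exists[OF xt])
  have Xy: "(\<lambda>q. X q (y i)) \<in> funs SC" if "i < dm" for i
    by (rule C.vector_field_funs[OF X funs_restrict]) (use F(3) that in blast)
  have "\<exists>U A. openin \<tau> U \<and> x \<in> U \<and> A \<in> funs S \<and> (\<forall>q\<in>U \<inter> C. A q = X q (y i))" if "i < dm" for i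
    by (rule funs_SC_D[OF Xy[OF that] x]) (intro exI conjI)
  then obtain U A where UA: "\<And>i. i < dm \<Longrightarrow> openin \<tau> (U i)" "\<And>i. i < dm \<Longrightarrow> x \<in> U i"
    "\<And>i. i < dm \<Longrightarrow> A i \<in> funs S" "\<And>i q. i < dm \<Longrightarrow> q \<in> U i \<Longrightarrow> q \<in> C \<Longrightarrow> A i q = X q (y i)"
    by (metis IntI)
  define W1 where "W1 = W \<inter> (topspace \<tau> \<inter> (\<Inter>i<dm. U i))"
  have oW1: "openin \<tau> W1" unfolding W1_def using F(1) UA(1)
    by (intro openin_Int openin_Int_Inter[of "U ` {..<dm}"]) auto
  have xW1: "x \<in> W1" using F(2) UA(2) xt by (simp add: W1_def)
  define X0 where "X0 = (\<lambda>q h. \<Sum>i<dm. A i q * E i q h)"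
  have X0: "vector_field S X0" unfolding X0_def
    by (rule vector_field_sum) (use F(4) UA(3) in auto)
  have eq: "X0 q = incl M (X q)" if q: "q \<in> W1" "q \<in> C" for q
  proof -
    have Xq: "X q \<in> tangent SC q" using C.vector_field_tangent[OF X] q(2) by simp
    have qW: "q \<in> W" using q(1) by (simp add: W1_def)
    have A: "A i q = incl M (X q) (y i)" if "i < dm" for i
      using UA(4)[OF that _ q(2)] q(1) that F(3) incl_apply by (simp add: W1_def)
    have "incl M (X q) = (\<lambda>h. \<Sum>i<dm. incl M (X q) (y i) * E i q h)"
      using F(6) qW incl_tangent[OF Xq] by blast
    also have "\<dots> = X0 q" unfolding X0_def by (rule ext, rule sum.cong) (simp_all add: A)
    finally show ?thesis ..
  qed
  obtain X' W2 where X': "vector_field S X'" "openin \<tau> W2" "x \<in> W2" "\<forall>q\<in>W2. \<forall>j<r. X' q (f j) = 0"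
    "\<forall>q. (\<forall>j<r. X0 q (f j) = 0) \<longrightarrow> X' q = X0 q" by (rule adjust[OF x X0])
  show ?thesis
  proof (rule that[OF X'(1)])
    show "openin \<tau> (W1 \<inter> W2)" by (rule openin_Int[OF oW1 X'(2)])
    show "x \<in> W1 \<inter> W2" using xW1 X'(3) by simp
    show "\<forall>q\<in>W1 \<inter> W2. \<forall>j<r. X' q (f j) = 0" using X'(4) by simp
    show "\<forall>q\<in>W1 \<inter> W2 \<inter> C. X' q = incl M (X q)"
    proof
      fix q assume q: "q \<in> W1 \<inter> W2 \<inter> C"
      have "X q \<in> tangent SC q" using C.vector_field_tangent[OF X] q by simp
      then have "\<forall>j<r. X0 q (f j) = 0" using eq incl_f q by simp
      then show "X' q = incl M (X q)" using X'(5) eq q by simp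
    qed
  qed
qed

text \<open>At points of \<open>C\<close> near \<open>x\<close> the values of \<open>Y\<close> have
  preimages under \<open>incl\<close> by \<open>tangent_C\<close>. Smoothness of the restriction is
  tested on a function \<open>h\<close> through a local ambient extension \<open>F\<close>: its
  derivative is the restriction of \<open>Y y F\<close>.\<close>

lemma restrict_to_C:
  assumes x: "x \<in> C" and Y: "vector_field S Y" and W: "openin \<tau> W" "x \<in> W"
    "\<forall>q\<in>W \<inter> C. \<forall>j<r. Y q (f j) = 0"
  obtains Z where "vector_field SC Z" "incl M (Z x) = Y x"
proof -
  define R where "R = (\<lambda>q. SOME z. z \<in> tangent SC q \<and> incl M z = Y q)"
  have R: "R q \<in> tangent SC q" "incl M (R q) = Y q" if q: "q \<in> W" "q \<in> C" for q
  proof -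
    have "Y q \<in> tangent S q" using vector_field_tangent[OF Y] q(2) C_subset by auto
    then have "Y q \<in> incl M ` tangent SC q" using tangent_C[OF q(2)] W(3) q by blast
    then have "\<exists>z. z \<in> tangent SC q \<and> incl M z = Y q" by auto
    from someI_ex[OF this] show "R q \<in> tangent SC q" "incl M (R q) = Y q" by (simp_all add: R_def)
  qed
  obtain Z W' where Z: "vector_field SC Z" "openin \<tau> W'" "x \<in> W'" "W' \<subseteq> W" "\<forall>q\<in>W'. Z q = R q"
  proof (rule C.vector_field_extend[of x W R])
    show "x \<in> points SC" "openin \<tau> W" "x \<in> W" using x W by simp_all
    show "R q \<in> tangent SC q" if "q \<in> W" "q \<in> points SC" for q using R that by simp
    show "\<exists>W F. openin \<tau> W \<and> q \<in> W \<and> F \<in> funs SC \<and> (\<forall>y\<in>W \<inter> points SC. F y = R y h)"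
      if h: "h \<in> funs SC" and q: "q \<in> W" "q \<in> points SC" for h q
    proof -
      have qC: "q \<in> C" using q(2) by simp
      obtain U F where U: "openin \<tau> U" "q \<in> U" "F \<in> funs S" "\<forall>y\<in>U \<inter> C. F y = h y"
        by (rule funs_SC_D[OF h qC])
      have "Y y F = R y h" if y: "y \<in> W \<inter> U" "y \<in> C" for y
        using incl_local[OF R(1) y(2) h U(1) _ U(3,4)] R(2) y by simp
      then show ?thesis
        by (intro exI[of _ "W \<inter> U"] exI[of _ "\<lambda>y. Y y F"] conjI)
          (use W(1) U q funs_restrict[OF vector_field_funs[OF Y U(3)]] in \<open>auto intro: openin_Int\<close>)
    qed
  qed
  have "incl M (Z x) = Y x" using Z(3,4,5) R(2) x by auto
  then show ?thesis using Z(1) that by blast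
qed

lemma C_vector_extend:
  assumes x: "x \<in> C" and z: "z \<in> tangent SC x"
  obtains Z where "vector_field SC Z" "Z x = z"
proof -
  have xt: "x \<in> topspace \<tau>" using x C_subset by auto
  obtain X where X: "vector_field S X" "X x = incl M z" by (rule vector_extend[OF xt incl_tangent[OF z]])
  obtain X' W where X': "vector_field S X'" "openin \<tau> W" "x \<in> W" "\<forall>q\<in>W. \<forall>j<r. X' q (f j) = 0"
    "\<forall>q. (\<forall>j<r. X q (f j) = 0) \<longrightarrow> X' q = X q" by (rule adjust[OF x X(1)])
  have X'x: "X' x = incl M z" using X'(5) X(2) incl_f[OF z x] by simp
  obtain Z where Z: "vector_field SC Z" "incl M (Z x) = X' x"
    by (rule restrict_to_C[OF x X'(1-3)]) (use X'(4) in auto)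
  have "Z x = z"
    by (rule incl_inj[OF _ z x]) (use Z X'x C.vector_field_tangent[OF Z(1)] x in auto)
  then show ?thesis using Z(1) that by blast
qed

end

section \<open>Self-parallel level sets\<close>

locale level_set_connection = level_set_mfd M C f r cv + manifold_connection M D
  for M :: "('a, 'e::euclidean_space) mfd" and C f r cv and D :: "'a conn" +
  assumes self_par: "self_parallel M D C"
begin

lemma self_parallelD:
  assumes "smooth_curve S I \<gamma>" "\<gamma> ` I \<subseteq> C" "parallel_along S D I \<gamma> Y" "s \<in> I" "t \<in> I"
    "Y s \<in> incl M ` tangent SC (\<gamma> s)"
  shows "Y t \<in> incl M ` tangent SC (\<gamma> t)"
proof -
  have "\<forall>s\<in>I. \<forall>t\<in>I. Y s \<in> incl M ` tangent SC (\<gamma> s) \<longrightarrow> Y t \<in> incl M ` tangent SC (\<gamma> t)"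
    using self_par assms(1-3) unfolding self_parallel_def by blast
  then show ?thesis using assms(4-6) by blast
qed

text \<open>Dual parallel transport: a parallel vector field \<open>a\<close> along \<open>\<gamma>\<close> has constant pairing with the
  covector \<open>l\<close> that solves the adjoint equation with \<open>l 0 = df\<^sub>j\<close>. Since parallel transport preserves
  \<open>TC\<close>, the covector \<open>l s\<close> annihilates \<open>TC\<close> at \<open>\<gamma> s\<close>, hence \<open>Y\<close>; differentiating \<open>l(Y) = 0\<close>
  at 0 gives \<open>df\<^sub>j(\<nabla>Y) = 0\<close>.\<close>

lemma conn_tangent:
  assumes X: "vector_field S X" and Y: "vector_field S Y" and x: "x \<in> C"
    and Xx: "X x \<in> incl M ` tangent SC x"
    and U: "openin \<tau> U" "x \<in> U" and YU: "\<forall>q\<in>U \<inter> C. Y q \<in> incl M ` tangent SC q"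
  shows "D X Y x \<in> incl M ` tangent SC x"
proof -
  have xt: "x \<in> topspace \<tau>" using x C_subset by auto
  have xp: "x \<in> points S" using xt by simp
  have Xf: "\<forall>j<r. X x (f j) = 0" using Xx tangent_C[OF x] by simp
  \<comment> \<open>Only the value at \<open>x\<close> of the first argument matters, so
    \<open>X\<close> may be exchanged for a field whose integral curves stay in
    \<open>C\<close>.\<close>
  obtain X0 W0 where X0: "vector_field S X0" and W0: "openin \<tau> W0" "x \<in> W0" "\<forall>q\<in>W0. \<forall>j<r. X0 q (f j) = 0"
    and X0X: "\<forall>q. (\<forall>j<r. X q (f j) = 0) \<longrightarrow> X0 q = X q" by (rule adjust[OF x X])
  have X0x: "X0 x = X x" using X0X Xf by blast
  have DX: "D X Y x = D X0 Y x" by (rule conn_pointwise[OF X X0 Y xt X0x[symmetric]])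
  obtain y E W where W: "openin \<tau> W" "x \<in> W" and y': "\<forall>i<dm. y i \<in> funs S" and E': "\<forall>i<dm. vector_field S (E i)"
    and "\<forall>q\<in>W. \<forall>i<dm. \<forall>j<dm. E i q (y j) = (if i = j then 1 else 0)"
    and expand: "\<forall>q\<in>W. \<forall>v\<in>tangent S q. v = (\<lambda>f. \<Sum>i<dm. v (y i) * E i q f)"
    by (rule frame_exists[OF xt])
  have y: "y i \<in> funs S" and E: "vector_field S (E i)" if "i < dm" for i using y' E' that by auto
  have X1: "\<forall>j<1::nat. vector_field S ((\<lambda>_. X0) j)"
    and X2: "\<forall>q\<in>W0. \<forall>j<1::nat. \<forall>i<r. (\<lambda>_. X0) j q (f i) = 0" using X0 W0(3) by simp_all
  have xUW: "x \<in> U \<inter> W" using U W by simp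
  obtain \<delta> where \<delta>: "0 < \<delta>" "\<forall>w. (\<forall>j<1. \<bar>w j\<bar> < \<delta>) \<longrightarrow> (\<exists>\<gamma>. \<gamma> 0 = x \<and> (\<forall>t\<in>{-2<..<2}. \<gamma> t \<in> U \<inter> W \<inter> C) \<and>
    (\<forall>f\<in>funs S. Cinf_on {-2<..<2::real} (f \<circ> \<gamma>)) \<and>
    (\<forall>f\<in>funs S. \<forall>t\<in>{-2<..<2}. ((f \<circ> \<gamma>) has_real_derivative (\<Sum>j<1::nat. w j * X0 (\<gamma> t) f)) (at t)))"
    using C_curves[OF X1 x openin_Int[OF U(1) W(1)] xUW W0(1,2) X2] by (elim exE conjE)
  define c where "c = \<delta> / 2"
  have c: "c > 0" using \<delta>(1) by (simp add: c_def)
  have "\<forall>j<1::nat. \<bar>(\<lambda>_. c) j\<bar> < \<delta>" using \<delta>(1) by (simp add: c_def)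
  from mp[OF spec[OF \<delta>(2), of "\<lambda>_. c"] this]
  obtain \<gamma> where \<gamma>: "\<gamma> 0 = x" "\<forall>t\<in>{-2<..<2}. \<gamma> t \<in> U \<inter> W \<inter> C" "\<forall>f\<in>funs S. Cinf_on {-2<..<2::real} (f \<circ> \<gamma>)"
    "\<forall>f\<in>funs S. \<forall>t\<in>{-2<..<2}. ((f \<circ> \<gamma>) has_real_derivative (\<Sum>j<1::nat. c * X0 (\<gamma> t) f)) (at t)"
    by (elim exE conjE)
  have d\<gamma>: "((h \<circ> \<gamma>) has_real_derivative c * X0 (\<gamma> t) h) (at t)" if "h \<in> funs S" "t \<in> {-2<..<2}" for h t
    using bspec[OF bspec[OF \<gamma>(4) that(1)] that(2)] by simp
  \<comment> \<open>Connection coefficients in the direction \<open>X0\<close>. In \<Gamma> they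
    acquire the factor \<open>c\<close>, because the velocity of \<gamma> is \<open>c\<close> times
    \<open>X0\<close>.\<close>
  define G where "G = (\<lambda>i b q. D X0 (E b) q (y i))"
  have G: "G i b \<in> funs S" if "i < dm" "b < dm" for i b
    unfolding G_def by (rule vector_field_funs[OF conn_vector_field[OF X0 E[OF that(2)]] y[OF that(1)]])
  have DE: "D X0 (E b) q = (\<lambda>h. \<Sum>i<dm. G i b q * E i q h)" if b: "b < dm" and q: "q \<in> W" for b q
  proof -
    have "q \<in> points S" using q openin_subset[OF W(1)] by auto
    then have "D X0 (E b) q \<in> tangent S q" by (rule vector_field_tangent[OF conn_vector_field[OF X0 E[OF b]]])
    then show ?thesis using expand q unfolding G_def by blast
  qed
  define \<Gamma> where "\<Gamma> = (\<lambda>i b t. c * (G i b \<circ> \<gamma>) t)"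
  have \<Gamma>: "Cinf_on {-2<..<2} (\<Gamma> i b)" if "i < dm" "b < dm" for i b
    unfolding \<Gamma>_def by (rule Cinf_on_mult[OF _ Cinf_on_const bspec[OF \<gamma>(3) G[OF that]]]) simp
  \<comment> \<open>Two systems are prepared: the one for components of parallel vectors, with
    matrix minus \<Gamma>, and below it the adjoint one for covectors, with the transpose of
    \<Gamma>. The opposite signs make the pairing of two solutions constant.\<close>
  have "\<exists>\<epsilon>>0. \<epsilon> < 2 \<and> (\<forall>s\<in>{-\<epsilon><..<\<epsilon>}. \<forall>w. \<exists>a. (\<forall>i<dm. a i s = w i) \<and>
    (\<forall>i<dm. Cinf_on {-\<epsilon><..<\<epsilon>} (a i)) \<and>
    (\<forall>i<dm. \<forall>t\<in>{-\<epsilon><..<\<epsilon>}. (a i has_real_derivative (\<Sum>j<dm. - 1 * \<Gamma> i j t * a j t)) (at t)))"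
    by (rule linear_ode[of 2 "\<lambda>i j t. - 1 * \<Gamma> i j t"])
      (use \<Gamma> in \<open>auto intro!: Cinf_on_mult[OF _ Cinf_on_const, of _ _ "-1", simplified]\<close>)
  then obtain \<epsilon>1 where \<epsilon>1: "0 < \<epsilon>1" "\<epsilon>1 < 2" "\<forall>s\<in>{-\<epsilon>1<..<\<epsilon>1}. \<forall>w. \<exists>a. (\<forall>i<dm. a i s = w i) \<and>
    (\<forall>i<dm. Cinf_on {-\<epsilon>1<..<\<epsilon>1} (a i)) \<and>
    (\<forall>i<dm. \<forall>t\<in>{-\<epsilon>1<..<\<epsilon>1}. (a i has_real_derivative (\<Sum>j<dm. - 1 * \<Gamma> i j t * a j t)) (at t))"
    by (elim exE conjE)
  have "\<exists>\<epsilon>>0. \<epsilon> < 2 \<and> (\<forall>s\<in>{-\<epsilon><..<\<epsilon>}. \<forall>w. \<exists>a. (\<forall>i<dm. a i s = w i) \<and>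
    (\<forall>i<dm. Cinf_on {-\<epsilon><..<\<epsilon>} (a i)) \<and>
    (\<forall>i<dm. \<forall>t\<in>{-\<epsilon><..<\<epsilon>}. (a i has_real_derivative (\<Sum>j<dm. \<Gamma> j i t * a j t)) (at t)))"
    by (rule linear_ode[of 2 "\<lambda>i j. \<Gamma> j i"]) (use \<Gamma> in auto)
  then obtain \<epsilon>2 where \<epsilon>2: "0 < \<epsilon>2" "\<epsilon>2 < 2" "\<forall>s\<in>{-\<epsilon>2<..<\<epsilon>2}. \<forall>w. \<exists>a. (\<forall>i<dm. a i s = w i) \<and>
    (\<forall>i<dm. Cinf_on {-\<epsilon>2<..<\<epsilon>2} (a i)) \<and>
    (\<forall>i<dm. \<forall>t\<in>{-\<epsilon>2<..<\<epsilon>2}. (a i has_real_derivative (\<Sum>j<dm. \<Gamma> j i t * a j t)) (at t))"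
    by (elim exE conjE)
  define \<epsilon> where "\<epsilon> = min \<epsilon>1 \<epsilon>2"
  let ?I = "{-\<epsilon><..<\<epsilon>}"
  have \<epsilon>: "0 < \<epsilon>" "?I \<subseteq> {-\<epsilon>1<..<\<epsilon>1}" "?I \<subseteq> {-\<epsilon>2<..<\<epsilon>2}" "?I \<subseteq> {-2<..<2}"
    using \<epsilon>1(1,2) \<epsilon>2(1,2) by (auto simp: \<epsilon>_def)
  have I: "open ?I" "0 \<in> ?I" using \<epsilon>(1) by auto
  have \<gamma>I: "\<gamma> t \<in> U" "\<gamma> t \<in> W" "\<gamma> t \<in> C" "\<gamma> t \<in> points S" if "t \<in> ?I" for t
  proof -
    have "\<gamma> t \<in> U \<inter> W \<inter> C" using \<gamma>(2) that \<epsilon>(4) by blast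
    then show "\<gamma> t \<in> U" "\<gamma> t \<in> W" "\<gamma> t \<in> C" "\<gamma> t \<in> points S" using C_subset by auto
  qed
  have curve: "smooth_curve S ?I \<gamma>"
    unfolding smooth_curve_def
  proof (intro conjI ballI)
    show "smooth_on ?I (h \<circ> \<gamma>)" if "h \<in> funs S" for h
      by (rule Cinf_on_imp_smooth_on[OF I(1) subset_refl Cinf_on_subset[OF bspec[OF \<gamma>(3) that] \<epsilon>(4)]])
    show "\<gamma> ` ?I \<subseteq> points S" using \<gamma>I(4) by blast
  qed (simp_all add: is_interval_oo)
  have vel: "velocity S \<gamma> t = (\<lambda>h. c * X0 (\<gamma> t) h)" if t: "t \<in> ?I" for t
  proof
    fix h
    show "velocity S \<gamma> t h = c * X0 (\<gamma> t) h"
    proof (cases "h \<in> funs S")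
      case True
      then show ?thesis using DERIV_imp_deriv[OF d\<gamma>[OF True]] t \<epsilon>(4) by (simp add: velocity_def subset_iff)
    next
      case False
      then show ?thesis
        using tangent_notin[OF vector_field_tangent[OF X0 \<gamma>I(4)[OF t]] False] by (simp add: velocity_def)
    qed
  qed
  have cX0: "vector_field S (\<lambda>q h. c * X0 q h)" by (rule vector_field_scale[OF funs_const X0])
  have con: "conn_at S D (\<gamma> t) (velocity S \<gamma> t) (E b) = (\<lambda>h. \<Sum>i<dm. \<Gamma> i b t * E i (\<gamma> t) h)"
    if t: "t \<in> ?I" and b: "b < dm" for t b
  proof -
    have "\<gamma> t \<in> topspace \<tau>" using \<gamma>I(4)[OF t] by simp
    then have "conn_at S D (\<gamma> t) (velocity S \<gamma> t) (E b) = D (\<lambda>q h. c * X0 q h) (E b) (\<gamma> t)"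
      by (rule conn_at_eq[OF cX0 E[OF b]]) (simp add: vel[OF t])
    also have "\<dots> = (\<lambda>h. c * D X0 (E b) (\<gamma> t) h)"
      by (rule conn_scale_left[OF X0 X0 E[OF b] funs_const \<gamma>I(4)[OF t]])
    also have "\<dots> = (\<lambda>h. \<Sum>i<dm. \<Gamma> i b t * E i (\<gamma> t) h)"
      unfolding DE[OF b \<gamma>I(2)[OF t]] by (simp add: sum_distrib_left \<Gamma>_def mult.assoc)
    finally show ?thesis .
  qed
  have parallel: "parallel_along S D ?I \<gamma> (\<lambda>t h. \<Sum>i<dm. a i t * E i (\<gamma> t) h)"
    if a: "\<forall>i<dm. Cinf_on ?I (a i)"
      "\<forall>i<dm. \<forall>t\<in>?I. (a i has_real_derivative (\<Sum>j<dm. - 1 * \<Gamma> i j t * a j t)) (at t)" for a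
    unfolding parallel_along_def
  proof
    fix t assume t: "t \<in> ?I"
    have "(\<Sum>i<dm. deriv (a i) t * E i (\<gamma> t) h + a i t * conn_at S D (\<gamma> t) (velocity S \<gamma> t) (E i) h) = 0" for h
    proof -
      have "(\<Sum>i<dm. deriv (a i) t * E i (\<gamma> t) h) = (\<Sum>i<dm. \<Sum>j<dm. - (\<Gamma> i j t * a j t * E i (\<gamma> t) h))"
      proof (rule sum.cong[OF refl])
        fix i assume "i \<in> {..<dm}"
        then have "deriv (a i) t = (\<Sum>j<dm. - 1 * \<Gamma> i j t * a j t)"
          using a(2) t by (intro DERIV_imp_deriv) auto
        then show "deriv (a i) t * E i (\<gamma> t) h = (\<Sum>j<dm. - (\<Gamma> i j t * a j t * E i (\<gamma> t) h))"
          by (simp add: sum_distrib_right)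
      qed
      moreover have "(\<Sum>i<dm. a i t * conn_at S D (\<gamma> t) (velocity S \<gamma> t) (E i) h)
          = (\<Sum>j<dm. \<Sum>i<dm. \<Gamma> i j t * a j t * E i (\<gamma> t) h)"
        by (rule sum.cong) (simp_all add: con[OF t] sum_distrib_left mult_ac)
      moreover have "\<dots> = (\<Sum>i<dm. \<Sum>j<dm. \<Gamma> i j t * a j t * E i (\<gamma> t) h)" by (rule sum.swap)
      ultimately show ?thesis by (simp add: sum.distrib sum_negf)
    qed
    moreover have "\<forall>i<dm. smooth_on ?I (a i)"
      using a(1) Cinf_on_imp_smooth_on[OF I(1) subset_refl, of "a _"] by blast
    ultimately show "has_covariant_derivative S D \<gamma> (\<lambda>t h. \<Sum>i<dm. a i t * E i (\<gamma> t) h) t (\<lambda>_. 0)"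
      unfolding has_covariant_derivative_def using t I E
      by (intro exI[of _ ?I] exI[of _ dm] exI[of _ a] exI[of _ E]) simp
  qed
  have key: "D X0 Y x (f j) = 0" if j: "j < r" for j
  proof -
    have "0 \<in> {-\<epsilon>2<..<\<epsilon>2}" using \<epsilon>2(1) by simp
    from spec[OF bspec[OF \<epsilon>2(3) this], of "\<lambda>i. E i x (f j)"]
    obtain l where l: "\<forall>i<dm. l i 0 = E i x (f j)"
      "\<forall>i<dm. \<forall>t\<in>{-\<epsilon>2<..<\<epsilon>2}. (l i has_real_derivative (\<Sum>j<dm. \<Gamma> j i t * l j t)) (at t)"
      by (elim exE conjE)
    have dl: "(l i has_real_derivative (\<Sum>j<dm. \<Gamma> j i t * l j t)) (at t)" if "i < dm" "t \<in> ?I" for i t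
      using l(2) that \<epsilon>(3) by blast
    define yf where "yf = (\<lambda>i q. Y q (y i))"
    have yf: "yf i \<in> funs S" if "i < dm" for i
      unfolding yf_def by (rule vector_field_funs[OF Y y[OF that]])
    have zero: "(\<Sum>i<dm. yf i (\<gamma> s) * l i s) = 0" if s: "s \<in> ?I" for s
    proof -
      \<comment> \<open>The parallel field takes the value of \<open>Y\<close> at time
        \<open>s\<close> and is compared with \<open>l\<close> at time 0, so the interval of
        existence must not depend on \<open>s\<close>.\<close>
      have "s \<in> {-\<epsilon>1<..<\<epsilon>1}" using s \<epsilon>(2) by blast
      from spec[OF bspec[OF \<epsilon>1(3) this], of "\<lambda>i. yf i (\<gamma> s)"]
      obtain a where a: "\<forall>i<dm. a i s = yf i (\<gamma> s)" "\<forall>i<dm. Cinf_on {-\<epsilon>1<..<\<epsilon>1} (a i)"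
        "\<forall>i<dm. \<forall>t\<in>{-\<epsilon>1<..<\<epsilon>1}. (a i has_real_derivative (\<Sum>j<dm. - 1 * \<Gamma> i j t * a j t)) (at t)"
        by (elim exE conjE)
      have a2: "\<forall>i<dm. Cinf_on ?I (a i)" using a(2) Cinf_on_subset[OF _ \<epsilon>(2), of "a _"] by blast
      have a3: "\<forall>i<dm. \<forall>t\<in>?I. (a i has_real_derivative (\<Sum>j<dm. - 1 * \<Gamma> i j t * a j t)) (at t)"
        using a(3) \<epsilon>(2) by blast
      let ?Z = "\<lambda>t h. \<Sum>i<dm. a i t * E i (\<gamma> t) h"
      have Ys: "Y (\<gamma> s) \<in> incl M ` tangent SC (\<gamma> s)" using YU \<gamma>I[OF s] by simp
      have "Y (\<gamma> s) = (\<lambda>h. \<Sum>i<dm. Y (\<gamma> s) (y i) * E i (\<gamma> s) h)"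
        using expand \<gamma>I(2)[OF s] vector_field_tangent[OF Y \<gamma>I(4)[OF s]] by blast
      also have "\<dots> = ?Z s" using a(1) by (simp add: yf_def)
      finally have Zs: "?Z s \<in> incl M ` tangent SC (\<gamma> s)" using Ys by simp
      have \<gamma>C: "\<gamma> ` ?I \<subseteq> C" using \<gamma>I(3) by (rule image_subsetI)
      have "?Z 0 \<in> incl M ` tangent SC (\<gamma> 0)"
        by (rule self_parallelD[OF curve \<gamma>C parallel[OF a2 a3] s I(2)]) (rule Zs)
      from iffD1[OF tangent_C[OF \<gamma>I(3)[OF I(2)]] this, THEN conjunct2, rule_format, OF j]
      have "?Z 0 (f j) = 0" .
      then have 0: "(\<Sum>i<dm. a i 0 * l i 0) = 0" using l(1) \<gamma>(1) by simp
      have "((\<lambda>t. \<Sum>i<dm. a i t * l i t) has_real_derivative 0) (at t)" if t: "t \<in> ?I" for t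
      proof -
        have "((\<lambda>t. \<Sum>i<dm. a i t * l i t) has_real_derivative
            (\<Sum>i<dm. a i t * (\<Sum>j<dm. \<Gamma> j i t * l j t) + (\<Sum>j<dm. - 1 * \<Gamma> i j t * a j t) * l i t)) (at t)"
          by (rule DERIV_sum) (use a3 dl t in \<open>auto intro!: DERIV_mult'\<close>)
        moreover have "(\<Sum>i<dm. (\<Sum>j<dm. - 1 * \<Gamma> i j t * a j t) * l i t)
            = - (\<Sum>i<dm. \<Sum>j<dm. a j t * (\<Gamma> i j t * l i t))"
          by (simp add: sum_distrib_right sum_distrib_left sum_negf mult_ac)
        moreover have "(\<Sum>i<dm. \<Sum>j<dm. a j t * (\<Gamma> i j t * l i t)) = (\<Sum>j<dm. \<Sum>i<dm. a j t * (\<Gamma> i j t * l i t))"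
          by (rule sum.swap)
        ultimately show ?thesis by (simp add: sum.distrib sum_distrib_left)
      qed
      then have "\<And>t. t \<in> ?I \<Longrightarrow> ((\<lambda>t. \<Sum>i<dm. a i t * l i t) has_real_derivative 0) (at t within ?I)"
        by (rule has_field_derivative_at_within)
      then have "\<exists>k. \<forall>t\<in>?I. (\<Sum>i<dm. a i t * l i t) = k"
        by (intro has_field_derivative_zero_constant) (simp add: convex_real_interval)
      then obtain k where k: "\<forall>t\<in>?I. (\<Sum>i<dm. a i t * l i t) = k" ..
      have "(\<Sum>i<dm. a i s * l i s) = 0" using bspec[OF k s] bspec[OF k I(2)] 0 by simp
      then show ?thesis using a(1) by simp
    qed
    \<comment> \<open>By the product rule the derivative at 0 of the vanishing pairing is
      \<open>c\<close> times \<open>D X0 Y x (f j)\<close>: differentiating the components of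
      \<open>Y\<close> gives one part of the Leibniz rule, and the equation for \<open>l\<close>
      supplies the connection coefficients.\<close>
    have "((\<lambda>s. \<Sum>i<dm. (yf i \<circ> \<gamma>) s * l i s) has_real_derivative
        (\<Sum>i<dm. (yf i \<circ> \<gamma>) 0 * (\<Sum>b<dm. \<Gamma> b i 0 * l b 0) + c * X0 (\<gamma> 0) (yf i) * l i 0)) (at 0)"
    proof (rule DERIV_sum)
      fix i assume "i \<in> {..<dm}"
      then have i: "i < dm" by simp
      have "0 \<in> {-2<..<2::real}" by simp
      from DERIV_mult'[OF d\<gamma>[OF yf[OF i] this] dl[OF i I(2)]]
      show "((\<lambda>s. (yf i \<circ> \<gamma>) s * l i s) has_real_derivative
        (yf i \<circ> \<gamma>) 0 * (\<Sum>b<dm. \<Gamma> b i 0 * l b 0) + c * X0 (\<gamma> 0) (yf i) * l i 0) (at 0)" .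
    qed
    moreover have "((\<lambda>s. \<Sum>i<dm. (yf i \<circ> \<gamma>) s * l i s) has_real_derivative 0) (at 0)"
      by (rule has_field_derivative_transform_within_open[OF DERIV_const[of 0] I]) (use zero in simp)
    ultimately have "0 = (\<Sum>i<dm. (yf i \<circ> \<gamma>) 0 * (\<Sum>b<dm. \<Gamma> b i 0 * l b 0) + c * X0 (\<gamma> 0) (yf i) * l i 0)"
      using DERIV_unique by blast
    also have "\<dots> = c * (\<Sum>i<dm. yf i x * (\<Sum>b<dm. G b i x * l b 0) + X0 x (yf i) * l i 0)"
      by (simp add: \<gamma>(1) \<Gamma>_def sum_distrib_left distrib_left mult_ac)
    finally have S0: "(\<Sum>i<dm. yf i x * (\<Sum>b<dm. G b i x * l b 0) + X0 x (yf i) * l i 0) = 0"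
      using c by simp
    have Yexp: "Y q = (\<lambda>h. \<Sum>i<dm. yf i q * E i q h)" if "q \<in> W" "q \<in> points S" for q
      using expand that vector_field_tangent[OF Y] unfolding yf_def by blast
    have v: "vector_field S (\<lambda>q h. \<Sum>i<dm. yf i q * E i q h)"
      by (rule vector_field_sum) (use yf E in auto)
    have "D X0 Y x = D X0 (\<lambda>q h. \<Sum>i<dm. yf i q * E i q h) x"
      by (rule conn_local_right[OF Y v X0 xp W Yexp])
    also have "\<dots> = (\<lambda>h. \<Sum>i<dm. X0 x (yf i) * E i x h + yf i x * D X0 (E i) x h)"
      by (rule conn_sum_right[OF X0 xp yf E])
    finally have "D X0 Y x (f j) = (\<Sum>i<dm. X0 x (yf i) * E i x (f j) + yf i x * D X0 (E i) x (f j))"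
      by simp
    also have "\<dots> = (\<Sum>i<dm. yf i x * (\<Sum>b<dm. G b i x * l b 0) + X0 x (yf i) * l i 0)"
      by (rule sum.cong) (use l(1) DE[OF _ W(2)] in simp_all)
    finally show ?thesis using S0 by simp
  qed
  have "D X0 Y x \<in> tangent S x" by (rule vector_field_tangent[OF conn_vector_field[OF X0 Y] xp])
  then show ?thesis unfolding DX tangent_C[OF x] using key by blast
qed

section \<open>The connection seen on the level set\<close>

abbreviation "DC \<equiv> conn_on M C D"

lemma extends_nearE:
  assumes "extends_near M C x X X'"
  obtains U where "vector_field S X'" "openin \<tau> U" "x \<in> U" "\<forall>y\<in>U \<inter> C. X' y = incl M (X y)"
  using assms unfolding extends_near_def by (elim exE conjE)

lemma extends_nearI:
  "vector_field S X' \<Longrightarrow> openin \<tau> U \<Longrightarrow> x \<in> U \<Longrightarrow> \<forall>y\<in>U \<inter> C. X' y = incl M (X y) \<Longrightarrow> extends_near M C x X X'"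
  unfolding extends_near_def by (intro exI[of _ U] conjI)

text \<open>In the first slot only the common value at \<open>x\<close> counts. In the second, the
  components of the two extensions agree on \<open>C\<close> near \<open>x\<close>; as the direction
  \<open>X2 x\<close> is tangent to \<open>C\<close>, it cannot distinguish them, and the Leibniz
  expansion in a frame uses nothing else.\<close>

lemma conn_extension_unique:
  assumes x: "x \<in> C" and X: "vector_field SC X" and Y: "vector_field SC Y"
    and e: "extends_near M C x X X1" "extends_near M C x X X2" "extends_near M C x Y Y1" "extends_near M C x Y Y2"
  shows "D X1 Y1 x = D X2 Y2 x"
proof -
  have xt: "x \<in> topspace \<tau>" using x C_subset by auto
  then have xp: "x \<in> points S" by simp
  obtain U1 where U1: "vector_field S X1" "openin \<tau> U1" "x \<in> U1" "\<forall>y\<in>U1 \<inter> C. X1 y = incl M (X y)"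
    by (rule extends_nearE[OF e(1)])
  obtain U2 where U2: "vector_field S X2" "openin \<tau> U2" "x \<in> U2" "\<forall>y\<in>U2 \<inter> C. X2 y = incl M (X y)"
    by (rule extends_nearE[OF e(2)])
  obtain U3 where U3: "vector_field S Y1" "openin \<tau> U3" "x \<in> U3" "\<forall>y\<in>U3 \<inter> C. Y1 y = incl M (Y y)"
    by (rule extends_nearE[OF e(3)])
  obtain U4 where U4: "vector_field S Y2" "openin \<tau> U4" "x \<in> U4" "\<forall>y\<in>U4 \<inter> C. Y2 y = incl M (Y y)"
    by (rule extends_nearE[OF e(4)])
  have X1x: "X1 x = X2 x" "X2 x = incl M (X x)" using U1 U2 x by auto
  have "D X1 Y1 x = D X2 Y1 x" by (rule conn_pointwise[OF U1(1) U2(1) U3(1) xt X1x(1)])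
  also have "D X2 Y1 x = D X2 Y2 x"
  proof -
    obtain y E W where W: "openin \<tau> W" "x \<in> W" and y': "\<forall>i<dm. y i \<in> funs S" and E': "\<forall>i<dm. vector_field S (E i)"
      and "\<forall>q\<in>W. \<forall>i<dm. \<forall>j<dm. E i q (y j) = (if i = j then 1 else 0)"
      and expand: "\<forall>q\<in>W. \<forall>v\<in>tangent S q. v = (\<lambda>f. \<Sum>i<dm. v (y i) * E i q f)"
      by (rule frame_exists[OF xt])
    have y: "y i \<in> funs S" and E: "vector_field S (E i)" if "i < dm" for i using y' E' that by auto
    define b where "b = (\<lambda>(Y :: 'a vfield) i q. Y q (y i))"
    have DY: "D X2 Y x = (\<lambda>h. \<Sum>i<dm. X2 x (b Y i) * E i x h + b Y i x * D X2 (E i) x h)"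
      if Y: "vector_field S Y" for Y
    proof -
      have bf: "b Y i \<in> funs S" if "i < dm" for i
        unfolding b_def by (rule vector_field_funs[OF Y y[OF that]])
      have v: "vector_field S (\<lambda>q h. \<Sum>i<dm. b Y i q * E i q h)"
        by (rule vector_field_sum) (use bf E in auto)
      have "D X2 Y x = D X2 (\<lambda>q h. \<Sum>i<dm. b Y i q * E i q h) x"
      proof (rule conn_local_right[OF Y v U2(1) xp W])
        fix q assume "q \<in> W" "q \<in> points S"
        then show "Y q = (\<lambda>h. \<Sum>i<dm. b Y i q * E i q h)"
          using expand vector_field_tangent[OF Y] unfolding b_def by blast
      qed
      also have "\<dots> = (\<lambda>h. \<Sum>i<dm. X2 x (b Y i) * E i x h + b Y i x * D X2 (E i) x h)"
        by (rule conn_sum_right[OF U2(1) xp bf E])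
      finally show ?thesis .
    qed
    have Xx: "X x \<in> tangent SC x" using C.vector_field_tangent[OF X] x by simp
    have bb: "b Y1 i q = b Y2 i q" if "q \<in> U3 \<inter> U4" "q \<in> C" for q i
      using U3(4) U4(4) that by (simp add: b_def)
    have "X2 x (b Y1 i) = X2 x (b Y2 i)" if i: "i < dm" for i
    proof -
      have b1: "b Y1 i \<in> funs S" "b Y2 i \<in> funs S"
        unfolding b_def using vector_field_funs[OF U3(1) y[OF i]] vector_field_funs[OF U4(1) y[OF i]] by auto
      have "X x (b Y1 i) = X x (b Y2 i)"
        by (rule C.tangent_local[OF Xx _ funs_restrict[OF b1(1)] funs_restrict[OF b1(2)] openin_Int[OF U3(2) U4(2)]])
          (use U3(3) U4(3) x bb in auto)
      then show ?thesis using X1x(2) incl_apply[OF b1(1)] incl_apply[OF b1(2)] by simp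
    qed
    moreover have "b Y1 i x = b Y2 i x" for i using bb U3(3) U4(3) x by simp
    ultimately show ?thesis unfolding DY[OF U3(1)] DY[OF U4(1)] by simp
  qed
  finally show ?thesis .
qed

text \<open>Discharges the definite description in \<open>conn_on\<close>: existence is the tangency
  of the covariant derivative, uniqueness is independence of the extensions together with
  injectivity of \<open>incl\<close>.\<close>

lemma conn_on_eq:
  assumes x: "x \<in> C" and X: "vector_field SC X" and Y: "vector_field SC Y"
    and e: "extends_near M C x X X'" "extends_near M C x Y Y'"
  shows "DC X Y x \<in> tangent SC x" and "incl M (DC X Y x) = D X' Y' x"
proof -
  let ?P = "\<lambda>z. z \<in> tangent SC x \<and>
    (\<exists>X' Y'. extends_near M C x X X' \<and> extends_near M C x Y Y' \<and> incl M z = D X' Y' x)"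
  obtain U1 where U1: "vector_field S X'" "openin \<tau> U1" "x \<in> U1" "\<forall>y\<in>U1 \<inter> C. X' y = incl M (X y)"
    by (rule extends_nearE[OF e(1)])
  obtain U2 where U2: "vector_field S Y'" "openin \<tau> U2" "x \<in> U2" "\<forall>y\<in>U2 \<inter> C. Y' y = incl M (Y y)"
    by (rule extends_nearE[OF e(2)])
  have "D X' Y' x \<in> incl M ` tangent SC x"
    by (rule conn_tangent[OF U1(1) U2(1) x _ U2(2,3)])
      (use U1(3,4) U2(4) x C.vector_field_tangent[OF X] C.vector_field_tangent[OF Y] in auto)
  then obtain z where z: "z \<in> tangent SC x" "D X' Y' x = incl M z" by auto
  have "?P z" using z e by (intro conjI exI[of _ X'] exI[of _ Y']) simp_all
  moreover have "z' = z" if z': "?P z'" for z'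
  proof -
    from z' obtain X2 Y2 where "z' \<in> tangent SC x" "extends_near M C x X X2" "extends_near M C x Y Y2"
      "incl M z' = D X2 Y2 x" by (elim exE conjE)
    then show ?thesis
      using conn_extension_unique[OF x X Y _ e(1) _ e(2)] z incl_inj[OF _ z(1) x] by metis
  qed
  ultimately have "DC X Y x = z" unfolding conn_on_def by (rule the_equality)
  then show "DC X Y x \<in> tangent SC x" "incl M (DC X Y x) = D X' Y' x" using z by simp_all
qed

text \<open>One extension has to serve all points of a neighbourhood, because smoothness of
  \<open>DC X Y\<close> concerns its variation with the point.\<close>

lemma common_extension:
  assumes x: "x \<in> C" and X: "vector_field SC X"
  obtains X' U where "vector_field S X'" "openin \<tau> U" "x \<in> U" "\<forall>y\<in>U \<inter> C. X' y = incl M (X y)"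
    "\<forall>y\<in>U. extends_near M C y X X'"
proof -
  obtain X' W where X': "vector_field S X'" "openin \<tau> W" "x \<in> W" "\<forall>q\<in>W \<inter> C. X' q = incl M (X q)"
    "\<forall>q\<in>W. \<forall>j<r. X' q (f j) = 0" by (rule extend_from_C[OF x X])
  show ?thesis by (rule that[OF X'(1-4)]) (use extends_nearI[OF X'(1,2) _ X'(4)] in blast)
qed

lemma DC_vector_field:
  assumes X: "vector_field SC X" and Y: "vector_field SC Y"
  shows "vector_field SC (DC X Y)"
proof (rule C.vector_fieldI)
  fix p assume "p \<in> points SC"
  then have p: "p \<in> C" by simp
  obtain X' U where X': "vector_field S X'" "openin \<tau> U" "p \<in> U" "\<forall>y\<in>U \<inter> C. X' y = incl M (X y)"
    "\<forall>y\<in>U. extends_near M C y X X'" by (rule common_extension[OF p X])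
  obtain Y' U' where Y': "vector_field S Y'" "openin \<tau> U'" "p \<in> U'" "\<forall>y\<in>U' \<inter> C. Y' y = incl M (Y y)"
    "\<forall>y\<in>U'. extends_near M C y Y Y'" by (rule common_extension[OF p Y])
  have eq: "DC X Y q \<in> tangent SC q" "incl M (DC X Y q) = D X' Y' q" if "q \<in> U" "q \<in> U'" "q \<in> C" for q
    using conn_on_eq[OF that(3) X Y bspec[OF X'(5) that(1)] bspec[OF Y'(5) that(2)]] by auto
  show "DC X Y p \<in> tangent SC p" using eq(1)[OF X'(3) Y'(3) p] .
  fix h assume h: "h \<in> funs SC"
  obtain Q F where Q: "openin \<tau> Q" "p \<in> Q" "F \<in> funs S" "\<forall>y\<in>Q \<inter> C. F y = h y"
    by (rule funs_SC_D[OF h p])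
  have "D X' Y' q F = DC X Y q h" if "q \<in> U \<inter> U' \<inter> Q" "q \<in> C" for q
    using incl_local[OF eq(1) that(2) h Q(1) _ Q(3,4)] eq(2) that by simp
  moreover have "openin \<tau> (U \<inter> U' \<inter> Q)" by (intro openin_Int X'(2) Y'(2) Q(1))
  ultimately show "\<exists>U F. openin \<tau> U \<and> p \<in> U \<and> F \<in> funs SC \<and> (\<forall>q\<in>U \<inter> points SC. F q = DC X Y q h)"
    using X'(3) Y'(3) Q(2) funs_restrict[OF vector_field_funs[OF conn_vector_field[OF X'(1) Y'(1)] Q(3)]]
    by (intro exI[of _ "U \<inter> U' \<inter> Q"] exI[of _ "\<lambda>q. D X' Y' q F"]) simp
qed

text \<open>Each rule is verified after applying the injective \<open>incl\<close>, where it becomes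
  the corresponding rule of \<open>D\<close> for extensions; sums and multiples of extensions extend
  sums and multiples.\<close>

lemma DC_linear_connection: "linear_connection SC DC"
  unfolding linear_connection_def
proof (intro conjI allI impI ballI)
  show "vector_field SC (DC X Y)" if "vector_field SC X \<and> vector_field SC Y" for X Y
    using that DC_vector_field by blast
next
  fix X Y Z k p h
  assume "vector_field SC X \<and> vector_field SC Y \<and> vector_field SC Z" and k: "k \<in> funs SC" and "p \<in> points SC"
  then have X: "vector_field SC X" and Y: "vector_field SC Y" and Z: "vector_field SC Z" and p: "p \<in> C"
    by simp_all
  have pp: "p \<in> points S" using p C_subset by auto
  obtain X' U1 where X': "vector_field S X'" "openin \<tau> U1" "p \<in> U1" "\<forall>y\<in>U1 \<inter> C. X' y = incl M (X y)"
    "\<forall>y\<in>U1. extends_near M C y X X'" by (rule common_extension[OF p X])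
  obtain Y' U2 where Y': "vector_field S Y'" "openin \<tau> U2" "p \<in> U2" "\<forall>y\<in>U2 \<inter> C. Y' y = incl M (Y y)"
    "\<forall>y\<in>U2. extends_near M C y Y Y'" by (rule common_extension[OF p Y])
  obtain Z' U3 where Z': "vector_field S Z'" "openin \<tau> U3" "p \<in> U3" "\<forall>y\<in>U3 \<inter> C. Z' y = incl M (Z y)"
    "\<forall>y\<in>U3. extends_near M C y Z Z'" by (rule common_extension[OF p Z])
  obtain Q F where Q: "openin \<tau> Q" "p \<in> Q" "F \<in> funs S" "\<forall>y\<in>Q \<inter> C. F y = k y"
    by (rule funs_SC_D[OF k p])
  note eX = bspec[OF X'(5) X'(3)] and eY = bspec[OF Y'(5) Y'(3)] and eZ = bspec[OF Z'(5) Z'(3)]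
  have Fp: "F p = k p" using Q p by simp
  have add: "extends_near M C p (\<lambda>q h. A q h + B q h) (\<lambda>q h. A' q h + B' q h)"
    if A: "extends_near M C p A A'" and B: "extends_near M C p B B'" for A A' B B'
  proof -
    obtain U where U: "vector_field S A'" "openin \<tau> U" "p \<in> U" "\<forall>y\<in>U \<inter> C. A' y = incl M (A y)"
      by (rule extends_nearE[OF A])
    obtain U' where U': "vector_field S B'" "openin \<tau> U'" "p \<in> U'" "\<forall>y\<in>U' \<inter> C. B' y = incl M (B y)"
      by (rule extends_nearE[OF B])
    show ?thesis
      by (rule extends_nearI[OF vector_field_add[OF U(1) U'(1)] openin_Int[OF U(2) U'(2)]])
        (use U U' in \<open>simp_all add: incl_add\<close>)
  qed
  have scale: "extends_near M C p (\<lambda>q h. k q * A q h) (\<lambda>q h. F q * A' q h)"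
    if A: "extends_near M C p A A'" for A A'
  proof -
    obtain U where U: "vector_field S A'" "openin \<tau> U" "p \<in> U" "\<forall>y\<in>U \<inter> C. A' y = incl M (A y)"
      by (rule extends_nearE[OF A])
    show ?thesis
      by (rule extends_nearI[OF vector_field_scale[OF Q(3) U(1)] openin_Int[OF U(2) Q(1)]])
        (use U Q in \<open>simp_all add: incl_scale\<close>)
  qed
  have tp: "DC A B p \<in> tangent SC p" if "vector_field SC A" "vector_field SC B" for A B
    using C.vector_field_tangent[OF DC_vector_field[OF that]] p by simp
  have tX: "X p \<in> tangent SC p" "Y p \<in> tangent SC p"
    using C.vector_field_tangent[OF X] C.vector_field_tangent[OF Y] p by simp_all
  have Xk: "X' p F = X p k"
    using incl_local[OF tX(1) p k Q] X'(3,4) p by simp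
  have inj: "u h = w h" if "u \<in> tangent SC p" "w \<in> tangent SC p" "incl M u = incl M w" for u w
    using incl_inj[OF that(1,2) p that(3)] by simp
  note XY = C.vector_field_add[OF X Y] and YZ = C.vector_field_add[OF Y Z]
    and kX = C.vector_field_scale[OF k X] and kY = C.vector_field_scale[OF k Y]
  show "DC (\<lambda>q h. X q h + Y q h) Z p h = DC X Z p h + DC Y Z p h"
    by (rule inj[OF tp[OF XY Z] C.tangent_plus[OF tp[OF X Z] tp[OF Y Z]]])
      (simp only: incl_add conn_on_eq(2)[OF p XY Z add[OF eX eY] eZ] conn_on_eq(2)[OF p X Z eX eZ]
        conn_on_eq(2)[OF p Y Z eY eZ] conn_add_left[OF X'(1) Y'(1) Z'(1) Q(3) pp])
  show "DC (\<lambda>q h. k q * X q h) Z p h = k p * DC X Z p h"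
    by (rule inj[OF tp[OF kX Z] C.tangent_scaled[OF tp[OF X Z]]])
      (simp only: incl_scale conn_on_eq(2)[OF p kX Z scale[OF eX] eZ] conn_on_eq(2)[OF p X Z eX eZ]
        conn_scale_left[OF X'(1) Y'(1) Z'(1) Q(3) pp] Fp)
  show "DC X (\<lambda>q h. Y q h + Z q h) p h = DC X Y p h + DC X Z p h"
    by (rule inj[OF tp[OF X YZ] C.tangent_plus[OF tp[OF X Y] tp[OF X Z]]])
      (simp only: incl_add conn_on_eq(2)[OF p X YZ eX add[OF eY eZ]] conn_on_eq(2)[OF p X Z eX eZ]
        conn_on_eq(2)[OF p X Y eX eY] conn_add_right[OF X'(1) Y'(1) Z'(1) Q(3) pp])
  have Y'p: "Y' p = incl M (Y p)" using Y'(3,4) p by simp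
  show "DC X (\<lambda>q h. k q * Y q h) p h = X p k * Y p h + k p * DC X Y p h"
    by (rule inj[OF tp[OF X kY] C.tangent_plus[OF C.tangent_scaled[OF tX(2)] C.tangent_scaled[OF tp[OF X Y]]]])
      (simp only: incl_add incl_scale conn_on_eq(2)[OF p X kY eX scale[OF eY]] conn_on_eq(2)[OF p X Y eX eY]
        conn_leibniz[OF X'(1) Y'(1) Z'(1) Q(3) pp] Fp Xk Y'p)
qed

lemma extension_apply:
  assumes x: "x \<in> C" and X: "vector_field SC X" and X': "extends_near M C x X X'"
    and h: "h \<in> funs SC" and Q: "openin \<tau> Q" "x \<in> Q" "F \<in> funs S" "\<forall>y\<in>Q \<inter> C. F y = h y"
  shows "X x h = X' x F"
proof -
  obtain U where U: "vector_field S X'" "openin \<tau> U" "x \<in> U" "\<forall>y\<in>U \<inter> C. X' y = incl M (X y)"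
    by (rule extends_nearE[OF X'])
  have "X x \<in> tangent SC x" using C.vector_field_tangent[OF X] x by simp
  from incl_local[OF this x h Q] show ?thesis using U x by simp
qed

lemma DC_torsionless:
  assumes tf: "torsionless S D"
  shows "torsionless SC DC"
  unfolding torsionless_def
proof (intro allI impI ballI)
  fix X Y p h assume "vector_field SC X \<and> vector_field SC Y" "p \<in> points SC"
  then have X: "vector_field SC X" and Y: "vector_field SC Y" and p: "p \<in> C" by simp_all
  have pp: "p \<in> points S" using p C_subset by auto
  obtain X' U1 where X': "vector_field S X'" "openin \<tau> U1" "p \<in> U1" "\<forall>y\<in>U1 \<inter> C. X' y = incl M (X y)"
    "\<forall>y\<in>U1. extends_near M C y X X'" by (rule common_extension[OF p X])
  obtain Y' U2 where Y': "vector_field S Y'" "openin \<tau> U2" "p \<in> U2" "\<forall>y\<in>U2 \<inter> C. Y' y = incl M (Y y)"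
    "\<forall>y\<in>U2. extends_near M C y Y Y'" by (rule common_extension[OF p Y])
  note eX = bspec[OF X'(5) X'(3)] and eY = bspec[OF Y'(5) Y'(3)]
  have tl: "lie_bracket X Y p \<in> tangent SC p"
    using C.vector_field_tangent[OF C.vector_field_lie_bracket[OF X Y]] p by simp
  have tp: "DC A B p \<in> tangent SC p" if "vector_field SC A" "vector_field SC B" for A B
    using C.vector_field_tangent[OF DC_vector_field[OF that]] p by simp
  \<comment> \<open>A field and its extension are related by the inclusion of \<open>C\<close>, and
    the bracket respects such relations.\<close>
  have br: "incl M (lie_bracket X Y p) = lie_bracket X' Y' p"
  proof
    fix F
    show "incl M (lie_bracket X Y p) F = lie_bracket X' Y' p F"
    proof (cases "F \<in> funs S")
      case True
      have apX: "\<forall>q\<in>U1 \<inter> C. X' q F = X q F" and apY: "\<forall>q\<in>U2 \<inter> C. Y' q F = Y q F"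
        using X'(4) Y'(4) by (simp_all add: incl_apply[OF True])
      have "X p (\<lambda>q. Y q F) = X' p (\<lambda>q. Y' q F)"
        by (rule extension_apply[OF p X eX C.vector_field_funs[OF Y funs_restrict[OF True]] Y'(2,3)
              vector_field_funs[OF Y'(1) True]]) (rule apY)
      moreover have "Y p (\<lambda>q. X q F) = Y' p (\<lambda>q. X' q F)"
        by (rule extension_apply[OF p Y eY C.vector_field_funs[OF X funs_restrict[OF True]] X'(2,3)
              vector_field_funs[OF X'(1) True]]) (rule apX)
      ultimately show ?thesis unfolding incl_apply[OF True] lie_bracket_def by simp
    next
      case False
      then show ?thesis
        using tangent_notin[OF vector_field_tangent[OF vector_field_lie_bracket[OF X'(1) Y'(1)] pp] False]
          incl_notin[OF False] by simp
    qed
  qed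
  have "(\<lambda>h. DC X Y p h - DC Y X p h) = lie_bracket X Y p"
  proof (rule incl_inj[OF _ tl p])
    show "(\<lambda>h. DC X Y p h - DC Y X p h) \<in> tangent SC p"
      using C.tangent_plus[OF tp[OF X Y] C.tangent_scaled[OF tp[OF Y X], of "-1"]] by simp
    show "incl M (\<lambda>h. DC X Y p h - DC Y X p h) = incl M (lie_bracket X Y p)"
      unfolding br incl_diff conn_on_eq(2)[OF p X Y eX eY] conn_on_eq(2)[OF p Y X eY eX]
      using tf X'(1) Y'(1) pp unfolding torsionless_def by (intro ext) blast
  qed
  then show "DC X Y p h - DC Y X p h = lie_bracket X Y p h" by metis
qed

text \<open>The identity is that of \<open>D\<close> for extensions of the three fields: as
  \<open>X p\<close> is tangent to \<open>C\<close>, it differentiates the pairing of the extensions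
  only through its values on \<open>C\<close>.\<close>

lemma DC_parallel:
  assumes \<omega>: "two_form S \<omega>" and par: "parallel_form S D \<omega>"
  shows "parallel_form SC DC (\<lambda>q u v. \<omega> q (incl M u) (incl M v))"
    and "vector_field SC X \<Longrightarrow> vector_field SC Y \<Longrightarrow> (\<lambda>q. \<omega> q (incl M (X q)) (incl M (Y q))) \<in> funs SC"
proof -
  show fn: "(\<lambda>q. \<omega> q (incl M (X q)) (incl M (Y q))) \<in> funs SC"
    if X: "vector_field SC X" and Y: "vector_field SC Y" for X Y
  proof (rule funs_SC_I)
    fix p assume p: "p \<in> C"
    obtain X' U1 where X': "vector_field S X'" "openin \<tau> U1" "p \<in> U1" "\<forall>y\<in>U1 \<inter> C. X' y = incl M (X y)"
      "\<forall>y\<in>U1. extends_near M C y X X'" by (rule common_extension[OF p X])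
    obtain Y' U2 where Y': "vector_field S Y'" "openin \<tau> U2" "p \<in> U2" "\<forall>y\<in>U2 \<inter> C. Y' y = incl M (Y y)"
      "\<forall>y\<in>U2. extends_near M C y Y Y'" by (rule common_extension[OF p Y])
    have "(\<lambda>q. \<omega> q (X' q) (Y' q)) \<in> funs S" using \<omega> X'(1) Y'(1) unfolding two_form_def by blast
    then show "\<exists>U F. openin \<tau> U \<and> p \<in> U \<and> F \<in> funs S \<and> (\<forall>y\<in>U \<inter> C. F y = \<omega> y (incl M (X y)) (incl M (Y y)))"
      using openin_Int[OF X'(2) Y'(2)] X'(3,4) Y'(3,4)
      by (intro exI[of _ "U1 \<inter> U2"] exI[of _ "\<lambda>q. \<omega> q (X' q) (Y' q)"]) simp
  qed
  show "parallel_form SC DC (\<lambda>q u v. \<omega> q (incl M u) (incl M v))"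
    unfolding parallel_form_def
  proof (intro allI impI ballI)
    fix X Y Z p assume "vector_field SC X \<and> vector_field SC Y \<and> vector_field SC Z" "p \<in> points SC"
    then have X: "vector_field SC X" and Y: "vector_field SC Y" and Z: "vector_field SC Z" and p: "p \<in> C"
      by simp_all
    have pp: "p \<in> points S" using p C_subset by auto
    obtain X' U1 where X': "vector_field S X'" "openin \<tau> U1" "p \<in> U1" "\<forall>y\<in>U1 \<inter> C. X' y = incl M (X y)"
      "\<forall>y\<in>U1. extends_near M C y X X'" by (rule common_extension[OF p X])
    obtain Y' U2 where Y': "vector_field S Y'" "openin \<tau> U2" "p \<in> U2" "\<forall>y\<in>U2 \<inter> C. Y' y = incl M (Y y)"
      "\<forall>y\<in>U2. extends_near M C y Y Y'" by (rule common_extension[OF p Y])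
    obtain Z' U3 where Z': "vector_field S Z'" "openin \<tau> U3" "p \<in> U3" "\<forall>y\<in>U3 \<inter> C. Z' y = incl M (Z y)"
      "\<forall>y\<in>U3. extends_near M C y Z Z'" by (rule common_extension[OF p Z])
    note eX = bspec[OF X'(5) X'(3)] and eY = bspec[OF Y'(5) Y'(3)] and eZ = bspec[OF Z'(5) Z'(3)]
    have F: "(\<lambda>q. \<omega> q (Y' q) (Z' q)) \<in> funs S" using \<omega> Z'(1) Y'(1) unfolding two_form_def by blast
    have "X p (\<lambda>q. \<omega> q (incl M (Y q)) (incl M (Z q))) = X' p (\<lambda>q. \<omega> q (Y' q) (Z' q))"
      by (rule extension_apply[OF p X eX fn[OF Y Z] openin_Int[OF Y'(2) Z'(2)] _ F])
        (use Y'(3,4) Z'(3,4) in simp_all)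
    also have "\<dots> = \<omega> p (D X' Y' p) (Z' p) + \<omega> p (Y' p) (D X' Z' p)"
      using par X'(1) Y'(1) Z'(1) pp unfolding parallel_form_def by blast
    also have "\<dots> = \<omega> p (incl M (DC X Y p)) (incl M (Z p)) + \<omega> p (incl M (Y p)) (incl M (DC X Z p))"
      using Y'(3,4) Z'(3,4) p conn_on_eq(2)[OF p X Y eX eY] conn_on_eq(2)[OF p X Z eX eZ] by simp
    finally show "X p (\<lambda>q. \<omega> q (incl M (Y q)) (incl M (Z q)))
        = \<omega> p (incl M (DC X Y p)) (incl M (Z p)) + \<omega> p (incl M (Y p)) (incl M (DC X Z p))" .
  qed
qed

end

section \<open>Projecting a connection along a submersion\<close>

text \<open>The mean value theorem on the segment from \<open>z\<close> to a nearby point expresses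
  the increment by the \<open>d j\<close> at an intermediate point, and their continuity makes the
  error small compared with the distance.\<close>

lemma has_derivative_from_directional:
  fixes h :: "'e::euclidean_space \<Rightarrow> real"
  assumes T: "open T" "z \<in> T"
    and dir: "\<And>y v. y \<in> T \<Longrightarrow> ((\<lambda>t. h (y + t *\<^sub>R v)) has_real_derivative (\<Sum>j<n. (v \<bullet> e j) * d j y)) (at 0)"
    and cont: "\<And>j. j < (n::nat) \<Longrightarrow> continuous_on T (d j)"
  shows "(h has_derivative (\<lambda>v. \<Sum>j<n. (v \<bullet> e j) * d j z)) (at z)"
  unfolding has_derivative_at_alt
proof (intro conjI allI impI)
  show "bounded_linear (\<lambda>v. \<Sum>j<n. (v \<bullet> e j) * d j z)"
    by (intro bounded_linear_sum bounded_linear_mult_const bounded_linear_inner_left)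
  fix \<epsilon> :: real assume \<epsilon>: "0 < \<epsilon>"
  \<comment> \<open>With each \<open>d j\<close> within \<open>\<epsilon> / A\<close> of its value
    at \<open>z\<close>, the errors add up to at most \<epsilon> times the distance. The summand 1
    keeps \<open>A\<close> positive when \<open>n\<close> is 0.\<close>
  define A where "A = (\<Sum>j<n. norm (e j)) + 1"
  have A: "0 < A" unfolding A_def by (intro add_nonneg_pos sum_nonneg) auto
  have "\<exists>\<delta>>0. \<forall>y. dist y z < \<delta> \<longrightarrow> y \<in> T \<and> \<bar>d j y - d j z\<bar> < \<epsilon> / A" if j: "j < n" for j
  proof -
    have "isCont (d j) z" using cont[OF j] T continuous_on_eq_continuous_at by blast
    then obtain \<delta>1 where "\<delta>1 > 0" "\<forall>y. dist y z < \<delta>1 \<longrightarrow> dist (d j y) (d j z) < \<epsilon> / A"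
      using \<epsilon> A unfolding continuous_at_eps_delta by (metis divide_pos_pos)
    moreover obtain \<delta>2 where "\<delta>2 > 0" "\<forall>y. dist y z < \<delta>2 \<longrightarrow> y \<in> T"
      using T open_dist by metis
    ultimately show ?thesis by (intro exI[of _ "min \<delta>1 \<delta>2"]) (auto simp: dist_real_def)
  qed
  then obtain \<delta> where \<delta>: "\<And>j. j < n \<Longrightarrow> 0 < \<delta> j"
    "\<And>j y. j < n \<Longrightarrow> dist y z < \<delta> j \<Longrightarrow> \<bar>d j y - d j z\<bar> < \<epsilon> / A" by metis
  obtain \<delta>2 where \<delta>2: "\<delta>2 > 0" "\<forall>y. dist y z < \<delta>2 \<longrightarrow> y \<in> T"
    using T open_dist by metis
  define \<eta> where "\<eta> = Min (insert \<delta>2 (\<delta> ` {..<n}))"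
  have \<eta>: "0 < \<eta>" "\<eta> \<le> \<delta>2" "\<And>j. j < n \<Longrightarrow> \<eta> \<le> \<delta> j" using \<delta>(1) \<delta>2(1) by (auto simp: \<eta>_def)
  have "norm (h y - h z - (\<Sum>j<n. ((y - z) \<bullet> e j) * d j z)) \<le> \<epsilon> * norm (y - z)"
    if y: "norm (y - z) < \<eta>" for y
  proof -
    define v where "v = y - z"
    have near: "dist (z + t *\<^sub>R v) z < \<eta>" if "0 \<le> t" "t \<le> 1" for t
    proof -
      have "dist (z + t *\<^sub>R v) z = t * norm v" using that by (simp add: dist_norm)
      also have "\<dots> \<le> 1 * norm v" using that by (intro mult_right_mono) auto
      finally show ?thesis using y by (simp add: v_def)
    qed
    have "((\<lambda>t. h (z + t *\<^sub>R v)) has_real_derivative (\<Sum>j<n. (v \<bullet> e j) * d j (z + t *\<^sub>R v))) (at t)"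
      if t: "0 \<le> t" "t \<le> 1" for t
    proof -
      have zt: "z + t *\<^sub>R v \<in> T" using near[OF t] \<delta>2(2) \<eta>(2) by simp
      have "((\<lambda>s. h (z + t *\<^sub>R v + s *\<^sub>R v)) has_real_derivative (\<Sum>j<n. (v \<bullet> e j) * d j (z + t *\<^sub>R v))) (at 0)"
        by (rule dir[OF zt])
      then have "((\<lambda>s. h (z + (t + s) *\<^sub>R v)) has_real_derivative (\<Sum>j<n. (v \<bullet> e j) * d j (z + t *\<^sub>R v))) (at 0)"
        by (simp add: scaleR_add_left add.assoc)
      then show ?thesis using DERIV_shift[of "\<lambda>t. h (z + t *\<^sub>R v)" _ 0 t] by (simp add: add.commute)
    qed
    then obtain s where s: "0 < s" "s < 1"
      "h (z + 1 *\<^sub>R v) - h (z + 0 *\<^sub>R v) = (1 - 0) * (\<Sum>j<n. (v \<bullet> e j) * d j (z + s *\<^sub>R v))"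
      using MVT2[of 0 1 "\<lambda>t. h (z + t *\<^sub>R v)" "\<lambda>t. \<Sum>j<n. (v \<bullet> e j) * d j (z + t *\<^sub>R v)"] by auto
    have "h y - h z - (\<Sum>j<n. (v \<bullet> e j) * d j z) = (\<Sum>j<n. (v \<bullet> e j) * (d j (z + s *\<^sub>R v) - d j z))"
      using s(3) by (simp add: v_def right_diff_distrib sum_subtractf)
    also have "\<bar>\<dots>\<bar> \<le> (\<Sum>j<n. (norm v * norm (e j)) * (\<epsilon> / A))"
    proof (rule order_trans[OF sum_abs sum_mono])
      fix j assume "j \<in> {..<n}"
      then have "\<bar>d j (z + s *\<^sub>R v) - d j z\<bar> < \<epsilon> / A"
        using \<delta>(2)[of j "z + s *\<^sub>R v"] near[of s] s(1,2) \<eta>(3)[of j] by auto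
      then show "\<bar>(v \<bullet> e j) * (d j (z + s *\<^sub>R v) - d j z)\<bar> \<le> (norm v * norm (e j)) * (\<epsilon> / A)"
        unfolding abs_mult using Cauchy_Schwarz_ineq2[of v "e j"] by (intro mult_mono) auto
    qed
    also have "\<dots> = norm v * (\<epsilon> / A) * (\<Sum>j<n. norm (e j))"
      by (simp add: sum_distrib_left mult_ac)
    also have "\<dots> \<le> norm v * (\<epsilon> / A) * A" using \<epsilon> A by (intro mult_left_mono) (auto simp: A_def)
    also have "\<dots> = \<epsilon> * norm v" using A by simp
    finally show ?thesis by (simp add: v_def)
  qed
  then show "\<exists>\<eta>>0. \<forall>y. norm (y - z) < \<eta> \<longrightarrow> norm (h y - h z - (\<Sum>j<n. ((y - z) \<bullet> e j) * d j z)) \<le> \<epsilon> * norm (y - z)"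
    using \<eta>(1) by (intro exI[of _ \<eta>]) simp
qed

text \<open>As soon as one of the \<open>\<rho> j\<close> equals 1 the product on the right
  vanishes, and the weights on the left add up to 1.\<close>

lemma telescoping_partition:
  fixes \<rho> :: "nat \<Rightarrow> real"
  shows "(\<Sum>i<k. \<rho> i * (\<Prod>j<i. 1 - \<rho> j)) = 1 - (\<Prod>j<k. 1 - \<rho> j)"
  by (induction k) (simp_all add: algebra_simps)

text \<open>The situation of \<open>C\<close> over \<open>N\<close>, stripped of the ambient
  manifold and of the group. \<open>curves\<close> stands in for charts on the total space,
  \<open>funs_continuous\<close> ties its functions to the topology, and \<open>fibre\<close> is
  what invariance under the group amounts to: other lifts of the same fields give at
  \<open>q\<close> the projected derivative found at \<open>p\<close>.\<close>

locale projection = manifold N + CC: connected_sspace SC \<tau>C Dc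
  for N :: "('b, 'n::euclidean_space) mfd" and SC :: "'a smooth_space" and \<tau>C and Dc +
  fixes \<pi> :: "'a \<Rightarrow> 'b" and \<sigma> :: "'a form2" and \<omega>' :: "'b form2"
  assumes sub: "submersion SC (mfd_space N) \<pi>"
    and surj: "\<pi> ` points SC = topspace (mtop N)"
    and sc: "second_countable \<tau>C"
    and tf: "torsionless SC Dc"
    and par: "parallel_form SC Dc \<sigma>"
    and sym: "symplectic_form (mfd_space N) \<omega>'"
    and pull: "p \<in> points SC \<Longrightarrow> u \<in> tangent SC p \<Longrightarrow> v \<in> tangent SC p \<Longrightarrow>
      \<sigma> p u v = \<omega>' (\<pi> p) (pushforward (mfd_space N) \<pi> u) (pushforward (mfd_space N) \<pi> v)"
    and extend: "p \<in> points SC \<Longrightarrow> z \<in> tangent SC p \<Longrightarrow> \<exists>Z. vector_field SC Z \<and> Z p = z"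
    and funs_continuous: "F \<in> funs SC \<Longrightarrow> p \<in> points SC \<Longrightarrow> 0 < (\<epsilon>::real) \<Longrightarrow>
      \<exists>U. openin \<tau>C U \<and> p \<in> U \<and> (\<forall>q\<in>U \<inter> points SC. \<bar>F q - F p\<bar> < \<epsilon>)"
    and curves: "\<forall>j<(n::nat). vector_field SC (Xs j) \<Longrightarrow> p \<in> points SC \<Longrightarrow> openin \<tau>C U \<Longrightarrow> p \<in> U \<Longrightarrow>
      \<exists>\<delta>>0. \<forall>w. (\<forall>j<n. \<bar>w j\<bar> < \<delta>) \<longrightarrow> (\<exists>\<gamma>. \<gamma> 0 = p \<and> (\<forall>t\<in>{-2<..<2::real}. \<gamma> t \<in> U \<inter> points SC) \<and>
        (\<forall>h\<in>funs SC. \<forall>t\<in>{-2<..<2}. ((h \<circ> \<gamma>) has_real_derivative (\<Sum>j<n. w j * Xs j (\<gamma> t) h)) (at t)))"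
    and fibre: "vector_field SC X \<Longrightarrow> vector_field SC Y \<Longrightarrow> projects_to SC (mfd_space N) \<pi> X X' \<Longrightarrow>
      projects_to SC (mfd_space N) \<pi> Y Y' \<Longrightarrow> p \<in> points SC \<Longrightarrow> q \<in> points SC \<Longrightarrow> \<pi> p = \<pi> q \<Longrightarrow>
      \<exists>X2 Y2. vector_field SC X2 \<and> vector_field SC Y2 \<and> projects_to SC (mfd_space N) \<pi> X2 X' \<and>
        projects_to SC (mfd_space N) \<pi> Y2 Y' \<and>
        pushforward (mfd_space N) \<pi> (Dc X2 Y2 q) = pushforward (mfd_space N) \<pi> (Dc X Y p)"
begin

abbreviation "pf \<equiv> pushforward S \<pi>"
abbreviation "lifts X X' \<equiv> projects_to SC S \<pi> X X'"

lemma pf_apply: "h \<in> funs S \<Longrightarrow> pf u h = u (h \<circ> \<pi>)"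
  and pf_notin: "h \<notin> funs S \<Longrightarrow> pf u h = 0"
  by (simp_all add: pushforward_def)

lemma pf_add: "pf (\<lambda>h. u h + v h) = (\<lambda>h. pf u h + pf v h)"
  and pf_scale: "pf (\<lambda>h. c * u h) = (\<lambda>h. c * pf u h)"
  and pf_diff: "pf (\<lambda>h. u h - v h) = (\<lambda>h. pf u h - pf v h)"
  by (simp_all add: pushforward_def fun_eq_iff)

lemma pi_point: "p \<in> points SC \<Longrightarrow> \<pi> p \<in> topspace \<tau>"
  using surj by blast

lemma pi_surj:
  assumes "n \<in> topspace \<tau>" obtains p where "p \<in> points SC" "\<pi> p = n"
proof -
  have "n \<in> \<pi> ` points SC" using assms surj by simp
  then show ?thesis using that by auto
qed

lemma pi_funs: "h \<in> funs S \<Longrightarrow> h \<circ> \<pi> \<in> funs SC"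
  using sub by (simp add: submersion_def smooth_map_def)

lemma pf_image: "p \<in> points SC \<Longrightarrow> pf ` tangent SC p = tangent S (\<pi> p)"
  using sub by (simp add: submersion_def)

lemma pf_tangent: "p \<in> points SC \<Longrightarrow> u \<in> tangent SC p \<Longrightarrow> pf u \<in> tangent S (\<pi> p)"
  using pf_image by blast

lemma liftsD: "lifts X X' \<Longrightarrow> p \<in> points SC \<Longrightarrow> pf (X p) = X' (\<pi> p)"
  by (simp add: projects_to_def)

lemma lifts_apply: "lifts X X' \<Longrightarrow> p \<in> points SC \<Longrightarrow> h \<in> funs S \<Longrightarrow> X p (h \<circ> \<pi>) = X' (\<pi> p) h"
  using liftsD[of X X' p] pf_apply[of h "X p"] by simp

text \<open>A bump function around \<open>\<pi> p\<close> composed with \<pi> is smooth and nonzero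
  at \<open>p\<close>. The axiom on reciprocals makes it nonzero in a neighbourhood, whose points
  are therefore mapped into the support.\<close>

lemma pi_continuous:
  assumes W: "openin \<tau> W" and p: "p \<in> points SC" "\<pi> p \<in> W"
  obtains U where "openin \<tau>C U" "p \<in> U" "\<forall>q\<in>U \<inter> points SC. \<pi> q \<in> W"
proof -
  have "\<pi> p \<in> points S" using pi_point[OF p(1)] by simp
  from bump[OF this W p(2)] obtain \<rho> B K where \<rho>: "\<rho> \<in> funs S" "openin \<tau> B" "\<pi> p \<in> B" "B \<subseteq> K"
    "closedin \<tau> K" "K \<subseteq> W" "\<forall>q\<in>B. \<rho> q = 1" "\<forall>q. q \<notin> K \<longrightarrow> \<rho> q = 0" by (elim exE conjE)
  have "(\<rho> \<circ> \<pi>) p \<noteq> 0" using \<rho>(3,7) by simp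
  from CC.recip[OF pi_funs[OF \<rho>(1)] p(1) this] obtain g U where U: "g \<in> funs SC" "openin \<tau>C U" "p \<in> U"
    "\<forall>q\<in>U \<inter> points SC. g q * (\<rho> \<circ> \<pi>) q = 1" by (elim exE conjE)
  have "\<pi> q \<in> W" if "q \<in> U \<inter> points SC" for q
  proof (rule ccontr)
    assume "\<pi> q \<notin> W"
    then have "\<rho> (\<pi> q) = 0" using \<rho>(6,8) by blast
    moreover have "g q * \<rho> (\<pi> q) = 1" using bspec[OF U(4) that] by simp
    ultimately show False by simp
  qed
  then show ?thesis using that[OF U(2,3)] by blast
qed

subsection \<open>Vertical vectors\<close>

lemma omega_rules:
  assumes "n \<in> topspace \<tau>" "u \<in> tangent S n" "v \<in> tangent S n" "w \<in> tangent S n"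
  shows "\<omega>' n (\<lambda>h. u h + v h) w = \<omega>' n u w + \<omega>' n v w" "\<omega>' n (\<lambda>h. c * u h) w = c * \<omega>' n u w"
    "\<omega>' n u w = - \<omega>' n w u"
proof -
  have n: "n \<in> points S" using assms(1) by simp
  note * = conjunct1[OF conjunct1[OF sym[unfolded symplectic_form_def two_form_def]]]
  note ** = bspec[OF bspec[OF bspec[OF bspec[OF * n] assms(2)] assms(3)] assms(4)]
  show "\<omega>' n (\<lambda>h. u h + v h) w = \<omega>' n u w + \<omega>' n v w" "\<omega>' n (\<lambda>h. c * u h) w = c * \<omega>' n u w"
    "\<omega>' n u w = - \<omega>' n w u"
    using ** by blast+
qed

text \<open>From left to right this is linearity. Conversely, as \<open>w\<close> runs through
  \<open>tangent SC p\<close> its image runs through the whole tangent space at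
  \<open>\<pi> p\<close>, so nondegeneracy of \<omega>' applies to \<open>pf u\<close>.\<close>

lemma vertical_iff:
  assumes p: "p \<in> points SC" and u: "u \<in> tangent SC p"
  shows "pf u = (\<lambda>_. 0) \<longleftrightarrow> (\<forall>w\<in>tangent SC p. \<sigma> p u w = 0)"
proof
  assume z: "pf u = (\<lambda>_. 0)"
  show "\<forall>w\<in>tangent SC p. \<sigma> p u w = 0"
  proof
    fix w assume w: "w \<in> tangent SC p"
    have "\<omega>' (\<pi> p) (\<lambda>h. 0 * pf u h) (pf w) = 0 * \<omega>' (\<pi> p) (pf u) (pf w)"
      using omega_rules(2)[OF pi_point[OF p] pf_tangent[OF p u] pf_tangent[OF p u] pf_tangent[OF p w]] .
    then show "\<sigma> p u w = 0" using z pull[OF p u w] by simp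
  qed
next
  assume a: "\<forall>w\<in>tangent SC p. \<sigma> p u w = 0"
  have "\<omega>' (\<pi> p) (pf u) w' = 0" if "w' \<in> tangent S (\<pi> p)" for w'
  proof -
    have "w' \<in> pf ` tangent SC p" using that pf_image[OF p] by simp
    then obtain w where "w \<in> tangent SC p" "w' = pf w" by auto
    then show ?thesis using a pull[OF p u] by simp
  qed
  moreover have "\<forall>n\<in>points S. \<forall>v\<in>tangent S n. (\<forall>w\<in>tangent S n. \<omega>' n v w = 0) \<longrightarrow> v = (\<lambda>_. 0)"
    using sym by (simp add: symplectic_form_def)
  ultimately show "pf u = (\<lambda>_. 0)" using pi_point[OF p] pf_tangent[OF p u] by (metis points_S)
qed

definition vertical :: "'a vfield \<Rightarrow> bool" where
  "vertical X \<longleftrightarrow> vector_field SC X \<and> (\<forall>p\<in>points SC. pf (X p) = (\<lambda>_. 0))"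

text \<open>Vertical means \<open>\<sigma>\<close>-orthogonal to everything, and \<open>\<sigma>\<close> is parallel.\<close>

lemma conn_vertical:
  assumes X: "vector_field SC X" and Y: "vertical Y" and p: "p \<in> points SC"
  shows "pf (Dc X Y p) = (\<lambda>_. 0)"
proof -
  have Yv: "vector_field SC Y" using Y by (simp add: vertical_def)
  have t: "Dc A B p \<in> tangent SC p" if "vector_field SC A" "vector_field SC B" for A B
    using CC.vector_field_tangent[OF CC.conn_vector_field[OF that] p] .
  have Y0: "\<sigma> q (Y q) w = 0" if "q \<in> points SC" "w \<in> tangent SC q" for q w
    using vertical_iff[OF that(1) CC.vector_field_tangent[OF Yv that(1)]] Y that by (simp add: vertical_def)
  have "\<sigma> p (Dc X Y p) w = 0" if w: "w \<in> tangent SC p" for w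
  proof -
    obtain Z where Z: "vector_field SC Z" "Z p = w" using extend[OF p w] by blast
    have "X p (\<lambda>_. 0) = X p (\<lambda>q. \<sigma> q (Y q) (Z q))"
      by (rule CC.tangent_cong[OF CC.vector_field_tangent[OF X p] p CC.funs_const])
        (use Y0 CC.vector_field_tangent[OF Z(1)] in simp)
    then have "X p (\<lambda>q. \<sigma> q (Y q) (Z q)) = 0"
      using CC.tangent_const[OF CC.vector_field_tangent[OF X p]] by simp
    moreover have "X p (\<lambda>q. \<sigma> q (Y q) (Z q)) = \<sigma> p (Dc X Y p) (Z p) + \<sigma> p (Y p) (Dc X Z p)"
      using par X Yv Z(1) p unfolding parallel_form_def by blast
    ultimately show ?thesis using Y0[OF p t[OF X Z(1)]] Z(2) by simp
  qed
  then show ?thesis using vertical_iff[OF p t[OF X Yv]] by blast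
qed

text \<open>Lifted fields act on functions pulled back from \<open>N\<close> as the projected fields
  act below, so the iterated derivatives that form the bracket correspond.\<close>

lemma bracket_projects:
  assumes X: "vector_field SC X" "lifts X X'" "vector_field S X'" and Y: "vector_field SC Y" "lifts Y Y'" "vector_field S Y'"
    and p: "p \<in> points SC"
  shows "pf (lie_bracket X Y p) = lie_bracket X' Y' (\<pi> p)"
proof
  fix h
  show "pf (lie_bracket X Y p) h = lie_bracket X' Y' (\<pi> p) h"
  proof (cases "h \<in> funs S")
    case True
    have *: "A p (\<lambda>q. B q (h \<circ> \<pi>)) = A' (\<pi> p) (\<lambda>n. B' n h)"
      if A: "vector_field SC A" "lifts A A'" and B: "lifts B B'" "vector_field S B'" for A A' B B'
    proof -
      note F = vector_field_funs[OF B(2) True]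
      have "A p (\<lambda>q. B q (h \<circ> \<pi>)) = A p ((\<lambda>n. B' n h) \<circ> \<pi>)"
        by (rule CC.tangent_cong[OF CC.vector_field_tangent[OF A(1) p] p pi_funs[OF F], symmetric])
          (simp add: lifts_apply[OF B(1) _ True])
      then show ?thesis using lifts_apply[OF A(2) p F] by simp
    qed
    show ?thesis unfolding pf_apply[OF True] lie_bracket_def
      using *[OF X(1,2) Y(2,3)] *[OF Y(1,2) X(2,3)] by simp
  next
    case False
    have "\<pi> p \<in> points S" using pi_point[OF p] by simp
    then show ?thesis
      using tangent_notin[OF vector_field_tangent[OF vector_field_lie_bracket[OF X(3) Y(3)]] False] pf_notin[OF False]
      by simp
  qed
qed

lemma vertical_lifts: "vertical X \<Longrightarrow> lifts X (\<lambda>_ _. 0)"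
  by (simp add: vertical_def projects_to_def)

lemma lifts_diff_vertical:
  assumes "vector_field SC X" "vector_field SC Y" "lifts X X'" "lifts Y X'"
  shows "vertical (\<lambda>q h. X q h - Y q h)"
  unfolding vertical_def pf_diff using CC.vector_field_diff[OF assms(1,2)] liftsD[OF assms(3)] liftsD[OF assms(4)]
  by simp

lemma lift_independent:
  assumes X: "vector_field SC X1" "vector_field SC X2" "lifts X1 X'" "lifts X2 X'"
    and Y: "vector_field SC Y1" "vector_field SC Y2" "lifts Y1 Y'" "lifts Y2 Y'" and Y': "vector_field S Y'"
    and p: "p \<in> points SC"
  shows "pf (Dc X1 Y1 p) = pf (Dc X2 Y2 p)"
proof -
  let ?A = "\<lambda>q h. X1 q h - X2 q h" and ?B = "\<lambda>q h. Y1 q h - Y2 q h"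
  have A: "vertical ?A" by (rule lifts_diff_vertical[OF X])
  have B: "vertical ?B" by (rule lifts_diff_vertical[OF Y])
  have Av: "vector_field SC ?A" and Bv: "vector_field SC ?B" using A B by (simp_all add: vertical_def)
  have "Dc X1 Y1 p = Dc X1 (\<lambda>q h. Y2 q h + ?B q h) p" by simp
  also have "\<dots> = (\<lambda>h. Dc X1 Y2 p h + Dc X1 ?B p h)"
    by (rule CC.conn_add_right[OF X(1) Y(2) Bv CC.funs_const p])
  finally have 1: "pf (Dc X1 Y1 p) = pf (Dc X1 Y2 p)"
    by (simp only: pf_add conn_vertical[OF X(1) B p]) simp
  have "Dc X1 Y2 p = Dc (\<lambda>q h. X2 q h + ?A q h) Y2 p" by simp
  also have "\<dots> = (\<lambda>h. Dc X2 Y2 p h + Dc ?A Y2 p h)"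
    by (rule CC.conn_add_left[OF X(2) Av Y(2) CC.funs_const p])
  finally have 2: "pf (Dc X1 Y2 p) = (\<lambda>h. pf (Dc X2 Y2 p) h + pf (Dc ?A Y2 p) h)"
    by (simp only: pf_add)
  have "Dc ?A Y2 p = (\<lambda>h. Dc Y2 ?A p h + lie_bracket ?A Y2 p h)"
  proof
    fix h
    have "Dc ?A Y2 p h - Dc Y2 ?A p h = lie_bracket ?A Y2 p h"
      using tf Av Y(2) p unfolding torsionless_def by blast
    then show "Dc ?A Y2 p h = Dc Y2 ?A p h + lie_bracket ?A Y2 p h" by linarith
  qed
  then have "pf (Dc ?A Y2 p) = (\<lambda>h. pf (Dc Y2 ?A p) h + pf (lie_bracket ?A Y2 p) h)"
    by (simp only: pf_add)
  also have "pf (Dc Y2 ?A p) = (\<lambda>_. 0)" by (rule conn_vertical[OF Y(2) A p])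
  also have "pf (lie_bracket ?A Y2 p) = lie_bracket (\<lambda>_ _. 0) Y' (\<pi> p)"
    by (rule bracket_projects[OF Av vertical_lifts[OF A] vector_field_zero Y(2,4) Y' p])
  also have "lie_bracket (\<lambda>_ _. 0) Y' (\<pi> p) = (\<lambda>_. 0)"
    using tangent_const[OF vector_field_tangent[OF Y']] pi_point[OF p] by (simp add: lie_bracket_def)
  finally show ?thesis using 1 2 by simp
qed

subsection \<open>Lifting vector fields\<close>

text \<open>Submersivity supplies preimages of the frame vectors one point at a time, with no smooth
  dependence. Extended arbitrarily and corrected by \<open>dual_frame\<close> for the functions
  \<open>y j \<circ> \<pi>\<close>, they become fields that lift the frame on a whole neighbourhood,
  since a vector below is determined by its values on the \<open>y j\<close>.\<close>

lemma local_lift: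
  assumes X': "vector_field S X'" and p: "p \<in> points SC"
  shows "\<exists>X W. vector_field SC X \<and> openin \<tau>C W \<and> p \<in> W \<and> (\<forall>q\<in>W \<inter> points SC. pf (X q) = X' (\<pi> q))"
proof -
  obtain y E W where W: "openin \<tau> W" "\<pi> p \<in> W" and y': "\<forall>i<dm. y i \<in> funs S" and E': "\<forall>i<dm. vector_field S (E i)"
    and dual: "\<forall>q\<in>W. \<forall>i<dm. \<forall>j<dm. E i q (y j) = (if i = j then 1 else 0)"
    and expand: "\<forall>q\<in>W. \<forall>v\<in>tangent S q. v = (\<lambda>f. \<Sum>i<dm. v (y i) * E i q f)"
    by (rule frame_exists[OF pi_point[OF p]])
  have y: "y i \<in> funs S" and E: "vector_field S (E i)" if "i < dm" for i using y' E' that by auto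
  have "\<exists>Z. vector_field SC Z \<and> pf (Z p) = E i (\<pi> p)" if i: "i < dm" for i
  proof -
    have "E i (\<pi> p) \<in> pf ` tangent SC p"
      using vector_field_tangent[OF E[OF i]] pi_point[OF p] pf_image[OF p] by simp
    then obtain z where z: "z \<in> tangent SC p" "E i (\<pi> p) = pf z" by auto
    then show ?thesis using extend[OF p z(1)] by auto
  qed
  then obtain Z where Z: "\<And>i. i < dm \<Longrightarrow> vector_field SC (Z i)" "\<And>i. i < dm \<Longrightarrow> pf (Z i p) = E i (\<pi> p)"
    by metis
  have "\<exists>F B. (\<forall>i<dm. vector_field SC (F i)) \<and> openin \<tau>C B \<and> p \<in> B \<and>
    (\<forall>q\<in>B \<inter> points SC. \<forall>i<dm. \<forall>j<dm. F i q (y j \<circ> \<pi>) = (if i = j then 1 else 0))"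
  proof (rule CC.dual_frame[OF p pi_funs[OF y] Z(1)])
    fix i j assume ij: "i < dm" "j < dm"
    have "Z i p (y j \<circ> \<pi>) = E i (\<pi> p) (y j)" using pf_apply[OF y[OF ij(2)], of "Z i p"] Z(2)[OF ij(1)] by simp
    then show "Z i p (y j \<circ> \<pi>) = (if i = j then 1 else 0)" using dual W(2) ij by simp
  qed
  then obtain F B where F': "\<forall>i<dm. vector_field SC (F i)" and B: "openin \<tau>C B" "p \<in> B"
    and FB: "\<forall>q\<in>B \<inter> points SC. \<forall>i<dm. \<forall>j<dm. F i q (y j \<circ> \<pi>) = (if i = j then 1 else 0)"
    by (elim exE conjE)
  obtain U where U: "openin \<tau>C U" "p \<in> U" "\<forall>q\<in>U \<inter> points SC. \<pi> q \<in> W" by (rule pi_continuous[OF W(1) p W(2)])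
  define X where "X = (\<lambda>q h. \<Sum>i<dm. ((\<lambda>n. X' n (y i)) \<circ> \<pi>) q * F i q h)"
  have X: "vector_field SC X" unfolding X_def
    by (rule CC.vector_field_sum, rule pi_funs[OF vector_field_funs[OF X' y]], simp, use F' in simp)
  have "pf (X q) = X' (\<pi> q)" if q: "q \<in> B \<inter> U \<inter> points SC" for q
  proof -
    have qW: "\<pi> q \<in> W" "q \<in> points SC" using q U(3) by auto
    have t: "pf (X q) \<in> tangent S (\<pi> q)" by (rule pf_tangent[OF qW(2) CC.vector_field_tangent[OF X qW(2)]])
    have t': "X' (\<pi> q) \<in> tangent S (\<pi> q)" using vector_field_tangent[OF X'] pi_point[OF qW(2)] by simp
    have eq: "pf (X q) (y j) = X' (\<pi> q) (y j)" if j: "j < dm" for j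
    proof -
      have "pf (X q) (y j) = (\<Sum>i<dm. X' (\<pi> q) (y i) * F i q (y j \<circ> \<pi>))"
        unfolding pf_apply[OF y[OF j]] by (simp add: X_def)
      also have "\<dots> = (\<Sum>i<dm. if i = j then X' (\<pi> q) (y i) else 0)"
        by (rule sum.cong) (use FB q j in auto)
      finally show ?thesis using j by simp
    qed
    have "pf (X q) = (\<lambda>f. \<Sum>i<dm. pf (X q) (y i) * E i (\<pi> q) f)" using expand qW(1) t by blast
    also have "\<dots> = (\<lambda>f. \<Sum>i<dm. X' (\<pi> q) (y i) * E i (\<pi> q) f)" using eq by simp
    also have "\<dots> = X' (\<pi> q)" using expand qW(1) t' by metis
    finally show ?thesis .
  qed
  then show ?thesis using X openin_Int[OF B(1) U(1)] B(2) U(2)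
    by (intro exI[of _ X] exI[of _ "B \<inter> U"]) simp
qed

text \<open>Local lifts are glued with the functions \<open>\<rho> i * (\<Prod>j<i. 1 - \<rho> j)\<close>, where \<open>\<rho> i = 1\<close> on \<open>B i\<close>
  and the countably many \<open>B i\<close> cover. Only the first \<open>k + 1\<close> of them are nonzero on \<open>B k\<close>.\<close>

lemma lift_exists:
  assumes X': "vector_field S X'"
  shows "\<exists>X. vector_field SC X \<and> lifts X X'"
proof (cases "points SC = {}")
  case True
  then show ?thesis using CC.vector_field_zero by (intro exI[of _ "\<lambda>_ _. 0"]) (simp add: projects_to_def)
next
  case False
  \<comment> \<open>The local lift need not project correctly where \<rho> vanishes; there its
    weight in the final sum is 0.\<close>
  let ?good = "\<lambda>p X \<rho> B. vector_field SC X \<and> \<rho> \<in> funs SC \<and> openin \<tau>C B \<and> p \<in> B \<and> (\<forall>q\<in>B. \<rho> q = 1) \<and>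
      (\<forall>q\<in>points SC. \<rho> q \<noteq> 0 \<longrightarrow> pf (X q) = X' (\<pi> q))"
  have "\<exists>X \<rho> B. ?good p X \<rho> B" if p: "p \<in> points SC" for p
  proof -
    obtain X W where X: "vector_field SC X" "openin \<tau>C W" "p \<in> W" "\<forall>q\<in>W \<inter> points SC. pf (X q) = X' (\<pi> q)"
      using local_lift[OF X' p] by (elim exE conjE)
    obtain \<rho> B K where \<rho>: "\<rho> \<in> funs SC" "openin \<tau>C B" "p \<in> B" "B \<subseteq> K" "closedin \<tau>C K" "K \<subseteq> W"
      "\<forall>q\<in>B. \<rho> q = 1" "\<forall>q. q \<notin> K \<longrightarrow> \<rho> q = 0" using CC.bump[OF p X(2,3)] by (elim exE conjE)
    have "\<forall>q\<in>points SC. \<rho> q \<noteq> 0 \<longrightarrow> pf (X q) = X' (\<pi> q)" using \<rho>(6,8) X(4) by blast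
    then show ?thesis using X(1) \<rho>(1,2,3,7) by (intro exI[of _ X] exI[of _ \<rho>] exI[of _ B] conjI)
  qed
  then obtain X \<rho> B where good: "\<And>p. p \<in> points SC \<Longrightarrow> ?good p (X p) (\<rho> p) (B p)" by metis
  have "Lindelof_space (subtopology \<tau>C (points SC))"
    by (rule second_countable_imp_Lindelof_space[OF second_countable_subtopology[OF sc]])
  moreover have "\<forall>U\<in>B ` points SC. openin \<tau>C U" "points SC \<subseteq> \<Union>(B ` points SC)" using good by auto
  ultimately obtain \<V> where \<V>: "countable \<V>" "\<V> \<subseteq> B ` points SC" "points SC \<subseteq> \<Union>\<V>"
    using Lindelof_space_subtopology_subset[OF CC.points_subset] by meson
  have ne: "\<V> \<noteq> {}" using \<V>(3) False by auto
  \<comment> \<open>The enumeration may repeat members, so a finite cover needs no separate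
    treatment; it only requires the cover to be nonempty.\<close>
  have "\<exists>p. p \<in> points SC \<and> B p = from_nat_into \<V> k" for k
    using from_nat_into[OF ne, of k] \<V>(2) by (metis imageE subsetD)
  then obtain c where c: "\<And>k. c k \<in> points SC" "\<And>k. B (c k) = from_nat_into \<V> k" by metis
  have cover: "\<exists>k. q \<in> B (c k)" if q: "q \<in> points SC" for q
  proof -
    obtain U where "U \<in> \<V>" "q \<in> U" using \<V>(3) q by blast
    then show ?thesis using from_nat_into_surj[OF \<V>(1)] c(2) by metis
  qed
  define r where "r = (\<lambda>k. \<rho> (c k))"
  define ch where "ch = (\<lambda>i q. r i q * (\<Prod>j<i. 1 - r j q))"
  define Z where "Z = (\<lambda>k q h. \<Sum>i<k. ch i q * X (c i) q h)"
  have r: "r k \<in> funs SC" "\<And>q. q \<in> B (c k) \<Longrightarrow> r k q = 1"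
    "\<And>q. q \<in> points SC \<Longrightarrow> r k q \<noteq> 0 \<Longrightarrow> pf (X (c k) q) = X' (\<pi> q)" for k
    using good[OF c(1)] by (simp_all add: r_def)
  have ch: "ch i \<in> funs SC" for i unfolding ch_def
    by (intro CC.funs_mult CC.funs_prod CC.funs_diff CC.funs_const r(1))
  have Z: "vector_field SC (Z k)" for k unfolding Z_def
    by (rule CC.vector_field_sum) (use ch good[OF c(1)] in auto)
  define m where "m = (\<lambda>q. LEAST k. q \<in> B (c k))"
  have m: "q \<in> B (c (m q))" "m q \<le> k" if "q \<in> B (c k)" for q k
    using LeastI[of "\<lambda>k. q \<in> B (c k)" k] Least_le[of "\<lambda>k. q \<in> B (c k)" k] that by (simp_all add: m_def)
  have ch0: "ch i q = 0" if "q \<in> B (c k)" "k < i" for i k q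
  proof -
    have "(\<Prod>j<i. 1 - r j q) = 0" using r(2)[OF that(1)] that(2) by (intro prod_zero) auto
    then show ?thesis by (simp add: ch_def)
  qed
  define Y where "Y = (\<lambda>q. Z (Suc (m q)) q)"
  have YZ: "Y q = Z (Suc k) q" if q: "q \<in> B (c k)" for q k
  proof
    fix h
    have "(\<Sum>i<Suc (m q). ch i q * X (c i) q h) = (\<Sum>i<Suc k. ch i q * X (c i) q h)"
      by (rule sum.mono_neutral_left) (use m[OF q] ch0[OF m(1)[OF q]] in auto)
    then show "Y q h = Z (Suc k) q h" by (simp add: Y_def Z_def)
  qed
  have Yv: "vector_field SC Y"
  proof (rule CC.vector_field_glue)
    fix p assume "p \<in> points SC"
    then obtain k where k: "p \<in> B (c k)" using cover by blast
    have "openin \<tau>C (B (c k))" using good[OF c(1)] by simp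
    then show "\<exists>W Y'. openin \<tau>C W \<and> p \<in> W \<and> vector_field SC Y' \<and> (\<forall>q\<in>W \<inter> points SC. Y' q = Y q)"
      using k Z YZ[of _ k] by (intro exI[of _ "B (c k)"] exI[of _ "Z (Suc k)"]) simp
  qed
  have YX: "pf (Y q) h = X' (\<pi> q) h" if q: "q \<in> points SC" for q h
  proof -
    obtain k where k: "q \<in> B (c k)" using cover[OF q] by blast
    have q': "\<pi> q \<in> points S" using pi_point[OF q] by simp
    show "pf (Y q) h = X' (\<pi> q) h"
    proof (cases "h \<in> funs S")
      case True
      have "pf (Y q) h = (\<Sum>i<Suc (m q). ch i q * pf (X (c i) q) h)"
        unfolding pf_apply[OF True] Y_def Z_def ..
      also have "\<dots> = (\<Sum>i<Suc (m q). ch i q * X' (\<pi> q) h)"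
      proof (rule sum.cong[OF refl])
        fix i
        show "ch i q * pf (X (c i) q) h = ch i q * X' (\<pi> q) h"
          using r(3)[OF q, of i] by (cases "r i q = 0") (simp_all add: ch_def)
      qed
      also have "\<dots> = (1 - (\<Prod>j<Suc (m q). 1 - r j q)) * X' (\<pi> q) h"
        unfolding sum_distrib_right[symmetric] ch_def telescoping_partition ..
      also have "(\<Prod>j<Suc (m q). 1 - r j q) = 0"
        using r(2)[OF m(1)[OF k]] by simp
      finally show ?thesis by simp
    next
      case False
      then show ?thesis using pf_notin tangent_notin[OF vector_field_tangent[OF X' q']] by simp
    qed
  qed
  have "lifts Y X'" unfolding projects_to_def by (rule ballI, rule ext, rule YX)
  then show ?thesis using Yv by blast
qed

subsection \<open>Descent of smooth functions\<close>

text \<open>The integral curves of lifts of the coordinate fields project to straight lines in the chart.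
  They show that the coordinate representation of \<open>g\<close> is continuous and that its directional
  derivatives are functions of the same kind, whence smoothness by induction.\<close>

lemma descent:
  assumes g0: "g0 \<circ> \<pi> \<in> funs SC"
  shows "g0 \<in> funs S"
proof (rule funs_chartI)
  fix n0 assume n0: "n0 \<in> topspace \<tau>"
  obtain U \<psi> where c: "(U, \<psi>) \<in> atlas N" "n0 \<in> U" by (rule chart_exists[OF n0])
  note c1 = c(1)
  obtain y E W where W: "openin \<tau> W" "n0 \<in> W" "W \<subseteq> U" and y': "\<forall>i<dm. y i \<in> funs S" and E': "\<forall>i<dm. vector_field S (E i)"
    and yq: "\<forall>i<dm. \<forall>q\<in>W. y i q = \<psi> q \<bullet> ev i"
    and "\<forall>i<dm. \<forall>q\<in>W. \<forall>f\<in>funs S. E i q f = frechet_derivative (rep U \<psi> f) (at (\<psi> q)) (ev i)"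
    and dual: "\<forall>q\<in>W. \<forall>i<dm. \<forall>j<dm. E i q (y j) = (if i = j then 1 else 0)"
    and "\<forall>q\<in>W. \<forall>v\<in>tangent S q. v = (\<lambda>f. \<Sum>i<dm. v (y i) * E i q f)"
    by (rule chart_frame[OF c])
  have y: "y i \<in> funs S" if "i < dm" for i using y' that by auto
  have "\<exists>X. vector_field SC X \<and> lifts X (E i)" if "i < dm" for i
    by (rule lift_exists) (use E' that in auto)
  then obtain X where X: "\<And>i. i < dm \<Longrightarrow> vector_field SC (X i)" "\<And>i. i < dm \<Longrightarrow> lifts (X i) (E i)" by metis
  obtain T0 where T0: "open T0" "\<psi> ` W = T0 \<inter> V" by (rule chart_open_image[OF c1 W(1,3)])
  define T where "T = {z. prj z \<in> T0}"
  have oT: "open T" unfolding T_def by (rule open_prj_vimage[OF T0(1)])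
  define pt where "pt = (\<lambda>z. inv_into U \<psi> (prj z))"
  have pt\<psi>: "pt (\<psi> n) = n" "\<psi> n \<in> T" if n: "n \<in> W" for n
  proof -
    have nU: "n \<in> U" using n W(3) by auto
    show "pt (\<psi> n) = n" unfolding pt_def chart_cdom(2)[OF c1 nU] by (rule inv_into_f_f[OF chart_inj[OF c1] nU])
    have "\<psi> n \<in> T0 \<inter> V" using T0(2) n by blast
    then show "\<psi> n \<in> T" using prj_id by (simp add: T_def)
  qed
  have pt: "pt z \<in> W" "\<psi> (pt z) = prj z" if z: "z \<in> T" for z
  proof -
    have "prj z \<in> \<psi> ` W" using z T0(2) prj_V by (auto simp: T_def)
    then obtain n where n: "n \<in> W" "prj z = \<psi> n" by auto
    then have "pt z = n" using W(3) inv_into_f_f[OF chart_inj[OF c1]] by (auto simp: pt_def)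
    then show "pt z \<in> W" "\<psi> (pt z) = prj z" using n by auto
  qed
  have pt_eq: "pt z = n" if "n \<in> W" "prj z = \<psi> n" for z n
    using that W(3) inv_into_f_f[OF chart_inj[OF c1]] by (auto simp: pt_def)
  have rep: "rep U \<psi> g z = g (pt z)" for g z by (simp add: rep_def pt_def)
  \<comment> \<open>Every chart point within \<delta> of the image of \<open>p\<close> is reached at
    time 1 by a curve inside \<open>U0\<close>; this uniformity in \<open>w\<close> is what
    continuity needs. The line appears because each coordinate minus its linear expression in the
    time has derivative 0.\<close>
  have straight: "\<exists>\<delta>>0. \<forall>w\<in>V. norm w < \<delta> \<longrightarrow> (\<exists>\<gamma>. \<gamma> 0 = p \<and>
      (\<forall>t\<in>{-2<..<2::real}. \<gamma> t \<in> U0 \<inter> points SC \<and> \<pi> (\<gamma> t) \<in> W \<and> \<psi> (\<pi> (\<gamma> t)) = \<psi> (\<pi> p) + t *\<^sub>R w) \<and>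
      (\<forall>h\<in>funs SC. \<forall>t\<in>{-2<..<2}. ((h \<circ> \<gamma>) has_real_derivative (\<Sum>j<dm. (w \<bullet> ev j) * X j (\<gamma> t) h)) (at t)))"
    if p: "p \<in> points SC" "\<pi> p \<in> W" and U0: "openin \<tau>C U0" "p \<in> U0" for p U0
  proof -
    obtain U1 where U1: "openin \<tau>C U1" "p \<in> U1" "\<forall>q\<in>U1 \<inter> points SC. \<pi> q \<in> W" by (rule pi_continuous[OF W(1) p])
    have pU: "p \<in> U0 \<inter> U1" using U0 U1 by simp
    have Xv: "\<forall>j<dm. vector_field SC (X j)" using X by simp
    obtain \<delta> where \<delta>: "0 < \<delta>" "\<forall>w. (\<forall>j<dm. \<bar>w j\<bar> < \<delta>) \<longrightarrow> (\<exists>\<gamma>. \<gamma> 0 = p \<and>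
        (\<forall>t\<in>{-2<..<2::real}. \<gamma> t \<in> (U0 \<inter> U1) \<inter> points SC) \<and>
        (\<forall>h\<in>funs SC. \<forall>t\<in>{-2<..<2}. ((h \<circ> \<gamma>) has_real_derivative (\<Sum>j<dm. w j * X j (\<gamma> t) h)) (at t)))"
      using curves[OF Xv p(1) openin_Int[OF U0(1) U1(1)] pU] by (elim exE conjE)
    show ?thesis
    proof (intro exI[of _ \<delta>] conjI \<delta>(1) ballI impI)
      fix w assume wV: "w \<in> V" and w: "norm w < \<delta>"
      have "\<bar>w \<bullet> ev j\<bar> < \<delta>" if "j < dm" for j
      proof -
        have "norm (ev j) = 1" using ev_inner[OF that that] by (simp add: norm_eq_1)
        then show ?thesis using Cauchy_Schwarz_ineq2[of w "ev j"] w by simp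
      qed
      then have "\<forall>j<dm. \<bar>(\<lambda>j. w \<bullet> ev j) j\<bar> < \<delta>" by simp
      from mp[OF spec[OF \<delta>(2), of "\<lambda>j. w \<bullet> ev j"] this]
      obtain \<gamma> where \<gamma>: "\<gamma> 0 = p" "\<forall>t\<in>{-2<..<2::real}. \<gamma> t \<in> (U0 \<inter> U1) \<inter> points SC"
        "\<forall>h\<in>funs SC. \<forall>t\<in>{-2<..<2}. ((h \<circ> \<gamma>) has_real_derivative (\<Sum>j<dm. (w \<bullet> ev j) * X j (\<gamma> t) h)) (at t)"
        by (elim exE conjE)
      have \<gamma>W: "\<pi> (\<gamma> t) \<in> W" if "t \<in> {-2<..<2}" for t using \<gamma>(2) U1(3) that by blast
      have line: "\<psi> (\<pi> (\<gamma> t)) = \<psi> (\<pi> p) + t *\<^sub>R w" if t: "t \<in> {-2<..<2}" for t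
      proof -
        have co: "\<psi> (\<pi> (\<gamma> t)) \<bullet> ev i = (\<psi> (\<pi> p) + t *\<^sub>R w) \<bullet> ev i" if i: "i < dm" for i
        proof -
          have d: "((\<lambda>s. (y i \<circ> \<pi> \<circ> \<gamma>) s - s * (w \<bullet> ev i)) has_real_derivative 0) (at s within {-2<..<2})"
            if s: "s \<in> {-2<..<2}" for s
          proof -
            have sp: "\<gamma> s \<in> points SC" using \<gamma>(2) s by blast
            have "(\<Sum>j<dm. (w \<bullet> ev j) * X j (\<gamma> s) (y i \<circ> \<pi>)) = (\<Sum>j<dm. if j = i then w \<bullet> ev j else 0)"
            proof (rule sum.cong[OF refl])
              fix j assume "j \<in> {..<dm}"
              then have j: "j < dm" by simp
              have "X j (\<gamma> s) (y i \<circ> \<pi>) = E j (\<pi> (\<gamma> s)) (y i)" by (rule lifts_apply[OF X(2)[OF j] sp y[OF i]])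
              then show "(w \<bullet> ev j) * X j (\<gamma> s) (y i \<circ> \<pi>) = (if j = i then w \<bullet> ev j else 0)"
                using dual \<gamma>W[OF s] i j by simp
            qed
            also have "\<dots> = w \<bullet> ev i" using i by simp
            finally have "((y i \<circ> \<pi> \<circ> \<gamma>) has_real_derivative (w \<bullet> ev i)) (at s)"
              using bspec[OF bspec[OF \<gamma>(3) pi_funs[OF y[OF i]]] s] by (simp add: o_assoc)
            from DERIV_diff[OF this DERIV_cmult_right[OF DERIV_ident, of "w \<bullet> ev i"]]
            have "((\<lambda>s. (y i \<circ> \<pi> \<circ> \<gamma>) s - s * (w \<bullet> ev i)) has_real_derivative 0) (at s)" by simp
            then show ?thesis by (rule has_field_derivative_at_within)
          qed
          have "\<exists>k. \<forall>s\<in>{-2<..<2}. (y i \<circ> \<pi> \<circ> \<gamma>) s - s * (w \<bullet> ev i) = k"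
            by (rule has_field_derivative_zero_constant[OF _ d]) (simp_all add: convex_real_interval)
          then obtain k where k: "\<forall>s\<in>{-2<..<2::real}. (y i \<circ> \<pi> \<circ> \<gamma>) s - s * (w \<bullet> ev i) = k" ..
          have "0 \<in> {-2<..<2::real}" by simp
          from bspec[OF k this] bspec[OF k t] have "y i (\<pi> (\<gamma> t)) = y i (\<pi> p) + t * (w \<bullet> ev i)"
            using \<gamma>(1) by simp
          then show ?thesis using yq i \<gamma>W[OF t] p(2) by (simp add: inner_add_left)
        qed
        have 1: "\<psi> (\<pi> (\<gamma> t)) \<in> V" "\<psi> (\<pi> p) \<in> V" using chart_V[OF c1] \<gamma>W[OF t] p(2) W(3) by auto
        then have 2: "\<psi> (\<pi> p) + t *\<^sub>R w \<in> V"
          by (intro subspace_add[OF subspace_V] subspace_scale[OF subspace_V] wV)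
        have "\<psi> (\<pi> (\<gamma> t)) = (\<Sum>i<dm. (\<psi> (\<pi> (\<gamma> t)) \<bullet> ev i) *\<^sub>R ev i)" by (rule V_expand[OF 1(1)])
        also have "\<dots> = (\<Sum>i<dm. ((\<psi> (\<pi> p) + t *\<^sub>R w) \<bullet> ev i) *\<^sub>R ev i)" using co by simp
        also have "\<dots> = \<psi> (\<pi> p) + t *\<^sub>R w" by (rule V_expand[OF 2, symmetric])
        finally show ?thesis .
      qed
      show "\<exists>\<gamma>. \<gamma> 0 = p \<and>
      (\<forall>t\<in>{-2<..<2::real}. \<gamma> t \<in> U0 \<inter> points SC \<and> \<pi> (\<gamma> t) \<in> W \<and> \<psi> (\<pi> (\<gamma> t)) = \<psi> (\<pi> p) + t *\<^sub>R w) \<and>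
      (\<forall>h\<in>funs SC. \<forall>t\<in>{-2<..<2}. ((h \<circ> \<gamma>) has_real_derivative (\<Sum>j<dm. (w \<bullet> ev j) * X j (\<gamma> t) h)) (at t))"
        using \<gamma> \<gamma>W line by (intro exI[of _ \<gamma>] conjI ballI) auto
    qed
  qed
  \<comment> \<open>The local form is what makes this class closed under coordinate derivatives:
    these are controlled only over \<open>W\<close>, so their pullbacks need not be restrictions of
    one global function.\<close>
  define Q where "Q = (\<lambda>g. \<forall>p\<in>points SC. \<pi> p \<in> W \<longrightarrow> (\<exists>U0 F. openin \<tau>C U0 \<and> p \<in> U0 \<and> F \<in> funs SC \<and>
    (\<forall>q\<in>U0 \<inter> points SC. F q = g (\<pi> q))))"
  have Qcont: "continuous_on T (rep U \<psi> g)" if Qg: "Q g" for g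
  proof -
    have "continuous (at z) (rep U \<psi> g)" if z: "z \<in> T" for z
      unfolding continuous_at_eps_delta
    proof (intro allI impI)
      fix \<epsilon> :: real assume \<epsilon>: "0 < \<epsilon>"
      have "pt z \<in> topspace \<tau>" using pt(1)[OF z] openin_subset[OF W(1)] by auto
      then obtain p where p: "p \<in> points SC" "\<pi> p = pt z" by (rule pi_surj)
      have pW: "\<pi> p \<in> W" using p pt(1)[OF z] by simp
      obtain U0 F where F: "openin \<tau>C U0" "p \<in> U0" "F \<in> funs SC" "\<forall>q\<in>U0 \<inter> points SC. F q = g (\<pi> q)"
        using mp[OF bspec[OF Qg[unfolded Q_def] p(1)] pW] by (elim exE conjE)
      obtain U1 where U1: "openin \<tau>C U1" "p \<in> U1" "\<forall>q\<in>U1 \<inter> points SC. \<bar>F q - F p\<bar> < \<epsilon>"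
        using funs_continuous[OF F(3) p(1) \<epsilon>] by (elim exE conjE)
      have pU: "p \<in> U0 \<inter> U1" using F U1 by simp
      obtain \<delta> where \<delta>: "0 < \<delta>" "\<forall>w\<in>V. norm w < \<delta> \<longrightarrow> (\<exists>\<gamma>. \<gamma> 0 = p \<and>
        (\<forall>t\<in>{-2<..<2::real}. \<gamma> t \<in> (U0 \<inter> U1) \<inter> points SC \<and> \<pi> (\<gamma> t) \<in> W \<and> \<psi> (\<pi> (\<gamma> t)) = \<psi> (\<pi> p) + t *\<^sub>R w) \<and>
        (\<forall>h\<in>funs SC. \<forall>t\<in>{-2<..<2}. ((h \<circ> \<gamma>) has_real_derivative (\<Sum>j<dm. (w \<bullet> ev j) * X j (\<gamma> t) h)) (at t)))"
        using straight[OF p(1) pW openin_Int[OF F(1) U1(1)] pU] by (elim exE conjE)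
      have "open {z'. prj z' \<in> ball (prj z) \<delta>}" by (rule open_prj_vimage) simp
      moreover have "z \<in> {z'. prj z' \<in> ball (prj z) \<delta>}" using \<delta>(1) by simp
      ultimately obtain \<eta> where \<eta>: "0 < \<eta>" "ball z \<eta> \<subseteq> {z'. prj z' \<in> ball (prj z) \<delta>}"
        using open_contains_ball by metis
      have "dist (rep U \<psi> g z') (rep U \<psi> g z) < \<epsilon>" if z': "dist z' z < \<eta>" for z'
      proof -
        define w where "w = prj z' - prj z"
        have wV: "w \<in> V" unfolding w_def by (intro subspace_diff[OF subspace_V] prj_V)
        have "z' \<in> ball z \<eta>" using z' by (simp add: dist_commute)
        then have "z' \<in> {z'. prj z' \<in> ball (prj z) \<delta>}" using \<eta>(2) by blast
        then have "norm w < \<delta>" by (simp add: w_def dist_norm norm_minus_commute)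
        from mp[OF bspec[OF \<delta>(2) wV] this] obtain \<gamma> where \<gamma>: "\<gamma> 0 = p"
          "\<forall>t\<in>{-2<..<2::real}. \<gamma> t \<in> (U0 \<inter> U1) \<inter> points SC \<and> \<pi> (\<gamma> t) \<in> W \<and> \<psi> (\<pi> (\<gamma> t)) = \<psi> (\<pi> p) + t *\<^sub>R w"
          by (elim exE conjE)
        have "1 \<in> {-2<..<2::real}" by simp
        from bspec[OF \<gamma>(2) this] have q: "\<gamma> 1 \<in> U0 \<inter> points SC" "\<gamma> 1 \<in> U1 \<inter> points SC" "\<pi> (\<gamma> 1) \<in> W"
          "\<psi> (\<pi> (\<gamma> 1)) = prj z'" using p(2) pt(2)[OF z] by (auto simp: w_def)
        have "pt z' = \<pi> (\<gamma> 1)" using pt_eq[OF q(3)] q(4) by simp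
        then have "rep U \<psi> g z' = F (\<gamma> 1)" using F(4) q(1) by (simp add: rep)
        moreover have "rep U \<psi> g z = F p" using F(2,4) p by (simp add: rep)
        ultimately show ?thesis using U1(3) q(2) by (simp add: dist_real_def)
      qed
      then show "\<exists>\<eta>>0. \<forall>z'. dist z' z < \<eta> \<longrightarrow> dist (rep U \<psi> g z') (rep U \<psi> g z) < \<epsilon>" using \<eta>(1) by blast
    qed
    then show ?thesis by (simp add: continuous_at_imp_continuous_on)
  qed
  have Qdir: "((\<lambda>t. rep U \<psi> g (z + t *\<^sub>R v)) has_real_derivative (\<Sum>j<dm. (v \<bullet> ev j) * X j p F)) (at 0)"
    if z: "z \<in> T" and p: "p \<in> points SC" "\<pi> p = pt z"
      and F: "openin \<tau>C U0" "p \<in> U0" "F \<in> funs SC" "\<forall>q\<in>U0 \<inter> points SC. F q = g (\<pi> q)" for g z v p U0 F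
  proof -
    have pW: "\<pi> p \<in> W" using p pt(1)[OF z] by simp
    obtain \<delta> where \<delta>: "0 < \<delta>" "\<forall>w\<in>V. norm w < \<delta> \<longrightarrow> (\<exists>\<gamma>. \<gamma> 0 = p \<and>
      (\<forall>t\<in>{-2<..<2::real}. \<gamma> t \<in> U0 \<inter> points SC \<and> \<pi> (\<gamma> t) \<in> W \<and> \<psi> (\<pi> (\<gamma> t)) = \<psi> (\<pi> p) + t *\<^sub>R w) \<and>
      (\<forall>h\<in>funs SC. \<forall>t\<in>{-2<..<2}. ((h \<circ> \<gamma>) has_real_derivative (\<Sum>j<dm. (w \<bullet> ev j) * X j (\<gamma> t) h)) (at t)))"
      using straight[OF p(1) pW F(1,2)] by (elim exE conjE)
    \<comment> \<open>The direction is shortened below \<delta> so that a curve exists, and the time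
      is stretched by \<open>inverse k\<close> to compensate. The summand 1 covers a direction with
      projection 0.\<close>
    define k where "k = \<delta> / (norm (prj v) + 1) / 2"
    have k: "0 < k" using \<delta>(1) by (simp add: k_def add_nonneg_pos)
    have "norm (k *\<^sub>R prj v) = k * norm (prj v)" using k by simp
    also have "\<dots> = \<delta> / 2 * (norm (prj v) / (norm (prj v) + 1))" by (simp add: k_def)
    also have "\<dots> \<le> \<delta> / 2 * 1"
      using \<delta>(1) by (intro mult_left_mono) (auto simp: divide_le_eq add_nonneg_pos)
    also have "\<dots> < \<delta>" using \<delta>(1) by simp
    finally have nk: "norm (k *\<^sub>R prj v) < \<delta>" .
    have kV: "k *\<^sub>R prj v \<in> V" by (rule subspace_scale[OF subspace_V prj_V])
    from mp[OF bspec[OF \<delta>(2) kV] nk] obtain \<gamma> where \<gamma>: "\<gamma> 0 = p"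
      "\<forall>t\<in>{-2<..<2::real}. \<gamma> t \<in> U0 \<inter> points SC \<and> \<pi> (\<gamma> t) \<in> W \<and> \<psi> (\<pi> (\<gamma> t)) = \<psi> (\<pi> p) + t *\<^sub>R (k *\<^sub>R prj v)"
      "\<forall>h\<in>funs SC. \<forall>t\<in>{-2<..<2}. ((h \<circ> \<gamma>) has_real_derivative (\<Sum>j<dm. (k *\<^sub>R prj v \<bullet> ev j) * X j (\<gamma> t) h)) (at t)"
      by (elim exE conjE)
    let ?I = "{-2 * k<..<2 * k}"
    have eq: "(F \<circ> \<gamma>) (inverse k * t) = rep U \<psi> g (z + t *\<^sub>R v)" if t: "t \<in> ?I" for t
    proof -
      have "inverse k * t \<in> {-2<..<2}" using t k by (auto simp: field_simps)
      from bspec[OF \<gamma>(2) this] have q: "\<gamma> (inverse k * t) \<in> U0 \<inter> points SC" "\<pi> (\<gamma> (inverse k * t)) \<in> W"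
        "\<psi> (\<pi> (\<gamma> (inverse k * t))) = \<psi> (\<pi> p) + t *\<^sub>R prj v" using k by auto
      have "prj (z + t *\<^sub>R v) = prj z + t *\<^sub>R prj v"
        using bounded_linear_prj by (simp add: linear_simps)
      then have "pt (z + t *\<^sub>R v) = \<pi> (\<gamma> (inverse k * t))" using pt_eq[OF q(2)] q(3) p(2) pt(2)[OF z] by simp
      then show ?thesis using F(4) q(1) by (simp add: rep)
    qed
    have "0 \<in> {-2<..<2::real}" by simp
    from bspec[OF bspec[OF \<gamma>(3) F(3)] this]
    have "((F \<circ> \<gamma>) has_real_derivative (\<Sum>j<dm. (k *\<^sub>R prj v \<bullet> ev j) * X j p F)) (at (inverse k * 0))"
      using \<gamma>(1) by simp
    from DERIV_chain'[OF DERIV_cmult_Id this]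
    have "((\<lambda>t. (F \<circ> \<gamma>) (inverse k * t)) has_real_derivative
        (\<Sum>j<dm. (k *\<^sub>R prj v \<bullet> ev j) * X j p F) * inverse k) (at 0)" by (simp only:)
    moreover have "(\<Sum>j<dm. (k *\<^sub>R prj v \<bullet> ev j) * X j p F) * inverse k = (\<Sum>j<dm. (v \<bullet> ev j) * X j p F)"
      unfolding sum_distrib_right by (rule sum.cong) (use k prj_inner in auto)
    ultimately have "((\<lambda>t. (F \<circ> \<gamma>) (inverse k * t)) has_real_derivative (\<Sum>j<dm. (v \<bullet> ev j) * X j p F)) (at 0)"
      by simp
    then show ?thesis
      by (rule has_field_derivative_transform_within_open[where S="?I"]) (use k eq in auto)
  qed
  \<comment> \<open>Being defined on \<open>N\<close>, this derivative does not mention a point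
    above. Its equality with \<open>X j p F\<close> shows that the latter depends only on
    \<open>\<pi> p\<close>, so differentiating representatives by \<open>X j\<close> keeps
    \<open>G g j\<close> in the class \<open>Q\<close>.\<close>
  define G where "G = (\<lambda>g j n. deriv (\<lambda>t. rep U \<psi> g (\<psi> n + t *\<^sub>R ev j)) 0)"
  have G: "G g j (\<pi> p) = X j p F"
    if j: "j < dm" and p: "p \<in> points SC" "\<pi> p \<in> W"
      and F: "openin \<tau>C U0" "p \<in> U0" "F \<in> funs SC" "\<forall>q\<in>U0 \<inter> points SC. F q = g (\<pi> q)" for g j p U0 F
  proof -
    have "(\<Sum>i<dm. (ev j \<bullet> ev i) * X i p F) = (\<Sum>i<dm. if i = j then X i p F else 0)"
      by (rule sum.cong) (use j ev_inner in auto)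
    then show ?thesis
      unfolding G_def using DERIV_imp_deriv[OF Qdir[OF pt\<psi>(2)[OF p(2)] p(1) pt\<psi>(1)[OF p(2), symmetric] F, of "ev j"]] j by simp
  qed
  have QG: "Q (G g j)" if Qg: "Q g" and j: "j < dm" for g j
    unfolding Q_def
  proof (intro ballI impI)
    fix p assume p: "p \<in> points SC" "\<pi> p \<in> W"
    obtain U0 F where F: "openin \<tau>C U0" "p \<in> U0" "F \<in> funs SC" "\<forall>q\<in>U0 \<inter> points SC. F q = g (\<pi> q)"
      using mp[OF bspec[OF Qg[unfolded Q_def] p(1)] p(2)] by (elim exE conjE)
    obtain U1 where U1: "openin \<tau>C U1" "p \<in> U1" "\<forall>q\<in>U1 \<inter> points SC. \<pi> q \<in> W" by (rule pi_continuous[OF W(1) p])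
    have "X j q F = G g j (\<pi> q)" if q: "q \<in> (U0 \<inter> U1) \<inter> points SC" for q
      by (rule G[OF j _ _ F(1) _ F(3,4), symmetric]) (use q U1(3) in auto)
    then show "\<exists>U0 F. openin \<tau>C U0 \<and> p \<in> U0 \<and> F \<in> funs SC \<and> (\<forall>q\<in>U0 \<inter> points SC. F q = G g j (\<pi> q))"
      using openin_Int[OF F(1) U1(1)] F(2) U1(2) CC.vector_field_funs[OF X(1)[OF j] F(3)]
      by (intro exI[of _ "U0 \<inter> U1"] exI[of _ "\<lambda>q. X j q F"]) simp
  qed
  have dir: "((\<lambda>t. rep U \<psi> g (z + t *\<^sub>R v)) has_real_derivative (\<Sum>j<dm. (v \<bullet> ev j) * rep U \<psi> (G g j) z)) (at 0)"
    if Qg: "Q g" and z: "z \<in> T" for g z v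
  proof -
    have "pt z \<in> topspace \<tau>" using pt(1)[OF z] openin_subset[OF W(1)] by auto
    then obtain p where p: "p \<in> points SC" "\<pi> p = pt z" by (rule pi_surj)
    have pW: "\<pi> p \<in> W" using p pt(1)[OF z] by simp
    obtain U0 F where F: "openin \<tau>C U0" "p \<in> U0" "F \<in> funs SC" "\<forall>q\<in>U0 \<inter> points SC. F q = g (\<pi> q)"
      using mp[OF bspec[OF Qg[unfolded Q_def] p(1)] pW] by (elim exE conjE)
    have "(\<Sum>j<dm. (v \<bullet> ev j) * X j p F) = (\<Sum>j<dm. (v \<bullet> ev j) * rep U \<psi> (G g j) z)"
      by (rule sum.cong) (use G[OF _ p(1) pW F] p(2) in \<open>simp_all add: rep\<close>)
    then show ?thesis using Qdir[OF z p F, of v] by simp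
  qed
  have smooth: "Ck_on k T (rep U \<psi> g)" if "Q g" for k g
    using that
  proof (induction k arbitrary: g)
    case 0
    then show ?case using Qcont by simp
  next
    case (Suc k)
    show ?case
    proof (rule Ck_on_SucI[OF oT])
      fix z assume z: "z \<in> T"
      show "(rep U \<psi> g has_derivative (\<lambda>v. \<Sum>j<dm. (v \<bullet> ev j) * rep U \<psi> (G g j) z)) (at z)"
        by (rule has_derivative_from_directional[OF oT z dir[OF Suc.prems] Qcont[OF QG[OF Suc.prems]]])
    next
      fix v
      show "Ck_on k T (\<lambda>z. \<Sum>j<dm. (v \<bullet> ev j) * rep U \<psi> (G g j) z)"
        by (intro Ck_on_sum Ck_on_mult Ck_on_const oT Suc.IH QG[OF Suc.prems]) simp
    qed
  qed
  have "Q g0" unfolding Q_def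
  proof (intro ballI impI)
    fix p assume "p \<in> points SC"
    then have "p \<in> topspace \<tau>C" using CC.points_subset by blast
    then show "\<exists>U0 F. openin \<tau>C U0 \<and> p \<in> U0 \<and> F \<in> funs SC \<and> (\<forall>q\<in>U0 \<inter> points SC. F q = g0 (\<pi> q))"
      using g0 by (intro exI[of _ "topspace \<tau>C"] exI[of _ "g0 \<circ> \<pi>"]) simp
  qed
  then have "Cinf_on T (rep U \<psi> g0)" using smooth by (intro Cinf_onI)
  moreover have "\<forall>n\<in>W. \<psi> n \<in> T \<and> g0 n = rep U \<psi> g0 (\<psi> n)" using pt\<psi> by (simp add: rep)
  ultimately show "\<exists>U \<phi> W T h. (U, \<phi>) \<in> atlas N \<and> openin \<tau> W \<and> n0 \<in> W \<and> W \<subseteq> U \<and>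
      open T \<and> Cinf_on T h \<and> (\<forall>y\<in>W. \<phi> y \<in> T \<and> g0 y = h (\<phi> y))"
    using c1 W(1,2,3) oT by (intro exI[of _ U] exI[of _ \<psi>] exI[of _ W] exI[of _ T] exI[of _ "rep U \<psi> g0"] conjI)
qed

subsection \<open>The projected connection\<close>

definition lft :: "'b vfield \<Rightarrow> 'a vfield" where
  "lft X' = (SOME X. vector_field SC X \<and> lifts X X')"

text \<open>The lifts and the point of the fibre are arbitrary choices; \<open>D'_eq\<close> removes
  the dependence on them.\<close>

definition D' :: "'b conn" where
  "D' X' Y' n = pf (Dc (lft X') (lft Y') (SOME p. p \<in> points SC \<and> \<pi> p = n))"

lemma lft: assumes "vector_field S X'" shows "vector_field SC (lft X')" "lifts (lft X') X'"
  using someI_ex[OF lift_exists[OF assms]] by (simp_all add: lft_def)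

text \<open>\<open>fibre\<close> carries the derivative from \<open>p\<close> to the chosen point of
  the same fibre at the price of other lifts, and \<open>lift_independent\<close> exchanges these
  for the chosen ones.\<close>

lemma D'_eq:
  assumes X': "vector_field S X'" and Y': "vector_field S Y'"
    and X: "vector_field SC X" "lifts X X'" and Y: "vector_field SC Y" "lifts Y Y'" and p: "p \<in> points SC"
  shows "pf (Dc X Y p) = D' X' Y' (\<pi> p)"
proof -
  let ?q = "SOME q. q \<in> points SC \<and> \<pi> q = \<pi> p"
  have q: "?q \<in> points SC" "\<pi> ?q = \<pi> p"
    using someI[of "\<lambda>q. q \<in> points SC \<and> \<pi> q = \<pi> p" p] p by simp_all
  obtain X2 Y2 where 2: "vector_field SC X2" "vector_field SC Y2" "lifts X2 X'" "lifts Y2 Y'"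
    "pf (Dc X2 Y2 ?q) = pf (Dc X Y p)"
    using fibre[OF X(1) Y(1) X(2) Y(2) p q(1) q(2)[symmetric]] by (elim exE conjE)
  have "pf (Dc X2 Y2 ?q) = pf (Dc (lft X') (lft Y') ?q)"
    by (rule lift_independent[OF 2(1) lft(1)[OF X'] 2(3) lft(2)[OF X'] 2(2) lft(1)[OF Y'] 2(4) lft(2)[OF Y'] Y' q(1)])
  then show ?thesis using 2(5) by (simp add: D'_def)
qed

text \<open>The derivative of \<open>h\<close> along the new field pulls back to the derivative of
  \<open>h \<circ> \<pi>\<close> along \<open>Dc\<close> of the lifts, which is smooth above;
  \<open>descent\<close> makes it smooth below.\<close>

lemma D'_vector_field:
  assumes X': "vector_field S X'" and Y': "vector_field S Y'"
  shows "vector_field S (D' X' Y')"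
  unfolding vector_field_def
proof (intro conjI ballI)
  note X = lft[OF X'] and Y = lft[OF Y']
  note XY = CC.conn_vector_field[OF X(1) Y(1)]
  fix n assume "n \<in> points S"
  then have "n \<in> topspace \<tau>" by simp
  from pi_surj[OF this] obtain p where p: "p \<in> points SC" "n = \<pi> p" by metis
  show "D' X' Y' n \<in> tangent S n"
    using D'_eq[OF X' Y' X Y p(1)] pf_tangent[OF p(1) CC.vector_field_tangent[OF XY p(1)]] p(2) by simp
next
  note X = lft[OF X'] and Y = lft[OF Y']
  note XY = CC.conn_vector_field[OF X(1) Y(1)]
  fix h assume h: "h \<in> funs S"
  have "(\<lambda>n. D' X' Y' n h) \<circ> \<pi> \<in> funs SC"
  proof (rule CC.funs_cong[OF CC.vector_field_funs[OF XY pi_funs[OF h]]])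
    fix q assume q: "q \<in> points SC"
    show "Dc (lft X') (lft Y') q (h \<circ> \<pi>) = ((\<lambda>n. D' X' Y' n h) \<circ> \<pi>) q"
      using D'_eq[OF X' Y' X Y q] pf_apply[OF h] by (metis o_apply)
  qed
  then show "(\<lambda>n. D' X' Y' n h) \<in> funs S" by (rule descent)
qed

lemma D'_linear_connection: "linear_connection S D'"
  unfolding linear_connection_def
proof (intro conjI allI impI ballI)
  show "vector_field S (D' X' Y')" if "vector_field S X' \<and> vector_field S Y'" for X' Y'
    using that D'_vector_field by blast
next
  fix X' Y' Z' k n h
  assume "vector_field S X' \<and> vector_field S Y' \<and> vector_field S Z'" and k: "k \<in> funs S" and "n \<in> points S"
  then have X': "vector_field S X'" and Y': "vector_field S Y'" and Z': "vector_field S Z'" by simp_all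
  have "n \<in> topspace \<tau>" using \<open>n \<in> points S\<close> by simp
  from pi_surj[OF this] obtain p where p: "p \<in> points SC" "n = \<pi> p" by metis
  note X = lft[OF X'] and Y = lft[OF Y'] and Z = lft[OF Z']
  have la: "lifts (\<lambda>q h. A q h + B q h) (\<lambda>n h. A' n h + B' n h)" if "lifts A A'" "lifts B B'" for A A' B B'
    using that unfolding projects_to_def pf_add by simp
  have ls: "lifts (\<lambda>q h. (k \<circ> \<pi>) q * A q h) (\<lambda>n h. k n * A' n h)" if "lifts A A'" for A A'
    using that unfolding projects_to_def pf_scale by simp
  note k' = pi_funs[OF k]
  note pX = D'_eq[OF _ _ _ _ _ _ p(1), symmetric]
  show "D' (\<lambda>q h. X' q h + Y' q h) Z' n h = D' X' Z' n h + D' Y' Z' n h"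
    unfolding p(2) pX[OF vector_field_add[OF X' Y'] Z' CC.vector_field_add[OF X(1) Y(1)] la[OF X(2) Y(2)] Z]
      pX[OF X' Z' X Z] pX[OF Y' Z' Y Z] CC.conn_add_left[OF X(1) Y(1) Z(1) k' p(1)] pf_add ..
  show "D' (\<lambda>q h. k q * X' q h) Z' n h = k n * D' X' Z' n h"
    unfolding p(2) pX[OF vector_field_scale[OF k X'] Z' CC.vector_field_scale[OF k' X(1)] ls[OF X(2)] Z]
      pX[OF X' Z' X Z] CC.conn_scale_left[OF X(1) Y(1) Z(1) k' p(1)] pf_scale by simp
  show "D' X' (\<lambda>q h. Y' q h + Z' q h) n h = D' X' Y' n h + D' X' Z' n h"
    unfolding p(2) pX[OF X' vector_field_add[OF Y' Z'] X CC.vector_field_add[OF Y(1) Z(1)] la[OF Y(2) Z(2)]]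
      pX[OF X' Z' X Z] pX[OF X' Y' X Y] CC.conn_add_right[OF X(1) Y(1) Z(1) k' p(1)] pf_add ..
  show "D' X' (\<lambda>q h. k q * Y' q h) n h = X' n k * Y' n h + k n * D' X' Y' n h"
    unfolding p(2) pX[OF X' vector_field_scale[OF k Y'] X CC.vector_field_scale[OF k' Y(1)] ls[OF Y(2)]]
      pX[OF X' Y' X Y] CC.conn_leibniz[OF X(1) Y(1) Z(1) k' p(1)] pf_add pf_scale
    using lifts_apply[OF X(2) p(1) k] liftsD[OF Y(2) p(1)] by simp
qed

lemma D'_torsionless: "torsionless S D'"
  unfolding torsionless_def
proof (intro allI impI ballI)
  fix X' Y' n h assume "vector_field S X' \<and> vector_field S Y'" "n \<in> points S"
  then have X': "vector_field S X'" and Y': "vector_field S Y'" by simp_all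
  have "n \<in> topspace \<tau>" using \<open>n \<in> points S\<close> by simp
  from pi_surj[OF this] obtain p where p: "p \<in> points SC" "n = \<pi> p" by metis
  note X = lft[OF X'] and Y = lft[OF Y']
  note XY = D'_eq[OF X' Y' X Y p(1)] and YX = D'_eq[OF Y' X' Y X p(1)]
  have br: "(\<lambda>h. Dc (lft X') (lft Y') p h - Dc (lft Y') (lft X') p h) = lie_bracket (lft X') (lft Y') p"
    by (rule ext) (use tf X(1) Y(1) p(1) in \<open>unfold torsionless_def, blast\<close>)
  have "D' X' Y' n h - D' Y' X' n h = pf (lie_bracket (lft X') (lft Y') p) h"
    unfolding p(2) XY[symmetric] YX[symmetric] br[symmetric] pf_diff ..
  then show "D' X' Y' n h - D' Y' X' n h = lie_bracket X' Y' n h"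
    unfolding p(2) bracket_projects[OF X X' Y Y' p(1)] .
qed

lemma D'_parallel: "parallel_form S D' \<omega>'"
  unfolding parallel_form_def
proof (intro allI impI ballI)
  fix X' Y' Z' n
  assume "vector_field S X' \<and> vector_field S Y' \<and> vector_field S Z'" and "n \<in> points S"
  then have X': "vector_field S X'" and Y': "vector_field S Y'" and Z': "vector_field S Z'" by simp_all
  have "n \<in> topspace \<tau>" using \<open>n \<in> points S\<close> by simp
  from pi_surj[OF this] obtain p where p: "p \<in> points SC" "n = \<pi> p" by metis
  note X = lft[OF X'] and Y = lft[OF Y'] and Z = lft[OF Z']
  have F: "(\<lambda>n. \<omega>' n (Y' n) (Z' n)) \<in> funs S"
    using sym Y' Z' unfolding symplectic_form_def two_form_def by blast
  have t: "A q \<in> tangent SC q" if "vector_field SC A" "q \<in> points SC" for A q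
    by (rule CC.vector_field_tangent[OF that])
  have tp: "Dc A B p \<in> tangent SC p" if "vector_field SC A" "vector_field SC B" for A B
    by (rule t[OF CC.conn_vector_field[OF that] p(1)])
  have "X' n (\<lambda>n. \<omega>' n (Y' n) (Z' n)) = lft X' p ((\<lambda>n. \<omega>' n (Y' n) (Z' n)) \<circ> \<pi>)"
    using lifts_apply[OF X(2) p(1) F] p(2) by simp
  also have "\<dots> = lft X' p (\<lambda>q. \<sigma> q (lft Y' q) (lft Z' q))"
    by (rule CC.tangent_cong[OF t[OF X(1) p(1)] p(1) pi_funs[OF F]])
      (simp add: pull t Y(1) Z(1) liftsD[OF Y(2)] liftsD[OF Z(2)])
  also have "\<dots> = \<sigma> p (Dc (lft X') (lft Y') p) (lft Z' p) + \<sigma> p (lft Y' p) (Dc (lft X') (lft Z') p)"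
    using par X(1) Y(1) Z(1) p(1) unfolding parallel_form_def by blast
  also have "\<dots> = \<omega>' n (D' X' Y' n) (Z' n) + \<omega>' n (Y' n) (D' X' Z' n)"
    unfolding pull[OF p(1) tp[OF X(1) Y(1)] t[OF Z(1) p(1)]] pull[OF p(1) t[OF Y(1) p(1)] tp[OF X(1) Z(1)]]
      D'_eq[OF X' Y' X Y p(1)] D'_eq[OF X' Z' X Z p(1)] liftsD[OF Y(2) p(1)] liftsD[OF Z(2) p(1)] p(2) ..
  finally show "X' n (\<lambda>n. \<omega>' n (Y' n) (Z' n)) = \<omega>' n (D' X' Y' n) (Z' n) + \<omega>' n (Y' n) (D' X' Z' n)" .
qed

theorem induced_connection:
  "\<exists>D'. symplectic_connection S \<omega>' D' \<and> induces_connection SC Dc S \<pi> D'"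
proof (intro exI conjI)
  show "symplectic_connection S \<omega>' D'"
    using D'_linear_connection D'_torsionless D'_parallel by (simp add: symplectic_connection_def)
  have "projects_to SC S \<pi> (Dc X Y) (D' X' Y')"
    if "vector_field S X'" "vector_field S Y'" "vector_field SC X" "vector_field SC Y" "lifts X X'" "lifts Y Y'"
    for X Y X' Y'
    using D'_eq[OF that(1,2,3,5,4,6)] by (simp add: projects_to_def)
  then show "induces_connection SC Dc S \<pi> D'"
    unfolding induces_connection_def
    using D'_linear_connection lift_exists CC.conn_vector_field by blast
qed

end

section \<open>Reduction\<close>

context manifold
begin

lemma continuous_at_point:
  assumes f: "f \<in> funs S" and p: "p \<in> topspace \<tau>" and \<epsilon>: "0 < \<epsilon>"
  obtains U where "openin \<tau> U" "p \<in> U" "\<forall>q\<in>U. \<bar>f q - f p\<bar> < \<epsilon>"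
proof -
  obtain U \<phi> where c: "(U, \<phi>) \<in> atlas M" "p \<in> U" by (rule chart_exists[OF p])
  let ?T = "cdom U \<phi> \<inter> rep U \<phi> f -` ball (f p) \<epsilon>"
  have "open ?T"
    by (rule continuous_open_preimage[OF Cinf_on_continuous[OF rep_smooth[OF c(1) f]] open_cdom[OF c(1)] open_ball])
  from chart_preimage[OF c(1) this] have o: "openin \<tau> {q \<in> U. \<phi> q \<in> ?T}" .
  have *: "f q \<in> ball (f p) \<epsilon>" if "q \<in> U" "\<phi> q \<in> ?T" for q
    using that chart_cdom(3)[OF c(1) that(1), of f] by auto
  have "p \<in> {q \<in> U. \<phi> q \<in> ?T}" using c(2) \<epsilon> chart_cdom(1)[OF c] chart_cdom(3)[OF c, of f] by simp
  moreover have "\<forall>q\<in>{q \<in> U. \<phi> q \<in> ?T}. \<bar>f q - f p\<bar> < \<epsilon>"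
  proof
    fix q assume "q \<in> {q \<in> U. \<phi> q \<in> ?T}"
    then have "f q \<in> ball (f p) \<epsilon>" using * by blast
    then show "\<bar>f q - f p\<bar> < \<epsilon>" by (simp add: dist_real_def abs_minus_commute)
  qed
  ultimately show ?thesis using that[OF o] by blast
qed

end

text \<open>Yields smoothness of each single \<open>\<Phi> g\<close>, since a smooth action is given
  as a smooth map on the product. The argument stays in one product chart and composes with the
  affine embedding of the second factor at height \<open>\<phi>0 g\<close>.\<close>

lemma funs_slice:
  fixes L :: "('g, 'k::euclidean_space) mfd" and M :: "('a, 'e::euclidean_space) mfd"
  assumes L: "smooth_manifold L" and M: "smooth_manifold M" and g: "g \<in> topspace (mtop L)"
    and F: "F \<in> funs (mfd_space (prod_mfd L M))"
  shows "(\<lambda>x. F (g, x)) \<in> funs (mfd_space M)"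
proof -
  interpret L: manifold L by unfold_locales (rule L)
  interpret M: manifold M by unfold_locales (rule M)
  show ?thesis
  proof (rule M.funs_chartI)
    fix q assume q: "q \<in> topspace M.\<tau>"
    obtain U0 \<phi>0 where c0: "(U0, \<phi>0) \<in> atlas L" "g \<in> U0" by (rule L.chart_exists[OF g])
    obtain U \<phi> where c: "(U, \<phi>) \<in> atlas M" "q \<in> U" by (rule M.chart_exists[OF q])
    let ?m = "map_prod \<phi>0 \<phi>"
    have "(U0 \<times> U, ?m) \<in> atlas (prod_mfd L M)" using c0(1) c(1) by (auto simp: prod_mfd_def)
    then have "smooth_on (?m ` (U0 \<times> U)) (F \<circ> inv_into (U0 \<times> U) ?m)"
      using F by (auto simp: mfd_space_def)
    moreover have "(\<phi>0 g, \<phi> q) \<in> ?m ` (U0 \<times> U)" using c0(2) c(2) by force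
    ultimately obtain R G where R: "open R" "(\<phi>0 g, \<phi> q) \<in> R" "Cinf_on R G"
      "\<forall>y\<in>R \<inter> ?m ` (U0 \<times> U). G y = (F \<circ> inv_into (U0 \<times> U) ?m) y" by (rule smooth_onE)
    have bl: "bounded_linear (\<lambda>z :: 'e. (0 :: 'k, z))"
      by (intro bounded_linear_Pair bounded_linear_zero bounded_linear_ident)
    have "Cinf_on UNIV (\<lambda>z :: 'e. (\<phi>0 g, 0) + (0, z))"
      by (intro Cinf_on_add Cinf_on_const Cinf_on_linear[OF bl] open_UNIV)
    then have pr: "Cinf_on UNIV (\<lambda>z :: 'e. (\<phi>0 g, z))" by simp
    let ?T = "(\<lambda>z. (\<phi>0 g, z)) -` R"
    have T: "open ?T" by (rule open_vimage[OF R(1) Cinf_on_continuous[OF pr]])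
    have h: "Cinf_on ?T (\<lambda>z. G (\<phi>0 g, z))"
      by (rule Cinf_on_compose[OF T R(1) _ Cinf_on_subset[OF pr subset_UNIV] R(3)]) auto
    have inj: "inj_on ?m (U0 \<times> U)"
      by (rule map_prod_inj_on[OF L.chart_inj[OF c0(1)] M.chart_inj[OF c(1)]])
    let ?W = "{y \<in> U. \<phi> y \<in> ?T}"
    have "F (g, y) = G (\<phi>0 g, \<phi> y)" if "y \<in> ?W" for y
    proof -
      have gy: "(g, y) \<in> U0 \<times> U" using c0(2) that by simp
      have "?m (g, y) \<in> R \<inter> ?m ` (U0 \<times> U)" using that gy by auto
      from bspec[OF R(4) this] show ?thesis using inv_into_f_f[OF inj gy] by simp
    qed
    then show "\<exists>U \<phi> W T h. (U, \<phi>) \<in> atlas M \<and> openin M.\<tau> W \<and> q \<in> W \<and> W \<subseteq> U \<and>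
        open T \<and> Cinf_on T h \<and> (\<forall>y\<in>W. \<phi> y \<in> T \<and> F (g, y) = h (\<phi> y))"
      using M.chart_preimage[OF c(1) T] R(2) c T h
      by (intro exI[of _ U] exI[of _ \<phi>] exI[of _ ?W] exI[of _ ?T] exI[of _ "\<lambda>z. G (\<phi>0 g, z)"] conjI) auto
  qed
qed

section \<open>Push-forward of fields by diffeomorphisms\<close>

context sspace
begin

lemma smooth_self_map_continuous:
  assumes \<phi>: "\<And>h. h \<in> funs S \<Longrightarrow> h \<circ> \<phi> \<in> funs S" and p: "p \<in> points S" "\<phi> p \<in> points S"
    and U: "openin \<tau> U" "\<phi> p \<in> U"
  obtains W where "openin \<tau> W" "p \<in> W" "\<forall>q\<in>W \<inter> points S. \<phi> q \<in> U"
proof -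
  obtain \<rho> B K where \<rho>: "\<rho> \<in> funs S" "openin \<tau> B" "\<phi> p \<in> B" "B \<subseteq> K" "closedin \<tau> K" "K \<subseteq> U"
    "\<forall>q\<in>B. \<rho> q = 1" "\<forall>q. q \<notin> K \<longrightarrow> \<rho> q = 0" using bump[OF p(2) U] by (elim exE conjE)
  have "(\<rho> \<circ> \<phi>) p \<noteq> 0" using \<rho>(3,7) by simp
  from recip[OF \<phi>[OF \<rho>(1)] p(1) this] obtain g W where W: "openin \<tau> W" "p \<in> W"
    "\<forall>q\<in>W \<inter> points S. g q * (\<rho> \<circ> \<phi>) q = 1" by (elim exE conjE)
  have "\<phi> q \<in> U" if "q \<in> W \<inter> points S" for q
  proof (rule ccontr)
    assume "\<phi> q \<notin> U"
    then have "\<rho> (\<phi> q) = 0" using \<rho>(6,8) by blast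
    then show False using bspec[OF W(3) that] by simp
  qed
  then show ?thesis using that[OF W(1,2)] by blast
qed

text \<open>Smoothness combines two pullbacks: the test function is pulled back along \<phi> before
  the field acts, and the result is pulled back along \<psi>.\<close>

lemma vector_field_push:
  assumes \<phi>: "\<And>h. h \<in> funs S \<Longrightarrow> h \<circ> \<phi> \<in> funs S" and \<psi>: "\<And>h. h \<in> funs S \<Longrightarrow> h \<circ> \<psi> \<in> funs S"
    and inv: "\<And>q. q \<in> points S \<Longrightarrow> \<psi> q \<in> points S \<and> \<phi> (\<psi> q) = q" and X: "vector_field S X"
  shows "vector_field S (\<lambda>q. pushforward S \<phi> (X (\<psi> q)))"
  unfolding vector_field_def
proof (intro conjI ballI)
  fix q assume q: "q \<in> points S"
  note v = vector_field_tangent[OF X conjunct1[OF inv[OF q]]]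
  have e: "\<phi> (\<psi> q) = q" using inv[OF q] by simp
  have "X (\<psi> q) ((\<lambda>x. f x + g x) \<circ> \<phi>) = X (\<psi> q) (f \<circ> \<phi>) + X (\<psi> q) (g \<circ> \<phi>)"
    if "f \<in> funs S" "g \<in> funs S" for f g
    using tangent_add[OF v \<phi>[OF that(1)] \<phi>[OF that(2)]] by (simp add: o_def)
  moreover have "X (\<psi> q) ((\<lambda>x. f x * g x) \<circ> \<phi>) = X (\<psi> q) (f \<circ> \<phi>) * g q + f q * X (\<psi> q) (g \<circ> \<phi>)"
    if "f \<in> funs S" "g \<in> funs S" for f g
    using tangent_mult[OF v \<phi>[OF that(1)] \<phi>[OF that(2)]] e by (simp add: o_def)
  moreover have "X (\<psi> q) ((\<lambda>x. c * f x) \<circ> \<phi>) = c * X (\<psi> q) (f \<circ> \<phi>)" if "f \<in> funs S" for f c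
    using tangent_scale[OF v \<phi>[OF that], of c] by (simp add: o_def)
  ultimately show "pushforward S \<phi> (X (\<psi> q)) \<in> tangent S q"
    unfolding tangent_def pushforward_def by (simp add: funs_add funs_mult funs_const)
next
  fix h assume h: "h \<in> funs S"
  have "(\<lambda>y. X y (h \<circ> \<phi>)) \<circ> \<psi> \<in> funs S" by (rule \<psi>[OF vector_field_funs[OF X \<phi>[OF h]]])
  then show "(\<lambda>q. pushforward S \<phi> (X (\<psi> q)) h) \<in> funs S"
    using h by (simp add: pushforward_def o_def)
qed

end

context level_set_mfd
begin

text \<open>The curves come from ambient extensions of the fields. For a function living only on
  \<open>C\<close> the derivative along the curve is found by comparing vectors: the velocity and
  the combination of the \<open>X j\<close> have the same image under \<open>incl\<close>, which is
  injective on derivations of \<open>C\<close>.\<close>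

lemma SC_curves:
  fixes X :: "nat \<Rightarrow> 'a vfield"
  assumes X: "\<forall>j<n. vector_field SC (X j)" and p: "p \<in> C" and U: "openin \<tau> U" "p \<in> U"
  shows "\<exists>\<delta>>0. \<forall>w. (\<forall>j<n. \<bar>w j\<bar> < \<delta>) \<longrightarrow> (\<exists>\<gamma>. \<gamma> 0 = p \<and> (\<forall>t\<in>{-2<..<2::real}. \<gamma> t \<in> U \<inter> C) \<and>
    (\<forall>h\<in>funs SC. \<forall>t\<in>{-2<..<2}. ((h \<circ> \<gamma>) has_real_derivative (\<Sum>j<n. w j * X j (\<gamma> t) h)) (at t)))"
proof -
  have pt: "p \<in> topspace \<tau>" using p C_subset by auto
  have "\<exists>X' W. vector_field S X' \<and> openin \<tau> W \<and> p \<in> W \<and> (\<forall>q\<in>W \<inter> C. X' q = incl M (X j q)) \<and>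
    (\<forall>q\<in>W. \<forall>i<r. X' q (f i) = 0)" if "j < n" for j
    by (rule extend_from_C[OF p, of "X j"]) (use X that in simp, intro exI conjI)
  then have "\<forall>j. j < n \<longrightarrow> (\<exists>X' W. vector_field S X' \<and> openin \<tau> W \<and> p \<in> W \<and>
    (\<forall>q\<in>W \<inter> C. X' q = incl M (X j q)) \<and> (\<forall>q\<in>W. \<forall>i<r. X' q (f i) = 0))"
    by (intro allI impI)
  then have "\<exists>X' W. \<forall>j. j < n \<longrightarrow> vector_field S (X' j) \<and> openin \<tau> (W j) \<and> p \<in> W j \<and>
    (\<forall>q\<in>W j \<inter> C. X' j q = incl M (X j q)) \<and> (\<forall>q\<in>W j. \<forall>i<r. X' j q (f i) = 0)"
    by (simp only: choice_iff')
  then obtain X' W where XW: "\<forall>j. j < n \<longrightarrow> vector_field S (X' j) \<and> openin \<tau> (W j) \<and> p \<in> W j \<and>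
    (\<forall>q\<in>W j \<inter> C. X' j q = incl M (X j q)) \<and> (\<forall>q\<in>W j. \<forall>i<r. X' j q (f i) = 0)"
    by (elim exE)
  have X': "vector_field S (X' j)" "openin \<tau> (W j)" "p \<in> W j" "\<forall>q\<in>W j \<inter> C. X' j q = incl M (X j q)"
    "\<forall>q\<in>W j. \<forall>i<r. X' j q (f i) = 0" if "j < n" for j
    using mp[OF spec[OF XW] that] by blast+
  define W0 where "W0 = topspace \<tau> \<inter> (\<Inter>j<n. W j)"
  have oW0: "openin \<tau> W0" unfolding W0_def using X'(2)
    by (intro openin_Int_Inter[of "W ` {..<n}"]) auto
  have pW0: "p \<in> W0" using X'(3) pt by (simp add: W0_def)
  have W0: "q \<in> W j" if "q \<in> W0" "j < n" for q j using that by (auto simp: W0_def)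
  have 1: "\<forall>j<n. vector_field S (X' j)" using X'(1) by simp
  have 2: "\<forall>q\<in>W0. \<forall>j<n. \<forall>i<r. X' j q (f i) = 0" using X'(5) W0 by blast
  have pU: "p \<in> U \<inter> W0" using U pW0 by simp
  obtain \<delta> where \<delta>: "0 < \<delta>" "\<forall>w. (\<forall>j<n. \<bar>w j\<bar> < \<delta>) \<longrightarrow> (\<exists>\<gamma>. \<gamma> 0 = p \<and> (\<forall>t\<in>{-2<..<2}. \<gamma> t \<in> U \<inter> W0 \<inter> C) \<and>
    (\<forall>f\<in>funs S. Cinf_on {-2<..<2::real} (f \<circ> \<gamma>)) \<and>
    (\<forall>f\<in>funs S. \<forall>t\<in>{-2<..<2}. ((f \<circ> \<gamma>) has_real_derivative (\<Sum>j<n. w j * X' j (\<gamma> t) f)) (at t)))"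
    using C_curves[OF 1 p openin_Int[OF U(1) oW0] pU oW0 pW0 2] by (elim exE conjE)
  show ?thesis
  proof (intro exI[of _ \<delta>] conjI \<delta>(1) allI impI)
    fix w :: "nat \<Rightarrow> real" assume "\<forall>j<n. \<bar>w j\<bar> < \<delta>"
    from mp[OF spec[OF \<delta>(2)] this] obtain \<gamma> where \<gamma>: "\<gamma> 0 = p" "\<forall>t\<in>{-2<..<2}. \<gamma> t \<in> U \<inter> W0 \<inter> C"
      "\<forall>f\<in>funs S. Cinf_on {-2<..<2::real} (f \<circ> \<gamma>)"
      "\<forall>f\<in>funs S. \<forall>t\<in>{-2<..<2}. ((f \<circ> \<gamma>) has_real_derivative (\<Sum>j<n. w j * X' j (\<gamma> t) f)) (at t)"
      by (elim exE conjE)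
    let ?I = "{-2<..<2::real}"
    have I: "open ?I" by simp
    have \<gamma>C: "\<gamma> ` ?I \<subseteq> C" using \<gamma>(2) by blast
    note sm = C_curve_smooth[OF I \<gamma>(3) \<gamma>C]
    have "((h \<circ> \<gamma>) has_real_derivative (\<Sum>j<n. w j * X j (\<gamma> t) h)) (at t)" if h: "h \<in> funs SC" and t: "t \<in> ?I" for h t
    proof -
      have gt: "\<gamma> t \<in> W0" "\<gamma> t \<in> C" "\<gamma> t \<in> points S" using \<gamma>(2) t C_subset by auto
      let ?u = "\<lambda>h. \<Sum>j<n. w j * X j (\<gamma> t) h"
      have u: "?u \<in> tangent SC (\<gamma> t)"
        by (rule C.tangent_lincomb) (use X C.vector_field_tangent gt(2) in simp)
      have v: "velocity SC \<gamma> t \<in> tangent SC (\<gamma> t)" by (rule C.velocity_tangent[OF I t sm(1)])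
      have "incl M (velocity SC \<gamma> t) = incl M ?u"
        unfolding sm(2)[OF t, symmetric]
      proof
        fix F
        show "velocity S \<gamma> t F = incl M ?u F"
        proof (cases "F \<in> funs S")
          case True
          have "velocity S \<gamma> t F = (\<Sum>j<n. w j * X' j (\<gamma> t) F)"
            using DERIV_imp_deriv[OF bspec[OF bspec[OF \<gamma>(4) True] t]] True by (simp add: velocity_def)
          also have "\<dots> = incl M ?u F"
            unfolding incl_apply[OF True]
          proof (rule sum.cong[OF refl])
            fix j assume "j \<in> {..<n}"
            then have j: "j < n" by simp
            have "X' j (\<gamma> t) = incl M (X j (\<gamma> t))" using X'(4)[OF j] W0[OF gt(1) j] gt(2) by blast
            then show "w j * X' j (\<gamma> t) F = w j * X j (\<gamma> t) F" by (simp add: incl_apply[OF True])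
          qed
          finally show ?thesis .
        next
          case False
          then show ?thesis by (simp add: velocity_def incl_notin)
        qed
      qed
      from incl_inj[OF v u gt(2) this] have "velocity SC \<gamma> t h = ?u h" by (rule fun_cong)
      then have "deriv (h \<circ> \<gamma>) t = ?u h" using h by (simp add: velocity_def)
      moreover have "(h \<circ> \<gamma>) differentiable (at t)"
        using Cinf_on_has_derivative[OF bspec[OF sm(1) h] t] by (rule differentiableI)
      ultimately show ?thesis using DERIV_deriv_iff_real_differentiable[of "h \<circ> \<gamma>" t] by simp
    qed
    then show "\<exists>\<gamma>. \<gamma> 0 = p \<and> (\<forall>t\<in>{-2<..<2}. \<gamma> t \<in> U \<inter> C) \<and>
      (\<forall>h\<in>funs SC. \<forall>t\<in>{-2<..<2}. ((h \<circ> \<gamma>) has_real_derivative (\<Sum>j<n. w j * X j (\<gamma> t) h)) (at t))"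
      using \<gamma>(1,2) by (intro exI[of _ \<gamma>] conjI ballI) auto
  qed
qed

lemma SC_continuous:
  assumes F: "F \<in> funs SC" and p: "p \<in> C" and \<epsilon>: "0 < (\<epsilon>::real)"
  shows "\<exists>U. openin \<tau> U \<and> p \<in> U \<and> (\<forall>q\<in>U \<inter> C. \<bar>F q - F p\<bar> < \<epsilon>)"
proof -
  have pt: "p \<in> topspace \<tau>" using p C_subset by auto
  obtain U F' where U: "openin \<tau> U" "p \<in> U" "F' \<in> funs S" "\<forall>y\<in>U \<inter> C. F' y = F y" by (rule funs_SC_D[OF F p])
  obtain W where W: "openin \<tau> W" "p \<in> W" "\<forall>q\<in>W. \<bar>F' q - F' p\<bar> < \<epsilon>"
    by (rule continuous_at_point[OF U(3) pt \<epsilon>])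
  have "\<bar>F q - F p\<bar> < \<epsilon>" if q: "q \<in> U \<inter> W \<inter> C" for q
  proof -
    have "F' q = F q" "F' p = F p" using U(2,4) q p by auto
    then show ?thesis using W(3) q by (metis IntE)
  qed
  then show ?thesis using openin_Int[OF U(1) W(1)] U(2) W(2) by (intro exI[of _ "U \<inter> W"]) simp
qed

end

section \<open>Invariance of the connection on the level set\<close>

context level_set_connection
begin

text \<open>\<open>DC\<close> is built from \<open>C\<close> and \<open>D\<close> alone, so a
  diffeomorphism preserving both preserves it: pushing an extension forward gives an extension of
  the pushed field.\<close>

lemma transport:
  assumes \<phi>: "\<And>h. h \<in> funs S \<Longrightarrow> h \<circ> \<phi> \<in> funs S" and \<psi>: "\<And>h. h \<in> funs S \<Longrightarrow> h \<circ> \<psi> \<in> funs S"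
    and inv: "\<And>q. q \<in> points S \<Longrightarrow> \<psi> q \<in> points S \<and> \<phi> (\<psi> q) = q"
    and inv': "\<And>q. q \<in> points S \<Longrightarrow> \<phi> q \<in> points S \<and> \<psi> (\<phi> q) = q"
    and C\<phi>: "\<phi> ` C \<subseteq> C" and C\<psi>: "\<psi> ` C \<subseteq> C"
    and D: "\<And>X Y q. vector_field S X \<Longrightarrow> vector_field S Y \<Longrightarrow> q \<in> points S \<Longrightarrow>
      pushforward S \<phi> (D X Y (\<psi> q))
      = D (\<lambda>q. pushforward S \<phi> (X (\<psi> q))) (\<lambda>q. pushforward S \<phi> (Y (\<psi> q))) q"
    and X: "vector_field SC X" and Y: "vector_field SC Y" and p: "p \<in> C"
  shows "vector_field SC (\<lambda>q. pushforward SC \<phi> (X (\<psi> q)))"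
    and "DC (\<lambda>q. pushforward SC \<phi> (X (\<psi> q))) (\<lambda>q. pushforward SC \<phi> (Y (\<psi> q))) (\<phi> p)
      = pushforward SC \<phi> (DC X Y p)"
proof -
  have restr: "h \<circ> \<theta> \<in> funs SC" if h: "h \<in> funs SC" and \<theta>: "\<And>h. h \<in> funs S \<Longrightarrow> h \<circ> \<theta> \<in> funs S" "\<theta> ` C \<subseteq> C" for h \<theta>
  proof (rule funs_SC_I)
    fix x assume x: "x \<in> C"
    have tx: "\<theta> x \<in> C" using \<theta>(2) x by auto
    have xp: "x \<in> points S" "\<theta> x \<in> points S" using x tx C_subset by auto
    obtain U F where U: "openin \<tau> U" "\<theta> x \<in> U" "F \<in> funs S" "\<forall>y\<in>U \<inter> C. F y = h y" by (rule funs_SC_D[OF h tx])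
    obtain W where W: "openin \<tau> W" "x \<in> W" "\<forall>q\<in>W \<inter> points S. \<theta> q \<in> U"
      by (rule smooth_self_map_continuous[OF \<theta>(1) xp U(1,2)])
    have "(F \<circ> \<theta>) y = (h \<circ> \<theta>) y" if y: "y \<in> W \<inter> C" for y
    proof -
      have "y \<in> W \<inter> points S" using y C_subset by auto
      then have "\<theta> y \<in> U \<inter> C" using W(3) \<theta>(2) y by auto
      then show ?thesis using U(4) by simp
    qed
    then show "\<exists>U F. openin \<tau> U \<and> x \<in> U \<and> F \<in> funs S \<and> (\<forall>y\<in>U \<inter> C. F y = (h \<circ> \<theta>) y)"
      using W(1,2) \<theta>(1)[OF U(3)] by (intro exI[of _ W] exI[of _ "F \<circ> \<theta>"] conjI ballI)
  qed
  note rp = restr[OF _ \<phi> C\<phi>] and rq = restr[OF _ \<psi> C\<psi>]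
  have invC: "\<psi> q \<in> points SC \<and> \<phi> (\<psi> q) = q" if "q \<in> points SC" for q
    using that C\<psi> inv[of q] C_subset by auto
  have push: "vector_field SC (\<lambda>q. pushforward SC \<phi> (Z (\<psi> q)))" if "vector_field SC Z" for Z
    by (rule C.vector_field_push[OF rp rq invC that])
  show "vector_field SC (\<lambda>q. pushforward SC \<phi> (X (\<psi> q)))" by (rule push[OF X])
  have fp: "\<phi> p \<in> C" using C\<phi> p by auto
  have pp: "p \<in> points S" and fpp: "\<phi> p \<in> points S" using p fp C_subset by auto
  have \<psi>\<phi>: "\<psi> (\<phi> p) = p" using inv'[OF pp] by simp
  have comp: "incl M (pushforward SC \<phi> u) = pushforward S \<phi> (incl M u)" for u
    by (rule ext) (simp add: pushforward_def o_def funs_restrict \<phi>[unfolded o_def])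
  have e: "extends_near M C (\<phi> p) (\<lambda>q. pushforward SC \<phi> (Z (\<psi> q))) (\<lambda>q. pushforward S \<phi> (Z' (\<psi> q)))"
    if Z: "extends_near M C p Z Z'" for Z Z'
  proof -
    obtain U where U: "vector_field S Z'" "openin \<tau> U" "p \<in> U" "\<forall>y\<in>U \<inter> C. Z' y = incl M (Z y)"
      by (rule extends_nearE[OF Z])
    have "\<psi> (\<phi> p) \<in> points S" "\<psi> (\<phi> p) \<in> U" using \<psi>\<phi> pp U(3) by simp_all
    then obtain W where W: "openin \<tau> W" "\<phi> p \<in> W" "\<forall>q\<in>W \<inter> points S. \<psi> q \<in> U"
      using smooth_self_map_continuous[OF \<psi> fpp _ U(2)] by blast
    show ?thesis
    proof (rule extends_nearI[OF vector_field_push[OF \<phi> \<psi> inv U(1)] W(1,2)])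
      show "\<forall>y\<in>W \<inter> C. pushforward S \<phi> (Z' (\<psi> y)) = incl M (pushforward SC \<phi> (Z (\<psi> y)))"
      proof
        fix y assume y: "y \<in> W \<inter> C"
        then have "y \<in> W \<inter> points S" using C_subset by auto
        then have "\<psi> y \<in> U \<inter> C" using W(3) C\<psi> y by auto
        then have "Z' (\<psi> y) = incl M (Z (\<psi> y))" using U(4) by blast
        then show "pushforward S \<phi> (Z' (\<psi> y)) = incl M (pushforward SC \<phi> (Z (\<psi> y)))" by (simp only: comp)
      qed
    qed
  qed
  obtain X' U where X': "vector_field S X'" "openin \<tau> U" "p \<in> U" "\<forall>y\<in>U \<inter> C. X' y = incl M (X y)"
    "\<forall>y\<in>U. extends_near M C y X X'" by (rule common_extension[OF p X])
  obtain Y' U' where Y': "vector_field S Y'" "openin \<tau> U'" "p \<in> U'" "\<forall>y\<in>U' \<inter> C. Y' y = incl M (Y y)"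
    "\<forall>y\<in>U'. extends_near M C y Y Y'" by (rule common_extension[OF p Y])
  note eX = bspec[OF X'(5) X'(3)] and eY = bspec[OF Y'(5) Y'(3)]
  note q = conn_on_eq[OF fp push[OF X] push[OF Y] e[OF eX] e[OF eY]]
  have "pushforward SC \<phi> (DC X Y p) \<in> tangent SC (\<phi> p)"
    using C.vector_field_tangent[OF push[OF DC_vector_field[OF X Y]], of "\<phi> p"] fp \<psi>\<phi> by simp
  moreover have "incl M (DC (\<lambda>q. pushforward SC \<phi> (X (\<psi> q))) (\<lambda>q. pushforward SC \<phi> (Y (\<psi> q))) (\<phi> p))
      = incl M (pushforward SC \<phi> (DC X Y p))"
    unfolding q(2) D[OF X'(1) Y'(1) fpp, symmetric] comp \<psi>\<phi> conn_on_eq(2)[OF p X Y eX eY] ..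
  ultimately show "DC (\<lambda>q. pushforward SC \<phi> (X (\<psi> q))) (\<lambda>q. pushforward SC \<phi> (Y (\<psi> q))) (\<phi> p)
      = pushforward SC \<phi> (DC X Y p)"
    by (rule incl_inj[OF q(1) _ fp])
qed

end

text \<open>The components of \<open>J\<close> along a basis of the Lie algebra cut out the level set.\<close>

lemma moment_level_set:
  fixes L :: "('g, 'k::euclidean_space) mfd" and M :: "('a, 'e::euclidean_space) mfd"
  assumes M: "smooth_manifold M" and G: "lie_group G L" and ham: "hamiltonian_action G L M \<omega> \<Phi> J"
    and \<xi>: "\<xi> \<in> lie_dual G L" and nc: "noncritical_value G L M J \<xi>" and C: "C = level_set M J \<xi>"
  shows "\<exists>f r cv. level_set_mfd M C f r cv"
proof -
  interpret L: manifold L by unfold_locales (use G in \<open>simp add: lie_group_def\<close>)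
  let ?e = "\<one>\<^bsub>G\<^esub>"
  have "group G" "topspace (mtop L) = carrier G" using G by (simp_all add: lie_group_def)
  then have e: "?e \<in> topspace L.\<tau>" using group.is_monoid monoid.one_closed by metis
  obtain y E W where W: "openin L.\<tau> W" "?e \<in> W" and y: "\<forall>i<L.dm. y i \<in> funs L.S" and E: "\<forall>i<L.dm. vector_field L.S (E i)"
    and dual: "\<forall>q\<in>W. \<forall>i<L.dm. \<forall>j<L.dm. E i q (y j) = (if i = j then 1 else 0)"
    and expand: "\<forall>q\<in>W. \<forall>v\<in>tangent L.S q. v = (\<lambda>f. \<Sum>i<L.dm. v (y i) * E i q f)"
    by (rule L.frame_exists[OF e])
  define A where "A = (\<lambda>i. E i ?e)"
  have A: "A i \<in> lie_algebra G L" if "i < L.dm" for i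
    using L.vector_field_tangent[of "E i" ?e] E that e by (simp add: A_def lie_algebra_def)
  have lin: "\<eta> (\<lambda>f. \<Sum>i<n. c i * A i f) = (\<Sum>i<n. c i * \<eta> (A i))" if \<eta>: "\<eta> \<in> lie_dual G L" and n: "n \<le> L.dm" for \<eta> c n
    using n
  proof (induction n)
    case 0
    have "\<forall>B\<in>tangent L.S ?e. \<forall>c. \<eta> (\<lambda>f. c * B f) = c * \<eta> B"
      using \<eta> unfolding lie_dual_def lie_algebra_def by blast
    from spec[OF bspec[OF this L.tangent_zero], of 0] show ?case by simp
  next
    case (Suc n)
    have n: "n < L.dm" using Suc.prems by simp
    have t: "(\<lambda>f. \<Sum>i<n. c i * A i f) \<in> lie_algebra G L"
      unfolding lie_algebra_def by (rule L.tangent_lincomb) (use A n in \<open>simp add: lie_algebra_def\<close>)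
    have s: "(\<lambda>f. c n * A n f) \<in> lie_algebra G L"
      using L.tangent_scaled A[OF n] by (simp add: lie_algebra_def)
    have "\<eta> (\<lambda>f. (\<Sum>i<n. c i * A i f) + c n * A n f) = \<eta> (\<lambda>f. \<Sum>i<n. c i * A i f) + \<eta> (\<lambda>f. c n * A n f)"
      by (rule bspec[OF bspec[OF conjunct1[OF \<eta>[unfolded lie_dual_def mem_Collect_eq]] t] s])
    moreover have "\<eta> (\<lambda>f. c n * A n f) = c n * \<eta> (A n)"
      by (rule spec[OF bspec[OF conjunct1[OF conjunct2[OF \<eta>[unfolded lie_dual_def mem_Collect_eq]]] A[OF n]]])
    ultimately show ?case using Suc by simp
  qed
  have expandA: "B = (\<lambda>f. \<Sum>i<L.dm. B (y i) * A i f)" if "B \<in> lie_algebra G L" for B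
    using expand W(2) that unfolding lie_algebra_def A_def by blast
  have ext_dual: "\<eta> = \<zeta>" if \<eta>: "\<eta> \<in> lie_dual G L" "\<zeta> \<in> lie_dual G L" "\<forall>i<L.dm. \<eta> (A i) = \<zeta> (A i)" for \<eta> \<zeta>
  proof
    fix B
    show "\<eta> B = \<zeta> B"
    proof (cases "B \<in> lie_algebra G L")
      case True
      have "\<eta> B = (\<Sum>i<L.dm. B (y i) * \<eta> (A i))" using lin[OF \<eta>(1) order_refl, of "\<lambda>i. B (y i)"] expandA[OF True] by simp
      also have "\<dots> = (\<Sum>i<L.dm. B (y i) * \<zeta> (A i))" using \<eta>(3) by simp
      also have "\<dots> = \<zeta> B" using lin[OF \<eta>(2) order_refl, of "\<lambda>i. B (y i)"] expandA[OF True] by simp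
      finally show ?thesis .
    next
      case False
      then show ?thesis using \<eta>(1,2) by (simp add: lie_dual_def)
    qed
  qed
  have J: "J x \<in> lie_dual G L" if "x \<in> topspace (mtop M)" for x
    using ham that by (simp add: hamiltonian_action_def mfd_space_def)
  have "level_set_mfd M C (\<lambda>i x. J x (A i)) L.dm (\<lambda>i. \<xi> (A i))"
  proof unfold_locales
    show "smooth_manifold M" by (rule M)
    show "C = {y \<in> topspace (mtop M). \<forall>i<L.dm. J y (A i) = \<xi> (A i)}"
      unfolding C level_set_def using ext_dual[OF J \<xi>] by auto
    show "(\<lambda>x. J x (A i)) \<in> funs (mfd_space M)" if "i < L.dm" for i
      using ham A[OF that] by (simp add: hamiltonian_action_def)
    fix x assume x: "x \<in> C"
    have "\<exists>v\<in>tangent (mfd_space M) x. \<forall>j<L.dm. v (\<lambda>x. J x (A j)) = (if i = j then 1 else 0)" if i: "i < L.dm" for i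
    proof -
      \<comment> \<open>The linear form dual to the basis vector \<open>A i\<close>. Surjectivity of
        the differential of \<open>J\<close> realises it by a vector at \<open>x\<close>, and these
        vectors are dual to the differentials of the components of \<open>J\<close>.\<close>
      define \<eta> where "\<eta> = (\<lambda>B :: 'g tvec. if B \<in> lie_algebra G L then B (y i) else 0)"
      have "\<eta> \<in> lie_dual G L"
        unfolding lie_dual_def \<eta>_def lie_algebra_def using L.tangent_plus L.tangent_scaled by auto
      then obtain v where v: "v \<in> tangent (mfd_space M) x" "\<forall>B\<in>lie_algebra G L. v (\<lambda>y. J y B) = \<eta> B"
        using nc x unfolding noncritical_value_def C by blast
      have "v (\<lambda>x. J x (A j)) = (if i = j then 1 else 0)" if j: "j < L.dm" for j
        using v(2) A[OF j] dual W(2) i j by (simp add: \<eta>_def) (simp add: A_def)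
      then show ?thesis using v(1) by blast
    qed
    then show "\<exists>v. \<forall>i<L.dm. v i \<in> tangent (mfd_space M) x \<and>
        (\<forall>j<L.dm. v i (\<lambda>x. J x (A j)) = (if i = j then 1 else 0))" by metis
  qed
  then show ?thesis by blast
qed

text \<open>Tangency, torsion and parallelism on \<open>C\<close> are already in place. What remains
  is the bookkeeping of orbits and the verification of \<open>fibre\<close>, by moving lifts with an
  element of the isotropy group.\<close>

theorem theorem1p1:
  fixes M :: "('a, 'e::euclidean_space) mfd" and \<omega> :: "'a form2" and D :: "'a conn"
    and G :: "'g monoid" and L :: "('g, 'k::euclidean_space) mfd"
    and \<Phi> :: "'g \<Rightarrow> 'a \<Rightarrow> 'a" and J :: "'a \<Rightarrow> 'g covec" and \<xi> :: "'g covec"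
    and C :: "'a set"
    and N :: "('a set, 'n::euclidean_space) mfd" and \<omega>' :: "'a set form2"
  assumes "smooth_manifold M" and "symplectic_form (mfd_space M) \<omega>"
    and "symplectic_connection (mfd_space M) \<omega> D"
    and "lie_group G L"
    and "hamiltonian_action G L M \<omega> \<Phi> J"
    and "affine_action G M D \<Phi>"
    and "\<xi> \<in> lie_dual G L" and "noncritical_value G L M J \<xi>"
    and "C = level_set M J \<xi>" and "self_parallel M D C"
    and "reduced_symplectic_manifold M \<omega> (isotropy G L \<xi>) \<Phi> C N \<omega>'"
  shows "\<exists>D'. symplectic_connection (mfd_space N) \<omega>' D' \<and>
           induces_connection (subm_space M C) (conn_on M C D)
             (mfd_space N) (orbit (isotropy G L \<xi>) \<Phi>) D'"
proof -
  obtain f r cv where "level_set_mfd M C f r cv"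
    using moment_level_set[OF assms(1,4,5,7,8,9)] by (elim exE)
  then interpret level_set_mfd M C f r cv .
  interpret level_set_connection M C f r cv D
    by unfold_locales (use assms(3,10) in \<open>simp_all add: symplectic_connection_def\<close>)
  let ?H = "isotropy G L \<xi>" and ?T = "mfd_space N"
  let ?\<pi> = "orbit ?H \<Phi>"
  have grp: "group G" and topL: "topspace (mtop L) = carrier G" and sL: "smooth_manifold L"
    using assms(4) by (simp_all add: lie_group_def)
  interpret group G by (rule grp)
  have act: "smooth_action G L M \<Phi>" using assms(5) by (simp add: hamiltonian_action_def)
  interpret A: group_action G "topspace \<tau>" \<Phi> using act by (simp add: smooth_action_def)
  have J\<Phi>: "J (\<Phi> g x) = coAd G L g (J x)" if "g \<in> carrier G" "x \<in> topspace \<tau>" for g x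
    using assms(5) that by (simp add: hamiltonian_action_def)
  have C_iff: "x \<in> C \<longleftrightarrow> x \<in> topspace \<tau> \<and> J x = \<xi>" for x by (simp add: assms(9) level_set_def)
  \<comment> \<open>By equivariance, membership in the isotropy group can be tested on any single
    point of \<open>C\<close>. Closure under products and inverses then follows from \<Phi> being an
    action, without computing with \<open>coAd\<close>.\<close>
  have stab: "g \<in> carrier ?H \<longleftrightarrow> g \<in> carrier G \<and> \<Phi> g x \<in> C" if x: "x \<in> C" for g x
  proof -
    have xt: "x \<in> topspace \<tau>" and Jx: "J x = \<xi>" using x C_iff by simp_all
    have "\<Phi> g x \<in> topspace \<tau>" if "g \<in> carrier G" using A.element_image[OF that xt] by simp
    then show ?thesis using J\<Phi>[OF _ xt] Jx by (auto simp: isotropy_def stabilizer_def C_iff)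
  qed
  have in_orbit: "y \<in> ?\<pi> x \<longleftrightarrow> (\<exists>g\<in>carrier ?H. y = \<Phi> g x)" for x y by (auto simp: orbit_def)
  have inv_stab: "inv\<^bsub>G\<^esub> g \<in> carrier ?H" if x: "x \<in> C" and g: "g \<in> carrier ?H" for x g
  proof -
    have g': "g \<in> carrier G" "\<Phi> g x \<in> C" using stab[OF x] g by simp_all
    have "\<Phi> (inv\<^bsub>G\<^esub> g) (\<Phi> g x) = x" by (rule A.orbit_sym_aux[OF g'(1) _ refl]) (use x C_subset in auto)
    then show ?thesis using stab[OF g'(2)] g'(1) x by simp
  qed
  have \<pi>\<Phi>: "?\<pi> (\<Phi> g x) = ?\<pi> x" if x: "x \<in> C" and g: "g \<in> carrier ?H" for x g
  proof -
    have xt: "x \<in> topspace \<tau>" using x C_subset by auto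
    have g': "g \<in> carrier G" "\<Phi> g x \<in> C" using stab[OF x] g by simp_all
    have 1: "\<Phi> h (\<Phi> g x) \<in> ?\<pi> x" if h: "h \<in> carrier ?H" for h
    proof -
      have h': "h \<in> carrier G" "\<Phi> h (\<Phi> g x) \<in> C" using stab[OF g'(2)] h by simp_all
      have "\<Phi> (h \<otimes>\<^bsub>G\<^esub> g) x = \<Phi> h (\<Phi> g x)" by (rule A.composition_rule[OF xt h'(1) g'(1)])
      moreover have "h \<otimes>\<^bsub>G\<^esub> g \<in> carrier ?H" using stab[OF x] h' g'(1) calculation by simp
      ultimately show ?thesis using in_orbit by metis
    qed
    have 2: "\<Phi> h x \<in> ?\<pi> (\<Phi> g x)" if h: "h \<in> carrier ?H" for h
    proof -
      have h': "h \<in> carrier G" "\<Phi> h x \<in> C" using stab[OF x] h by simp_all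
      have ig: "inv\<^bsub>G\<^esub> g \<in> carrier G" using g'(1) by simp
      have "\<Phi> (h \<otimes>\<^bsub>G\<^esub> inv\<^bsub>G\<^esub> g) (\<Phi> g x) = \<Phi> h (\<Phi> (inv\<^bsub>G\<^esub> g) (\<Phi> g x))"
        by (rule A.composition_rule[OF _ h'(1) ig]) (use g'(2) C_subset in auto)
      also have "\<Phi> (inv\<^bsub>G\<^esub> g) (\<Phi> g x) = x" by (rule A.orbit_sym_aux[OF g'(1) xt refl])
      finally have eq: "\<Phi> (h \<otimes>\<^bsub>G\<^esub> inv\<^bsub>G\<^esub> g) (\<Phi> g x) = \<Phi> h x" .
      then have "h \<otimes>\<^bsub>G\<^esub> inv\<^bsub>G\<^esub> g \<in> carrier ?H" using stab[OF g'(2)] h' ig by simp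
      then show ?thesis using eq in_orbit by metis
    qed
    show ?thesis
    proof (intro equalityI subsetI)
      fix y assume "y \<in> ?\<pi> (\<Phi> g x)"
      then obtain h where "h \<in> carrier ?H" "y = \<Phi> h (\<Phi> g x)" using in_orbit by metis
      then show "y \<in> ?\<pi> x" using 1 by simp
    next
      fix y assume "y \<in> ?\<pi> x"
      then obtain h where "h \<in> carrier ?H" "y = \<Phi> h x" using in_orbit by metis
      then show "y \<in> ?\<pi> (\<Phi> g x)" using 2 by simp
    qed
  qed
  have same_orbit: "\<exists>g\<in>carrier ?H. q = \<Phi> g p" if p: "p \<in> C" and q: "q \<in> C" and eq: "?\<pi> p = ?\<pi> q" for p q
  proof -
    have qt: "q \<in> topspace \<tau>" using q C_subset by auto
    have "\<Phi> \<one>\<^bsub>G\<^esub> q = q" using A.id_eq_one qt by (metis restrict_apply')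
    then have "\<one>\<^bsub>G\<^esub> \<in> carrier ?H" using stab[OF q] q by simp
    then have "q \<in> ?\<pi> q" using in_orbit \<open>\<Phi> \<one>\<^bsub>G\<^esub> q = q\<close> by metis
    then show ?thesis using eq in_orbit by metis
  qed
  have \<Phi>_smooth: "h \<circ> \<Phi> g \<in> funs S" if g: "g \<in> carrier G" and h: "h \<in> funs S" for g h
  proof -
    have "h \<circ> (\<lambda>(g, x). \<Phi> g x) \<in> funs (mfd_space (prod_mfd L M))"
      using act h by (simp add: smooth_action_def smooth_map_def)
    from funs_slice[OF sL assms(1) _ this, of g] show ?thesis using g topL by (simp add: o_def)
  qed
  have red: "smooth_manifold N" "topspace (mtop N) = orbits ?H C \<Phi>" "submersion SC ?T ?\<pi>"
    "symplectic_form ?T \<omega>'"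
    and pull: "\<forall>x\<in>C. \<forall>v\<in>tangent SC x. \<forall>w\<in>tangent SC x.
        \<omega>' (?\<pi> x) (pushforward ?T ?\<pi> v) (pushforward ?T ?\<pi> w) = \<omega> x (incl M v) (incl M w)"
    using assms(11) by (simp_all add: reduced_symplectic_manifold_def)
  have two: "two_form S \<omega>" and par: "parallel_form S D \<omega>" and tf: "torsionless S D"
    using assms(2,3) by (simp_all add: symplectic_form_def symplectic_connection_def)
  have fibre: "\<exists>X2 Y2. vector_field SC X2 \<and> vector_field SC Y2 \<and> projects_to SC ?T ?\<pi> X2 X' \<and>
      projects_to SC ?T ?\<pi> Y2 Y' \<and> pushforward ?T ?\<pi> (DC X2 Y2 q) = pushforward ?T ?\<pi> (DC X Y p)"
    if X: "vector_field SC X" and Y: "vector_field SC Y" and X': "projects_to SC ?T ?\<pi> X X'"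
      and Y': "projects_to SC ?T ?\<pi> Y Y'" and p: "p \<in> C" and q: "q \<in> C" and eq: "?\<pi> p = ?\<pi> q"
    for X Y X' Y' p q
  proof -
    obtain g where g: "g \<in> carrier ?H" and qg: "q = \<Phi> g p" using same_orbit[OF p q eq] by blast
    have gG: "g \<in> carrier G" using stab[OF p] g by simp
    have ig: "inv\<^bsub>G\<^esub> g \<in> carrier ?H" by (rule inv_stab[OF p g])
    have igG: "inv\<^bsub>G\<^esub> g \<in> carrier G" using gG by simp
    let ?\<phi> = "\<Phi> g" and ?\<psi> = "\<Phi> (inv\<^bsub>G\<^esub> g)"
    have inv': "?\<phi> y \<in> points S \<and> ?\<psi> (?\<phi> y) = y" if "y \<in> points S" for y
      using A.element_image[OF gG, of y] A.orbit_sym_aux[OF gG, of y] that by simp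
    have inv: "?\<psi> y \<in> points S \<and> ?\<phi> (?\<psi> y) = y" if "y \<in> points S" for y
      using A.element_image[OF igG, of y] A.orbit_sym_aux[OF igG, of y] that gG by simp
    have C\<phi>: "?\<phi> ` C \<subseteq> C" and C\<psi>: "?\<psi> ` C \<subseteq> C" using stab g ig by auto
    have Dp: "pushforward S ?\<phi> (D X Y (?\<psi> q))
        = D (\<lambda>q. pushforward S ?\<phi> (X (?\<psi> q))) (\<lambda>q. pushforward S ?\<phi> (Y (?\<psi> q))) q"
      if "vector_field S X" "vector_field S Y" "q \<in> points S" for X Y q
      using assms(6) gG that unfolding affine_action_def Let_def by blast
    have \<pi>inv: "?\<pi> (?\<phi> y) = ?\<pi> y" "?\<pi> (?\<psi> y) = ?\<pi> y" if "y \<in> C" for y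
      using \<pi>\<Phi>[OF that g] \<pi>\<Phi>[OF that ig] by simp_all
    \<comment> \<open>On \<open>C\<close> the functions pulled back from \<open>N\<close> are
      unchanged by \<open>?\<phi>\<close>, and a derivation at a point of \<open>C\<close> does not
      see their values elsewhere. So moved lifts project to the same fields.\<close>
    have pfp: "pushforward ?T ?\<pi> (pushforward SC ?\<phi> u) = pushforward ?T ?\<pi> u" if u: "u \<in> tangent SC x" and x: "x \<in> C" for u x
    proof
      fix h
      show "pushforward ?T ?\<pi> (pushforward SC ?\<phi> u) h = pushforward ?T ?\<pi> u h"
      proof (cases "h \<in> funs ?T")
        case True
        have h\<pi>: "h \<circ> ?\<pi> \<in> funs SC" using red(3) True by (simp add: submersion_def smooth_map_def)
        have "u (h \<circ> ?\<pi>) = u ((h \<circ> ?\<pi>) \<circ> ?\<phi>)"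
          by (rule C.tangent_cong[OF u _ h\<pi>]) (use x \<pi>inv in simp_all)
        then show ?thesis using True h\<pi> by (simp add: pushforward_def)
      next
        case False
        then show ?thesis by (simp add: pushforward_def)
      qed
    qed
    let ?X = "\<lambda>q. pushforward SC ?\<phi> (X (?\<psi> q))" and ?Y = "\<lambda>q. pushforward SC ?\<phi> (Y (?\<psi> q))"
    have tr: "vector_field SC (\<lambda>q. pushforward SC ?\<phi> (Z (?\<psi> q)))" if Z: "vector_field SC Z" for Z
      by (rule transport(1)[of ?\<phi> ?\<psi>, OF \<Phi>_smooth[OF gG] \<Phi>_smooth[OF igG] inv inv' C\<phi> C\<psi> Dp Z Z p])
    have DC_tr: "DC ?X ?Y (?\<phi> p) = pushforward SC ?\<phi> (DC X Y p)"
      by (rule transport(2)[of ?\<phi> ?\<psi>, OF \<Phi>_smooth[OF gG] \<Phi>_smooth[OF igG] inv inv' C\<phi> C\<psi> Dp X Y p])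
    have pr: "projects_to SC ?T ?\<pi> (\<lambda>q. pushforward SC ?\<phi> (Z (?\<psi> q))) Z'"
      if Z: "vector_field SC Z" and Z': "projects_to SC ?T ?\<pi> Z Z'" for Z Z'
      unfolding projects_to_def
    proof
      fix y assume y: "y \<in> points SC"
      then have yC: "y \<in> C" "?\<psi> y \<in> C" using C\<psi> by auto
      have "pushforward ?T ?\<pi> (pushforward SC ?\<phi> (Z (?\<psi> y))) = pushforward ?T ?\<pi> (Z (?\<psi> y))"
        by (rule pfp[OF C.vector_field_tangent[OF Z] yC(2)]) (use yC in simp)
      also have "\<dots> = Z' (?\<pi> y)" using Z' yC \<pi>inv(2)[OF yC(1)] by (simp add: projects_to_def)
      finally show "pushforward ?T ?\<pi> (pushforward SC ?\<phi> (Z (?\<psi> y))) = Z' (?\<pi> y)" .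
    qed
    have "DC X Y p \<in> tangent SC p" using C.vector_field_tangent[OF DC_vector_field[OF X Y]] p by simp
    from pfp[OF this p] have "pushforward ?T ?\<pi> (DC ?X ?Y q) = pushforward ?T ?\<pi> (DC X Y p)"
      unfolding qg DC_tr .
    then show ?thesis using tr[OF X] tr[OF Y] pr[OF X X'] pr[OF Y Y']
      by (intro exI[of _ ?X] exI[of _ ?Y] conjI)
  qed
  interpret P: projection N SC \<tau> DC ?\<pi> "\<lambda>q u v. \<omega> q (incl M u) (incl M v)" \<omega>'
  proof unfold_locales
    show "smooth_manifold N" by (rule red(1))
    show "linear_connection SC DC" by (rule DC_linear_connection)
    show "submersion SC ?T ?\<pi>" by (rule red(3))
    show "?\<pi> ` points SC = topspace (mtop N)" unfolding red(2) orbits_def by auto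
    show "second_countable \<tau>" using assms(1) by (simp add: smooth_manifold_def)
    show "torsionless SC DC" by (rule DC_torsionless[OF tf])
    show "parallel_form SC DC (\<lambda>q u v. \<omega> q (incl M u) (incl M v))" by (rule DC_parallel(1)[OF two par])
    show "symplectic_form ?T \<omega>'" by (rule red(4))
    show "\<omega> p (incl M u) (incl M v) = \<omega>' (?\<pi> p) (pushforward ?T ?\<pi> u) (pushforward ?T ?\<pi> v)"
      if "p \<in> points SC" "u \<in> tangent SC p" "v \<in> tangent SC p" for p u v
      using pull that by simp
    show "\<exists>Z. vector_field SC Z \<and> Z p = z" if p: "p \<in> points SC" and z: "z \<in> tangent SC p" for p z
    proof -
      have pC: "p \<in> C" using p by simp
      obtain Z where "vector_field SC Z" "Z p = z" by (rule C_vector_extend[OF pC z])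
      then show ?thesis by (intro exI conjI)
    qed
    show "\<exists>U. openin \<tau> U \<and> p \<in> U \<and> (\<forall>q\<in>U \<inter> points SC. \<bar>F q - F p\<bar> < \<epsilon>)"
      if "F \<in> funs SC" "p \<in> points SC" "0 < \<epsilon>" for F p \<epsilon>
      using SC_continuous[OF that(1) _ that(3), of p] that(2) by simp
    show "\<exists>\<delta>>0. \<forall>w. (\<forall>j<n. \<bar>w j\<bar> < \<delta>) \<longrightarrow> (\<exists>\<gamma>. \<gamma> 0 = p \<and> (\<forall>t\<in>{-2<..<2::real}. \<gamma> t \<in> U \<inter> points SC) \<and>
        (\<forall>h\<in>funs SC. \<forall>t\<in>{-2<..<2}. ((h \<circ> \<gamma>) has_real_derivative (\<Sum>j<n. w j * X j (\<gamma> t) h)) (at t)))"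
      if "\<forall>j<n. vector_field SC (X j)" "p \<in> points SC" "openin \<tau> U" "p \<in> U" for n :: nat and X p U
      using SC_curves[OF that(1) _ that(3,4)] that(2) by simp
    show "\<exists>X2 Y2. vector_field SC X2 \<and> vector_field SC Y2 \<and> projects_to SC ?T ?\<pi> X2 X' \<and>
        projects_to SC ?T ?\<pi> Y2 Y' \<and> pushforward ?T ?\<pi> (DC X2 Y2 q) = pushforward ?T ?\<pi> (DC X Y p)"
      if "vector_field SC X" "vector_field SC Y" "projects_to SC ?T ?\<pi> X X'"
        "projects_to SC ?T ?\<pi> Y Y'" "p \<in> points SC" "q \<in> points SC" "?\<pi> p = ?\<pi> q" for X Y X' Y' p q
      by (rule fibre[OF that(1-4) _ _ that(7)]) (use that(5,6) in simp_all)
  qed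
  show ?thesis by (rule P.induced_connection)
qed

end
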